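(* (a) The normalized Haar system $(h_I/\|h_I\|_{L^1})_{I\in\mathcal D^+}$ of $L^1[0,1]$ has the factorization property. (b) The normalized bi-parameter Haar system $\big(h_I\otimes h_J/\|h_I\otimes h_J\|_{L^1}\big)_{I,J\in\mathcal D^+}$ of $L^1([0,1]^2)$ has the factorization property. (c) For every $1\le p<\infty$, the tensor product of the unit vector basis $(u_n)_{n\in\mathbb N}$ of $\ell^p$ with the normalized Haar system of $L^1[0,1]$, i.e. the system $\big(u_n\otimes (h_I/\|h_I\|_{L^1})\big)_{n\in\mathbb N,\,I\in\mathcal D^+}$ in $\ell^p(L^1)$, has the factorization property.
   Context: All Banach spaces are real. $\mathcal D$ is the set of dyadic intervals $[\frac{i-1}{2^j},\frac{i}{2^j})$, $j\ge 0$, $1\le i\le 2^j$. For $I\in\mathcal D$ with left half $I^+$ and right half $I^-$ put $h_I=\chi_{I^+}-\chi_{I^-}$. Put $\mathcal D^+=\mathcal D\cup\{\emptyset\}$ and $h_\emptyset=\chi_{[0,1)}$. $(h_I\otimes h_J)(s,t)=h_I(s)h_J(t)$. The space $\ell^p(L^1)$ consists of sequences $(f_n)_n$ in $L^1[0,1]$ with norm $(\sum_n\|f_n\|_{L^1}^p)^{1/p}<\infty$, and $u_n\otimes f$ is the sequence whose $n$-th coordinate is $f$ and whose other coordinates are $0$. Each of these systems, suitably linearly ordered, is a normalized Schauder basis. A normalized Schauder basis $(e_k)_k$ of a Banach space $X$ with biorthogonal functionals $(e_k^* )_k$ has the factorization property if for every bounded linear operator $T:X\to X$ with $\inf_k|e_k^*(Te_k)|>0$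 the identity of $X$ factors through $T$, i.e. there are bounded linear operators $R,S:X\to X$ with $I=STR$. (This property does not depend on the order of the basis, only on the biorthogonal functionals.) *)

theory Defs
  imports "HOL-Analysis.Analysis" "HOL-Library.Function_Algebras"
begin

section \<open>The Banach spaces $L^1([0,1])$ and $L^1([0,1]^2)$\<close>

text \<open>
  The closed unit cube \<open>cbox 0 One\<close> is \<open>{0..1}\<close> in \<open>real\<close> and \<open>{0..1} \<times> {0..1}\<close> in
  \<open>real \<times> real\<close>. Hence \<open>real L1\<close> below is $L^1([0,1])$, and \<open>(real \<times> real) L1\<close> is
  $L^1([0,1]^2)$.
\<close>

definition cube_measure :: "'a::euclidean_space measure" where
  "cube_measure = restrict_space lborel (cbox 0 One)"

lemma cube_real: "cbox 0 One = {0..1::real}"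
  by (simp add: cbox_interval)

lemma cube_real2: "cbox 0 One = {0..1::real} \<times> {0..1::real}"
  by (auto simp: mem_box Basis_prod_def)

definition L1_rel :: "('a::euclidean_space \<Rightarrow> real) \<Rightarrow> ('a \<Rightarrow> real) \<Rightarrow> bool" where
  "L1_rel f g \<longleftrightarrow> integrable cube_measure f \<and> integrable cube_measure g \<and>
     (AE x in cube_measure. f x = g x)"

quotient_type (overloaded) 'a L1 = "'a::euclidean_space \<Rightarrow> real" / partial: L1_rel
proof (rule part_equivpI)
  show "\<exists>f. L1_rel f f"
    by (rule exI[of _ "\<lambda>_. 0"]) (simp add: L1_rel_def)
  show "symp L1_rel"
    by (rule sympI) (auto simp: L1_rel_def elim!: eventually_mono)
  show "transp L1_rel"
    by (rule transpI) (auto simp: L1_rel_def elim: eventually_elim2)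
qed

instantiation L1 :: (euclidean_space) real_vector
begin

lift_definition zero_L1 :: "'a L1" is "\<lambda>_. 0"
  by (simp add: L1_rel_def)

lift_definition plus_L1 :: "'a L1 \<Rightarrow> 'a L1 \<Rightarrow> 'a L1" is "\<lambda>f g x. f x + g x"
  by (auto simp: L1_rel_def elim: eventually_elim2)

lift_definition minus_L1 :: "'a L1 \<Rightarrow> 'a L1 \<Rightarrow> 'a L1" is "\<lambda>f g x. f x - g x"
  by (auto simp: L1_rel_def elim: eventually_elim2)

lift_definition uminus_L1 :: "'a L1 \<Rightarrow> 'a L1" is "\<lambda>f x. - f x"
  by (auto simp: L1_rel_def elim!: eventually_mono)

lift_definition scaleR_L1 :: "real \<Rightarrow> 'a L1 \<Rightarrow> 'a L1" is "\<lambda>c f x. c * f x"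
  by (auto simp: L1_rel_def elim!: eventually_mono)

instance
proof
  fix f g h :: "'a L1" and a b :: real
  show "f + g + h = f + (g + h)"
    by transfer (auto simp: L1_rel_def algebra_simps)
  show "f + g = g + f"
    by transfer (auto simp: L1_rel_def algebra_simps)
  show "0 + f = f"
    by transfer (auto simp: L1_rel_def)
  show "- f + f = 0"
    by transfer (auto simp: L1_rel_def)
  show "f - g = f + - g"
    by transfer (auto simp: L1_rel_def)
  show "a *\<^sub>R (f + g) = a *\<^sub>R f + a *\<^sub>R g"
    by transfer (auto simp: L1_rel_def algebra_simps)
  show "(a + b) *\<^sub>R f = a *\<^sub>R f + b *\<^sub>R f"
    by transfer (auto simp: L1_rel_def algebra_simps)
  show "a *\<^sub>R b *\<^sub>R f = (a * b) *\<^sub>R f"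
    by transfer (auto simp: L1_rel_def algebra_simps)
  show "1 *\<^sub>R f = f"
    by transfer (auto simp: L1_rel_def)
qed

end

instantiation L1 :: (euclidean_space) real_normed_vector
begin

lift_definition norm_L1 :: "'a L1 \<Rightarrow> real" is "\<lambda>f. LINT x|cube_measure. \<bar>f x\<bar>"
  by (auto simp: L1_rel_def intro!: integral_cong_AE elim!: eventually_mono)

definition "sgn_L1 (f :: 'a L1) = f /\<^sub>R norm f"
definition "dist_L1 (f :: 'a L1) g = norm (f - g)"
definition "uniformity_L1 = (INF e\<in>{0 <..}. principal {(f :: 'a L1, g). dist f g < e})"
definition "open_L1 (U :: 'a L1 set) = (\<forall>f\<in>U. eventually (\<lambda>(f', g). f' = f \<longrightarrow> g \<in> U) uniformity)"

instance
proof
  fix f g :: "'a L1" and a :: real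
  show "(norm f = 0) = (f = 0)"
    by transfer (auto simp: L1_rel_def integral_nonneg_eq_0_iff_AE)
  show "norm (f + g) \<le> norm f + norm g"
  proof transfer
    fix f g :: "'a \<Rightarrow> real" assume "L1_rel f f" "L1_rel g g"
    then have i: "integrable cube_measure f" "integrable cube_measure g"
      by (auto simp: L1_rel_def)
    have "(LINT x|cube_measure. \<bar>f x + g x\<bar>) \<le> (LINT x|cube_measure. \<bar>f x\<bar> + \<bar>g x\<bar>)"
      using i by (intro integral_mono) auto
    then show "(LINT x|cube_measure. \<bar>f x + g x\<bar>)
        \<le> (LINT x|cube_measure. \<bar>f x\<bar>) + (LINT x|cube_measure. \<bar>g x\<bar>)"
      using i by simp
  qed
  show "norm (a *\<^sub>R f) = \<bar>a\<bar> * norm f"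
    by transfer (auto simp: L1_rel_def abs_mult)
qed (simp_all add: sgn_L1_def dist_L1_def uniformity_L1_def open_L1_def)

end

text \<open>The class of an integrable function; it is unspecified for non-integrable arguments.\<close>

abbreviation to_L1 :: "('a::euclidean_space \<Rightarrow> real) \<Rightarrow> 'a L1" where
  "to_L1 \<equiv> abs_L1"

lemma norm_to_L1:
  assumes "integrable cube_measure f"
  shows "norm (to_L1 f) = (LINT x|cube_measure. \<bar>f x\<bar>)"
  using assms by (simp add: norm_L1.abs_eq L1_rel_def)

lemma to_L1_surj: "\<exists>f. integrable cube_measure f \<and> F = to_L1 f"
  using Quotient_rep_reflp[OF Quotient_L1, of F] Quotient_abs_rep[OF Quotient_L1, of F]
  by (auto simp: L1_rel_def intro!: exI[of _ "rep_L1 F"])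

lemma to_L1_eq_iff:
  assumes "integrable cube_measure f" "integrable cube_measure g"
  shows "to_L1 f = to_L1 g \<longleftrightarrow> (AE x in cube_measure. f x = g x)"
  using assms Quotient_rel[OF Quotient_L1, of f g] by (auto simp: L1_rel_def)

instance L1 :: (euclidean_space) banach
proof
  fix X :: "nat \<Rightarrow> 'a L1"
  assume X: "Cauchy X"
  have "\<forall>k. \<exists>N. \<forall>m\<ge>N. \<forall>n\<ge>N. norm (X m - X n) < (1/2)^k"
    using X unfolding Cauchy_def dist_norm by (meson zero_less_power half_gt_zero zero_less_one)
  then obtain N where N: "\<And>k m n. m \<ge> N k \<Longrightarrow> n \<ge> N k \<Longrightarrow> norm (X m - X n) < (1/2)^k"
    by metis
  define r where "r = rec_nat (N 0) (\<lambda>k rk. max (Suc rk) (N (Suc k)))"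
  have r_Suc: "r (Suc k) = max (Suc (r k)) (N (Suc k))" for k by (simp add: r_def)
  have r_N: "r k \<ge> N k" for k by (cases k) (auto simp: r_def)
  have r_mono: "strict_mono r" by (rule strict_monoI_Suc) (simp add: r_Suc)
  obtain f where f: "\<And>n. integrable cube_measure (f n)" "\<And>n. X (r n) = to_L1 (f n)"
  proof -
    have "\<forall>n. \<exists>g. integrable cube_measure g \<and> X (r n) = to_L1 g"
      using to_L1_surj by blast
    from choice[OF this] show ?thesis using that by blast
  qed
  define d where "d k x = f (Suc k) x - f k x" for k x
  have d_int[simp]: "integrable cube_measure (d k)" for k
    unfolding d_def using f by auto
  have d_eq: "to_L1 (d k) = X (r (Suc k)) - X (r k)" for k
    using f by (simp add: minus_L1.abs_eq L1_rel_def d_def[abs_def])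
  have d_norm: "(LINT x|cube_measure. \<bar>d k x\<bar>) < (1/2)^k" for k
  proof -
    have "(LINT x|cube_measure. \<bar>d k x\<bar>) = norm (X (r (Suc k)) - X (r k))"
      by (simp add: norm_to_L1 flip: d_eq)
    also have "\<dots> < (1/2)^k"
      using r_N[of k] r_Suc[of k] by (intro N) auto
    finally show ?thesis .
  qed
  have geo: "summable (\<lambda>k. (1/2::real)^k)" by (rule summable_geometric) simp
  have summ: "summable (\<lambda>k. LINT x|cube_measure. norm (d k x))"
    by (rule summable_comparison_test'[OF geo, of 0]) (use d_norm less_imp_le in auto)
  have "(\<integral>\<^sup>+x. (\<Sum>k. ennreal (norm (d k x))) \<partial>cube_measure)
      = (\<Sum>k. \<integral>\<^sup>+x. ennreal (norm (d k x)) \<partial>cube_measure)"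
    using borel_measurable_integrable[OF d_int] by (intro nn_integral_suminf) measurable
  also have "\<dots> = (\<Sum>k. ennreal (LINT x|cube_measure. norm (d k x)))"
    by (intro suminf_cong nn_integral_eq_integral) auto
  also have "\<dots> \<noteq> \<infinity>"
    using summ by (simp add: ennreal_suminf_neq_top)
  finally have fin: "(\<integral>\<^sup>+x. (\<Sum>k. ennreal (norm (d k x))) \<partial>cube_measure) \<noteq> \<infinity>" .
  have ae: "AE x in cube_measure. summable (\<lambda>k. norm (d k x))"
  proof -
    have "AE x in cube_measure. (\<Sum>k. ennreal (norm (d k x))) \<noteq> \<infinity>"
      using borel_measurable_integrable[OF d_int] fin by (intro nn_integral_PInf_AE) measurable
    then show ?thesis
      by (rule AE_mp) (auto intro!: summable_suminf_not_top)
  qed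
  define s where "s x = (\<Sum>k. d k x)" for x
  have s_int: "integrable cube_measure s"
    unfolding s_def by (rule integrable_suminf[OF d_int ae summ])
  define L where "L = to_L1 (\<lambda>x. f 0 x + s x)"
  have tail: "norm (X (r n) - L) \<le> (\<Sum>k. (1/2)^(k+n))" for n
  proof -
    have sh: "summable (\<lambda>k. LINT x|cube_measure. norm (d (k+n) x))"
      using summable_ignore_initial_segment[OF summ] .
    have aesh: "AE x in cube_measure. summable (\<lambda>k. norm (d (k+n) x))"
      using ae by (rule AE_mp) (intro AE_I2 impI summable_ignore_initial_segment)
    have shn: "summable (\<lambda>k. LINT x|cube_measure. norm (norm (d (k+n) x)))"
      using sh by simp
    have aeshn: "AE x in cube_measure. summable (\<lambda>k. norm (norm (d (k+n) x)))"
      using aesh by simp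
    have ni: "integrable cube_measure (\<lambda>x. norm (d (k+n) x))" for k by auto
    have Lr: "X (r n) - L = to_L1 (\<lambda>x. f n x - (f 0 x + s x))"
      using f s_int by (simp add: minus_L1.abs_eq L1_rel_def L_def)
    have tele: "f n x = f 0 x + (\<Sum>k<n. d k x)" for x
      using sum_lessThan_telescope[of "\<lambda>k. f k x" n] by (simp add: d_def)
    have "norm (X (r n) - L) = (LINT x|cube_measure. \<bar>f n x - (f 0 x + s x)\<bar>)"
      unfolding Lr using f s_int by (intro norm_to_L1) auto
    also have "\<dots> \<le> (LINT x|cube_measure. (\<Sum>k. norm (d (k+n) x)))"
    proof (rule integral_mono_AE)
      show "integrable cube_measure (\<lambda>x. \<bar>f n x - (f 0 x + s x)\<bar>)"
        using f s_int by auto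
      show "integrable cube_measure (\<lambda>x. \<Sum>k. norm (d (k+n) x))"
        by (rule integrable_suminf[OF ni aeshn shn])
      show "AE x in cube_measure. \<bar>f n x - (f 0 x + s x)\<bar> \<le> (\<Sum>k. norm (d (k+n) x))"
        using ae
      proof (rule AE_mp, intro AE_I2 impI)
        fix x assume sx: "summable (\<lambda>k. norm (d k x))"
        then have "s x = (\<Sum>k. d (k+n) x) + (\<Sum>k<n. d k x)"
          unfolding s_def by (rule suminf_split_initial_segment[OF summable_norm_cancel])
        then have "\<bar>f n x - (f 0 x + s x)\<bar> = norm (\<Sum>k. d (k+n) x)"
          by (simp add: tele)
        also have "\<dots> \<le> (\<Sum>k. norm (d (k+n) x))"
          by (rule summable_norm[OF summable_ignore_initial_segment[OF sx]])
        finally show "\<bar>f n x - (f 0 x + s x)\<bar> \<le> (\<Sum>k. norm (d (k+n) x))" .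
      qed
    qed
    also have "\<dots> = (\<Sum>k. LINT x|cube_measure. norm (d (k+n) x))"
      by (rule integral_suminf[OF ni aeshn shn])
    also have "\<dots> \<le> (\<Sum>k. (1/2)^(k+n))"
    proof (rule suminf_le[OF _ sh summable_ignore_initial_segment[OF geo]])
      show "(LINT x|cube_measure. norm (d (k+n) x)) \<le> (1/2)^(k+n)" for k
        using d_norm[of "k+n"] by simp
    qed
    finally show ?thesis .
  qed
  have "(\<lambda>n. \<Sum>k. (1/2::real)^(k+n)) \<longlonglongrightarrow> 0"
    by (rule suminf_exist_split2[OF geo])
  then have "(\<lambda>n. norm (X (r n) - L)) \<longlonglongrightarrow> 0"
    by (rule metric_tendsto_imp_tendsto) (auto intro!: always_eventually order_trans[OF tail])
  then have "(X \<circ> r) \<longlonglongrightarrow> L"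
    by (simp add: tendsto_norm_zero_iff LIM_zero_iff o_def)
  then show "convergent X"
    using Cauchy_converges_subseq[OF X r_mono] by (auto simp: convergent_def o_def)
qed


section \<open>The space $\ell^p(L^1)$\<close>

text \<open>Sequences form a real vector space under the pointwise operations.\<close>

instantiation "fun" :: (type, real_vector) real_vector
begin

definition "scaleR_fun (c :: real) (f :: 'a \<Rightarrow> 'b) = (\<lambda>x. c *\<^sub>R f x)"

instance
  by standard (auto simp: scaleR_fun_def fun_eq_iff algebra_simps)

end

definition lp_carrier :: "real \<Rightarrow> (nat \<Rightarrow> 'b::real_normed_vector) set" where
  "lp_carrier p = {f. summable (\<lambda>n. norm (f n) powr p)}"

definition lp_norm :: "real \<Rightarrow> (nat \<Rightarrow> 'b::real_normed_vector) \<Rightarrow> real" where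
  "lp_norm p f = (\<Sum>n. norm (f n) powr p) powr (1 / p)"

definition unit_tensor :: "nat \<Rightarrow> 'b::zero \<Rightarrow> nat \<Rightarrow> 'b" where
  "unit_tensor n f = (\<lambda>m. if m = n then f else 0)"


section \<open>Schauder bases and the factorization property\<close>

text \<open>
  Since $\ell^p(L^1)$ depends on the number $p$, it cannot be a type of its own. A Banach space
  is therefore given by a linear subspace \<open>V\<close> of a real vector space and a complete norm \<open>N\<close>
  on \<open>V\<close>; for a Banach space that is a type, take \<open>V = UNIV\<close> and \<open>N = norm\<close>.
\<close>

definition bounded_operator_on ::
  "'a::real_vector set \<Rightarrow> ('a \<Rightarrow> real) \<Rightarrow> ('a \<Rightarrow> 'a) \<Rightarrow> bool" where
  "bounded_operator_on V N T \<longleftrightarrow>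
     (\<forall>x\<in>V. T x \<in> V) \<and>
     (\<forall>x\<in>V. \<forall>y\<in>V. T (x + y) = T x + T y) \<and>
     (\<forall>c. \<forall>x\<in>V. T (c *\<^sub>R x) = c *\<^sub>R T x) \<and>
     (\<exists>C. \<forall>x\<in>V. N (T x) \<le> C * N x)"

lemma bounded_operator_on_UNIV: "bounded_operator_on UNIV norm T \<longleftrightarrow> bounded_linear T"
  by (auto simp: bounded_operator_on_def bounded_linear_def bounded_linear_axioms_def
      linear_iff mult.commute)

definition is_expansion ::
  "('a::real_vector \<Rightarrow> real) \<Rightarrow> (nat \<Rightarrow> 'a) \<Rightarrow> 'a \<Rightarrow> (nat \<Rightarrow> real) \<Rightarrow> bool" where
  "is_expansion N e x a \<longleftrightarrow> (\<lambda>n. N (x - (\<Sum>k<n. a k *\<^sub>R e k))) \<longlonglongrightarrow> 0"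

definition normalized_schauder_basis ::
  "'a::real_vector set \<Rightarrow> ('a \<Rightarrow> real) \<Rightarrow> (nat \<Rightarrow> 'a) \<Rightarrow> bool" where
  "normalized_schauder_basis V N e \<longleftrightarrow>
     (\<forall>k. e k \<in> V \<and> N (e k) = 1) \<and> (\<forall>x\<in>V. \<exists>!a. is_expansion N e x a)"

text \<open>The biorthogonal functionals $e_k^*$ of a Schauder basis.\<close>

definition coordinate ::
  "('a::real_vector \<Rightarrow> real) \<Rightarrow> (nat \<Rightarrow> 'a) \<Rightarrow> nat \<Rightarrow> 'a \<Rightarrow> real" where
  "coordinate N e k x = (THE a. is_expansion N e x a) k"

definition factorization_property ::
  "'a::real_vector set \<Rightarrow> ('a \<Rightarrow> real) \<Rightarrow> (nat \<Rightarrow> 'a) \<Rightarrow> bool" where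
  "factorization_property V N e \<longleftrightarrow>
     normalized_schauder_basis V N e \<and>
     (\<forall>T. bounded_operator_on V N T \<and> (INF k. \<bar>coordinate N e k (T (e k))\<bar>) > 0 \<longrightarrow>
        (\<exists>R S. bounded_operator_on V N R \<and> bounded_operator_on V N S \<and>
           (\<forall>x\<in>V. S (T (R x)) = x)))"

text \<open>
  For a countable system indexed by \<open>K\<close> without a given order: the system is a normalized
  Schauder basis with the factorization property in a suitable linear order of type $\omega$.
\<close>

definition system_factorization_property ::
  "'a::real_vector set \<Rightarrow> ('a \<Rightarrow> real) \<Rightarrow> 'k set \<Rightarrow> ('k \<Rightarrow> 'a) \<Rightarrow> bool" where
  "system_factorization_property V N K e \<longleftrightarrow>
     (\<exists>\<phi>. bij_betw \<phi> (UNIV :: nat set) K \<and> factorization_property V N (\<lambda>n. e (\<phi> n)))"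


section \<open>The Haar systems\<close>

definition dyadic :: "real set set" where
  "dyadic = {{(real i - 1) / 2 ^ j ..< real i / 2 ^ j} | i j :: nat. 1 \<le> i \<and> i \<le> 2 ^ j}"

definition dyadic_plus :: "real set set" where
  "dyadic_plus = insert {} dyadic"

definition left_half :: "real set \<Rightarrow> real set" where
  "left_half I = {x \<in> I. x < (Inf I + Sup I) / 2}"

definition right_half :: "real set \<Rightarrow> real set" where
  "right_half I = {x \<in> I. (Inf I + Sup I) / 2 \<le> x}"

definition haar :: "real set \<Rightarrow> real \<Rightarrow> real" where
  "haar I = (if I = {} then indicator {0..<1}
     else (\<lambda>x. indicator (left_half I) x - indicator (right_half I) x))"

definition haar_tensor :: "real set \<Rightarrow> real set \<Rightarrow> real \<times> real \<Rightarrow> real" where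
  "haar_tensor I J = (\<lambda>(s, t). haar I s * haar J t)"

lemma integrable_cube_bounded:
  fixes f :: "'a::euclidean_space \<Rightarrow> real"
  assumes "f \<in> borel_measurable borel" "\<And>x. \<bar>f x\<bar> \<le> B"
  shows "integrable cube_measure f"
proof -
  have "emeasure lborel (cbox 0 (One::'a)) < \<infinity>"
    by (rule emeasure_compact_finite) simp
  then have "finite_measure (cube_measure :: 'a measure)"
    unfolding cube_measure_def
    by (intro finite_measure_restrict_space finite_measureI) (auto simp: emeasure_restrict_space)
  then interpret finite_measure "cube_measure :: 'a measure" .
  have "f \<in> borel_measurable cube_measure"
    using assms(1) unfolding cube_measure_def by (intro measurable_restrict_space1) simp
  then show ?thesis
    by (intro integrable_const_bound[of _ B]) (use assms(2) in auto)
qed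

lemma haar_measurable:
  assumes "I \<in> dyadic_plus"
  shows "haar I \<in> borel_measurable borel"
proof -
  have I: "I \<in> sets borel"
    using assms by (auto simp: dyadic_plus_def dyadic_def)
  have "left_half I = I \<inter> {..<(Inf I + Sup I) / 2}" "right_half I = I \<inter> {(Inf I + Sup I) / 2..}"
    by (auto simp: left_half_def right_half_def)
  then have "left_half I \<in> sets borel" "right_half I \<in> sets borel"
    using I by auto
  then show ?thesis
    by (auto simp: haar_def)
qed

lemma abs_haar_le_1: "\<bar>haar I x\<bar> \<le> 1"
  by (auto simp: haar_def indicator_def)

lemma integrable_haar:
  assumes "I \<in> dyadic_plus"
  shows "integrable cube_measure (haar I)"
  by (rule integrable_cube_bounded[OF haar_measurable[OF assms] abs_haar_le_1])

lemma integrable_haar_tensor: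
  assumes "I \<in> dyadic_plus" "J \<in> dyadic_plus"
  shows "integrable cube_measure (haar_tensor I J)"
proof (rule integrable_cube_bounded)
  note [measurable] = haar_measurable[OF assms(1)] haar_measurable[OF assms(2)]
  show "haar_tensor I J \<in> borel_measurable borel"
    unfolding haar_tensor_def borel_prod[symmetric] by measurable
  show "\<bar>haar_tensor I J z\<bar> \<le> 1" for z
    by (auto simp: haar_tensor_def abs_mult abs_haar_le_1 mult_le_one split: prod.split)
qed

definition normalized_haar :: "real set \<Rightarrow> real L1" where
  "normalized_haar I = to_L1 (haar I) /\<^sub>R norm (to_L1 (haar I))"

definition normalized_haar2 :: "real set \<times> real set \<Rightarrow> (real \<times> real) L1" where
  "normalized_haar2 = (\<lambda>(I, J). to_L1 (haar_tensor I J) /\<^sub>R norm (to_L1 (haar_tensor I J)))"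

definition lp_haar :: "nat \<times> real set \<Rightarrow> nat \<Rightarrow> real L1" where
  "lp_haar = (\<lambda>(n, I). unit_tensor n (normalized_haar I))"

end

theory Submission
  imports Defs "HOL-Real_Asymp.Real_Asymp" "HOL-Library.Discrete_Functions"
begin

text \<open>
  Why the theorem holds. Both \<open>L\<^sup>1\<close> spaces are treated at once as a Banach space \<open>X\<close> with
  a binary tree of cells, the cell \<open>i\<close> of level \<open>n\<close> having measure \<open>1 / 2 ^ n\<close> (locale \<open>l1_tree\<close>);
  for the square the tree arises by halving alternately in the two directions. The spaces in (a), (b)
  and (c) are then \<open>X\<close>, \<open>X\<close> and \<open>\<ell>\<^sup>p(X)\<close>, three instances of one kind of direct sum of copies
  of \<open>X\<close> (locale \<open>direct_sum\<close>).

  \<^emph>\<open>The diagonal of an operator.\<close> Let \<open>\<tau>\<close> be a bounded operator on \<open>X\<close>. At level \<open>k\<close> it has the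
  matrix of the integrals over a cell \<open>u\<close> of the image of the indicator of a cell \<open>v\<close>. The entries in
  the blocks \<open>u, v\<close> with the same ancestor at level \<open>n\<close> have total mass at most \<open>\<parallel>\<tau>\<parallel>\<close>, and mass that
  has left the smaller blocks of a level \<open>m\<close> never returns to them under refinement. So the mass that
  lies inside the \<open>n\<close>-blocks but off the diagonal tends to 0 as \<open>n\<close> grows, uniformly in the level of
  the matrix (\<open>off_diag_small\<close>). There are two consequences. The diagonal sums converge to a functional
  \<open>D \<tau>\<close> on step functions, which stands for the part of \<open>\<tau>\<close> that acts by multiplication. And signs
  inside the blocks hardly matter: a Haar coefficient \<open>\<langle>h\<^sub>I, \<tau> h\<^sub>I\<rangle>\<close> is a signed sum over the block of
  \<open>I\<close>, so if these coefficients are large then \<open>D \<tau>\<close> is large on some cell (\<open>good_cell\<close>). On the square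
  the same works with blocks two levels deep; only the tensors \<open>h\<^sub>I \<otimes> h\<^sub>J\<close> with \<open>I\<close> and \<open>J\<close> of equal
  length enter.

  \<^emph>\<open>A copy of \<open>X\<close> on which the operator is almost scalar.\<close> On a given support one can put random signs
  on the Haar functions of a fine level. Second moments show that for some choice the resulting
  function \<open>b\<close> is almost annihilated by finitely many given functionals, that \<open>\<langle>b, \<tau> b\<rangle>\<close> is close to
  \<open>D \<tau> \<bar>b\<bar>\<close>, and that \<open>b\<close> splits its support into two halves of almost equal \<open>D \<tau>\<close>
  (\<open>good_haar_step\<close>). Iterating this inside a cell with indicator \<open>A\<close>, in all summands of the direct sum
  simultaneously, gives a copy of the Haar system (\<open>node_choice\<close>), with operators of norm at most 1:
  \<open>J\<close>, which maps onto the copy, and \<open>P\<close>, which reads off the coefficients (\<open>copy_operators\<close>). The matrix of \<open>P \<tau> J\<close> is by construction close to that of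
  the scalar \<open>D \<tau> A\<close> divided by the measure of the cell; as the norm of an operator on \<open>L\<^sup>1\<close> is the
  supremum of the column sums, it is close in norm, and the blocks between different summands have
  small, summable norms (\<open>block_estimate\<close>).

  \<^emph>\<open>Conclusion.\<close> Composing with these operators and dividing by the scalars, which are bounded away
  from 0, turns the given operator into one within \<open>1 / 2\<close> of the identity, and a Neumann series
  finishes the factorization (\<open>identity_factors\<close>).

  It remains to see that the three systems, suitably ordered, are normalized Schauder bases with the
  expected coordinate functionals (\<open>schauder_criterion\<close>). The partial sums of the Haar expansion are
  bounded by 2 because their kernels can be rewritten with functions of which at most two overlap
  (\<open>kernel_adapted\<close>); tensoring these kernels bounds the sums over rectangles of the bi-parameter system,
  and in the order by square shells a partial sum is made of five rectangles.
\<close>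

section \<open>Step functions on the dyadic points\<close>

lemma sum_lessThan_double:
  fixes g :: "nat \<Rightarrow> 'a::comm_monoid_add"
  shows "(\<Sum>i<2 * N. g i) = (\<Sum>i<N. g (2 * i) + g (2 * i + 1))"
  by (induction N) (simp_all add: add.assoc)

lemma sum_lessThan_add:
  fixes g :: "nat \<Rightarrow> 'a::comm_monoid_add"
  shows "(\<Sum>l<m + k. g l) = (\<Sum>l<m. g l) + (\<Sum>i<k. g (m + i))"
  by (induction k) (simp_all add: add.assoc)

text \<open>
  Only the values at dyadic points matter, and \<open>i / 2 ^ m\<close> represents the cell \<open>i\<close> of level \<open>m\<close>.
  Its left child \<open>2 * i\<close> is represented by the same point, so a function is constant on the cells of
  level \<open>n\<close> as soon as its value is inherited by right children.
\<close>

definition step :: "nat \<Rightarrow> (real \<Rightarrow> real) \<Rightarrow> bool" where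
  "step n f \<longleftrightarrow> (\<forall>m\<ge>n. \<forall>i. f (real (2 * i + 1) / 2 ^ Suc m) = f (real i / 2 ^ m))"

lemma step_mono: "step n f \<Longrightarrow> n \<le> m \<Longrightarrow> step m f"
  by (auto simp: step_def)

lemma step_odd: "step n f \<Longrightarrow> n \<le> m \<Longrightarrow> f (real (2 * i + 1) / 2 ^ Suc m) = f (real i / 2 ^ m)"
  by (simp only: step_def)

lemma dyadic_even: "real (2 * i) / 2 ^ Suc m = real i / 2 ^ m"
  by simp

lemma step_const [simp]: "step n (\<lambda>_. c)"
  by (simp add: step_def)

lemma step_mult: "step n f \<Longrightarrow> step n g \<Longrightarrow> step n (\<lambda>x. f x * g x)"
  by (simp add: step_def)

lemma step_add: "step n f \<Longrightarrow> step n g \<Longrightarrow> step n (\<lambda>x. f x + g x)"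
  by (simp add: step_def)

lemma step_diff: "step n f \<Longrightarrow> step n g \<Longrightarrow> step n (\<lambda>x. f x - g x)"
  by (simp add: step_def)

lemma step_comp: "step n f \<Longrightarrow> step n (\<lambda>x. F (f x))"
  by (simp add: step_def)

lemma step_sum: "(\<And>i. i \<in> I \<Longrightarrow> step n (f i)) \<Longrightarrow> step n (\<lambda>x. \<Sum>i\<in>I. f i x)"
  by (simp add: step_def)

definition cell_index :: "nat \<Rightarrow> real \<Rightarrow> nat" where
  "cell_index n x = nat \<lfloor>2 ^ n * x\<rfloor>"

lemma cell_index_dyadic: "n \<le> m \<Longrightarrow> cell_index n (real i / 2 ^ m) = i div 2 ^ (m - n)"
proof -
  assume nm: "n \<le> m"
  have "2 ^ n * (real i / 2 ^ m) = real i / real (2 ^ (m - n))"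
    using nm by (auto simp: le_iff_add power_add)
  then show ?thesis
    unfolding cell_index_def by (metis floor_divide_of_nat_eq nat_int of_nat_eq_iff)
qed

lemma cell_index_self [simp]: "cell_index n (real i / 2 ^ n) = i"
  by (simp add: cell_index_dyadic)

lemma step_cell_index: "step n (\<lambda>x. F (cell_index n x))"
  unfolding step_def
proof (intro allI impI)
  fix m i :: nat assume nm: "n \<le> m"
  have "cell_index n (real (2 * i + 1) / 2 ^ Suc m) = (2 * i + 1) div 2 ^ (Suc m - n)"
    using nm by (intro cell_index_dyadic) simp
  also have "\<dots> = (2 * i + 1) div 2 div 2 ^ (m - n)"
    using nm by (simp only: Suc_diff_le power_Suc div_mult2_eq)
  also have "\<dots> = cell_index n (real i / 2 ^ m)"
    using nm by (simp add: cell_index_dyadic)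
  finally show "F (cell_index n (real (2 * i + 1) / 2 ^ Suc m)) = F (cell_index n (real i / 2 ^ m))"
    by simp
qed

definition mean :: "nat \<Rightarrow> (real \<Rightarrow> real) \<Rightarrow> real" where
  "mean n f = (\<Sum>i<2 ^ n. f (real i / 2 ^ n)) / 2 ^ n"

lemma mean_Suc: "step n f \<Longrightarrow> mean (Suc n) f = mean n f"
  unfolding mean_def power_Suc sum_lessThan_double
  using step_odd[of n f n] by (simp add: field_simps sum_divide_distrib)

lemma mean_level: 
  assumes "step n f" "n \<le> m" shows "mean m f = mean n f"
  using assms(2)
proof (induction m rule: dec_induct)
  case (step m) then show ?case using mean_Suc[of m f] step_mono[OF assms(1)] by simp
qed simp

section \<open>Banach spaces with a tree of cells\<close>

text \<open>
  What is used of \<open>L\<^sup>1\<close> of a probability measure with a tree of cells: the cell \<open>i\<close> of level \<open>n\<close> is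
  the union of the cells \<open>2 * i\<close> and \<open>2 * i + 1\<close> of level \<open>n + 1\<close>, \<open>atom n i\<close> is its indicator function
  and \<open>E n i\<close> is the integral over it.
\<close>

locale l1_tree =
  fixes atom :: "nat \<Rightarrow> nat \<Rightarrow> 'b::banach" and E :: "nat \<Rightarrow> nat \<Rightarrow> 'b \<Rightarrow> real"
  assumes E_linear: "linear (E n i)"
    and E_split: "i < 2 ^ n \<Longrightarrow> E n i x = E (Suc n) (2 * i) x + E (Suc n) (2 * i + 1) x"
    and E_norm: "(\<Sum>i<2 ^ n. \<bar>E n i x\<bar>) \<le> norm x"
    and atom_split: "i < 2 ^ n \<Longrightarrow> atom n i = atom (Suc n) (2 * i) + atom (Suc n) (2 * i + 1)"
    and atom_norm: "i < 2 ^ n \<Longrightarrow> norm (atom n i) \<le> 1 / 2 ^ n"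
    and E_atom: "i < 2 ^ n \<Longrightarrow> k < 2 ^ n \<Longrightarrow> E n i (atom n k) = (if i = k then 1 / 2 ^ n else 0)"
    and atom_dense: "closure (span {atom n i | n i. i < 2 ^ n}) = UNIV"
begin

lemmas E_add = linear_add[OF E_linear]
lemmas E_diff = linear_diff[OF E_linear]
lemmas E_scale = linear_scale[OF E_linear]
lemmas E_sum = linear_sum[OF E_linear]

lemma abs_E_le: "i < 2 ^ n \<Longrightarrow> \<bar>E n i x\<bar> \<le> norm x"
  using member_le_sum[of i "{..<2 ^ n}" "\<lambda>i. \<bar>E n i x\<bar>"] E_norm[of n x] by simp

definition emb :: "nat \<Rightarrow> (real \<Rightarrow> real) \<Rightarrow> 'b" where
  "emb n f = (\<Sum>i<2 ^ n. f (real i / 2 ^ n) *\<^sub>R atom n i)"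

definition pair :: "nat \<Rightarrow> (real \<Rightarrow> real) \<Rightarrow> 'b \<Rightarrow> real" where
  "pair n f x = (\<Sum>i<2 ^ n. f (real i / 2 ^ n) * E n i x)"

lemma emb_Suc: "step n f \<Longrightarrow> emb (Suc n) f = emb n f"
  unfolding emb_def power_Suc sum_lessThan_double
  using step_odd[of n f n] by (auto intro!: sum.cong simp: atom_split[of _ n] algebra_simps)

lemma pair_Suc: "step n f \<Longrightarrow> pair (Suc n) f x = pair n f x"
  unfolding pair_def power_Suc sum_lessThan_double
  using step_odd[of n f n] by (auto intro!: sum.cong simp: E_split[of _ n] algebra_simps)

lemma emb_level: assumes "step n f" "n \<le> m" shows "emb m f = emb n f"
  using assms(2)
proof (induction m rule: dec_induct)
  case (step m) then show ?case using emb_Suc[of m f] step_mono[OF assms(1)] by simp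
qed simp

lemma pair_level: assumes "step n f" "n \<le> m" shows "pair m f x = pair n f x"
  using assms(2)
proof (induction m rule: dec_induct)
  case (step m) then show ?case using pair_Suc[of m f] step_mono[OF assms(1)] by simp
qed simp

text \<open>
  Taking the least possible level makes the vector of a step function, its pairing with a vector and
  its integral depend on the function alone. For arguments that are not step functions the values
  below are meaningless.
\<close>

definition step_level :: "(real \<Rightarrow> real) \<Rightarrow> nat" where "step_level f = (LEAST n. step n f)"

lemma step_level_step: "step n f \<Longrightarrow> step (step_level f) f" "step n f \<Longrightarrow> step_level f \<le> n"
  unfolding step_level_def by (auto intro: LeastI Least_le)

definition Emb where "Emb f = emb (step_level f) f"
definition Pr where "Pr f = pair (step_level f) f"
definition Mean where "Mean f = mean (step_level f) f"

lemma Emb_eq: "step n f \<Longrightarrow> Emb f = emb n f"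
  unfolding Emb_def by (metis emb_level step_level_step)

lemma Pr_eq: "step n f \<Longrightarrow> Pr f x = pair n f x"
  unfolding Pr_def by (metis pair_level step_level_step)

lemma Mean_eq: "step n f \<Longrightarrow> Mean f = mean n f"
  unfolding Mean_def by (metis mean_level step_level_step)

lemma Emb_add: "step n f \<Longrightarrow> step n g \<Longrightarrow> Emb (\<lambda>x. f x + g x) = Emb f + Emb g"
  by (simp add: Emb_eq[of n] step_add emb_def sum.distrib algebra_simps)

lemma Emb_diff: "step n f \<Longrightarrow> step n g \<Longrightarrow> Emb (\<lambda>x. f x - g x) = Emb f - Emb g"
  by (simp add: Emb_eq[of n] step_diff emb_def sum_subtractf algebra_simps)

lemma Emb_scale: "step n f \<Longrightarrow> Emb (\<lambda>x. c * f x) = c *\<^sub>R Emb f"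
  by (simp add: Emb_eq[of n] step_mult emb_def scaleR_sum_right)

lemma Pr_add: "step n f \<Longrightarrow> step n g \<Longrightarrow> Pr (\<lambda>x. f x + g x) y = Pr f y + Pr g y"
  by (simp add: Pr_eq[of n] step_add pair_def sum.distrib algebra_simps)

lemma Pr_diff: "step n f \<Longrightarrow> step n g \<Longrightarrow> Pr (\<lambda>x. f x - g x) y = Pr f y - Pr g y"
  by (simp add: Pr_eq[of n] step_diff pair_def sum_subtractf algebra_simps)

lemma Pr_scale: "step n f \<Longrightarrow> Pr (\<lambda>x. c * f x) y = c * Pr f y"
  by (simp add: Pr_eq[of n] step_mult pair_def sum_distrib_left algebra_simps)

lemma Mean_add: "step n f \<Longrightarrow> step n g \<Longrightarrow> Mean (\<lambda>x. f x + g x) = Mean f + Mean g"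
  by (simp add: Mean_eq[of n] step_add mean_def sum.distrib add_divide_distrib)

lemma Mean_scale: "step n f \<Longrightarrow> Mean (\<lambda>x. c * f x) = c * Mean f"
  by (simp add: Mean_eq[of n] step_mult mean_def sum_distrib_left)

lemma linear_Pr: "linear (Pr f)"
  unfolding Pr_def pair_def[abs_def]
  by (intro linearI) (simp_all add: E_add E_scale sum.distrib algebra_simps sum_distrib_left)

lemma Pr_bound:
  assumes "step n f" "\<And>x. \<bar>f x\<bar> \<le> B" shows "\<bar>Pr f y\<bar> \<le> B * norm y"
proof -
  have B: "B \<ge> 0" using assms(2)[of 0] by linarith
  have "\<bar>Pr f y\<bar> \<le> (\<Sum>i<2 ^ n. B * \<bar>E n i y\<bar>)"
    unfolding Pr_eq[OF assms(1)] pair_def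
    by (intro order_trans[OF sum_abs] sum_mono) (simp add: abs_mult mult_right_mono assms)
  also have "\<dots> \<le> B * norm y"
    using E_norm[of n y] B by (simp flip: sum_distrib_left add: mult_left_mono)
  finally show ?thesis .
qed

lemma E_emb: "i < 2 ^ n \<Longrightarrow> E n i (emb n f) = f (real i / 2 ^ n) / 2 ^ n"
  by (simp add: emb_def E_sum E_scale E_atom if_distrib cong: if_cong)

lemma Pr_Emb:
  assumes "step n f" "step n g" shows "Pr f (Emb g) = Mean (\<lambda>x. f x * g x)"
  using assms
  by (simp add: Pr_eq[of n] Emb_eq[of n] Mean_eq[of n] step_mult pair_def E_emb mean_def sum_divide_distrib)

lemma norm_emb_le: "norm (emb n f) \<le> mean n (\<lambda>x. \<bar>f x\<bar>)"
proof -
  have "norm (emb n f) \<le> (\<Sum>i<2 ^ n. \<bar>f (real i / 2 ^ n)\<bar> * (1 / 2 ^ n))"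
    unfolding emb_def by (intro order_trans[OF norm_sum] sum_mono) (use mult_left_mono[OF atom_norm] in auto)
  then show ?thesis by (simp add: mean_def sum_divide_distrib)
qed

lemma norm_Emb:
  assumes "step n f" shows "norm (Emb f) = Mean (\<lambda>x. \<bar>f x\<bar>)"
proof (rule antisym)
  show "norm (Emb f) \<le> Mean (\<lambda>x. \<bar>f x\<bar>)"
    using norm_emb_le[of n f] assms by (simp add: Emb_eq[of n] Mean_eq[of n] step_comp)
  show "Mean (\<lambda>x. \<bar>f x\<bar>) \<le> norm (Emb f)"
    using E_norm[of n "emb n f"] assms
    by (simp add: Emb_eq[of n] Mean_eq[of n] step_comp E_emb mean_def sum_divide_distrib)
qed

definition cell_ind :: "nat \<Rightarrow> nat \<Rightarrow> real \<Rightarrow> real" where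
  "cell_ind n i x = (if cell_index n x = i then 1 else 0)"

lemma step_cell_ind: "step n (cell_ind n i)"
  unfolding cell_ind_def[abs_def] by (rule step_cell_index)

lemma Emb_cell_ind: "i < 2 ^ n \<Longrightarrow> Emb (cell_ind n i) = atom n i"
  by (simp add: Emb_eq[OF step_cell_ind] emb_def cell_ind_def if_distrib[where f = "\<lambda>a. a *\<^sub>R _"] cong: if_cong)

lemma span_step:
  assumes "x \<in> span {atom n i | n i. i < 2 ^ n}"
  shows "\<exists>n f. step n f \<and> x = Emb f"
  using assms
proof (induction rule: span_induct_alt)
  case base
  then show ?case by (intro exI[of _ 0] exI[of _ "\<lambda>_. 0"]) (simp add: Emb_eq[of 0] emb_def)
next
  case (step c x y)
  from step(1) obtain n i where x: "x = atom n i" "i < 2 ^ n" by auto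
  from step(2) obtain m f where y: "step m f" "y = Emb f" by auto
  let ?k = "max n m"
  have s: "step ?k (cell_ind n i)" "step ?k f"
    using step_mono[OF step_cell_ind[of n i]] step_mono[OF y(1)] by auto
  have "c *\<^sub>R x + y = Emb (\<lambda>x. c * cell_ind n i x + f x)"
    using x y s by (simp add: Emb_add[of ?k] step_mult Emb_scale[of ?k] Emb_cell_ind)
  moreover have "step ?k (\<lambda>x. c * cell_ind n i x + f x)"
    using s by (intro step_add step_mult step_const)
  ultimately show ?case by blast
qed

lemma dense_step:
  assumes "e > 0" obtains n f where "step n f" "norm (x - Emb f) < e"
proof -
  have "x \<in> closure (span {atom n i | n i. i < 2 ^ n})" using atom_dense by simp
  then obtain y where "y \<in> span {atom n i | n i. i < 2 ^ n}" "dist y x < e"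
    using assms unfolding closure_approachable by blast
  then show ?thesis using span_step[of y] that by (metis dist_commute dist_norm)
qed

text \<open>
  For a step function the integrals over the cells of a fine level give the norm exactly; the general
  case follows by density.
\<close>

lemma norm_le_E:
  assumes "\<And>j. j0 \<le> j \<Longrightarrow> (\<Sum>i<2 ^ j. \<bar>E j i x\<bar>) \<le> B"
  shows "norm x \<le> B"
proof (rule field_le_epsilon)
  fix e :: real assume "e > 0"
  then obtain n f where f: "step n f" "norm (x - Emb f) < e / 2"
    using dense_step[of "e/2" x] by auto
  define k where "k = max n j0"
  have k: "step k f" "j0 \<le> k" using step_mono[OF f(1)] by (auto simp: k_def)
  have "norm (Emb f) = (\<Sum>i<2 ^ k. \<bar>E k i (emb k f)\<bar>)"
    using k by (simp add: norm_Emb[of k] Mean_eq[of k] step_comp E_emb mean_def sum_divide_distrib)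
  also have "\<dots> \<le> (\<Sum>i<2 ^ k. \<bar>E k i x\<bar> + \<bar>E k i (x - emb k f)\<bar>)"
    by (intro sum_mono) (auto simp: E_diff)
  also have "\<dots> \<le> B + norm (x - emb k f)"
    unfolding sum.distrib by (intro add_mono assms k E_norm)
  finally have "norm (Emb f) \<le> B + e / 2" using f(2) k by (simp add: Emb_eq[of k])
  moreover have "norm x \<le> norm (Emb f) + norm (x - Emb f)"
    using norm_triangle_sub[of x "Emb f"] by simp
  ultimately show "norm x \<le> B + e" using f(2) by linarith
qed

end

section \<open>The diagonal of an operator\<close>

lemma sum_same_block:
  fixes g :: "nat \<Rightarrow> nat \<Rightarrow> real"
  assumes "R > 0"
  shows "(\<Sum>u<N * R. \<Sum>v<N * R. if u div R = v div R then g u v else 0)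
    = (\<Sum>i<N. \<Sum>u<R. \<Sum>v<R. g (R * i + u) (R * i + v))"
proof -
  have block: "(\<Sum>u<N * R. h u) = (\<Sum>i<N. \<Sum>u<R. h (R * i + u))" for h :: "nat \<Rightarrow> real"
  proof -
    have "sum h {i * R..<i * R + R} = (\<Sum>u<R. h (R * i + u))" for i
      using sum.shift_bounds_nat_ivl[of h 0 "i * R" R]
      by (simp add: atLeast0LessThan algebra_simps)
    then show ?thesis using sum.nat_group[of h R N] by simp
  qed
  have inner: "(\<Sum>v<N * R. if (R * i + u) div R = v div R then g (R * i + u) v else 0)
      = (\<Sum>v<R. g (R * i + u) (R * i + v))" if "i < N" "u < R" for i u
  proof -
    have "(\<Sum>v<N * R. if (R * i + u) div R = v div R then g (R * i + u) v else 0)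
        = (\<Sum>j<N. \<Sum>v<R. if i = j then g (R * i + u) (R * j + v) else 0)"
      unfolding block using that by (intro sum.cong) auto
    also have "\<dots> = (\<Sum>j<N. if i = j then \<Sum>v<R. g (R * i + u) (R * j + v) else 0)"
      by (intro sum.cong) auto
    finally show ?thesis using that by simp
  qed
  have "(\<Sum>u<N * R. \<Sum>v<N * R. if u div R = v div R then g u v else 0)
    = (\<Sum>i<N. \<Sum>u<R. \<Sum>v<N * R. if (R * i + u) div R = v div R then g (R * i + u) v else 0)"
    by (rule block)
  also have "\<dots> = (\<Sum>i<N. \<Sum>u<R. \<Sum>v<R. g (R * i + u) (R * i + v))"
    by (intro sum.cong refl inner) auto
  finally show ?thesis .
qed

context l1_tree
begin

definition mat :: "('b \<Rightarrow> 'b) \<Rightarrow> nat \<Rightarrow> nat \<Rightarrow> nat \<Rightarrow> real" where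
  "mat \<tau> k u v = E k u (\<tau> (atom k v))"

text \<open>
  The level \<open>k\<close> matrix of an operator is cut into blocks: \<open>u\<close> and \<open>v\<close> lie in the same \<open>n\<close>-block if the
  two cells have the same ancestor at level \<open>n\<close>. The mass \<open>near_diag\<close> of the \<open>n\<close>-blocks is that of the
  finer \<open>m\<close>-blocks plus \<open>off_diag\<close>.
\<close>

definition near_diag :: "('b \<Rightarrow> 'b) \<Rightarrow> nat \<Rightarrow> nat \<Rightarrow> real" where
  "near_diag \<tau> n k = (\<Sum>u<2 ^ k. \<Sum>v<2 ^ k.
     if u div 2 ^ (k - n) = v div 2 ^ (k - n) then \<bar>mat \<tau> k u v\<bar> else 0)"

definition off_diag :: "('b \<Rightarrow> 'b) \<Rightarrow> nat \<Rightarrow> nat \<Rightarrow> nat \<Rightarrow> real" where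
  "off_diag \<tau> n m k = (\<Sum>u<2 ^ k. \<Sum>v<2 ^ k.
     if u div 2 ^ (k - n) = v div 2 ^ (k - n) \<and> u div 2 ^ (k - m) \<noteq> v div 2 ^ (k - m)
     then \<bar>mat \<tau> k u v\<bar> else 0)"

definition diag_sum :: "('b \<Rightarrow> 'b) \<Rightarrow> nat \<Rightarrow> (real \<Rightarrow> real) \<Rightarrow> real" where
  "diag_sum \<tau> k f = (\<Sum>u<2 ^ k. f (real u / 2 ^ k) * mat \<tau> k u u)"

text \<open>
  For an operator on \<open>L\<^sup>1\<close> that is given by a kernel of measures, this is the integral of \<open>f\<close> against
  the mass that the kernel puts on the diagonal.
\<close>

definition D :: "('b \<Rightarrow> 'b) \<Rightarrow> (real \<Rightarrow> real) \<Rightarrow> real" where "D \<tau> f = lim (\<lambda>k. diag_sum \<tau> k f)"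

text \<open>
  Haar functions of the cells, normalized to modulus 1, and the integrals against them.
\<close>

definition hatom :: "nat \<Rightarrow> nat \<Rightarrow> 'b" where
  "hatom k i = atom (Suc k) (2 * i) - atom (Suc k) (2 * i + 1)"

definition hE :: "nat \<Rightarrow> nat \<Rightarrow> 'b \<Rightarrow> real" where
  "hE k i x = E (Suc k) (2 * i) x - E (Suc k) (2 * i + 1) x"

context
  fixes \<tau> :: "'b \<Rightarrow> 'b" and C :: real
  assumes lin: "linear \<tau>" and bnd: "\<And>x. norm (\<tau> x) \<le> C * norm x"
begin

lemma C_nonneg: "0 \<le> C"
proof -
  have "norm (atom 0 0) \<noteq> 0" using E_atom[of 0 0 0] linear_0[OF E_linear] by auto
  moreover have "0 \<le> C * norm (atom 0 0)" using bnd[of "atom 0 0"] norm_ge_zero order_trans by blast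
  ultimately show ?thesis by (simp add: zero_le_mult_iff)
qed

lemma mat_column: "v < 2 ^ k \<Longrightarrow> (\<Sum>u<2 ^ k. \<bar>mat \<tau> k u v\<bar>) \<le> C / 2 ^ k"
  using order_trans[OF E_norm[of k "\<tau> (atom k v)"]] bnd[of "atom k v"]
    mult_left_mono[OF atom_norm[of v k] C_nonneg]
  by (auto simp: mat_def intro: order_trans)

lemma abs_mat_le: "u < 2 ^ k \<Longrightarrow> v < 2 ^ k \<Longrightarrow> \<bar>mat \<tau> k u v\<bar> \<le> C / 2 ^ k"
  using member_le_sum[of u "{..<2 ^ k}" "\<lambda>u. \<bar>mat \<tau> k u v\<bar>"] mat_column[of v k] by simp

lemma mat_split:
  assumes "u < 2 ^ k" "v < 2 ^ k"
  shows "mat \<tau> k u v = mat \<tau> (Suc k) (2 * u) (2 * v) + mat \<tau> (Suc k) (2 * u) (2 * v + 1)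
     + (mat \<tau> (Suc k) (2 * u + 1) (2 * v) + mat \<tau> (Suc k) (2 * u + 1) (2 * v + 1))"
  by (simp only: mat_def E_split[OF assms(1)] atom_split[OF assms(2)] linear_add[OF lin] E_add)

lemma sum_mat_Suc:
  assumes "step k f"
  shows "(\<Sum>u<2 ^ k. \<Sum>v<2 ^ k. if c u v then f (real u / 2 ^ k) * mat \<tau> k u v else 0)
    = (\<Sum>u<2 ^ Suc k. \<Sum>v<2 ^ Suc k.
         if c (u div 2) (v div 2) then f (real u / 2 ^ Suc k) * mat \<tau> (Suc k) u v else 0)"
proof -
  have d: "(2 * u + 1) div 2 = u" for u :: nat by simp
  show ?thesis
    unfolding power_Suc sum_lessThan_double sum.distrib[symmetric]
    by (intro sum.cong refl) (use step_odd[OF assms order_refl] in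
        \<open>auto simp: mat_split[of _ k] d algebra_simps simp del: of_nat_add\<close>)
qed

text \<open>
  An entry is the sum of the four entries below it, so refining the matrix can only increase the mass
  of a union of blocks.
\<close>

lemma sum_abs_mat_Suc:
  "(\<Sum>u<2 ^ k. \<Sum>v<2 ^ k. if c u v then \<bar>mat \<tau> k u v\<bar> else 0)
    \<le> (\<Sum>u<2 ^ Suc k. \<Sum>v<2 ^ Suc k. if c (u div 2) (v div 2) then \<bar>mat \<tau> (Suc k) u v\<bar> else 0)"
proof -
  have d: "(2 * u + 1) div 2 = u" for u :: nat by simp
  show ?thesis
    unfolding power_Suc sum_lessThan_double sum.distrib[symmetric]
    by (intro sum_mono) (auto simp: mat_split[of _ k] d)
qed

lemma div2_div: "n \<le> k \<Longrightarrow> u div 2 div 2 ^ (k - n) = u div 2 ^ (Suc k - n)" for u :: nat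
  by (simp only: Suc_diff_le power_Suc div_mult2_eq)

lemma off_diag_mono:
  assumes "n \<le> m" "m \<le> k" shows "off_diag \<tau> n m m \<le> off_diag \<tau> n m k"
  using assms(2)
proof (induction k rule: dec_induct)
  case (step k)
  have "off_diag \<tau> n m k \<le> off_diag \<tau> n m (Suc k)"
    unfolding off_diag_def
    by (rule order_trans[OF sum_abs_mat_Suc]) (use step(1) assms(1) in \<open>simp add: div2_div\<close>)
  with step show ?case by simp
qed simp

lemma near_diag_off_diag:
  assumes "n \<le> m" "m \<le> k" shows "near_diag \<tau> n k = near_diag \<tau> m k + off_diag \<tau> n m k"
proof -
  have *: "u div 2 ^ (k - n) = v div 2 ^ (k - n)" if "u div 2 ^ (k - m) = v div 2 ^ (k - m)" for u v :: nat
  proof -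
    have "k - n = (k - m) + (m - n)" using assms by simp
    then show ?thesis using that by (simp only: power_add div_mult2_eq)
  qed
  have "(if u div 2 ^ (k - n) = v div 2 ^ (k - n) then a else 0) =
     (if u div 2 ^ (k - m) = v div 2 ^ (k - m) then a else 0) +
     (if u div 2 ^ (k - n) = v div 2 ^ (k - n) \<and> u div 2 ^ (k - m) \<noteq> v div 2 ^ (k - m) then a else 0)"
    for u v :: nat and a :: real
    using *[of u v] by argo
  then show ?thesis
    unfolding near_diag_def off_diag_def sum.distrib[symmetric] by (simp only:)
qed

lemma near_diag_le: "near_diag \<tau> n k \<le> C"
proof -
  have "near_diag \<tau> n k \<le> (\<Sum>u<2 ^ k. \<Sum>v<2 ^ k. \<bar>mat \<tau> k u v\<bar>)"
    unfolding near_diag_def by (intro sum_mono) auto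
  also have "\<dots> = (\<Sum>v<2 ^ k. \<Sum>u<2 ^ k. \<bar>mat \<tau> k u v\<bar>)" by (rule sum.swap)
  also have "\<dots> \<le> (\<Sum>v<(2::nat) ^ k. C / 2 ^ k)" by (intro sum_mono mat_column) simp
  finally show ?thesis by simp
qed

lemma near_diag_nonneg: "0 \<le> near_diag \<tau> n k"
  unfolding near_diag_def by (intro sum_nonneg) auto

text \<open>
  Let \<open>w n\<close> be the supremum over all levels of the mass in the \<open>n\<close>-blocks. Mass outside the \<open>m\<close>-blocks
  persists under refinement, so that \<open>w m + off_diag \<tau> n m m \<le> w n\<close>. Thus \<open>w\<close> is decreasing, and
  \<open>off_diag\<close> is bounded by differences of a convergent sequence.
\<close>

lemma off_diag_small:
  assumes "e > 0" obtains n0 where "\<And>n m. n0 \<le> n \<Longrightarrow> n \<le> m \<Longrightarrow> off_diag \<tau> n m m \<le> e"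
proof -
  define w where "w n = (SUP k\<in>{n..}. near_diag \<tau> n k)" for n
  have bdd: "bdd_above (near_diag \<tau> n ` {n..})" for n by (rule bdd_aboveI2[of _ _ C]) (rule near_diag_le)
  have w: "w m + off_diag \<tau> n m m \<le> w n" if "n \<le> m" for n m
  proof -
    have "w m \<le> w n - off_diag \<tau> n m m"
      unfolding w_def[of m]
    proof (rule cSUP_least)
      fix k assume k: "k \<in> {m..}"
      have "near_diag \<tau> n k \<le> w n"
        unfolding w_def by (rule cSUP_upper[OF _ bdd]) (use k that in auto)
      then show "near_diag \<tau> m k \<le> w n - off_diag \<tau> n m m"
        using near_diag_off_diag[of n m k] off_diag_mono[of n m k] k that by auto
    qed simp
    then show ?thesis by simp
  qed
  have offd0: "0 \<le> off_diag \<tau> n m k" for n m k unfolding off_diag_def by (intro sum_nonneg) auto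
  have wdec: "w m \<le> w n" if "n \<le> m" for n m using w[OF that] offd0[of n m m] by simp
  have w0: "0 \<le> w n" for n
    using cSUP_upper[OF _ bdd[of n], of n] near_diag_nonneg[of n n] by (auto simp: w_def)
  define I where "I = (INF n. w n)"
  have bddI: "bdd_below (range w)" by (rule bdd_belowI2[of _ 0]) (rule w0)
  obtain n0 where n0: "w n0 < I + e"
    using cINF_less_iff[OF _ bddI, of "I + e"] assms by (auto simp: I_def)
  show ?thesis
  proof (rule that[of n0])
    fix n m assume nm: "n0 \<le> n" "n \<le> m"
    have "I \<le> w m" unfolding I_def by (rule cINF_lower[OF bddI]) simp
    then show "off_diag \<tau> n m m \<le> e" using w[OF nm(2)] wdec[OF nm(1)] n0 by linarith
  qed
qed

lemma diag_sum_near_diag: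
  assumes "step n f" "n \<le> m"
  shows "diag_sum \<tau> n f = (\<Sum>u<2 ^ m. \<Sum>v<2 ^ m.
    if u div 2 ^ (m - n) = v div 2 ^ (m - n) then f (real u / 2 ^ m) * mat \<tau> m u v else 0)"
  using assms(2)
proof (induction m rule: dec_induct)
  case base
  show ?case unfolding diag_sum_def by (intro sum.cong) auto
next
  case (step m)
  show ?case
    unfolding step.IH sum_mat_Suc[OF step_mono[OF assms(1) step(1)]] using step(1)
    by (simp only: div2_div)
qed

text \<open>
  Attaching the same signs to rows and columns leaves the diagonal unchanged.
\<close>

lemma signed_diag_sum:
  assumes f: "\<And>x. \<bar>f x\<bar> \<le> B" and "n \<le> m" and \<theta>: "\<And>u. \<bar>\<theta> u\<bar> = 1"
  shows "\<bar>(\<Sum>u<2 ^ m. \<Sum>v<2 ^ m. if u div 2 ^ (m - n) = v div 2 ^ (m - n)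
      then f (real u / 2 ^ m) * (\<theta> u * \<theta> v) * mat \<tau> m u v else 0) - diag_sum \<tau> m f\<bar> \<le> B * off_diag \<tau> n m m"
proof -
  have \<theta>2: "\<theta> u * \<theta> u = 1" for u using \<theta>[of u] by (metis abs_mult_self_eq mult_1)
  have B: "B \<ge> 0" using f[of 0] by linarith
  have "diag_sum \<tau> m f = (\<Sum>u<2 ^ m. \<Sum>v<2 ^ m. if u = v then f (real u / 2 ^ m) * mat \<tau> m u v else 0)"
    unfolding diag_sum_def by (intro sum.cong) auto
  then have eq: "(\<Sum>u<2 ^ m. \<Sum>v<2 ^ m. if u div 2 ^ (m - n) = v div 2 ^ (m - n)
      then f (real u / 2 ^ m) * (\<theta> u * \<theta> v) * mat \<tau> m u v else 0) - diag_sum \<tau> m f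
    = (\<Sum>u<2 ^ m. \<Sum>v<2 ^ m. if u div 2 ^ (m - n) = v div 2 ^ (m - n) \<and> u \<noteq> v
      then f (real u / 2 ^ m) * (\<theta> u * \<theta> v) * mat \<tau> m u v else 0)"
    by (simp only: sum_subtractf[symmetric]) (intro sum.cong refl, auto simp: \<theta>2)
  have "\<bar>\<Sum>u<2 ^ m. \<Sum>v<2 ^ m. if u div 2 ^ (m - n) = v div 2 ^ (m - n) \<and> u \<noteq> v
      then f (real u / 2 ^ m) * (\<theta> u * \<theta> v) * mat \<tau> m u v else 0\<bar>
      \<le> (\<Sum>u<2 ^ m. \<Sum>v<2 ^ m. B * (if u div 2 ^ (m - n) = v div 2 ^ (m - n) \<and> u \<noteq> v
      then \<bar>mat \<tau> m u v\<bar> else 0))"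
    by (intro order_trans[OF sum_abs] sum_mono) (auto simp: abs_mult \<theta> B mult_right_mono f)
  also have "\<dots> = B * off_diag \<tau> n m m"
    by (simp add: off_diag_def sum_distrib_left)
  finally show ?thesis unfolding eq .
qed

lemma diag_sum_dist:
  assumes "step n f" "\<And>x. \<bar>f x\<bar> \<le> B" "n \<le> m"
  shows "\<bar>diag_sum \<tau> n f - diag_sum \<tau> m f\<bar> \<le> B * off_diag \<tau> n m m"
  using signed_diag_sum[of f B n m "\<lambda>_. 1"] assms diag_sum_near_diag[OF assms(1,3)] by (simp cong: if_cong)

lemma diag_sum_tendsto:
  assumes "step n f" "\<And>x. \<bar>f x\<bar> \<le> B"
  shows "(\<lambda>k. diag_sum \<tau> k f) \<longlonglongrightarrow> D \<tau> f"
proof -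
  have B: "B \<ge> 0" using assms(2)[of 0] by linarith
  have "Cauchy (\<lambda>k. diag_sum \<tau> k f)"
  proof (rule metric_CauchyI)
    fix e :: real assume e: "e > 0"
    then have "e / (2 * (B + 1)) > 0" using B by simp
    then obtain n0 where n0: "\<And>n m. n0 \<le> n \<Longrightarrow> n \<le> m \<Longrightarrow> off_diag \<tau> n m m \<le> e / (2 * (B + 1))"
      using off_diag_small by blast
    define N where "N = max n n0"
    have le: "\<bar>diag_sum \<tau> N f - diag_sum \<tau> m f\<bar> \<le> e / 2 * (B / (B + 1))" if "N \<le> m" for m
    proof -
      have "\<bar>diag_sum \<tau> N f - diag_sum \<tau> m f\<bar> \<le> B * off_diag \<tau> N m m"
        by (rule diag_sum_dist) (use assms that step_mono[OF assms(1)] in \<open>auto simp: N_def\<close>)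
      also have "\<dots> \<le> B * (e / (2 * (B + 1)))"
        using B that by (intro mult_left_mono n0) (auto simp: N_def)
      finally show ?thesis by (simp add: field_simps)
    qed
    have lt: "e / 2 * (B / (B + 1)) < e / 2" using e B by (simp add: field_simps)
    have *: "\<bar>diag_sum \<tau> N f - diag_sum \<tau> m f\<bar> < e / 2" if "N \<le> m" for m
      using le[OF that] lt by (rule le_less_trans)
    have "dist (diag_sum \<tau> m f) (diag_sum \<tau> m' f) < e" if "N \<le> m" "N \<le> m'" for m m'
      using *[OF that(1)] *[OF that(2)] unfolding dist_real_def by linarith
    then show "\<exists>M. \<forall>m\<ge>M. \<forall>n\<ge>M. dist (diag_sum \<tau> m f) (diag_sum \<tau> n f) < e" by blast
  qed
  then show ?thesis unfolding D_def by (simp add: Cauchy_convergent convergent_LIMSEQ_iff[symmetric])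
qed

lemma D_add:
  assumes "step n f" "\<And>x. \<bar>f x\<bar> \<le> B" "step n g" "\<And>x. \<bar>g x\<bar> \<le> B'"
  shows "D \<tau> (\<lambda>x. f x + g x) = D \<tau> f + D \<tau> g"
proof (rule LIMSEQ_unique)
  show "(\<lambda>k. diag_sum \<tau> k (\<lambda>x. f x + g x)) \<longlonglongrightarrow> D \<tau> (\<lambda>x. f x + g x)"
    by (rule diag_sum_tendsto[of n _ "B + B'"])
      (use assms(2,4) in \<open>auto intro!: step_add assms order_trans[OF abs_triangle_ineq] add_mono\<close>)
  show "(\<lambda>k. diag_sum \<tau> k (\<lambda>x. f x + g x)) \<longlonglongrightarrow> D \<tau> f + D \<tau> g"
    using tendsto_add[OF diag_sum_tendsto[OF assms(1,2)] diag_sum_tendsto[OF assms(3,4)]]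
    by (simp add: diag_sum_def sum.distrib algebra_simps)
qed

lemma D_scale:
  assumes "step n f" "\<And>x. \<bar>f x\<bar> \<le> B"
  shows "D \<tau> (\<lambda>x. c * f x) = c * D \<tau> f"
proof (rule LIMSEQ_unique)
  show "(\<lambda>k. diag_sum \<tau> k (\<lambda>x. c * f x)) \<longlonglongrightarrow> D \<tau> (\<lambda>x. c * f x)"
    by (rule diag_sum_tendsto[of n _ "\<bar>c\<bar> * B"])
      (auto intro!: step_mult assms mult_left_mono simp: abs_mult)
  show "(\<lambda>k. diag_sum \<tau> k (\<lambda>x. c * f x)) \<longlonglongrightarrow> c * D \<tau> f"
    using tendsto_mult_left[OF diag_sum_tendsto[OF assms(1,2)], of c]
    by (simp add: diag_sum_def sum_distrib_left algebra_simps)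
qed

lemma D_zero: "D \<tau> (\<lambda>_. 0) = 0"
  using D_scale[of 0 "\<lambda>_. 0" 0 0] by simp

lemma D_sum:
  assumes "finite I" "\<And>i. i \<in> I \<Longrightarrow> step n (f i)" "\<And>i x. i \<in> I \<Longrightarrow> \<bar>f i x\<bar> \<le> B"
  shows "D \<tau> (\<lambda>x. \<Sum>i\<in>I. f i x) = (\<Sum>i\<in>I. D \<tau> (f i))"
  using assms
proof (induction I rule: finite_induct)
  case (insert i I)
  have "\<bar>\<Sum>j\<in>I. f j x\<bar> \<le> real (card I) * B" for x
    using insert by (intro order_trans[OF sum_abs sum_bounded_above]) auto
  then have "D \<tau> (\<lambda>x. f i x + (\<Sum>i\<in>I. f i x)) = D \<tau> (f i) + D \<tau> (\<lambda>x. \<Sum>i\<in>I. f i x)"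
    using insert by (intro D_add[of n _ B _ "real (card I) * B"] step_sum) auto
  then show ?case using insert by simp
qed (simp add: D_zero)

lemma D_bound:
  assumes f: "step n f" "\<And>x. \<bar>f x\<bar> \<le> B"
  shows "\<bar>D \<tau> f\<bar> \<le> C * Mean (\<lambda>x. \<bar>f x\<bar>)"
proof (rule LIMSEQ_le_const2)
  show "(\<lambda>k. \<bar>diag_sum \<tau> k f\<bar>) \<longlonglongrightarrow> \<bar>D \<tau> f\<bar>" by (intro tendsto_rabs diag_sum_tendsto[OF f])
  have "\<bar>diag_sum \<tau> k f\<bar> \<le> C * Mean (\<lambda>x. \<bar>f x\<bar>)" if "n \<le> k" for k
  proof -
    have "\<bar>diag_sum \<tau> k f\<bar> \<le> (\<Sum>u<2 ^ k. \<bar>f (real u / 2 ^ k)\<bar> * (C / 2 ^ k))"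
      unfolding diag_sum_def
      by (rule order_trans[OF sum_abs], rule sum_mono, simp only: abs_mult)
        (intro mult_left_mono abs_mat_le, auto)
    also have "\<dots> = C * Mean (\<lambda>x. \<bar>f x\<bar>)"
      using step_mono[OF f(1) that] by (simp add: Mean_eq[of k] step_comp mean_def sum_distrib_left sum_divide_distrib mult_ac)
    finally show ?thesis .
  qed
  then show "\<exists>N. \<forall>k\<ge>N. \<bar>diag_sum \<tau> k f\<bar> \<le> C * Mean (\<lambda>x. \<bar>f x\<bar>)" by blast
qed

lemma D_close:
  assumes "e > 0"
  obtains n0 where "\<And>n m f. n0 \<le> n \<Longrightarrow> n \<le> m \<Longrightarrow> step n f \<Longrightarrow> (\<And>x. \<bar>f x\<bar> \<le> 1) \<Longrightarrow> \<bar>diag_sum \<tau> m f - D \<tau> f\<bar> \<le> e"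
proof -
  obtain n0 where n0: "\<And>n m. n0 \<le> n \<Longrightarrow> n \<le> m \<Longrightarrow> off_diag \<tau> n m m \<le> e"
    using off_diag_small[OF assms] by blast
  show ?thesis
  proof (rule that[of n0])
    fix n m :: nat and f :: "real \<Rightarrow> real" assume a: "n0 \<le> n" "n \<le> m" "step n f" "\<And>x. \<bar>f x\<bar> \<le> 1"
    have "(\<lambda>k. \<bar>diag_sum \<tau> m f - diag_sum \<tau> k f\<bar>) \<longlonglongrightarrow> \<bar>diag_sum \<tau> m f - D \<tau> f\<bar>"
      by (intro tendsto_intros diag_sum_tendsto[OF a(3,4)])
    moreover have "\<bar>diag_sum \<tau> m f - diag_sum \<tau> k f\<bar> \<le> e" if "m \<le> k" for k
      using diag_sum_dist[OF step_mono[OF a(3,2)] a(4) that] n0[of m k] a(1,2) that by simp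
    ultimately show "\<bar>diag_sum \<tau> m f - D \<tau> f\<bar> \<le> e"
      by (intro LIMSEQ_le_const2) blast+
  qed
qed

text \<open>
  A diagonal Haar coefficient is the sum over a \<open>2 \<times> 2\<close> block with the signs \<open>\<plusminus>1\<close>, so
  \<open>signed_diag_sum\<close> compares it with the diagonal sum of the next level.
\<close>

lemma haar_diag_tendsto:
  assumes "step n f" "\<And>x. \<bar>f x\<bar> \<le> B"
  shows "(\<lambda>k. \<Sum>i<2 ^ k. f (real i / 2 ^ k) * hE k i (\<tau> (hatom k i))) \<longlonglongrightarrow> D \<tau> f"
proof -
  define h where "h k = (\<Sum>i<2 ^ k. f (real i / 2 ^ k) * hE k i (\<tau> (hatom k i)))" for k
  have B: "B \<ge> 0" using assms(2)[of 0] by linarith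
  have close: "\<bar>h k - diag_sum \<tau> (Suc k) f\<bar> \<le> B * off_diag \<tau> k (Suc k) (Suc k)" if "n \<le> k" for k
  proof -
    have d: "(2 * u + 1) div 2 = u" for u :: nat by simp
    have "h k = (\<Sum>u<2 ^ Suc k. \<Sum>v<2 ^ Suc k. if u div 2 ^ (Suc k - k) = v div 2 ^ (Suc k - k)
        then f (real u / 2 ^ Suc k) * ((-1) ^ u * (-1) ^ v) * mat \<tau> (Suc k) u v else 0)"
    proof -
      have "h k = (\<Sum>i<2 ^ k. \<Sum>u<2. \<Sum>v<2. f (real (2 * i + u) / 2 ^ Suc k)
          * ((-1) ^ (2 * i + u) * (-1) ^ (2 * i + v)) * mat \<tau> (Suc k) (2 * i + u) (2 * i + v))"
        unfolding h_def
      proof (intro sum.cong refl)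
        fix i :: nat
        have two: "(\<Sum>u<2. g u) = g 0 + g (1::nat)" for g :: "nat \<Rightarrow> real"
          by (simp add: numeral_2_eq_2)
        have o: "f (real (2 * i + 1) / 2 ^ Suc k) = f (real i / 2 ^ k)"
          by (rule step_odd[OF assms(1) that])
        have e: "f (real (2 * i + 0) / 2 ^ Suc k) = f (real i / 2 ^ k)" by simp
        have s: "(-1::real) ^ (2 * i + 0) = 1" "(-1::real) ^ (2 * i + 1) = -1" by simp_all
        have m: "hE k i (\<tau> (hatom k i)) = mat \<tau> (Suc k) (2 * i + 0) (2 * i + 0) - mat \<tau> (Suc k) (2 * i + 0) (2 * i + 1)
          - (mat \<tau> (Suc k) (2 * i + 1) (2 * i + 0) - mat \<tau> (Suc k) (2 * i + 1) (2 * i + 1))"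
          by (simp add: hE_def hatom_def linear_diff[OF lin] E_diff mat_def)
        show "f (real i / 2 ^ k) * hE k i (\<tau> (hatom k i)) = (\<Sum>u<2. \<Sum>v<2. f (real (2 * i + u) / 2 ^ Suc k)
          * ((-1) ^ (2 * i + u) * (-1) ^ (2 * i + v)) * mat \<tau> (Suc k) (2 * i + u) (2 * i + v))"
          unfolding two o e s m by (simp only: algebra_simps mult_1 minus_mult_minus)
      qed
      also have "\<dots> = (\<Sum>u<2 ^ k * 2. \<Sum>v<2 ^ k * 2. if u div 2 = v div 2
        then f (real u / 2 ^ Suc k) * ((-1) ^ u * (-1) ^ v) * mat \<tau> (Suc k) u v else 0)"
        by (rule sum_same_block[symmetric]) simp
      finally show ?thesis by (simp add: mult.commute)
    qed
    then show ?thesis using signed_diag_sum[of f B k "Suc k" "\<lambda>u. (-1) ^ u"] assms by simp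
  qed
  have "(\<lambda>k. h k - diag_sum \<tau> (Suc k) f) \<longlonglongrightarrow> 0"
  proof (rule LIMSEQ_I)
    fix e :: real assume e: "e > 0"
    then have "e / (2 * (B + 1)) > 0" using B by simp
    then obtain n0 where n0: "\<And>n m. n0 \<le> n \<Longrightarrow> n \<le> m \<Longrightarrow> off_diag \<tau> n m m \<le> e / (2 * (B + 1))"
      using off_diag_small by blast
    have "norm (h k - diag_sum \<tau> (Suc k) f - 0) < e" if "max n n0 \<le> k" for k
    proof -
      have "\<bar>h k - diag_sum \<tau> (Suc k) f\<bar> \<le> B * (e / (2 * (B + 1)))"
        using that by (intro order_trans[OF close] mult_left_mono n0 B) auto
      also have "\<dots> < e" using e B add_nonneg_pos[of "B * e" "e * 2"] by (simp add: field_simps)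
      finally show ?thesis by simp
    qed
    then show "\<exists>N. \<forall>k\<ge>N. norm (h k - diag_sum \<tau> (Suc k) f - 0) < e" by blast
  qed
  from tendsto_add[OF this LIMSEQ_Suc[OF diag_sum_tendsto[OF assms]]] show ?thesis
    by (simp add: h_def)
qed

text \<open>
  The passage from large diagonal coefficients to a large diagonal. The hypothesis bounds the signed
  sums over the blocks of arbitrarily fine levels \<open>k\<close> from below, with \<open>r\<close> the depth of the blocks.
  Summed over all blocks with a suitable sign in front of each, they amount to at least \<open>\<delta>\<close>; but up to
  small off-diagonal errors this sum is \<open>D \<tau> f\<close> for the step function \<open>f\<close> of those signs, so the
  cells of level \<open>k\<close> cannot all have small \<open>D \<tau>\<close>.
\<close>

lemma good_cell:
  assumes "\<delta> > 0"
    and inf: "\<And>n. \<exists>k\<ge>n. \<exists>r \<theta>. (\<forall>u. \<bar>\<theta> u\<bar> = 1) \<and> (\<forall>i<2 ^ k. \<delta> / 2 ^ k \<le>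
      \<bar>\<Sum>u<2 ^ r. \<theta> (2 ^ r * i + u) * E (k + r) (2 ^ r * i + u)
          (\<tau> (\<Sum>v<2 ^ r. \<theta> (2 ^ r * i + v) *\<^sub>R atom (k + r) (2 ^ r * i + v)))\<bar>)"
  shows "\<exists>k i. i < 2 ^ k \<and> \<delta> / 2 / 2 ^ k \<le> \<bar>D \<tau> (cell_ind k i)\<bar>"
proof (rule ccontr)
  assume neg: "\<not> ?thesis"
  have "\<delta> / 8 > 0" using assms by simp
  then obtain n0 where n0: "\<And>n m f. n0 \<le> n \<Longrightarrow> n \<le> m \<Longrightarrow> step n f \<Longrightarrow> (\<And>x. \<bar>f x\<bar> \<le> 1) \<Longrightarrow> \<bar>diag_sum \<tau> m f - D \<tau> f\<bar> \<le> \<delta> / 8"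
    using D_close by blast
  obtain n1 where n1: "\<And>n m. n1 \<le> n \<Longrightarrow> n \<le> m \<Longrightarrow> off_diag \<tau> n m m \<le> \<delta> / 8"
    using off_diag_small \<open>\<delta> / 8 > 0\<close> by blast
  obtain k r \<theta> where k: "max n0 n1 \<le> k" and \<theta>: "\<And>u. \<bar>\<theta> u\<bar> = 1"
    and big: "\<And>i. i < 2 ^ k \<Longrightarrow> \<delta> / 2 ^ k \<le>
      \<bar>\<Sum>u<2 ^ r. \<theta> (2 ^ r * i + u) * E (k + r) (2 ^ r * i + u)
          (\<tau> (\<Sum>v<2 ^ r. \<theta> (2 ^ r * i + v) *\<^sub>R atom (k + r) (2 ^ r * i + v)))\<bar>"
    using inf[of "max n0 n1"] by blast
  define G where "G i = (\<Sum>u<2 ^ r. \<Sum>v<2 ^ r. \<theta> (2 ^ r * i + u) * \<theta> (2 ^ r * i + v) *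
     mat \<tau> (k + r) (2 ^ r * i + u) (2 ^ r * i + v))" for i
  have G: "\<delta> / 2 ^ k \<le> \<bar>G i\<bar>" if "i < 2 ^ k" for i
    using big[OF that]
    by (simp add: G_def mat_def linear_sum[OF lin] linear_scale[OF lin] E_sum E_scale sum_distrib_left mult.assoc)
  define f where "f x = (\<Sum>i<2 ^ k. sgn (G i) * cell_ind k i x)" for x
  have fval: "f x = (if cell_index k x < 2 ^ k then sgn (G (cell_index k x)) else 0)" for x
    unfolding f_def cell_ind_def by (simp add: if_distrib[where f = "\<lambda>a. _ * a"] cong: if_cong)
  have f1: "\<bar>f x\<bar> \<le> 1" for x by (simp add: fval abs_sgn_eq)
  have fs: "step k f"
    unfolding f_def[abs_def] by (intro step_sum step_mult step_const step_cell_ind)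
  have "\<delta> \<le> (\<Sum>i<2 ^ k. \<bar>G i\<bar>)"
    using sum_mono[of "{..<2 ^ k}" "\<lambda>_. \<delta> / 2 ^ k" "\<lambda>i. \<bar>G i\<bar>"] G by simp
  also have "\<dots> = (\<Sum>i<2 ^ k. sgn (G i) * G i)"
    by (intro sum.cong) (auto simp: abs_sgn mult.commute)
  also have "\<dots> = (\<Sum>i<2 ^ k. \<Sum>u<2 ^ r. \<Sum>v<2 ^ r.
      f (real (2 ^ r * i + u) / 2 ^ (k + r)) * (\<theta> (2 ^ r * i + u) * \<theta> (2 ^ r * i + v)) *
      mat \<tau> (k + r) (2 ^ r * i + u) (2 ^ r * i + v))"
  proof (intro sum.cong refl)
    fix i :: nat assume i: "i \<in> {..<2 ^ k}"
    have "f (real (2 ^ r * i + u) / 2 ^ (k + r)) = sgn (G i)" if "u < 2 ^ r" for u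
      using i that unfolding fval by (simp add: cell_index_dyadic del: of_nat_add of_nat_mult)
    then show "sgn (G i) * G i = (\<Sum>u<2 ^ r. \<Sum>v<2 ^ r.
      f (real (2 ^ r * i + u) / 2 ^ (k + r)) * (\<theta> (2 ^ r * i + u) * \<theta> (2 ^ r * i + v)) *
      mat \<tau> (k + r) (2 ^ r * i + u) (2 ^ r * i + v))"
      unfolding G_def sum_distrib_left by (intro sum.cong refl) (simp add: mult_ac del: of_nat_add of_nat_mult)
  qed
  also have "\<dots> = (\<Sum>u<2 ^ (k + r). \<Sum>v<2 ^ (k + r). if u div 2 ^ (k + r - k) = v div 2 ^ (k + r - k)
      then f (real u / 2 ^ (k + r)) * (\<theta> u * \<theta> v) * mat \<tau> (k + r) u v else 0)"
    using sum_same_block[of "2 ^ r" "\<lambda>u v. f (real u / 2 ^ (k + r)) * (\<theta> u * \<theta> v) * mat \<tau> (k + r) u v" "2 ^ k"]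
    by (simp add: power_add)
  also have "\<dots> \<le> diag_sum \<tau> (k + r) f + off_diag \<tau> k (k + r) (k + r)"
    using signed_diag_sum[of f 1 k "k + r" \<theta>] f1 \<theta> by simp
  also have "\<dots> \<le> D \<tau> f + \<delta> / 8 + \<delta> / 8"
  proof -
    have "\<bar>diag_sum \<tau> (k + r) f - D \<tau> f\<bar> \<le> \<delta> / 8" using n0[of k "k + r" f] k fs f1 by auto
    moreover have "off_diag \<tau> k (k + r) (k + r) \<le> \<delta> / 8" using n1[of k "k + r"] k by auto
    ultimately show ?thesis by linarith
  qed
  also have "D \<tau> f \<le> \<delta> / 2"
  proof -
    have c1: "\<bar>cell_ind k i x\<bar> \<le> 1" for i x by (simp add: cell_ind_def)
    have "D \<tau> f = (\<Sum>i<2 ^ k. D \<tau> (\<lambda>x. sgn (G i) * cell_ind k i x))"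
      unfolding f_def[abs_def]
      by (intro D_sum[where n = k and B = 1]) (auto intro!: step_mult step_cell_ind simp: abs_mult abs_sgn_eq c1)
    also have "\<dots> = (\<Sum>i<2 ^ k. sgn (G i) * D \<tau> (cell_ind k i))"
      by (intro sum.cong refl D_scale[where n = k and B = 1] step_cell_ind) (auto simp: cell_ind_def)
    also have "\<dots> \<le> (\<Sum>i<(2::nat) ^ k. \<delta> / 2 / 2 ^ k)"
    proof (rule sum_mono)
      fix i :: nat assume "i \<in> {..<2 ^ k}"
      then have "\<bar>D \<tau> (cell_ind k i)\<bar> < \<delta> / 2 / 2 ^ k" using neg by force
      moreover have "sgn (G i) * D \<tau> (cell_ind k i) \<le> \<bar>D \<tau> (cell_ind k i)\<bar>"
        by (auto simp: sgn_if)
      ultimately show "sgn (G i) * D \<tau> (cell_ind k i) \<le> \<delta> / 2 / 2 ^ k" by linarith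
    qed
    finally show ?thesis by simp
  qed
  finally show False using assms(1) by simp
qed

end

end

section \<open>Random signs\<close>

text \<open>
  The expectation over independent signs in the first \<open>n\<close> places, with 1 in all other places.
\<close>

fun signavg :: "nat \<Rightarrow> ((nat \<Rightarrow> real) \<Rightarrow> real) \<Rightarrow> real" where
  "signavg 0 F = F (\<lambda>_. 1)"
| "signavg (Suc n) F = (signavg n (\<lambda>\<epsilon>. F (\<epsilon>(n := 1))) + signavg n (\<lambda>\<epsilon>. F (\<epsilon>(n := -1)))) / 2"

lemma signavg_add: "signavg n (\<lambda>\<epsilon>. F \<epsilon> + G \<epsilon>) = signavg n F + signavg n G"
  by (induction n arbitrary: F G) (simp_all add: field_simps)

lemma signavg_scale: "signavg n (\<lambda>\<epsilon>. c * F \<epsilon>) = c * signavg n F"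
  by (induction n arbitrary: F) (simp_all add: field_simps)

lemma signavg_const [simp]: "signavg n (\<lambda>_. c) = c"
  by (induction n) simp_all

lemma signavg_sum: "finite I \<Longrightarrow> signavg n (\<lambda>\<epsilon>. \<Sum>p\<in>I. F p \<epsilon>) = (\<Sum>p\<in>I. signavg n (F p))"
  by (induction I rule: finite_induct) (simp_all add: signavg_add)

lemma signavg_attained:
  "\<exists>\<epsilon>. (\<forall>i. \<epsilon> i = 1 \<or> \<epsilon> i = -1) \<and> F \<epsilon> \<le> signavg n F"
proof (induction n arbitrary: F)
  case (Suc n)
  obtain s :: real where s: "s = 1 \<or> s = -1" "signavg n (\<lambda>\<epsilon>. F (\<epsilon>(n := s))) \<le> signavg (Suc n) F"
    by (cases "signavg n (\<lambda>\<epsilon>. F (\<epsilon>(n := 1))) \<le> signavg n (\<lambda>\<epsilon>. F (\<epsilon>(n := -1)))") force+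
  obtain \<epsilon> where \<epsilon>: "\<forall>i. \<epsilon> i = 1 \<or> \<epsilon> i = -1" "F (\<epsilon>(n := s)) \<le> signavg n (\<lambda>\<epsilon>. F (\<epsilon>(n := s)))"
    using Suc[of "\<lambda>\<epsilon>. F (\<epsilon>(n := s))"] by blast
  have "\<forall>i. (\<epsilon>(n := s)) i = 1 \<or> (\<epsilon>(n := s)) i = -1" using \<epsilon>(1) s(1) by simp
  with order_trans[OF \<epsilon>(2) s(2)] show ?case by blast
qed (auto intro!: exI[of _ "\<lambda>_. 1"])

text \<open>
  The contribution of the last sign: the parallelogram law removes the cross terms.
\<close>

lemma signavg_flip: "signavg n (\<lambda>\<epsilon>. (S \<epsilon> + L \<epsilon>)\<^sup>2) + signavg n (\<lambda>\<epsilon>. (S \<epsilon> - L \<epsilon>)\<^sup>2)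
    = 2 * (signavg n (\<lambda>\<epsilon>. (S \<epsilon>)\<^sup>2) + signavg n (\<lambda>\<epsilon>. (L \<epsilon>)\<^sup>2))"
  by (simp flip: signavg_add signavg_scale) (simp add: power2_eq_square algebra_simps)

lemma signavg_linear: "signavg n (\<lambda>\<epsilon>. (\<Sum>i<n. \<epsilon> i * w i)\<^sup>2) = (\<Sum>i<n. (w i)\<^sup>2)"
proof (induction n)
  case (Suc n)
  have "(\<Sum>i<Suc n. (\<epsilon>(n := s)) i * w i) = (\<Sum>i<n. \<epsilon> i * w i) + s * w n" for \<epsilon> s
    by simp
  then show ?case
    using signavg_flip[of n "\<lambda>\<epsilon>. \<Sum>i<n. \<epsilon> i * w i" "\<lambda>_. w n"] Suc by simp
qed simp

lemma signavg_quadratic: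
  "signavg n (\<lambda>\<epsilon>. (\<Sum>i<n. \<Sum>j<i. \<epsilon> i * \<epsilon> j * s i j)\<^sup>2) = (\<Sum>i<n. \<Sum>j<i. (s i j)\<^sup>2)"
proof (induction n)
  case (Suc n)
  have "(\<Sum>i<Suc n. \<Sum>j<i. (\<epsilon>(n := c)) i * (\<epsilon>(n := c)) j * s i j)
     = (\<Sum>i<n. \<Sum>j<i. \<epsilon> i * \<epsilon> j * s i j) + c * (\<Sum>j<n. \<epsilon> j * s n j)" for \<epsilon> c
    by (simp add: sum_distrib_left mult.assoc)
  then show ?case
    using signavg_flip[of n "\<lambda>\<epsilon>. \<Sum>i<n. \<Sum>j<i. \<epsilon> i * \<epsilon> j * s i j" "\<lambda>\<epsilon>. \<Sum>j<n. \<epsilon> j * s n j"] Suc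
    by (simp add: signavg_linear)
qed simp

lemma sum_square_triangle:
  fixes g :: "nat \<Rightarrow> nat \<Rightarrow> real"
  shows "(\<Sum>i<n. \<Sum>j<n. g i j) = (\<Sum>i<n. g i i) + (\<Sum>i<n. \<Sum>j<i. g i j + g j i)"
  by (induction n) (simp_all add: sum.distrib algebra_simps)

text \<open>
  All requirements are tested by the sum of their squares. Its expectation is at most \<open>\<beta>\<^sup>2\<close>, because
  the signs, and likewise the products of two different signs, are orthonormal; so some choice of signs
  does not exceed this.
\<close>

lemma good_signs:
  fixes w :: "'p \<Rightarrow> nat \<Rightarrow> real" and t :: "nat \<Rightarrow> nat \<Rightarrow> real"
  assumes "finite P"
    and B: "(\<Sum>p\<in>P. \<Sum>i<n. (w p i)\<^sup>2) + 2 * (\<Sum>i<n. \<Sum>j<n. (t i j)\<^sup>2) \<le> \<beta>\<^sup>2" "0 \<le> \<beta>"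
  obtains \<epsilon> where "\<And>i. \<epsilon> i = 1 \<or> \<epsilon> i = -1"
    "\<And>p. p \<in> P \<Longrightarrow> \<bar>\<Sum>i<n. \<epsilon> i * w p i\<bar> \<le> \<beta>"
    "\<bar>(\<Sum>i<n. \<Sum>j<n. \<epsilon> i * \<epsilon> j * t i j) - (\<Sum>i<n. t i i)\<bar> \<le> \<beta>"
proof -
  define Q where "Q \<epsilon> = (\<Sum>i<n. \<Sum>j<i. \<epsilon> i * \<epsilon> j * (t i j + t j i))" for \<epsilon>
  define F where "F \<epsilon> = (\<Sum>p\<in>P. (\<Sum>i<n. \<epsilon> i * w p i)\<^sup>2) + (Q \<epsilon>)\<^sup>2" for \<epsilon>
  obtain \<epsilon> where \<epsilon>: "\<And>i. \<epsilon> i = 1 \<or> \<epsilon> i = -1" "F \<epsilon> \<le> signavg n F"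
    using signavg_attained[of F n] by blast
  have "signavg n F = (\<Sum>p\<in>P. \<Sum>i<n. (w p i)\<^sup>2) + (\<Sum>i<n. \<Sum>j<i. (t i j + t j i)\<^sup>2)"
    unfolding F_def[abs_def] Q_def signavg_add signavg_sum[OF assms(1)] signavg_linear signavg_quadratic ..
  also have "(\<Sum>i<n. \<Sum>j<i. (t i j + t j i)\<^sup>2) \<le> (\<Sum>i<n. \<Sum>j<i. 2 * ((t i j)\<^sup>2 + (t j i)\<^sup>2))"
  proof (intro sum_mono)
    fix i j show "(t i j + t j i)\<^sup>2 \<le> 2 * ((t i j)\<^sup>2 + (t j i)\<^sup>2)"
      using zero_le_power2[of "t i j - t j i"] by (simp add: power2_eq_square algebra_simps)
  qed
  also have "\<dots> \<le> 2 * (\<Sum>i<n. \<Sum>j<n. (t i j)\<^sup>2)"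
    unfolding sum_square_triangle[of "\<lambda>i j. (t i j)\<^sup>2"] by (simp add: sum_distrib_left sum_nonneg)
  finally have F: "F \<epsilon> \<le> \<beta>\<^sup>2" using \<epsilon>(2) B by linarith
  have "\<bar>\<Sum>i<n. \<epsilon> i * w p i\<bar> \<le> \<beta>" if "p \<in> P" for p
  proof -
    have "(\<Sum>i<n. \<epsilon> i * w p i)\<^sup>2 \<le> (\<Sum>p\<in>P. (\<Sum>i<n. \<epsilon> i * w p i)\<^sup>2)"
      using assms(1) that by (intro member_le_sum) auto
    then have "(\<Sum>i<n. \<epsilon> i * w p i)\<^sup>2 \<le> \<beta>\<^sup>2" using F unfolding F_def by (smt (verit) zero_le_power2)
    then show ?thesis using B(2) by (simp add: abs_le_square_iff[symmetric])
  qed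
  moreover have "\<bar>(\<Sum>i<n. \<Sum>j<n. \<epsilon> i * \<epsilon> j * t i j) - (\<Sum>i<n. t i i)\<bar> \<le> \<beta>"
  proof -
    have \<epsilon>2: "\<epsilon> i * \<epsilon> i = 1" for i using \<epsilon>(1)[of i] by auto
    have "(\<Sum>i<n. \<Sum>j<n. \<epsilon> i * \<epsilon> j * t i j) - (\<Sum>i<n. t i i) = Q \<epsilon>"
      unfolding sum_square_triangle[of "\<lambda>i j. \<epsilon> i * \<epsilon> j * t i j"] Q_def
      by (simp add: \<epsilon>2 algebra_simps)
    moreover have "(Q \<epsilon>)\<^sup>2 \<le> \<beta>\<^sup>2" using F sum_nonneg[of P "\<lambda>p. (\<Sum>i<n. \<epsilon> i * w p i)\<^sup>2"]
      unfolding F_def by simp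
    ultimately show ?thesis using B(2) by (simp add: abs_le_square_iff[symmetric])
  qed
  ultimately show ?thesis using that[of \<epsilon>] \<epsilon>(1) by blast
qed

text \<open>
  On each cell \<open>i\<close> of level \<open>k\<close> the Haar function of the cell times the sign \<open>\<epsilon> i\<close>, restricted to the
  support \<open>a\<close>.
\<close>

definition haar_step :: "nat \<Rightarrow> (real \<Rightarrow> real) \<Rightarrow> (nat \<Rightarrow> real) \<Rightarrow> real \<Rightarrow> real" where
  "haar_step k a \<epsilon> x = a x * \<epsilon> (cell_index k x) * (-1) ^ cell_index (Suc k) x"

lemma step_haar_step:
  assumes "step k a" shows "step (Suc k) (haar_step k a \<epsilon>)"
  unfolding haar_step_def[abs_def]
  by (intro step_mult step_cell_index step_mono[OF assms] step_mono[OF step_cell_index, of k]) auto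

lemma haar_step_value:
  assumes "step k a"
  shows "haar_step k a \<epsilon> (real (2 * i) / 2 ^ Suc k) = a (real i / 2 ^ k) * \<epsilon> i"
    "haar_step k a \<epsilon> (real (2 * i + 1) / 2 ^ Suc k) = - (a (real i / 2 ^ k) * \<epsilon> i)"
proof -
  have "cell_index k (real (2 * i) / 2 ^ Suc k) = i" "cell_index k (real (2 * i + 1) / 2 ^ Suc k) = i"
    by (subst cell_index_dyadic; simp)+
  then show "haar_step k a \<epsilon> (real (2 * i) / 2 ^ Suc k) = a (real i / 2 ^ k) * \<epsilon> i"
    "haar_step k a \<epsilon> (real (2 * i + 1) / 2 ^ Suc k) = - (a (real i / 2 ^ k) * \<epsilon> i)"
    unfolding haar_step_def step_odd[OF assms order_refl] cell_index_self
    by (simp_all only: dyadic_even cell_index_self) simp_all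
qed

context l1_tree
begin

lemma emb_haar_step: "step k a \<Longrightarrow> Emb (haar_step k a \<epsilon>) = (\<Sum>i<2 ^ k. (\<epsilon> i * a (real i / 2 ^ k)) *\<^sub>R hatom k i)"
  unfolding Emb_eq[OF step_haar_step] emb_def power_Suc[of "2::nat" k] sum_lessThan_double
  unfolding haar_step_value hatom_def by (simp add: algebra_simps)

lemma Pr_haar_step: "step k a \<Longrightarrow> Pr (haar_step k a \<epsilon>) x = (\<Sum>i<2 ^ k. \<epsilon> i * (a (real i / 2 ^ k) * hE k i x))"
  unfolding Pr_eq[OF step_haar_step] pair_def power_Suc[of "2::nat" k] sum_lessThan_double
  unfolding haar_step_value hE_def by (simp add: algebra_simps)

lemma Mean_haar_step:
  assumes "step k a" "step k g" shows "Mean (\<lambda>x. g x * haar_step k a \<epsilon> x) = 0"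
proof -
  have st: "step (Suc k) (\<lambda>x. g x * haar_step k a \<epsilon> x)"
    using step_mult[OF step_mono[OF assms(2)] step_haar_step[OF assms(1)]] by simp
  show ?thesis
    unfolding Mean_eq[OF st] mean_def power_Suc[of "2::nat" k] sum_lessThan_double
    unfolding haar_step_value[OF assms(1)]
    unfolding step_odd[OF assms(2) order_refl] dyadic_even
    by (simp add: algebra_simps)
qed

lemma Pr_haar_step_Emb: "step k a \<Longrightarrow> step k g \<Longrightarrow> Pr (haar_step k a \<epsilon>) (Emb g) = 0"
  using Mean_haar_step[of k a g \<epsilon>] Pr_Emb[OF step_haar_step step_mono, of k a k g \<epsilon>]
  by (simp add: mult.commute)

lemma sum_abs_hE: "(\<Sum>i<2 ^ k. \<bar>hE k i x\<bar>) \<le> norm x"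
proof -
  have "(\<Sum>i<2 ^ k. \<bar>hE k i x\<bar>) \<le> (\<Sum>i<2 ^ Suc k. \<bar>E (Suc k) i x\<bar>)"
    unfolding power_Suc[of "2::nat" k] sum_lessThan_double hE_def by (intro sum_mono) auto
  also have "\<dots> \<le> norm x" by (rule E_norm)
  finally show ?thesis .
qed

lemma norm_hatom: "i < 2 ^ k \<Longrightarrow> norm (hatom k i) \<le> 1 / 2 ^ k"
  using norm_triangle_ineq4[of "atom (Suc k) (2 * i)" "atom (Suc k) (2 * i + 1)"]
    atom_norm[of "2 * i" "Suc k"] atom_norm[of "2 * i + 1" "Suc k"] by (simp add: hatom_def)

lemma linear_hE: "linear (hE k i)"
  unfolding hE_def[abs_def] by (intro linear_compose_sub E_linear)

text \<open>
  Step functions have no Haar coefficients at fine levels, and they are dense.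
\<close>

lemma haar_vanish:
  assumes "0 < \<eta>" shows "\<forall>\<^sub>F k in sequentially. (\<Sum>i<2 ^ k. \<bar>hE k i g\<bar>) \<le> \<eta>"
proof -
  obtain n f where f: "step n f" "norm (g - Emb f) < \<eta>" using dense_step[OF assms] by blast
  have "(\<Sum>i<2 ^ k. \<bar>hE k i g\<bar>) \<le> \<eta>" if k: "n \<le> k" for k
  proof -
    have z: "hE k i (Emb f) = 0" if i: "i < 2 ^ k" for i
    proof -
      have e: "Emb f = emb (Suc k) f" using step_mono[OF f(1)] k by (intro Emb_eq) simp
      have "2 * i + 1 < 2 ^ Suc k" using i by simp
      then have "E (Suc k) (2 * i + 1) (Emb f) = f (real i / 2 ^ k) / 2 ^ Suc k"
        "E (Suc k) (2 * i) (Emb f) = f (real i / 2 ^ k) / 2 ^ Suc k"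
        unfolding e by (subst E_emb; simp only: step_odd[OF f(1) k] dyadic_even; simp)+
      then show ?thesis by (simp add: hE_def)
    qed
    have "(\<Sum>i<2 ^ k. \<bar>hE k i g\<bar>) = (\<Sum>i<2 ^ k. \<bar>hE k i (g - Emb f)\<bar>)"
      by (intro sum.cong) (simp_all add: linear_diff[OF linear_hE] z)
    also have "\<dots> \<le> norm (g - Emb f)" by (rule sum_abs_hE)
    finally show ?thesis using f(2) by simp
  qed
  then show ?thesis by (auto simp: eventually_sequentially)
qed

lemma D_cong:
  assumes "\<And>m i. i < 2 ^ m \<Longrightarrow> f (real i / 2 ^ m) = g (real i / 2 ^ m)"
  shows "D \<tau> f = D \<tau> g"
  unfolding D_def diag_sum_def using assms by simp

lemma Mean_cell_ind: "i < 2 ^ k \<Longrightarrow> Mean (cell_ind k i) = 1 / 2 ^ k"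
  by (simp add: Mean_eq[OF step_cell_ind] mean_def cell_ind_def)

lemma sum_squares_le:
  fixes w :: "nat \<Rightarrow> real"
  assumes "\<And>i. i < 2 ^ k \<Longrightarrow> \<bar>w i\<bar> \<le> K / 2 ^ k" shows "(\<Sum>i<2 ^ k. (w i)\<^sup>2) \<le> K\<^sup>2 / 2 ^ k"
proof -
  have "(\<Sum>i<2 ^ k. (w i)\<^sup>2) \<le> (\<Sum>i<(2::nat) ^ k. (K / 2 ^ k)\<^sup>2)"
    using power_mono[OF assms, of _ 2] by (intro sum_mono) simp
  then show ?thesis by (simp add: power2_eq_square)
qed

text \<open>
  At level \<open>k\<close> the coefficients in the sign sums for the functionals in \<open>\<Phi>\<close> and for \<open>D \<tau>\<close>, and the
  column sums of the quadratic form \<open>Pr b (\<tau> (Emb b))\<close>, are all of order \<open>1 / 2 ^ k\<close>, which leaves mean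
  squares of order \<open>1 / 2 ^ k\<close>. The diagonal of the quadratic form is independent of the signs and
  tends to \<open>D \<tau> a\<close>, and the condition on \<open>G\<close> holds for all signs by \<open>haar_vanish\<close>.
\<close>

lemma good_haar_step:
  assumes \<tau>: "linear \<tau>" "\<And>x. norm (\<tau> x) \<le> C * norm x"
    and a: "step n0 a" "\<And>x. a x = 0 \<or> a x = 1"
    and \<rho>: "step n0 \<rho>" "\<And>x. \<bar>\<rho> x\<bar> \<le> 1"
    and \<Phi>: "finite \<Phi>" "\<And>\<phi>. \<phi> \<in> \<Phi> \<Longrightarrow> linear \<phi>" "\<And>\<phi> x. \<phi> \<in> \<Phi> \<Longrightarrow> \<bar>\<phi> x\<bar> \<le> K * norm x"
    and G: "finite G" and \<eta>: "0 < \<eta>"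
  shows "\<exists>k\<ge>n0. \<exists>\<epsilon>. (\<forall>i. \<epsilon> i = 1 \<or> \<epsilon> i = -1) \<and>
    (\<forall>\<phi>\<in>\<Phi>. \<bar>\<phi> (Emb (haar_step k a \<epsilon>))\<bar> \<le> \<eta>) \<and>
    (\<forall>g\<in>G. \<bar>Pr (haar_step k a \<epsilon>) g\<bar> \<le> \<eta>) \<and>
    \<bar>Pr (haar_step k a \<epsilon>) (\<tau> (Emb (haar_step k a \<epsilon>))) - D \<tau> a\<bar> \<le> \<eta> \<and>
    \<bar>D \<tau> (\<lambda>x. \<rho> x * haar_step k a \<epsilon> x)\<bar> \<le> \<eta>"
proof -
  note C = C_nonneg[OF \<tau>]
  have a1: "\<bar>a x\<bar> \<le> 1" for x using a(2)[of x] by auto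
  \<comment> \<open>This over \<open>2 ^ k\<close> bounds the total mean square: \<open>card \<Phi>\<close>
    functionals, the functional \<open>D \<tau>\<close>, and twice the squares of the matrix, as in
    \<open>good_signs\<close>.\<close>
  define Z where "Z = (real (card \<Phi>) * K\<^sup>2 + C\<^sup>2) + 2 * C\<^sup>2"
  have ev1: "\<forall>\<^sub>F k in sequentially. \<forall>g\<in>G. (\<Sum>i<2 ^ k. \<bar>hE k i g\<bar>) \<le> \<eta>"
    using G by (intro eventually_ball_finite) (auto intro: haar_vanish[OF \<eta>])
  have ev2: "\<forall>\<^sub>F k in sequentially. dist (\<Sum>i<2 ^ k. a (real i / 2 ^ k) * hE k i (\<tau> (hatom k i))) (D \<tau> a) < \<eta> / 2"
    using haar_diag_tendsto[OF \<tau> a(1) a1] \<eta> by (intro tendstoD) auto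
  have "(\<lambda>k. Z / 2 ^ k) \<longlonglongrightarrow> 0" by real_asymp
  then have ev3: "\<forall>\<^sub>F k in sequentially. Z / 2 ^ k < (\<eta> / 2)\<^sup>2"
    using \<eta> by (intro order_tendstoD(2)) auto
  have "\<forall>\<^sub>F k in sequentially. n0 \<le> k" by (rule eventually_ge_at_top)
  with ev1 ev2 ev3 have "\<forall>\<^sub>F k in sequentially. (\<forall>g\<in>G. (\<Sum>i<2 ^ k. \<bar>hE k i g\<bar>) \<le> \<eta>) \<and>
     dist (\<Sum>i<2 ^ k. a (real i / 2 ^ k) * hE k i (\<tau> (hatom k i))) (D \<tau> a) < \<eta> / 2 \<and>
     Z / 2 ^ k < (\<eta> / 2)\<^sup>2 \<and> n0 \<le> k" by eventually_elim auto
  then obtain k where k1: "\<And>g. g \<in> G \<Longrightarrow> (\<Sum>i<2 ^ k. \<bar>hE k i g\<bar>) \<le> \<eta>"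
    and k2: "dist (\<Sum>i<2 ^ k. a (real i / 2 ^ k) * hE k i (\<tau> (hatom k i))) (D \<tau> a) < \<eta> / 2"
    and k3: "Z / 2 ^ k < (\<eta> / 2)\<^sup>2" and k4: "n0 \<le> k"
    unfolding eventually_sequentially by blast
  have ak: "step k a" and \<rho>k: "step k \<rho>" using step_mono[OF a(1) k4] step_mono[OF \<rho>(1) k4] .
  define \<alpha> where "\<alpha> i = a (real i / 2 ^ k)" for i
  have \<alpha>1: "\<bar>\<alpha> i\<bar> \<le> 1" for i by (simp add: \<alpha>_def a1)
  define W where "W i x = \<rho> x * a x * cell_ind k i x * (-1) ^ cell_index (Suc k) x" for i x
  have W1: "\<bar>W i x\<bar> \<le> 1 * 1 * cell_ind k i x * 1" for i x
    unfolding W_def abs_mult by (intro mult_mono \<rho> a1) (auto simp: cell_ind_def)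
  have W1': "\<bar>W i x\<bar> \<le> 1" for i x using W1[of i x] by (simp add: cell_ind_def split: if_splits)
  have Ws: "step (Suc k) (W i)" for i
    unfolding W_def[abs_def]
    by (intro step_mult step_cell_index step_mono[OF \<rho>k] step_mono[OF ak] step_mono[OF step_cell_ind]) auto
  have DW: "\<bar>D \<tau> (W i)\<bar> \<le> C / 2 ^ k" if i: "i < 2 ^ k" for i
  proof -
    have "Mean (\<lambda>x. \<bar>W i x\<bar>) \<le> Mean (cell_ind k i)"
      using W1[of i] step_mono[OF step_cell_ind[of k i], of "Suc k"]
      by (simp add: Mean_eq[of "Suc k"] step_comp[OF Ws] mean_def divide_right_mono sum_mono)
    then show ?thesis
      using D_bound[OF \<tau> Ws W1', of i] mult_left_mono[OF _ C] i by (force simp: Mean_cell_ind)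
  qed
  \<comment> \<open>The index \<open>None\<close> carries the condition on \<open>D \<tau>\<close>, the others those
    on \<open>\<Phi>\<close>.\<close>
  define w where "w p i = (case p of None \<Rightarrow> D \<tau> (W i) | Some \<phi> \<Rightarrow> \<alpha> i * \<phi> (hatom k i))" for p i
  define t where "t i j = \<alpha> i * \<alpha> j * hE k i (\<tau> (hatom k j))" for i j
  let ?P = "insert None (Some ` \<Phi>)"
  have wS: "(\<Sum>p\<in>Some ` \<Phi>. \<Sum>i<2 ^ k. (w p i)\<^sup>2) \<le> real (card (Some ` \<Phi>)) * (K\<^sup>2 / 2 ^ k)"
  proof (rule sum_bounded_above)
    fix p assume "p \<in> Some ` \<Phi>"
    then obtain \<phi> where \<phi>: "p = Some \<phi>" "\<phi> \<in> \<Phi>" by blast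
    have K: "0 \<le> K" using \<Phi>(3)[OF \<phi>(2), of "atom 0 0"] E_atom[of 0 0 0] linear_0[OF E_linear]
      by (smt (verit) abs_ge_zero mult_neg_pos norm_ge_zero zero_less_norm_iff divide_self less_numeral_extra power_0)
    show "(\<Sum>i<2 ^ k. (w p i)\<^sup>2) \<le> K\<^sup>2 / 2 ^ k"
    proof (rule sum_squares_le)
      fix i :: nat assume i: "i < 2 ^ k"
      have "\<bar>w p i\<bar> \<le> 1 * (K * norm (hatom k i))"
        unfolding w_def \<phi>(1) option.case abs_mult by (intro mult_mono \<alpha>1 \<Phi>(3) \<phi>) auto
      also have "\<dots> \<le> K / 2 ^ k" using mult_left_mono[OF norm_hatom[OF i] K] by simp
      finally show "\<bar>w p i\<bar> \<le> K / 2 ^ k" .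
    qed
  qed
  have wN: "(\<Sum>i<2 ^ k. (w None i)\<^sup>2) \<le> C\<^sup>2 / 2 ^ k"
    by (rule sum_squares_le) (simp add: w_def DW)
  have tS: "(\<Sum>i<2 ^ k. \<Sum>j<2 ^ k. (t i j)\<^sup>2) \<le> C\<^sup>2 / 2 ^ k"
  proof -
    have col: "(\<Sum>i<2 ^ k. \<bar>t i j\<bar>) \<le> C / 2 ^ k" if j: "j < 2 ^ k" for j
    proof -
      have "(\<Sum>i<2 ^ k. \<bar>t i j\<bar>) \<le> (\<Sum>i<2 ^ k. 1 * 1 * \<bar>hE k i (\<tau> (hatom k j))\<bar>)"
        unfolding t_def abs_mult by (intro sum_mono mult_mono \<alpha>1) auto
      also have "\<dots> \<le> C * norm (hatom k j)"
        using sum_abs_hE[of k "\<tau> (hatom k j)"] \<tau>(2)[of "hatom k j"] by simp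
      also have "\<dots> \<le> C / 2 ^ k" using mult_left_mono[OF norm_hatom[OF j] C] by simp
      finally show ?thesis .
    qed
    have "(\<Sum>i<2 ^ k. (t i j)\<^sup>2) \<le> C / 2 ^ k * (C / 2 ^ k)" if j: "j < 2 ^ k" for j
    proof -
      have "(t i j)\<^sup>2 \<le> \<bar>t i j\<bar> * (C / 2 ^ k)" if i: "i < 2 ^ k" for i
      proof -
        have "\<bar>t i j\<bar> \<le> C / 2 ^ k"
          using order_trans[OF member_le_sum[of i "{..<2 ^ k}" "\<lambda>i. \<bar>t i j\<bar>"] col[OF j]] i by simp
        then have "\<bar>t i j\<bar> * \<bar>t i j\<bar> \<le> \<bar>t i j\<bar> * (C / 2 ^ k)" by (intro mult_left_mono) auto
        then show ?thesis by (simp add: power2_eq_square)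
      qed
      then have "(\<Sum>i<2 ^ k. (t i j)\<^sup>2) \<le> (\<Sum>i<2 ^ k. \<bar>t i j\<bar>) * (C / 2 ^ k)"
        unfolding sum_distrib_right by (intro sum_mono) simp
      also have "\<dots> \<le> C / 2 ^ k * (C / 2 ^ k)" using col[OF j] C by (intro mult_right_mono) auto
      finally show ?thesis .
    qed
    then have "(\<Sum>j<2 ^ k. \<Sum>i<2 ^ k. (t i j)\<^sup>2) \<le> (\<Sum>j<(2::nat) ^ k. C / 2 ^ k * (C / 2 ^ k))"
      by (intro sum_mono) simp
    then show ?thesis by (subst sum.swap) (simp add: power2_eq_square)
  qed
  have total: "(\<Sum>p\<in>?P. \<Sum>i<2 ^ k. (w p i)\<^sup>2) + 2 * (\<Sum>i<2 ^ k. \<Sum>j<2 ^ k. (t i j)\<^sup>2) \<le> (\<eta> / 2)\<^sup>2"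
  proof -
    have "(\<Sum>p\<in>?P. \<Sum>i<2 ^ k. (w p i)\<^sup>2) = (\<Sum>i<2 ^ k. (w None i)\<^sup>2) + (\<Sum>p\<in>Some ` \<Phi>. \<Sum>i<2 ^ k. (w p i)\<^sup>2)"
      using \<Phi>(1) by (subst sum.insert) auto
    also have "\<dots> \<le> C\<^sup>2 / 2 ^ k + real (card \<Phi>) * (K\<^sup>2 / 2 ^ k)"
      using wN wS by (simp add: card_image)
    finally have "(\<Sum>p\<in>?P. \<Sum>i<2 ^ k. (w p i)\<^sup>2) + 2 * (\<Sum>i<2 ^ k. \<Sum>j<2 ^ k. (t i j)\<^sup>2)
       \<le> C\<^sup>2 / 2 ^ k + real (card \<Phi>) * (K\<^sup>2 / 2 ^ k) + 2 * (C\<^sup>2 / 2 ^ k)" using tS by linarith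
    also have "\<dots> = Z / 2 ^ k" by (simp add: Z_def field_simps)
    finally show ?thesis using k3 by linarith
  qed
  obtain \<epsilon> where \<epsilon>: "\<And>i. \<epsilon> i = 1 \<or> \<epsilon> i = -1"
    and \<epsilon>w: "\<And>p. p \<in> ?P \<Longrightarrow> \<bar>\<Sum>i<2 ^ k. \<epsilon> i * w p i\<bar> \<le> \<eta> / 2"
    and \<epsilon>t: "\<bar>(\<Sum>i<2 ^ k. \<Sum>j<2 ^ k. \<epsilon> i * \<epsilon> j * t i j) - (\<Sum>i<2 ^ k. t i i)\<bar> \<le> \<eta> / 2"
    using good_signs[OF _ total] \<Phi>(1) \<eta> by auto
  have \<epsilon>1: "\<bar>\<epsilon> i\<bar> = 1" for i using \<epsilon>[of i] by auto
  define b where "b = haar_step k a \<epsilon>"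
  have "\<bar>\<phi> (Emb b)\<bar> \<le> \<eta>" if "\<phi> \<in> \<Phi>" for \<phi>
  proof -
    have "\<phi> (Emb b) = (\<Sum>i<2 ^ k. \<epsilon> i * w (Some \<phi>) i)"
      unfolding b_def emb_haar_step[OF ak] w_def
      by (simp add: linear_sum[OF \<Phi>(2)[OF that]] linear_scale[OF \<Phi>(2)[OF that]] \<alpha>_def mult.assoc)
    then show ?thesis using \<epsilon>w[of "Some \<phi>"] that \<eta> by simp
  qed
  moreover have "\<bar>Pr b g\<bar> \<le> \<eta>" if "g \<in> G" for g
  proof -
    have "\<bar>Pr b g\<bar> \<le> (\<Sum>i<2 ^ k. \<bar>hE k i g\<bar>)"
      unfolding b_def Pr_haar_step[OF ak]
      by (intro order_trans[OF sum_abs] sum_mono)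
        (use a1 in \<open>auto simp: abs_mult \<epsilon>1 intro: mult_left_le_one_le\<close>)
    then show ?thesis using k1[OF that] by simp
  qed
  moreover have "\<bar>Pr b (\<tau> (Emb b)) - D \<tau> a\<bar> \<le> \<eta>"
  proof -
    have "Pr b (\<tau> (Emb b)) = (\<Sum>i<2 ^ k. \<Sum>j<2 ^ k. \<epsilon> i * \<epsilon> j * t i j)"
      unfolding b_def Pr_haar_step[OF ak] emb_haar_step[OF ak]
      by (simp add: linear_sum[OF \<tau>(1)] linear_scale[OF \<tau>(1)] linear_sum[OF linear_hE]
          linear_scale[OF linear_hE] t_def \<alpha>_def sum_distrib_left mult_ac)
    moreover have "(\<Sum>i<2 ^ k. t i i) = (\<Sum>i<2 ^ k. a (real i / 2 ^ k) * hE k i (\<tau> (hatom k i)))"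
    proof (intro sum.cong refl)
      fix i show "t i i = a (real i / 2 ^ k) * hE k i (\<tau> (hatom k i))"
        using a(2)[of "real i / 2 ^ k"] by (auto simp: t_def \<alpha>_def)
    qed
    ultimately show ?thesis using \<epsilon>t k2 unfolding dist_real_def by linarith
  qed
  moreover have "\<bar>D \<tau> (\<lambda>x. \<rho> x * b x)\<bar> \<le> \<eta>"
  proof -
    have "D \<tau> (\<lambda>x. \<rho> x * b x) = D \<tau> (\<lambda>x. \<Sum>i<2 ^ k. \<epsilon> i * W i x)"
    proof (rule D_cong)
      fix m i :: nat assume i: "i < 2 ^ m"
      have lt: "cell_index k (real i / 2 ^ m) < 2 ^ k"
      proof -
        have "2 ^ k * (real i / 2 ^ m) < 2 ^ k" using i by (simp add: field_simps)
        then show ?thesis by (simp add: cell_index_def nat_less_iff floor_less_iff)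
      qed
      have "(\<Sum>j<2 ^ k. \<epsilon> j * W j x) = \<rho> x * b x" if "cell_index k x < 2 ^ k" for x
      proof -
        have "(\<Sum>j<2 ^ k. \<epsilon> j * W j x) = (\<Sum>j<2 ^ k. if j = cell_index k x
           then \<epsilon> j * (\<rho> x * a x * (-1) ^ cell_index (Suc k) x) else 0)"
          by (intro sum.cong) (auto simp: W_def cell_ind_def)
        then show ?thesis using that by (simp add: b_def haar_step_def mult_ac)
      qed
      from this[OF lt] show "\<rho> (real i / 2 ^ m) * b (real i / 2 ^ m) = (\<Sum>j<2 ^ k. \<epsilon> j * W j (real i / 2 ^ m))"
        by simp
    qed
    also have "\<dots> = (\<Sum>i<2 ^ k. D \<tau> (\<lambda>x. \<epsilon> i * W i x))"
      by (intro D_sum[OF \<tau>, where n = "Suc k" and B = 1] step_mult Ws) (auto simp: abs_mult \<epsilon>1 W1')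
    also have "\<dots> = (\<Sum>i<2 ^ k. \<epsilon> i * w None i)"
      by (simp add: w_def D_scale[OF \<tau> Ws W1'])
    finally show ?thesis using \<epsilon>w[of None] \<eta> by simp
  qed
  ultimately show ?thesis using k4 \<epsilon> unfolding b_def by blast
qed

end

section \<open>Choosing copies of the Haar system\<close>

text \<open>
  For \<open>u \<in> {-1, 0, 1}\<close> the indicator of \<open>u = 1\<close> if \<open>l\<close> is even, and of \<open>u = - 1\<close> if \<open>l\<close> is odd.
\<close>

definition half :: "nat \<Rightarrow> real \<Rightarrow> real" where
  "half l u = (u * u + (-1) ^ l * u) / 2"

text \<open>
  Nodes are numbered as in a heap: 0 is the empty set, 1 the root, and \<open>l\<close> has the children \<open>2 * l\<close>
  and \<open>2 * l + 1\<close>. The copy of the indicator of a node will be \<open>b 0\<close> times the support of the node, not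
  the support itself: also this function has to be almost annihilated by the functionals chosen before
  it, which requires oscillation. Hence it is \<open>b 0 * b l\<close> whose sign separates the two children of \<open>l\<close>.
\<close>

definition node_support :: "(real \<Rightarrow> real) \<Rightarrow> (nat \<Rightarrow> real \<Rightarrow> real) \<Rightarrow> nat \<Rightarrow> real \<Rightarrow> real" where
  "node_support A b l = (if l \<le> 1 then A else (\<lambda>x. half l (b 0 x * b (l div 2) x)))"

lemma half_01: "u \<in> {-1, 0, 1} \<Longrightarrow> half l u = 0 \<or> half l u = 1"
  by (cases "even l") (auto simp: half_def)

lemma signs_mult: "u \<in> {-1, 0, 1} \<Longrightarrow> v \<in> {-1, 0, 1} \<Longrightarrow> u * v \<in> {-1, 0, 1::real}"
  by auto

lemma prod_encode_mono: "l < l' \<Longrightarrow> prod_encode (m, l) < prod_encode (m, l')"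
proof -
  have "k \<le> k' \<Longrightarrow> triangle k \<le> triangle k'" for k k'
    unfolding triangle_def by (intro div_le_mono mult_le_mono) auto
  then have le: "prod_encode (m, l) \<le> prod_encode (m, l')" if "l \<le> l'" for l l'
    unfolding prod_encode_def using that by (auto intro!: add_mono)
  assume "l < l'"
  then have "prod_encode (m, l) \<noteq> prod_encode (m, l')" by simp
  with le[of l l'] \<open>l < l'\<close> show ?thesis by linarith
qed

context l1_tree
begin

text \<open>
  The functions for all summands \<open>m\<close> and nodes \<open>l\<close> are chosen one after the other, in the order of
  \<open>prod_encode\<close>. Then at each step only finitely many functions precede, and \<open>good_haar_step\<close> applies
  with the functionals and vectors that they define through the blocks \<open>\<tau>\<close>. The tolerance depends on
  the later of the two functions only.
\<close>

lemma node_choice: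
  assumes \<tau>: "\<And>m m'. linear (\<tau> m m')" "\<And>m m' x. norm (\<tau> m m' x) \<le> C * norm x"
    and A: "\<And>m. step (n m) (A m)" "\<And>m x. A m x = 0 \<or> A m x = 1"
    and \<eta>: "\<And>q. 0 < \<eta> q"
  obtains b :: "nat \<Rightarrow> nat \<Rightarrow> real \<Rightarrow> real" and lv :: "nat \<Rightarrow> nat \<Rightarrow> nat" where
    "\<And>m l. prod_encode (m, l) \<le> lv m l"
    "\<And>m l x. b m l x \<in> {-1, 0, 1}"
    "\<And>m l. step (lv m l) (A m)"
    "\<And>m l m' l'. prod_encode (m', l') < prod_encode (m, l) \<Longrightarrow> step (lv m l) (b m' l')"
    "\<And>m l. \<exists>\<epsilon>. (\<forall>i. \<epsilon> i = 1 \<or> \<epsilon> i = -1) \<and> b m l = haar_step (lv m l) (node_support (A m) (b m) l) \<epsilon>"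
    "\<And>m l m' l'. (m', l') \<noteq> (m, l) \<Longrightarrow>
       \<bar>Pr (b m' l') (\<tau> m' m (Emb (b m l)))\<bar> \<le> \<eta> (max (prod_encode (m', l')) (prod_encode (m, l)))"
    "\<And>m l. \<bar>Pr (b m l) (\<tau> m m (Emb (b m l))) - D (\<tau> m m) (node_support (A m) (b m) l)\<bar> \<le> \<eta> (prod_encode (m, l))"
    "\<And>m l. 1 \<le> l \<Longrightarrow> \<bar>D (\<tau> m m) (\<lambda>x. b m 0 x * b m l x)\<bar> \<le> \<eta> (prod_encode (m, l))"
proof -
  define B :: "(nat \<times> nat \<Rightarrow> nat \<times> (real \<Rightarrow> real)) \<Rightarrow> nat \<Rightarrow> nat \<Rightarrow> real \<Rightarrow> real"
    where "B f m l = snd (f (m, l))" for f m l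
  define R where "R = inv_image less_than prod_encode"
  \<comment> \<open>The choice \<open>r\<close> of a level and a function is admissible at \<open>p\<close> after the
    earlier choices \<open>f\<close>.\<close>
  define P :: "(nat \<times> nat \<Rightarrow> nat \<times> (real \<Rightarrow> real)) \<Rightarrow> nat \<times> nat \<Rightarrow> nat \<times> (real \<Rightarrow> real) \<Rightarrow> bool" where
    "P f p r \<longleftrightarrow> (case p of (m, l) \<Rightarrow> case r of (k, b) \<Rightarrow>
       prod_encode p \<le> k \<and> (\<forall>x. b x \<in> {-1, 0, 1}) \<and> step k (A m) \<and>
       (\<forall>m' l'. ((m', l'), p) \<in> R \<longrightarrow> step k (B f m' l')) \<and>
       (\<exists>\<epsilon>. (\<forall>i. \<epsilon> i = 1 \<or> \<epsilon> i = -1) \<and> b = haar_step k (node_support (A m) (B f m) l) \<epsilon>) \<and>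
       (\<forall>m' l'. ((m', l'), p) \<in> R \<longrightarrow> \<bar>Pr (B f m' l') (\<tau> m' m (Emb b))\<bar> \<le> \<eta> (prod_encode p) \<and>
          \<bar>Pr b (\<tau> m m' (Emb (B f m' l')))\<bar> \<le> \<eta> (prod_encode p)) \<and>
       \<bar>Pr b (\<tau> m m (Emb b)) - D (\<tau> m m) (node_support (A m) (B f m) l)\<bar> \<le> \<eta> (prod_encode p) \<and>
       (1 \<le> l \<longrightarrow> \<bar>D (\<tau> m m) (\<lambda>x. B f m 0 x * b x)\<bar> \<le> \<eta> (prod_encode p)))" for f p r
  \<comment> \<open>The node \<open>l div 2\<close> and the node 0, which determine the support of \<open>l\<close>,
    come earlier.\<close>
  have par: "((m, 0), (m, l)) \<in> R" "((m, l div 2), (m, l)) \<in> R" if "1 \<le> l" for m l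
    unfolding R_def in_inv_image less_than_iff by (intro prod_encode_mono; use that in simp)+
  have nsc: "node_support (A m) (B f m) l = node_support (A m) (B g m) l"
    if "\<And>z. (z, (m, l)) \<in> R \<Longrightarrow> f z = g z" for f g m l
    using par[of l m] that by (auto simp: node_support_def B_def)
  have "\<exists>f. \<forall>p. P f p (f p)"
  proof (rule dependent_wf_choice[of R P])
    show "wf R" by (simp add: R_def wf_inv_image)
    show "P f p r = P g p r" if *: "\<And>z. (z, p) \<in> R \<Longrightarrow> f z = g z" for f g p r
    proof -
      obtain m l where p: "p = (m, l)" by force
      obtain k b where r: "r = (k, b)" by force
      have B: "((m', l'), (m, l)) \<in> R \<Longrightarrow> B f m' l' = B g m' l'" for m' l'
        using * unfolding p by (simp add: B_def)
      have B0: "1 \<le> l \<Longrightarrow> B f m 0 = B g m 0" using B par(1) by blast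
      have N: "node_support (A m) (B f m) l = node_support (A m) (B g m) l" by (rule nsc) (use * p in blast)
      show ?thesis unfolding P_def p r prod.case N using B B0 by (auto cong: conj_cong imp_cong)
    qed
    show "\<exists>r. P f p r" if IH: "\<And>y. (y, p) \<in> R \<Longrightarrow> P f y (f y)" for p f
    proof -
      obtain m l where p: "p = (m, l)" by force
      define F where "F = {p'. (p', p) \<in> R}"
      have finF: "finite F"
      proof (rule finite_subset)
        show "F \<subseteq> prod_decode ` {..<prod_encode p}"
          by (auto simp: F_def R_def image_iff) (metis lessThan_iff prod_encode_inverse)
      qed simp
      have prev: "\<forall>x. B f m' l' x \<in> {-1, 0, 1}" "step (Suc (fst (f (m', l')))) (B f m' l')"
        if "((m', l'), p) \<in> R" for m' l'
      proof -
        let ?k = "fst (f (m', l'))"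
        have P: "P f (m', l') (?k, B f m' l')" using IH[OF that] by (simp add: B_def)
        then show "\<forall>x. B f m' l' x \<in> {-1, 0, 1}" by (simp add: P_def)
        have "step ?k (node_support (A m') (B f m') l')"
        proof (cases "l' \<le> 1")
          case False
          then have "step ?k (B f m' 0)" "step ?k (B f m' (l' div 2))"
            using P par[of l' m'] by (auto simp: P_def)
          then show ?thesis using False
            by (auto simp: node_support_def intro!: step_comp[of _ _ "half l'"] step_mult)
        qed (use P in \<open>simp add: node_support_def P_def\<close>)
        then show "step (Suc ?k) (B f m' l')"
          using P step_haar_step unfolding P_def by fastforce
      qed
      \<comment> \<open>A level at which all earlier choices are step functions.\<close>
      define n0 where "n0 = prod_encode p + n m + (\<Sum>p'\<in>F. Suc (fst (f p')))"
      have n0: "step n0 (B f m' l')" if "((m', l'), p) \<in> R" for m' l'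
      proof (rule step_mono[OF prev(2)[OF that]])
        have "Suc (fst (f (m', l'))) \<le> (\<Sum>p'\<in>F. Suc (fst (f p')))"
          using finF that by (intro member_le_sum) (auto simp: F_def)
        then show "Suc (fst (f (m', l'))) \<le> n0" by (simp add: n0_def)
      qed
      have A0: "step n0 (A m)" by (rule step_mono[OF A(1)]) (simp add: n0_def)
      define a where "a = node_support (A m) (B f m) l"
      have a: "step n0 a" "\<And>x. a x = 0 \<or> a x = 1"
      proof -
        have "step n0 a \<and> (\<forall>x. a x = 0 \<or> a x = 1)"
        proof (cases "l \<le> 1")
          case False
          then have pr: "((m, 0), p) \<in> R" "((m, l div 2), p) \<in> R" using par[of l m] p by auto
          have "step n0 a"
            using False n0[OF pr(1)] n0[OF pr(2)]
            by (auto simp: a_def node_support_def intro!: step_comp[of _ _ "half l"] step_mult)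
          moreover have "a x = 0 \<or> a x = 1" for x
            using False prev(1)[OF pr(1)] prev(1)[OF pr(2)]
            unfolding a_def node_support_def by (simp del: insert_iff add: half_01 signs_mult)
          ultimately show ?thesis by blast
        qed (use A0 A(2) in \<open>simp add: a_def node_support_def\<close>)
        then show "step n0 a" "\<And>x. a x = 0 \<or> a x = 1" by auto
      qed
      define \<rho> where "\<rho> = (if 1 \<le> l then B f m 0 else (\<lambda>_. 0))"
      have \<rho>: "step n0 \<rho>" "\<bar>\<rho> x\<bar> \<le> 1" for x
        using n0[of m 0] prev(1)[of m 0] par(1)[of l m] p by (auto simp: \<rho>_def) (smt (verit))+
      define \<Phi> where "\<Phi> = (\<lambda>(m', l') x. Pr (B f m' l') (\<tau> m' m x)) ` F"
      define G where "G = (\<lambda>(m', l'). \<tau> m m' (Emb (B f m' l'))) ` F"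
      have \<Phi>1: "linear \<phi>" if "\<phi> \<in> \<Phi>" for \<phi>
        using that linear_compose[OF \<tau>(1) linear_Pr] by (auto simp: \<Phi>_def o_def)
      have \<Phi>2: "\<bar>\<phi> x\<bar> \<le> C * norm x" if "\<phi> \<in> \<Phi>" for \<phi> x
      proof -
        obtain m' l' where q: "((m', l'), p) \<in> R" "\<phi> = (\<lambda>x. Pr (B f m' l') (\<tau> m' m x))"
          using \<open>\<phi> \<in> \<Phi>\<close> unfolding \<Phi>_def F_def by auto
        have "\<bar>B f m' l' x\<bar> \<le> 1" for x using prev(1)[OF q(1)] by (smt (verit) insertE singletonD)
        then have "\<bar>\<phi> x\<bar> \<le> 1 * norm (\<tau> m' m x)"
          unfolding q(2) by (rule Pr_bound[OF n0[OF q(1)]])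
        then show ?thesis using \<tau>(2)[of m' m x] by simp
      qed
      have fin: "finite \<Phi>" "finite G" by (simp_all add: \<Phi>_def G_def finF)
      have sel: "\<exists>k\<ge>n0. \<exists>\<epsilon>. (\<forall>i. \<epsilon> i = 1 \<or> \<epsilon> i = -1) \<and>
        (\<forall>\<phi>\<in>\<Phi>. \<bar>\<phi> (Emb (haar_step k a \<epsilon>))\<bar> \<le> \<eta> (prod_encode p)) \<and>
        (\<forall>g\<in>G. \<bar>Pr (haar_step k a \<epsilon>) g\<bar> \<le> \<eta> (prod_encode p)) \<and>
        \<bar>Pr (haar_step k a \<epsilon>) (\<tau> m m (Emb (haar_step k a \<epsilon>))) - D (\<tau> m m) a\<bar> \<le> \<eta> (prod_encode p) \<and>
        \<bar>D (\<tau> m m) (\<lambda>x. \<rho> x * haar_step k a \<epsilon> x)\<bar> \<le> \<eta> (prod_encode p)"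
        by (rule good_haar_step[where C = C and K = C]) (fact \<tau> a \<rho> fin \<Phi>1 \<Phi>2 \<eta>)+
      obtain k \<epsilon> where k: "n0 \<le> k" and \<epsilon>: "\<forall>i. \<epsilon> i = 1 \<or> \<epsilon> i = -1"
        and s1: "\<forall>\<phi>\<in>\<Phi>. \<bar>\<phi> (Emb (haar_step k a \<epsilon>))\<bar> \<le> \<eta> (prod_encode p)"
        and s2: "\<forall>g\<in>G. \<bar>Pr (haar_step k a \<epsilon>) g\<bar> \<le> \<eta> (prod_encode p)"
        and s3: "\<bar>Pr (haar_step k a \<epsilon>) (\<tau> m m (Emb (haar_step k a \<epsilon>))) - D (\<tau> m m) a\<bar> \<le> \<eta> (prod_encode p)"
        and s4: "\<bar>D (\<tau> m m) (\<lambda>x. \<rho> x * haar_step k a \<epsilon> x)\<bar> \<le> \<eta> (prod_encode p)"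
        using sel by blast
      define b where "b = haar_step k a \<epsilon>"
      have b1: "b x \<in> {-1, 0, 1}" for x
      proof -
        have "a x \<in> {-1, 0, 1}" using a(2)[of x] by auto
        moreover have "\<epsilon> (cell_index k x) \<in> {-1, 0, 1}" using \<epsilon> by blast
        moreover have "(-1) ^ cell_index (Suc k) x \<in> {-1, 0, 1::real}"
          by (cases "even (cell_index (Suc k) x)") auto
        ultimately show ?thesis unfolding b_def haar_step_def by (intro signs_mult)
      qed
      have "P f p (k, b)"
        unfolding P_def p prod.case
      proof (intro conjI allI impI)
        show "prod_encode (m, l) \<le> k" using k by (simp add: n0_def p)
        show "b x \<in> {-1, 0, 1}" for x by (rule b1)
        show "step k (A m)" by (rule step_mono[OF A0 k])
        show "step k (B f m' l')" if "((m', l'), (m, l)) \<in> R" for m' l'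
          using step_mono[OF n0 k] that p by blast
        show "\<exists>\<epsilon>. (\<forall>i. \<epsilon> i = 1 \<or> \<epsilon> i = - 1) \<and> b = haar_step k (node_support (A m) (B f m) l) \<epsilon>"
          using \<epsilon> b_def a_def by blast
        show "\<bar>Pr (B f m' l') (\<tau> m' m (Emb b))\<bar> \<le> \<eta> (prod_encode (m, l))"
          if "((m', l'), (m, l)) \<in> R" for m' l'
          using s1 that by (force simp: \<Phi>_def F_def p b_def)
        show "\<bar>Pr b (\<tau> m m' (Emb (B f m' l')))\<bar> \<le> \<eta> (prod_encode (m, l))"
          if "((m', l'), (m, l)) \<in> R" for m' l'
          using s2 that by (force simp: G_def F_def p b_def)
        show "\<bar>Pr b (\<tau> m m (Emb b)) - D (\<tau> m m) (node_support (A m) (B f m) l)\<bar> \<le> \<eta> (prod_encode (m, l))"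
          using s3 by (simp add: b_def a_def p)
        show "\<bar>D (\<tau> m m) (\<lambda>x. B f m 0 x * b x)\<bar> \<le> \<eta> (prod_encode (m, l))" if "1 \<le> l"
          using s4 that by (simp add: \<rho>_def b_def p)
      qed
      then show ?thesis by blast
    qed
  qed
  then obtain f where f: "\<And>p. P f p (f p)" by blast
  define b where "b = B f"
  define lv where "lv m l = fst (f (m, l))" for m l
  have fP: "P f (m, l) (lv m l, b m l)" for m l using f[of "(m, l)"] by (simp add: lv_def b_def B_def)
  show ?thesis
  proof (rule that[of lv b])
    fix m l m' l' x
    note q = fP[of m l, unfolded P_def prod.case, folded b_def]
    note q' = fP[of m' l', unfolded P_def prod.case, folded b_def]
    show "prod_encode (m, l) \<le> lv m l" "b m l x \<in> {-1, 0, 1}" "step (lv m l) (A m)"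
      "\<exists>\<epsilon>. (\<forall>i. \<epsilon> i = 1 \<or> \<epsilon> i = -1) \<and> b m l = haar_step (lv m l) (node_support (A m) (b m) l) \<epsilon>"
      "\<bar>Pr (b m l) (\<tau> m m (Emb (b m l))) - D (\<tau> m m) (node_support (A m) (b m) l)\<bar> \<le> \<eta> (prod_encode (m, l))"
      using q by blast+
    show "1 \<le> l \<Longrightarrow> \<bar>D (\<tau> m m) (\<lambda>x. b m 0 x * b m l x)\<bar> \<le> \<eta> (prod_encode (m, l))"
      using q by blast
    show "prod_encode (m', l') < prod_encode (m, l) \<Longrightarrow> step (lv m l) (b m' l')"
      using q by (simp add: R_def)
    assume ne: "(m', l') \<noteq> (m, l)"
    then have "prod_encode (m', l') \<noteq> prod_encode (m, l)" by simp
    then consider "prod_encode (m', l') < prod_encode (m, l)" | "prod_encode (m, l) < prod_encode (m', l')"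
      by linarith
    then show "\<bar>Pr (b m' l') (\<tau> m' m (Emb (b m l)))\<bar> \<le> \<eta> (max (prod_encode (m', l')) (prod_encode (m, l)))"
    proof cases
      case 1 then show ?thesis using q by (simp add: R_def max_def)
    next
      case 2 then show ?thesis using q' by (simp add: R_def max_def)
    qed
  qed
qed

end

section \<open>The operators of a copy\<close>

lemma operator_limit:
  fixes U :: "nat \<Rightarrow> 'b::real_normed_vector \<Rightarrow> 'c::banach"
  assumes lin: "\<And>j. linear (U j)" and bnd: "\<And>j x. norm (U j x) \<le> K * norm x"
    and dense: "\<And>x e. 0 < e \<Longrightarrow> \<exists>y\<in>S. norm (x - y) < e"
    and const: "\<And>y. y \<in> S \<Longrightarrow> \<exists>n. \<forall>j\<ge>n. U (Suc j) y = U j y"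
  obtains L where "linear L" "\<And>x. norm (L x) \<le> K * norm x" "\<And>x. (\<lambda>j. U j x) \<longlonglongrightarrow> L x"
proof -
  have const': "\<exists>n. \<forall>j\<ge>n. U j y = U n y" if y: "y \<in> S" for y
  proof -
    obtain n where n: "\<And>j. j \<ge> n \<Longrightarrow> U (Suc j) y = U j y" using const[OF y] by blast
    have "U j y = U n y" if "n \<le> j" for j
      using that by (induction j rule: dec_induct) (simp_all add: n)
    then show ?thesis by blast
  qed
  have "Cauchy (\<lambda>j. U j x)" for x
  proof (rule CauchyI)
    fix e :: real assume e: "0 < e"
    have K1: "0 < \<bar>K\<bar> + 1" by simp
    obtain y where y: "y \<in> S" "norm (x - y) < e / (2 * (\<bar>K\<bar> + 1))"
      using dense[of "e / (2 * (\<bar>K\<bar> + 1))"] e K1 by auto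
    obtain n where n: "\<And>j. j \<ge> n \<Longrightarrow> U j y = U n y" using const'[OF y(1)] by blast
    have close: "norm (U j x - U n y) < e / 2" if "n \<le> j" for j
    proof -
      have "norm (U j x - U n y) = norm (U j (x - y))"
        using n[OF that] by (simp add: linear_diff[OF lin])
      also have "\<dots> \<le> (\<bar>K\<bar> + 1) * norm (x - y)"
        by (rule order_trans[OF bnd]) (intro mult_right_mono, auto)
      also have "\<dots> < (\<bar>K\<bar> + 1) * (e / (2 * (\<bar>K\<bar> + 1)))"
        using y(2) K1 by (intro mult_strict_left_mono) auto
      also have "\<dots> = e / 2" using K1 by (simp add: field_simps)
      finally show ?thesis .
    qed
    have "norm (U j x - U k x) < e" if "n \<le> j" "n \<le> k" for j k
      using close[OF that(1)] close[OF that(2)]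
        norm_triangle_ineq4[of "U j x - U n y" "U k x - U n y"] by simp
    then show "\<exists>M. \<forall>m\<ge>M. \<forall>n\<ge>M. norm (U m x - U n x) < e" by blast
  qed
  then have conv: "(\<lambda>j. U j x) \<longlonglongrightarrow> lim (\<lambda>j. U j x)" for x
    by (simp add: Cauchy_convergent convergent_LIMSEQ_iff[symmetric])
  show ?thesis
  proof (rule that[of "\<lambda>x. lim (\<lambda>j. U j x)"])
    show "linear (\<lambda>x. lim (\<lambda>j. U j x))"
    proof (rule linearI)
      fix x y show "lim (\<lambda>j. U j (x + y)) = lim (\<lambda>j. U j x) + lim (\<lambda>j. U j y)"
        using tendsto_add[OF conv[of x] conv[of y]] by (intro limI) (simp add: linear_add[OF lin])
    next
      fix c x show "lim (\<lambda>j. U j (c *\<^sub>R x)) = c *\<^sub>R lim (\<lambda>j. U j x)"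
        using tendsto_scaleR[OF tendsto_const conv[of x]] by (intro limI) (simp add: linear_scale[OF lin])
    qed
    show "norm (lim (\<lambda>j. U j x)) \<le> K * norm x" for x
      by (rule LIMSEQ_le_const2[OF tendsto_norm[OF conv]]) (use bnd in auto)
  qed (rule conv)
qed

lemma node_support_children:
  assumes "1 \<le> l"
  shows "node_support A b (2 * l) x + node_support A b (2 * l + 1) x = (b 0 x * b l x) * (b 0 x * b l x)"
    "node_support A b (2 * l) x - node_support A b (2 * l + 1) x = b 0 x * b l x"
proof -
  have d: "(2 * l + 1) div 2 = l" by simp
  have "node_support A b (2 * l) x = half (2 * l) (b 0 x * b l x)"
    "node_support A b (2 * l + 1) x = half (2 * l + 1) (b 0 x * b l x)"
    using assms d by (simp_all add: node_support_def del: Suc_eq_plus1)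
  then show "node_support A b (2 * l) x + node_support A b (2 * l + 1) x = (b 0 x * b l x) * (b 0 x * b l x)"
    "node_support A b (2 * l) x - node_support A b (2 * l + 1) x = b 0 x * b l x"
    by (simp_all add: half_def field_simps)
qed

text \<open>
  One summand of the outcome of \<open>node_choice\<close>.
\<close>

locale tree_copy = l1_tree atom E for atom :: "nat \<Rightarrow> nat \<Rightarrow> 'b::banach" and E +
  fixes A :: "real \<Rightarrow> real" and b :: "nat \<Rightarrow> real \<Rightarrow> real" and lv :: "nat \<Rightarrow> nat" and \<epsilon> :: "nat \<Rightarrow> nat \<Rightarrow> real"
  assumes lv_ge: "l \<le> lv l" and b_values: "b l x \<in> {-1, 0, 1}"
    and A_step: "step (lv l) A" and A_values: "A x = 0 \<or> A x = 1"
    and b_step: "l' < l \<Longrightarrow> step (lv l) (b l')"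
    and signs: "\<epsilon> l i = 1 \<or> \<epsilon> l i = -1"
    and b_eq: "b l = haar_step (lv l) (node_support A b l) (\<epsilon> l)"
    and A_pos: "0 < Mean A"
begin

abbreviation a :: "nat \<Rightarrow> real \<Rightarrow> real" where "a \<equiv> node_support A b"
text \<open>
  The copy of the indicator of the node \<open>l\<close>. The functions \<open>b\<close> play the part of the Haar functions: \<open>b l\<close>
  is the difference of the copies of the two children, and \<open>b 0\<close> is the copy of the root.
\<close>

definition c :: "nat \<Rightarrow> real \<Rightarrow> real" where "c l x = b 0 x * a l x"

lemma a_step: "step (lv l) (a l)"
proof (cases "l \<le> 1")
  case False
  then show ?thesis using b_step[of 0 l] b_step[of "l div 2" l]
    by (auto simp: node_support_def intro!: step_comp[of _ _ "half l"] step_mult)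
qed (simp add: node_support_def A_step)

lemma a_values: "a l x = 0 \<or> a l x = 1"
  using A_values b_values[of 0 x] b_values[of "l div 2" x]
  by (simp add: node_support_def half_01 signs_mult del: insert_iff)

lemma b_square: "b l x * b l x = a l x"
proof -
  have "(- 1) ^ n * (- 1) ^ n = (1::real)" for n by (simp flip: power_mult_distrib)
  then have *: "(e * z) * (e * z) = 1" if "e = 1 \<or> e = -1" "z = (-1) ^ n" for e z :: real and n
    using that by auto
  show ?thesis
    using a_values[of l x] *[OF signs[of l "cell_index (lv l) x"] refl, of "cell_index (Suc (lv l)) x"]
    by (auto simp: fun_cong[OF b_eq] haar_step_def mult_ac)
qed

lemma a0: "a 0 = A" "a 1 = A" by (simp_all add: node_support_def)

lemma A_a: "A x * a l x = a l x"
proof (cases "A x = 0")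
  case True
  then have "b 0 x = 0" using b_square[of 0 x] a0 by simp
  then show ?thesis using True by (simp add: node_support_def half_def)
next
  case False then show ?thesis using A_values[of x] by simp
qed

lemma A_b: "A x * b l x = b l x"
proof (cases "A x = 0")
  case True
  then have "b l x * b l x = 0" using A_a[of x l] b_square[of l x] by simp
  then show ?thesis by simp
next
  case False then show ?thesis using A_values[of x] by simp
qed

lemma a_children: 
  assumes "1 \<le> l" shows "a (2 * l) x + a (2 * l + 1) x = a l x"
    "a (2 * l) x - a (2 * l + 1) x = b 0 x * b l x"
proof -
  have "(b 0 x * b l x) * (b 0 x * b l x) = (b 0 x * b 0 x) * (b l x * b l x)" by simp
  also have "\<dots> = a l x" by (simp only: b_square a0 A_a)
  finally show "a (2 * l) x + a (2 * l + 1) x = a l x"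
    using node_support_children(1)[OF assms, of A b x] by simp
  show "a (2 * l) x - a (2 * l + 1) x = b 0 x * b l x"
    by (rule node_support_children(2)[OF assms])
qed

lemma a_halves:
  assumes "1 \<le> l" shows "a (2 * l) x = (a l x + b 0 x * b l x) / 2"
    "a (2 * l + 1) x = (a l x - b 0 x * b l x) / 2"
proof -
  have *: "p = (s + d) / 2" "q = (s - d) / 2" if "p + q = s" "p - q = d" for p q s d :: real
    using that by (auto simp: field_simps)
  show "a (2 * l) x = (a l x + b 0 x * b l x) / 2" by (rule *(1)[OF a_children[OF assms]])
  show "a (2 * l + 1) x = (a l x - b 0 x * b l x) / 2" by (rule *(2)[OF a_children[OF assms]])
qed

lemma c_children:
  assumes "1 \<le> l"
  shows "c (2 * l) = (\<lambda>x. 1 / 2 * (c l x + b l x))" "c (2 * l + 1) = (\<lambda>x. 1 / 2 * (c l x - b l x))"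
proof -
  have "c (2 * l) x = 1 / 2 * (c l x + b l x) \<and> c (2 * l + 1) x = 1 / 2 * (c l x - b l x)" for x
  proof -
    have e: "b 0 x * (b 0 x * b l x) = b l x"
      using A_b[of x l] b_square[of 0 x] a0 by (simp add: mult.assoc[symmetric])
    show ?thesis unfolding c_def a_halves[OF assms]
      by (simp only: times_divide_eq_right distrib_left right_diff_distrib e) simp
  qed
  then show "c (2 * l) = (\<lambda>x. 1 / 2 * (c l x + b l x))" "c (2 * l + 1) = (\<lambda>x. 1 / 2 * (c l x - b l x))"
    by blast+
qed

lemma abs_c: "\<bar>c l x\<bar> = a l x"
proof -
  have "c l x * c l x = (b 0 x * b 0 x) * (a l x * a l x)" by (simp add: c_def)
  also have "\<dots> = (a l x)\<^sup>2" by (simp add: b_square a0 mult.assoc[symmetric] A_a power2_eq_square del: mult_eq_0_iff)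
  finally have "(c l x)\<^sup>2 = (a l x)\<^sup>2" by (simp add: power2_eq_square)
  then show ?thesis using a_values[of l x] by (auto simp: power2_eq_iff)
qed

lemma a_le_1: "\<bar>a l x\<bar> \<le> 1" using a_values[of l x] by auto
lemma b_le_1: "\<bar>b l x\<bar> \<le> 1" using b_values[of l x] by auto
lemma b_step_Suc: "step (Suc (lv l)) (b l)"
  using step_haar_step[OF a_step[of l], of "\<epsilon> l"] b_eq[of l] by simp

lemma level_ex: "\<exists>N. \<forall>l\<le>L. step N (a l) \<and> step N (b l) \<and> step N (c l)"
proof -
  define N where "N = (\<Sum>l\<le>L. Suc (lv l))"
  have N: "Suc (lv l) \<le> N" if "l \<le> L" for l
    unfolding N_def using that by (intro member_le_sum) auto
  have "step N (a l)" "step N (b l)" if "l \<le> L" for l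
    using step_mono[OF a_step[of l]] step_mono[OF b_step_Suc[of l]] N[OF that] by auto
  then show ?thesis by (auto simp: c_def[abs_def] intro!: step_mult exI[of _ N])
qed

lemma obtain_level:
  obtains N where "step N (a l)" "step N (b l)" "step N (c l)"
  using level_ex[of l] by blast

text \<open>
  Since \<open>b l\<close> oscillates within the cells on which \<open>b 0\<close> is constant, it is orthogonal to \<open>b 0\<close>, and the
  two children have equal measure.
\<close>

lemma Mean_a:
  assumes "i < 2 ^ j" shows "Mean (a (2 ^ j + i)) = Mean A / 2 ^ j"
  using assms
proof (induction j arbitrary: i)
  case 0 then show ?case by (simp add: node_support_def)
next
  case (Suc j)
  define l where "l = 2 ^ j + i div 2"
  have "i div 2 < 2 ^ j" using Suc.prems by auto
  then have IH: "Mean (a l) = Mean A / 2 ^ j" unfolding l_def by (rule Suc.IH)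
  have l1: "1 \<le> l" by (simp add: l_def Suc_leI)
  have u: "step (Suc (lv l)) (\<lambda>x. b 0 x * b l x)"
    using step_mono[OF b_step[of 0 l], of "Suc (lv l)"] b_step_Suc l1 by (auto intro!: step_mult)
  have m0: "Mean (\<lambda>x. b 0 x * b l x) = 0"
    using Mean_haar_step[OF a_step b_step, of 0 l "\<epsilon> l"] b_eq[of l] l1 by simp
  have s: "step (Suc (lv l)) (a l)" using step_mono[OF a_step[of l]] by simp
  have "a (2 * l) x = 1 / 2 * (a l x + b 0 x * b l x)" for x
    using a_halves(1)[OF l1, of x] by simp
  then have "a (2 * l) = (\<lambda>x. 1 / 2 * (a l x + b 0 x * b l x))" by blast
  then have half1: "Mean (a (2 * l)) = Mean A / 2 ^ Suc j"
    by (simp only: Mean_scale[OF step_add[OF s u]] Mean_add[OF s u] m0 IH) simp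
  have "a (2 * l + 1) x = 1 / 2 * (a l x + (-1) * (b 0 x * b l x))" for x
    unfolding a_halves(2)[OF l1] by simp
  then have "a (2 * l + 1) = (\<lambda>x. 1 / 2 * (a l x + (-1) * (b 0 x * b l x)))" by blast
  then have half2: "Mean (a (2 * l + 1)) = Mean A / 2 ^ Suc j"
    by (simp only: Mean_scale[OF step_add[OF s step_mult[OF step_const u]]] Mean_add[OF s step_mult[OF step_const u]]
        Mean_scale[OF u] m0 IH) simp
  note half = half1 half2
  have "2 ^ Suc j + i = 2 * l \<or> 2 ^ Suc j + i = 2 * l + 1" unfolding l_def power_Suc by presburger
  then show ?case using half by auto
qed

lemma norm_Emb_c:
  assumes "i < 2 ^ j" shows "norm (Emb (c (2 ^ j + i))) = Mean A / 2 ^ j"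
proof -
  obtain N where N: "step N (a (2 ^ j + i))" "step N (b (2 ^ j + i))" "step N (c (2 ^ j + i))"
    by (rule obtain_level)
  show ?thesis using norm_Emb[OF N(3)] Mean_a[OF assms] by (simp add: abs_c)
qed

lemma sum_a: "(\<Sum>i<2 ^ j. a (2 ^ j + i) x) = A x"
proof (induction j)
  case 0 then show ?case by (simp add: node_support_def)
next
  case (Suc j)
  have "(\<Sum>i<2 ^ Suc j. a (2 ^ Suc j + i) x) = (\<Sum>i<2 ^ j. a (2 * (2 ^ j + i)) x + a (2 * (2 ^ j + i) + 1) x)"
    unfolding power_Suc sum_lessThan_double by (simp add: algebra_simps)
  also have "\<dots> = (\<Sum>i<2 ^ j. a (2 ^ j + i) x)"
    by (intro sum.cong refl a_children) (simp add: Suc_leI trans_le_add1)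
  finally show ?case using Suc by simp
qed

lemma Emb_c_children:
  assumes "1 \<le> l"
  shows "Emb (c (2 * l)) = (1 / 2) *\<^sub>R (Emb (c l) + Emb (b l))" "Emb (c (2 * l + 1)) = (1 / 2) *\<^sub>R (Emb (c l) - Emb (b l))"
proof -
  obtain N where N: "step N (a l)" "step N (b l)" "step N (c l)" by (rule obtain_level)
  show "Emb (c (2 * l)) = (1 / 2) *\<^sub>R (Emb (c l) + Emb (b l))" "Emb (c (2 * l + 1)) = (1 / 2) *\<^sub>R (Emb (c l) - Emb (b l))"
    unfolding c_children[OF assms] Emb_scale[OF step_add[OF N(3,2)]] Emb_scale[OF step_diff[OF N(3,2)]]
      Emb_add[OF N(3,2)] Emb_diff[OF N(3,2)] by simp_all
qed

lemma Pr_c_children: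
  assumes "1 \<le> l"
  shows "Pr (c (2 * l)) y = 1 / 2 * (Pr (c l) y + Pr (b l) y)" "Pr (c (2 * l + 1)) y = 1 / 2 * (Pr (c l) y - Pr (b l) y)"
proof -
  obtain N where N: "step N (a l)" "step N (b l)" "step N (c l)" by (rule obtain_level)
  show "Pr (c (2 * l)) y = 1 / 2 * (Pr (c l) y + Pr (b l) y)" "Pr (c (2 * l + 1)) y = 1 / 2 * (Pr (c l) y - Pr (b l) y)"
    unfolding c_children[OF assms] Pr_scale[OF step_add[OF N(3,2)]] Pr_scale[OF step_diff[OF N(3,2)]]
      Pr_add[OF N(3,2)] Pr_diff[OF N(3,2)] by simp_all
qed

lemma Pr_b_Emb: "step k g \<Longrightarrow> k \<le> l \<Longrightarrow> Pr (b l) (Emb g) = 0"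
  using Pr_haar_step_Emb[OF a_step step_mono, of k g l "\<epsilon> l"] lv_ge[of l] b_eq[of l] by simp

text \<open>
  The copies of indicators, normalized to the norm of the atoms, define an isometric embedding of the
  functions of level \<open>j\<close>; \<open>Pn\<close> recovers the integrals over cells from the pairings with these copies.
  On a fixed step function both sequences are eventually constant: \<open>Jn\<close> because the copies add up along
  the tree, and \<open>Pn\<close> because \<open>b l\<close> annihilates step functions of level at most \<open>l\<close>.
\<close>

definition Jn :: "nat \<Rightarrow> 'b \<Rightarrow> 'b" where
  "Jn j x = (\<Sum>i<2 ^ j. (2 ^ j / Mean A * E j i x) *\<^sub>R Emb (c (2 ^ j + i)))"

definition Pn :: "nat \<Rightarrow> 'b \<Rightarrow> 'b" where
  "Pn j y = (\<Sum>i<2 ^ j. (2 ^ j * Pr (c (2 ^ j + i)) y) *\<^sub>R atom j i)"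

lemma norm_Jn: "norm (Jn j x) \<le> norm x"
proof -
  have "norm (Jn j x) \<le> (\<Sum>i<2 ^ j. \<bar>E j i x\<bar>)"
    unfolding Jn_def
    by (rule order_trans[OF norm_sum], rule sum_mono) (use A_pos in \<open>simp add: norm_Emb_c abs_mult\<close>)
  then show ?thesis using E_norm order_trans by blast
qed

lemma norm_Pn: "norm (Pn j y) \<le> norm y"
proof -
  obtain N where N: "\<And>l. l \<le> 2 ^ Suc j \<Longrightarrow> step N (c l)" using level_ex[of "2 ^ Suc j"] by blast
  have "norm (Pn j y) \<le> (\<Sum>i<2 ^ j. \<bar>2 ^ j * Pr (c (2 ^ j + i)) y\<bar> * (1 / 2 ^ j))"
    unfolding Pn_def
    by (rule order_trans[OF norm_sum], rule sum_mono, simp only: norm_scaleR)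
      (intro mult_left_mono atom_norm, auto)
  also have "\<dots> = (\<Sum>i<2 ^ j. \<bar>Pr (c (2 ^ j + i)) y\<bar>)" by (simp add: abs_mult)
  also have "\<dots> = (\<Sum>i<2 ^ j. \<bar>pair N (c (2 ^ j + i)) y\<bar>)"
    by (intro sum.cong refl arg_cong[where f = abs] Pr_eq N) auto
  also have "\<dots> \<le> (\<Sum>i<2 ^ j. \<Sum>u<2 ^ N. a (2 ^ j + i) (real u / 2 ^ N) * \<bar>E N u y\<bar>)"
    unfolding pair_def by (intro sum_mono order_trans[OF sum_abs]) (simp add: abs_mult abs_c)
  also have "\<dots> = (\<Sum>u<2 ^ N. A (real u / 2 ^ N) * \<bar>E N u y\<bar>)"
    by (subst sum.swap) (simp flip: sum_distrib_right add: sum_a)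
  also have "\<dots> \<le> (\<Sum>u<2 ^ N. 1 * \<bar>E N u y\<bar>)"
  proof (intro sum_mono mult_right_mono)
    show "A (real u / 2 ^ N) \<le> 1" for u using A_values[of "real u / 2 ^ N"] by auto
  qed auto
  also have "\<dots> \<le> norm y" using E_norm by simp
  finally show ?thesis .
qed

lemma linear_Jn: "linear (Jn j)"
  unfolding Jn_def[abs_def]
  by (rule linearI) (simp_all add: E_add E_scale algebra_simps sum.distrib scaleR_sum_right)

lemma linear_Pn: "linear (Pn j)"
  unfolding Pn_def[abs_def]
  by (rule linearI) (simp_all add: linear_add[OF linear_Pr] linear_scale[OF linear_Pr] algebra_simps
      sum.distrib scaleR_sum_right)

lemma E_Emb:
  assumes "step n f" "n \<le> j" "i < 2 ^ j" shows "E j i (Emb f) = f (real i / 2 ^ j) / 2 ^ j"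
  using E_emb[OF assms(3)] Emb_eq[OF step_mono[OF assms(1,2)]] by simp

lemma Jn_Suc:
  assumes "step n f" "n \<le> j" shows "Jn (Suc j) (Emb f) = Jn j (Emb f)"
proof -
  have "Jn (Suc j) (Emb f) = (\<Sum>i<2 ^ j.
      (2 ^ Suc j / Mean A * E (Suc j) (2 * i) (Emb f)) *\<^sub>R Emb (c (2 * (2 ^ j + i))) +
      (2 ^ Suc j / Mean A * E (Suc j) (2 * i + 1) (Emb f)) *\<^sub>R Emb (c (2 * (2 ^ j + i) + 1)))"
    unfolding Jn_def power_Suc[of "2::nat" j] sum_lessThan_double by (simp add: algebra_simps)
  also have "\<dots> = Jn j (Emb f)"
    unfolding Jn_def
  proof (rule sum.cong[OF refl])
    fix i :: nat assume i: "i \<in> {..<2 ^ j}"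
    have l: "1 \<le> 2 ^ j + i" by (simp add: Suc_leI trans_le_add1)
    have e0: "E j i (Emb f) = f (real i / 2 ^ j) / 2 ^ j"
      using i by (intro E_Emb[OF assms]) simp
    have e1: "E (Suc j) (2 * i) (Emb f) = f (real i / 2 ^ j) / 2 ^ Suc j"
      using i by (subst E_Emb[OF assms(1)]) (use assms in auto)
    have e2: "E (Suc j) (2 * i + 1) (Emb f) = f (real i / 2 ^ j) / 2 ^ Suc j"
      by (subst E_Emb[OF assms(1)], use assms i in simp, use i in simp,
          simp only: step_odd[OF assms])
    show "(2 ^ Suc j / Mean A * E (Suc j) (2 * i) (Emb f)) *\<^sub>R Emb (c (2 * (2 ^ j + i))) +
      (2 ^ Suc j / Mean A * E (Suc j) (2 * i + 1) (Emb f)) *\<^sub>R Emb (c (2 * (2 ^ j + i) + 1))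
      = (2 ^ j / Mean A * E j i (Emb f)) *\<^sub>R Emb (c (2 ^ j + i))"
      unfolding e0 e1 e2 Emb_c_children[OF l]
      by (simp add: algebra_simps flip: scaleR_add_left)
  qed
  finally show ?thesis .
qed

lemma Pn_Suc:
  assumes "step n g" "n \<le> j" shows "Pn (Suc j) (Emb g) = Pn j (Emb g)"
proof -
  have "Pn (Suc j) (Emb g) = (\<Sum>i<2 ^ j.
      (2 ^ Suc j * Pr (c (2 * (2 ^ j + i))) (Emb g)) *\<^sub>R atom (Suc j) (2 * i) +
      (2 ^ Suc j * Pr (c (2 * (2 ^ j + i) + 1)) (Emb g)) *\<^sub>R atom (Suc j) (2 * i + 1))"
    unfolding Pn_def power_Suc[of "2::nat" j] sum_lessThan_double by (simp add: algebra_simps)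
  also have "\<dots> = Pn j (Emb g)"
    unfolding Pn_def
  proof (rule sum.cong[OF refl])
    fix i :: nat assume i: "i \<in> {..<2 ^ j}"
    have l: "1 \<le> 2 ^ j + i" by (simp add: Suc_leI trans_le_add1)
    have "j < 2 ^ j" by (rule less_exp)
    then have "Pr (b (2 ^ j + i)) (Emb g) = 0" using assms(2) by (intro Pr_b_Emb[OF assms(1)]) linarith
    then show "(2 ^ Suc j * Pr (c (2 * (2 ^ j + i))) (Emb g)) *\<^sub>R atom (Suc j) (2 * i) +
      (2 ^ Suc j * Pr (c (2 * (2 ^ j + i) + 1)) (Emb g)) *\<^sub>R atom (Suc j) (2 * i + 1)
      = (2 ^ j * Pr (c (2 ^ j + i)) (Emb g)) *\<^sub>R atom j i"
      using atom_split[of i j] i unfolding Pr_c_children[OF l] by (simp add: algebra_simps)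
  qed
  finally show ?thesis .
qed

lemma E_Pn: "i < 2 ^ j \<Longrightarrow> E j i (Pn (j + d) y) = Pr (c (2 ^ j + i)) y"
proof (induction d arbitrary: j i)
  case 0
  then show ?case
    by (simp add: Pn_def E_sum E_scale E_atom if_distrib[where f = "\<lambda>a. _ * a"] cong: if_cong)
next
  case (Suc d)
  have l: "1 \<le> 2 ^ j + i" by (simp add: Suc_leI trans_le_add1)
  have "E j i (Pn (j + Suc d) y) = E (Suc j) (2 * i) (Pn (Suc j + d) y) + E (Suc j) (2 * i + 1) (Pn (Suc j + d) y)"
    using E_split[OF Suc.prems] by simp
  also have "\<dots> = Pr (c (2 ^ Suc j + 2 * i)) y + Pr (c (2 ^ Suc j + (2 * i + 1))) y"
    using Suc.prems by (intro arg_cong2[where f = "(+)"] Suc.IH) auto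
  also have "\<dots> = Pr (c (2 * (2 ^ j + i))) y + Pr (c (2 * (2 ^ j + i) + 1)) y"
    by (simp add: algebra_simps)
  also have "\<dots> = Pr (c (2 ^ j + i)) y" unfolding Pr_c_children[OF l] by (simp add: field_simps)
  finally show ?case .
qed

lemma copy_operators:
  obtains J P where "linear J" "\<And>x. norm (J x) \<le> norm x"
    "\<And>j i. i < 2 ^ j \<Longrightarrow> J (atom j i) = (1 / Mean A) *\<^sub>R Emb (c (2 ^ j + i))"
    "linear P" "\<And>y. norm (P y) \<le> norm y"
    "\<And>j i y. i < 2 ^ j \<Longrightarrow> E j i (P y) = Pr (c (2 ^ j + i)) y"
proof -
  let ?S = "{Emb f | n f. step n f}"
  have dense: "\<exists>y\<in>?S. norm (x - y) < e" if "0 < e" for x e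
  proof -
    obtain n f where "step n f" "norm (x - Emb f) < e" by (rule dense_step[OF \<open>0 < e\<close>])
    then show ?thesis by (intro bexI[of _ "Emb f"]) auto
  qed
  obtain J where J: "linear J" "\<And>x. norm (J x) \<le> 1 * norm x" "\<And>x. (\<lambda>j. Jn j x) \<longlonglongrightarrow> J x"
  proof (rule operator_limit[of Jn 1 ?S])
    show "\<exists>n. \<forall>j\<ge>n. Jn (Suc j) y = Jn j y" if "y \<in> ?S" for y using that Jn_Suc by blast
  qed (use linear_Jn norm_Jn dense in auto)
  obtain P where P: "linear P" "\<And>x. norm (P x) \<le> 1 * norm x" "\<And>x. (\<lambda>j. Pn j x) \<longlonglongrightarrow> P x"
  proof (rule operator_limit[of Pn 1 ?S])
    show "\<exists>n. \<forall>j\<ge>n. Pn (Suc j) y = Pn j y" if "y \<in> ?S" for y using that Pn_Suc by blast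
  qed (use linear_Pn norm_Pn dense in auto)
  show ?thesis
  proof (rule that[of J P])
    show "norm (J x) \<le> norm x" "norm (P x) \<le> norm x" for x using J(2)[of x] P(2)[of x] by auto
    fix j i :: nat assume i: "i < 2 ^ j"
    have Jk: "Jn k (atom j i) = Jn j (atom j i)" if "j \<le> k" for k
      using that
    proof (induction k rule: dec_induct)
      case (step k)
      then show ?case using Jn_Suc[OF step_cell_ind[of j i], of k] i by (simp add: Emb_cell_ind)
    qed simp
    have "Jn j (atom j i) = (1 / Mean A) *\<^sub>R Emb (c (2 ^ j + i))"
      using i by (simp add: Jn_def E_atom if_distrib[where f = "\<lambda>a. _ * a"] if_distrib[where f = "\<lambda>a. a *\<^sub>R _"]
          cong: if_cong)
    moreover have "(\<lambda>k. Jn k (atom j i)) \<longlonglongrightarrow> Jn j (atom j i)"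
      by (rule tendsto_eventually) (use Jk in \<open>unfold eventually_sequentially, blast\<close>)
    ultimately show "J (atom j i) = (1 / Mean A) *\<^sub>R Emb (c (2 ^ j + i))"
      using LIMSEQ_unique[OF J(3)] by metis
  next
    fix j i y assume i: "i < (2::nat) ^ j"
    have "bounded_linear (E j i)"
      by (rule bounded_linear_intro[of _ 1]) (simp_all add: E_add[where n = j] E_scale[where n = j] abs_E_le[OF i])
    then have "(\<lambda>k. E j i (Pn k y)) \<longlonglongrightarrow> E j i (P y)"
      by (rule bounded_linear.tendsto[OF _ P(3)])
    moreover have "(\<lambda>k. E j i (Pn k y)) \<longlonglongrightarrow> Pr (c (2 ^ j + i)) y"
    proof (rule tendsto_eventually)
      have "E j i (Pn k y) = Pr (c (2 ^ j + i)) y" if "j \<le> k" for k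
        using E_Pn[OF i, of "k - j" y] that by simp
      then show "\<forall>\<^sub>F k in sequentially. E j i (Pn k y) = Pr (c (2 ^ j + i)) y"
        by (auto simp: eventually_sequentially)
    qed
    ultimately show "E j i (P y) = Pr (c (2 ^ j + i)) y" using LIMSEQ_unique by blast
  qed (fact J P)+
qed

end

section \<open>Compressing an operator to the copies\<close>

text \<open>
  The four entries below an entry of the matrix of \<open>P \<tau> J\<close>. With \<open>x\<close> the entry above, the copies
  of the children being \<open>(c + b) / 2\<close> and \<open>(c - b) / 2\<close>, the new ones are a quarter of signed sums of \<open>x\<close>
  and three entries \<open>p\<close>, \<open>q\<close>, \<open>r\<close> that involve \<open>b\<close>. The value predicted for a diagonal entry is \<open>v\<close>, and \<open>d\<close> is
  the defect in halving it.
\<close>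

lemma quarter_split:
  fixes x p q r d t v :: real
  assumes "\<bar>p\<bar> \<le> t" "\<bar>q\<bar> \<le> t" "\<bar>r - v\<bar> \<le> t"
  shows "\<bar>(x - p + q - r) / 4\<bar> \<le> \<bar>x - v\<bar> / 4 + 2 * t"
    and "\<bar>(x + p - q - r) / 4\<bar> \<le> \<bar>x - v\<bar> / 4 + 2 * t"
    and "\<bar>d\<bar> \<le> t \<Longrightarrow> \<bar>(x + p + q + r) / 4 - (v + d) / 2\<bar> \<le> \<bar>x - v\<bar> / 4 + 2 * t"
    and "\<bar>d\<bar> \<le> t \<Longrightarrow> \<bar>(x - p - q + r) / 4 - (v - d) / 2\<bar> \<le> \<bar>x - v\<bar> / 4 + 2 * t"
proof -
  have b: "p \<le> t" "- t \<le> p" "q \<le> t" "- t \<le> q" "r \<le> v + t" "v - t \<le> r"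
    using assms by (auto simp: abs_le_iff)
  have y: "x \<le> v + \<bar>x - v\<bar>" "v - \<bar>x - v\<bar> \<le> x" by auto
  define y where "y = \<bar>x - v\<bar>"
  note b = b y[folded y_def]
  show "\<bar>(x - p + q - r) / 4\<bar> \<le> \<bar>x - v\<bar> / 4 + 2 * t" "\<bar>(x + p - q - r) / 4\<bar> \<le> \<bar>x - v\<bar> / 4 + 2 * t"
    unfolding y_def[symmetric] by (rule abs_leI; use b in \<open>simp add: field_simps\<close>)+
  assume "\<bar>d\<bar> \<le> t"
  then have d: "d \<le> t" "- t \<le> d" by (auto simp: abs_le_iff)
  show "\<bar>(x + p + q + r) / 4 - (v + d) / 2\<bar> \<le> \<bar>x - v\<bar> / 4 + 2 * t"
    "\<bar>(x - p - q + r) / 4 - (v - d) / 2\<bar> \<le> \<bar>x - v\<bar> / 4 + 2 * t"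
    unfolding y_def[symmetric] by (rule abs_leI; use b d in \<open>simp add: field_simps\<close>)+
qed

context l1_tree
begin

text \<open>
  An operator on \<open>L\<^sup>1\<close> is bounded by its values on normalized atoms.
\<close>

lemma norm_le_columns:
  assumes lin: "linear W" and bnd: "\<And>x. norm (W x) \<le> K' * norm x"
    and col: "\<And>j i. i < 2 ^ j \<Longrightarrow> (\<Sum>i'<2 ^ j. \<bar>E j i' (W (atom j i))\<bar>) \<le> K / 2 ^ j"
  shows "norm (W x) \<le> K * norm x"
proof -
  have K: "0 \<le> K" using col[of 0 0] by (simp add: order_trans[OF abs_ge_zero])
  have K': "0 \<le> K'" by (rule C_nonneg[OF lin bnd])
  have simple: "norm (W (Emb f)) \<le> K * norm (Emb f)" if f: "step n f" for n f
  proof (rule norm_le_E[of n])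
    fix j assume j: "n \<le> j"
    have fj: "step j f" by (rule step_mono[OF f j])
    have "(\<Sum>i'<2 ^ j. \<bar>E j i' (W (Emb f))\<bar>)
        = (\<Sum>i'<2 ^ j. \<bar>\<Sum>i<2 ^ j. f (real i / 2 ^ j) * E j i' (W (atom j i))\<bar>)"
      by (simp add: Emb_eq[OF fj] emb_def linear_sum[OF lin] linear_scale[OF lin] E_sum E_scale)
    also have "\<dots> \<le> (\<Sum>i'<2 ^ j. \<Sum>i<2 ^ j. \<bar>f (real i / 2 ^ j)\<bar> * \<bar>E j i' (W (atom j i))\<bar>)"
      by (intro sum_mono order_trans[OF sum_abs]) (simp add: abs_mult)
    also have "\<dots> = (\<Sum>i<2 ^ j. \<bar>f (real i / 2 ^ j)\<bar> * (\<Sum>i'<2 ^ j. \<bar>E j i' (W (atom j i))\<bar>))"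
      by (subst sum.swap) (simp add: sum_distrib_left)
    also have "\<dots> \<le> (\<Sum>i<2 ^ j. \<bar>f (real i / 2 ^ j)\<bar> * (K / 2 ^ j))"
      by (intro sum_mono mult_left_mono col) auto
    also have "\<dots> = K * norm (Emb f)"
      by (simp add: norm_Emb[OF fj] Mean_eq[OF step_comp[OF fj]] mean_def sum_distrib_left sum_divide_distrib mult_ac)
    finally show "(\<Sum>i'<2 ^ j. \<bar>E j i' (W (Emb f))\<bar>) \<le> K * norm (Emb f)" .
  qed
  show ?thesis
  proof (rule field_le_epsilon)
    fix e :: real assume e: "0 < e"
    define d where "d = e / (K + K' + 1)"
    have d: "0 < d" using e K K' by (simp add: d_def)
    obtain n f where f: "step n f" "norm (x - Emb f) < d" by (rule dense_step[OF d])
    have "norm (W x) \<le> norm (W (Emb f)) + norm (W (x - Emb f))"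
      using norm_triangle_sub[of "W x" "W (Emb f)"] by (simp add: linear_diff[OF lin])
    also have "\<dots> \<le> K * (norm x + d) + K' * d"
    proof (intro add_mono)
      have "norm (Emb f) \<le> norm x + d"
        using f(2) norm_triangle_ineq2[of "Emb f" x] by (simp add: norm_minus_commute)
      then show "norm (W (Emb f)) \<le> K * (norm x + d)"
        using simple[OF f(1)] mult_left_mono[OF _ K] order_trans by blast
      show "norm (W (x - Emb f)) \<le> K' * d"
        using bnd[of "x - Emb f"] mult_left_mono[OF less_imp_le[OF f(2)] K'] by linarith
    qed
    also have "\<dots> = K * norm x + (K + K') * d" by (simp add: algebra_simps)
    also have "(K + K') * d \<le> e"
      unfolding d_def using e K K' by (simp add: field_simps)
    finally show "norm (W x) \<le> K * norm x + e" by simp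
  qed
qed

text \<open>
  The entry of \<open>P m' (\<tau> m' m (J m _))\<close> at two nodes of level \<open>j\<close> is predicted to be \<open>D (\<tau> m m)\<close> of
  the support on the diagonal of a diagonal block, and 0 elsewhere. The error of an entry passes to
  each of its four children with the factor \<open>1 / 4\<close>, up to the tolerances of \<open>node_choice\<close>; these decay fast
  enough along the tree to keep the column sums of the errors at level \<open>j\<close> of order \<open>1 / 2 ^ j\<close>, as
  \<open>norm_le_columns\<close> requires. Finally the supports of the nodes of one level have almost equal \<open>D (\<tau> m m)\<close>.
\<close>

lemma block_estimate:
  assumes \<tau>: "\<And>m m'. linear (\<tau> m m')" "\<And>m m' x. norm (\<tau> m m' x) \<le> C * norm x"
    and A: "\<And>m. step (n m) (A m)" "\<And>m x. A m x = 0 \<or> A m x = 1" "\<And>m. 0 < Mean (A m)"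
    and \<delta>: "0 < \<delta>"
  obtains J P :: "nat \<Rightarrow> 'b \<Rightarrow> 'b" where
    "\<And>m. linear (J m)" "\<And>m x. norm (J m x) \<le> norm x"
    "\<And>m. linear (P m)" "\<And>m x. norm (P m x) \<le> norm x"
    "\<And>m' m x. norm (P m' (\<tau> m' m (J m x)) - (if m' = m then D (\<tau> m m) (A m) / Mean (A m) else 0) *\<^sub>R x)
        \<le> 4 * \<delta> * (1 / 8) ^ (m' + m) * norm x"
proof -
  have Mean1: "Mean (A m) \<le> 1" for m
  proof -
    have "A m x \<le> 1" for x using A(2)[of m x] by auto
    then have "(\<Sum>i<2 ^ n m. A m (real i / 2 ^ n m)) \<le> (\<Sum>i<(2::nat) ^ n m. 1)" by (intro sum_mono)
    then show ?thesis by (simp add: Mean_eq[OF A(1)] mean_def)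
  qed
  \<comment> \<open>As \<open>512 = 8 ^ 3\<close>, this provides a factor \<open>1 / 8\<close> for each of
    \<open>m\<close>, \<open>m'\<close> and the level, and the product of the means one factor
    \<open>Mean (A m)\<close>, whichever \<open>m \<le> q\<close> it is.\<close>
  define \<eta> where "\<eta> q = \<delta> * (1 / 512) ^ q * (\<Prod>m\<le>q. Mean (A m))" for q :: nat
  have \<eta>_pos: "0 < \<eta> q" for q using \<delta> A(3) by (simp add: \<eta>_def prod_pos)
  have \<eta>_le: "\<eta> q \<le> \<delta> * Mean (A m) * (1 / 8) ^ (m' + m + k)" if "m' \<le> q" "m \<le> q" "k \<le> q" for q m m' k
  proof -
    have "(\<Prod>m\<le>q. Mean (A m)) = Mean (A m) * (\<Prod>m\<in>{..q} - {m}. Mean (A m))"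
      using that by (subst prod.remove[of _ m]) auto
    also have "\<dots> \<le> Mean (A m) * 1"
      using A(3) Mean1 by (intro mult_left_mono prod_le_1) (auto intro: less_imp_le)
    finally have 1: "(\<Prod>m\<le>q. Mean (A m)) \<le> Mean (A m)" by simp
    have "(1 / 512 :: real) ^ q = (1 / 8) ^ (3 * q)" by (simp add: power_mult power_divide)
    also have "\<dots> \<le> (1 / 8) ^ (m' + m + k)" using that by (intro power_decreasing) auto
    finally have "(1 / 512 :: real) ^ q \<le> (1 / 8) ^ (m' + m + k)" .
    then have "\<delta> * (1 / 512) ^ q * (\<Prod>m\<le>q. Mean (A m)) \<le> \<delta> * (1 / 8) ^ (m' + m + k) * Mean (A m)"
      using 1 \<delta> prod_nonneg[of "{..q}" "\<lambda>m. Mean (A m)"] less_imp_le[OF A(3)] by (intro mult_mono) auto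
    then show ?thesis by (simp add: \<eta>_def mult_ac)
  qed
  obtain b lv where lv: "\<And>m l. prod_encode (m, l) \<le> lv m l"
    and b1: "\<And>m l x. b m l x \<in> {-1, 0, 1}"
    and lvA: "\<And>m l. step (lv m l) (A m)"
    and lvb: "\<And>m l m' l'. prod_encode (m', l') < prod_encode (m, l) \<Longrightarrow> step (lv m l) (b m' l')"
    and bhaar: "\<And>m l. \<exists>\<epsilon>. (\<forall>i. \<epsilon> i = 1 \<or> \<epsilon> i = -1) \<and> b m l = haar_step (lv m l) (node_support (A m) (b m) l) \<epsilon>"
    and off: "\<And>m l m' l'. (m', l') \<noteq> (m, l) \<Longrightarrow>
       \<bar>Pr (b m' l') (\<tau> m' m (Emb (b m l)))\<bar> \<le> \<eta> (max (prod_encode (m', l')) (prod_encode (m, l)))"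
    and diag: "\<And>m l. \<bar>Pr (b m l) (\<tau> m m (Emb (b m l))) - D (\<tau> m m) (node_support (A m) (b m) l)\<bar> \<le> \<eta> (prod_encode (m, l))"
    and balance: "\<And>m l. 1 \<le> l \<Longrightarrow> \<bar>D (\<tau> m m) (\<lambda>x. b m 0 x * b m l x)\<bar> \<le> \<eta> (prod_encode (m, l))"
  proof -
    show ?thesis
      by (rule node_choice[where \<tau> = \<tau> and C = C and n = n and A = A and \<eta> = \<eta>])
        (fact \<tau> A(1,2) \<eta>_pos that)+
  qed
  have "\<exists>\<epsilon>. \<forall>m l. (\<forall>i. \<epsilon> m l i = 1 \<or> \<epsilon> m l i = -1) \<and> b m l = haar_step (lv m l) (node_support (A m) (b m) l) (\<epsilon> m l)"
    using bhaar by metis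
  then obtain \<epsilon> where \<epsilon>: "\<And>m l i. \<epsilon> m l i = 1 \<or> \<epsilon> m l i = -1"
    "\<And>m l. b m l = haar_step (lv m l) (node_support (A m) (b m) l) (\<epsilon> m l)" by blast
  have copy: "tree_copy atom E (A m) (b m) (lv m) (\<epsilon> m)" for m
  proof (unfold_locales)
    show "l \<le> lv m l" for l using lv[of m l] le_prod_encode_2[of l m] by linarith
    show "step (lv m l) (b m l')" if "l' < l" for l l' using lvb[OF prod_encode_mono[OF that]] .
  qed (use b1 lvA A(2,3) \<epsilon> in auto)
  define c where "c m = tree_copy.c (A m) (b m)" for m
  have "\<exists>J P. linear J \<and> (\<forall>x. norm (J x) \<le> norm x) \<and>
      (\<forall>j i. i < 2 ^ j \<longrightarrow> J (atom j i) = (1 / Mean (A m)) *\<^sub>R Emb (c m (2 ^ j + i))) \<and>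
      linear P \<and> (\<forall>y. norm (P y) \<le> norm y) \<and>
      (\<forall>j i y. i < 2 ^ j \<longrightarrow> E j i (P y) = Pr (c m (2 ^ j + i)) y)" for m
    by (rule tree_copy.copy_operators[OF copy[of m]]) (unfold c_def, blast)
  then obtain J P where J: "\<And>m. linear (J m)" "\<And>m x. norm (J m x) \<le> norm x"
      "\<And>m j i. i < 2 ^ j \<Longrightarrow> J m (atom j i) = (1 / Mean (A m)) *\<^sub>R Emb (c m (2 ^ j + i))"
    and P: "\<And>m. linear (P m)" "\<And>m y. norm (P m y) \<le> norm y"
      "\<And>m j i y. i < 2 ^ j \<Longrightarrow> E j i (P m y) = Pr (c m (2 ^ j + i)) y"
    by metis
  have "norm (P m' (\<tau> m' m (J m x)) - (if m' = m then D (\<tau> m m) (A m) / Mean (A m) else 0) *\<^sub>R x)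
        \<le> 4 * \<delta> * (1 / 8) ^ (m' + m) * norm x" for m' m x
  proof -
    interpret M: tree_copy atom E "A m" "b m" "lv m" "\<epsilon> m" by (rule copy)
    interpret M': tree_copy atom E "A m'" "b m'" "lv m'" "\<epsilon> m'" by (rule copy)
    define T where "T = \<tau> m' m"
    have T: "linear T" "\<And>x. norm (T x) \<le> C * norm x" unfolding T_def by (fact \<tau>)+
    define \<kappa> where "\<kappa> = \<delta> * Mean (A m) * (1 / 8) ^ (m' + m)"
    have \<kappa>: "0 < \<kappa>" using \<delta> A(3) by (simp add: \<kappa>_def)
    define t where "t j = \<kappa> * (1 / 8) ^ Suc j" for j :: nat
    have \<eta>_t: "\<eta> q \<le> t j" if "m' \<le> q" "m \<le> q" "2 ^ j \<le> q" for q j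
    proof -
      have "Suc j \<le> q" using that(3) less_exp[of j] by linarith
      from \<eta>_le[OF that(1,2) this] show ?thesis by (simp add: t_def \<kappa>_def power_add mult_ac)
    qed
    have \<eta>_\<kappa>: "\<eta> q \<le> \<kappa>" if "m' \<le> q" "m \<le> q" for q
      using \<eta>_le[of m' q m 0] that by (simp add: \<kappa>_def)
    define Q where "Q l' l = max (prod_encode (m', l')) (prod_encode (m, l))" for l' l
    have Q: "m' \<le> Q l' l" "m \<le> Q l' l" "l' \<le> Q l' l" "l \<le> Q l' l" for l' l
      using le_prod_encode_1[of m' l'] le_prod_encode_1[of m l] le_prod_encode_2[of l' m'] le_prod_encode_2[of l m]
      by (auto simp: Q_def)
    have off': "\<bar>Pr (b m' l') (T (Emb (b m l)))\<bar> \<le> t j" if "(m', l') \<noteq> (m, l)" "2 ^ j \<le> l' \<or> 2 ^ j \<le> l" for l' l j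
    proof -
      have "2 ^ j \<le> Q l' l" using that(2) Q(3,4) order_trans by blast
      then show ?thesis using off[OF that(1)] \<eta>_t[OF Q(1,2)] unfolding T_def Q_def by (meson order_trans)
    qed
    have c1: "c m 1 = b m 0" "c m' 1 = b m' 0"
      unfolding c_def M.c_def[abs_def] M'.c_def[abs_def] M.a0 M'.a0 using M.A_b[of _ 0] M'.A_b[of _ 0] by (auto simp: mult.commute)
    note Ech = M.Emb_c_children[folded c_def]
    note Pch = M'.Pr_c_children[folded c_def]
    have parent: "\<exists>k. 1 \<le> k \<and> (l = 2 * k \<or> l = 2 * k + 1)" if "2 \<le> l" for l :: nat
      using that by presburger
    \<comment> \<open>Down the path from the root, where the copy is \<open>b m' 0\<close>, each copy is half the sum
      or difference of the copy of its parent and a function \<open>b m' k\<close>, so entries that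
      meet \<open>b m l\<close> stay small.\<close>
    have rowc: "\<bar>Pr (c m' l') (T (Emb (b m l)))\<bar> \<le> t j" if "1 \<le> l'" "l' < 2 ^ Suc j" "2 ^ j \<le> l" for l' l j
      using that(1,2)
    proof (induction l' rule: less_induct)
      case (less l')
      show ?case
      proof (cases "l' = 1")
        case True
        have "0 < l" by (rule order_less_le_trans[OF _ that(3)]) simp
        then have "(m', 0) \<noteq> (m, l)" by simp
        then show ?thesis using off'[of 0 l j] that(3) unfolding True c1 by blast
      next
        case False
        then obtain k where k: "1 \<le> k" "l' = 2 * k \<or> l' = 2 * k + 1" using parent[of l'] less.prems by fastforce
        have "k < 2 ^ j" using k(2) less.prems(2) by auto
        then have "(m', k) \<noteq> (m, l)" using that(3) by auto
        then have "\<bar>Pr (b m' k) (T (Emb (b m l)))\<bar> \<le> t j" using off'[of k l j] that(3) by blast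
        moreover have "\<bar>Pr (c m' k) (T (Emb (b m l)))\<bar> \<le> t j"
          using k less.prems by (intro less.IH) auto
        ultimately show ?thesis using k(2) Pch[OF k(1), of "T (Emb (b m l))"] by (auto simp: abs_le_iff)
      qed
    qed
    have colc: "\<bar>Pr (b m' l') (T (Emb (c m l)))\<bar> \<le> t j" if "1 \<le> l" "l < 2 ^ Suc j" "2 ^ j \<le> l'" for l' l j
      using that(1,2)
    proof (induction l rule: less_induct)
      case (less l)
      show ?case
      proof (cases "l = 1")
        case True
        have "0 < l'" by (rule order_less_le_trans[OF _ that(3)]) simp
        then have "(m', l') \<noteq> (m, 0)" by simp
        then show ?thesis using off'[of l' 0 j] that(3) unfolding True c1 by blast
      next
        case False
        then obtain k where k: "1 \<le> k" "l = 2 * k \<or> l = 2 * k + 1" using parent[of l] less.prems by fastforce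
        have "k < 2 ^ j" using k(2) less.prems(2) by auto
        then have "(m', l') \<noteq> (m, k)" using that(3) by auto
        then have "\<bar>Pr (b m' l') (T (Emb (b m k)))\<bar> \<le> t j" using off'[of l' k j] that(3) by blast
        moreover have "\<bar>Pr (b m' l') (T (Emb (c m k)))\<bar> \<le> t j"
          using k less.prems by (intro less.IH) auto
        moreover have "Pr (b m' l') (T (Emb (c m l))) = (Pr (b m' l') (T (Emb (c m k))) + Pr (b m' l') (T (Emb (b m k)))) / 2
          \<or> Pr (b m' l') (T (Emb (c m l))) = (Pr (b m' l') (T (Emb (c m k))) - Pr (b m' l') (T (Emb (b m k)))) / 2"
          using k(2) Ech[OF k(1)]
          by (auto simp: linear_add[OF T(1)] linear_diff[OF T(1)] linear_scale[OF T(1)]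
              linear_add[OF linear_Pr] linear_diff[OF linear_Pr] linear_scale[OF linear_Pr])
        ultimately show ?thesis unfolding abs_le_iff by argo
      qed
    qed
    define X where "X l' l = Pr (c m' l') (T (Emb (c m l)))" for l' l
    \<comment> \<open>The predicted entries.\<close>
    define dd where "dd l' l = (if m' = m \<and> l' = l then D (\<tau> m m) (M.a l) else 0)" for l' l
    have bb: "\<bar>Pr (b m' l') (T (Emb (b m l))) - dd l' l\<bar> \<le> t j"
      if "2 ^ j \<le> l" for l' l j
    proof (cases "(m', l') = (m, l)")
      case True
      have "2 ^ j \<le> prod_encode (m, l)" using that le_prod_encode_2[of l m] order_trans by blast
      then have "\<eta> (prod_encode (m, l)) \<le> t j"
        using \<eta>_t[of "prod_encode (m, l)" j] le_prod_encode_1[of m l] True by simp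
      then show ?thesis using diag[of m l] True by (auto simp: dd_def T_def)
    next
      case False
      then show ?thesis using off'[of l' l j] that by (auto simp: dd_def)
    qed
    have bal: "\<bar>D (\<tau> m m) (\<lambda>x. b m 0 x * b m l x)\<bar> \<le> t j" if "2 ^ j \<le> l" "m' = m" for l j
    proof -
      have "2 ^ j \<le> prod_encode (m, l)" using that(1) le_prod_encode_2[of l m] order_trans by blast
      moreover have "1 \<le> l" using that(1) by (metis one_le_numeral one_le_power order_trans)
      ultimately show ?thesis
        using balance[of l m] \<eta>_t[of "prod_encode (m, l)" j] le_prod_encode_1[of m l] that(2) by linarith
    qed
    have Dchild: "D (\<tau> m m) (M.a (2 * l)) = (D (\<tau> m m) (M.a l) + D (\<tau> m m) (\<lambda>x. b m 0 x * b m l x)) / 2"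
      "D (\<tau> m m) (M.a (2 * l + 1)) = (D (\<tau> m m) (M.a l) - D (\<tau> m m) (\<lambda>x. b m 0 x * b m l x)) / 2"
      if l: "1 \<le> l" for l
    proof -
      obtain N where N: "\<And>k. k \<le> l \<Longrightarrow> step N (M.a k) \<and> step N (b m k)" using M.level_ex[of l] by blast
      have u: "step N (\<lambda>x. b m 0 x * b m l x)" "\<And>x. \<bar>b m 0 x * b m l x\<bar> \<le> 1"
        using N[of 0] N[of l] M.b_le_1 by (auto intro!: step_mult mult_le_one simp: abs_mult)
      have al: "step N (M.a l)" "\<And>x. \<bar>M.a l x\<bar> \<le> 1" using N[of l] M.a_le_1 by auto
      note st = \<tau>(1)[of m m] \<tau>(2)[of m m]
      have add: "D (\<tau> m m) (\<lambda>x. 1 / 2 * M.a l x + e * (b m 0 x * b m l x))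
        = 1 / 2 * D (\<tau> m m) (M.a l) + e * D (\<tau> m m) (\<lambda>x. b m 0 x * b m l x)" for e
      proof -
        have "D (\<tau> m m) (\<lambda>x. 1 / 2 * M.a l x + e * (b m 0 x * b m l x))
          = D (\<tau> m m) (\<lambda>x. 1 / 2 * M.a l x) + D (\<tau> m m) (\<lambda>x. e * (b m 0 x * b m l x))"
        proof (rule D_add[OF st step_mult[OF step_const al(1)] _ step_mult[OF step_const u(1)]])
          show "\<bar>1 / 2 * M.a l x\<bar> \<le> 1 / 2" for x using al(2)[of x] by (simp add: abs_mult)
          show "\<bar>e * (b m 0 x * b m l x)\<bar> \<le> \<bar>e\<bar> * 1" for x
            unfolding abs_mult[of e] by (intro mult_left_mono u(2)) simp
        qed
        then show ?thesis by (simp only: D_scale[OF st al] D_scale[OF st u])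
      qed
      have "M.a (2 * l) = (\<lambda>x. 1 / 2 * M.a l x + 1 / 2 * (b m 0 x * b m l x))"
        using M.a_halves(1)[OF l] by (auto simp: add_divide_distrib)
      then show "D (\<tau> m m) (M.a (2 * l)) = (D (\<tau> m m) (M.a l) + D (\<tau> m m) (\<lambda>x. b m 0 x * b m l x)) / 2"
        by (simp only: add) (simp add: field_simps)
      have "M.a (2 * l + 1) = (\<lambda>x. 1 / 2 * M.a l x + (- 1 / 2) * (b m 0 x * b m l x))"
        using M.a_halves(2)[OF l] by (auto simp: diff_divide_distrib)
      then show "D (\<tau> m m) (M.a (2 * l + 1)) = (D (\<tau> m m) (M.a l) - D (\<tau> m m) (\<lambda>x. b m 0 x * b m l x)) / 2"
        by (simp only: add) (simp add: field_simps)
    qed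
    define err where "err l' l = \<bar>X l' l - dd l' l\<bar>" for l' l
    have err_child: "err (2 * l' + s') (2 * l + s) \<le> err l' l / 4 + 2 * t j"
      if l: "2 ^ j \<le> l" "l < 2 ^ Suc j" and l': "2 ^ j \<le> l'" "l' < 2 ^ Suc j" and s: "s \<in> {0, 1}" "s' \<in> {0, 1}"
      for l l' s s' j
    proof -
      have pos: "1 \<le> l" "1 \<le> l'" using l(1) l'(1) one_le_power[of "2::nat" j] by linarith+
      define p where "p = Pr (b m' l') (T (Emb (c m l)))"
      define q where "q = Pr (c m' l') (T (Emb (b m l)))"
      define r where "r = Pr (b m' l') (T (Emb (b m l)))"
      define d where "d = D (\<tau> m m) (\<lambda>x. b m 0 x * b m l x)"
      have p: "\<bar>p\<bar> \<le> t j" unfolding p_def by (rule colc[OF pos(1) l(2) l'(1)])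
      have q: "\<bar>q\<bar> \<le> t j" unfolding q_def by (rule rowc[OF pos(2) l'(2) l(1)])
      have r: "\<bar>r - dd l' l\<bar> \<le> t j" unfolding r_def by (rule bb[OF l(1)])
      have d: "m' = m \<Longrightarrow> \<bar>d\<bar> \<le> t j" unfolding d_def by (rule bal[OF l(1)])
      note lins = linear_add[OF T(1)] linear_diff[OF T(1)] linear_scale[OF T(1)]
              linear_add[OF linear_Pr] linear_diff[OF linear_Pr] linear_scale[OF linear_Pr]
      have X: "X (2 * l') (2 * l) = (X l' l + p + q + r) / 4" "X (2 * l' + 1) (2 * l) = (X l' l - p + q - r) / 4"
          "X (2 * l') (2 * l + 1) = (X l' l + p - q - r) / 4" "X (2 * l' + 1) (2 * l + 1) = (X l' l - p - q + r) / 4"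
        unfolding X_def Ech[OF pos(1)] Pch[OF pos(2)] p_def q_def r_def lins by (simp_all add: field_simps)
      have t0: "0 \<le> t j" using \<kappa> by (simp add: t_def)
      show ?thesis
      proof (cases "m' = m \<and> l' = l")
        case True
        then have DD: "dd (2 * l') (2 * l) = (dd l' l + d) / 2" "dd (2 * l' + 1) (2 * l + 1) = (dd l' l - d) / 2"
          "dd (2 * l') (2 * l + 1) = 0" "dd (2 * l' + 1) (2 * l) = 0"
          using Dchild[OF pos(1)] by (auto simp: dd_def d_def)
        have d': "\<bar>d\<bar> \<le> t j" using d True by simp
        note arith = quarter_split(1,2)[OF p q r] quarter_split(3,4)[OF p q r d']
        have "\<bar>X (2 * l') (2 * l) - dd (2 * l') (2 * l)\<bar> \<le> err l' l / 4 + 2 * t j"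
          "\<bar>X (2 * l' + 1) (2 * l) - dd (2 * l' + 1) (2 * l)\<bar> \<le> err l' l / 4 + 2 * t j"
          "\<bar>X (2 * l') (2 * l + 1) - dd (2 * l') (2 * l + 1)\<bar> \<le> err l' l / 4 + 2 * t j"
          "\<bar>X (2 * l' + 1) (2 * l + 1) - dd (2 * l' + 1) (2 * l + 1)\<bar> \<le> err l' l / 4 + 2 * t j"
          unfolding err_def X DD diff_0_right by (rule arith)+
        then show ?thesis using s unfolding err_def by (auto simp del: Suc_eq_plus1)
      next
        case False
        then have "dd l' l = 0" "dd (2 * l' + s') (2 * l + s) = 0" using s by (auto simp: dd_def)
        note dd0 = this
        have r': "\<bar>r - 0\<bar> \<le> t j" using r dd0 by simp
        have "\<bar>0::real\<bar> \<le> t j" using t0 by simp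
        note arith = quarter_split(1,2)[OF p q r'] quarter_split(3,4)[OF p q r' this]
        have "\<bar>X (2 * l') (2 * l)\<bar> \<le> err l' l / 4 + 2 * t j" "\<bar>X (2 * l' + 1) (2 * l)\<bar> \<le> err l' l / 4 + 2 * t j"
          "\<bar>X (2 * l') (2 * l + 1)\<bar> \<le> err l' l / 4 + 2 * t j" "\<bar>X (2 * l' + 1) (2 * l + 1)\<bar> \<le> err l' l / 4 + 2 * t j"
          unfolding err_def X dd0(1) using arith[of "X l' l"] by simp_all
        then show ?thesis using s dd0(2) unfolding err_def by (auto simp del: Suc_eq_plus1)
      qed
    qed
    have nodes: "2 ^ j \<le> 2 ^ j + i" "2 ^ j + i < 2 ^ Suc j" if "i < 2 ^ j" for i j :: nat using that by auto
    \<comment> \<open>Column sums \<open>R\<close> of the errors. Each entry of the parent column contributes to two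
      entries of the child column, so \<open>R\<close> is halved up to \<open>4 * 2 ^ j * t j\<close>;
      the stated bound solves this recursion.\<close>
    define R where "R j i = (\<Sum>i'<2 ^ j. err (2 ^ j + i') (2 ^ j + i))" for j i :: nat
    have R: "R j i \<le> (3 - 2 * (1 / 2) ^ j) * \<kappa> / 2 ^ j" if "i < 2 ^ j" for j i
      using that
    proof (induction j arbitrary: i)
      case 0
      have "err 1 1 \<le> \<kappa>"
      proof (cases "m' = m")
        case True
        have "\<eta> (prod_encode (m, 0)) \<le> \<kappa>" using \<eta>_\<kappa>[of "prod_encode (m, 0)"] le_prod_encode_1[of m 0] True by simp
        then show ?thesis using diag[of m 0] True M.a0
          unfolding err_def X_def dd_def c1 T_def by simp
      next
        case False
        then have "\<bar>Pr (b m' 0) (T (Emb (b m 0)))\<bar> \<le> \<kappa>"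
          using off[of m' 0 m 0] \<eta>_\<kappa>[OF Q(1,2), of 0 0] unfolding Q_def T_def by force
        then show ?thesis using False unfolding err_def X_def dd_def c1 by simp
      qed
      then show ?case using 0 by (simp add: R_def)
    next
      case (Suc j)
      define k s where "k = i div 2" and "s = i mod 2"
      have i: "i = 2 * k + s" "s \<in> {0, 1}" "k < 2 ^ j" using Suc.prems by (auto simp: k_def s_def)
      have "R (Suc j) i = (\<Sum>i'<2 ^ j. err (2 * (2 ^ j + i') + 0) (2 * (2 ^ j + k) + s) + err (2 * (2 ^ j + i') + 1) (2 * (2 ^ j + k) + s))"
        unfolding R_def power_Suc[of "2::nat" j] sum_lessThan_double i(1) by (simp add: algebra_simps)
      also have "\<dots> \<le> (\<Sum>i'<2 ^ j. (err (2 ^ j + i') (2 ^ j + k) / 4 + 2 * t j) + (err (2 ^ j + i') (2 ^ j + k) / 4 + 2 * t j))"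
        using i nodes by (intro sum_mono add_mono err_child) auto
      also have "\<dots> = R j k / 2 + 2 ^ j * (4 * t j)"
        by (simp add: R_def sum.distrib sum_divide_distrib[symmetric])
      also have "\<dots> \<le> (3 - 2 * (1 / 2) ^ j) * \<kappa> / 2 ^ j / 2 + 2 ^ j * (4 * t j)"
        using Suc.IH[OF i(3)] by simp
      also have "\<dots> = (3 - 2 * (1 / 2) ^ Suc j) * \<kappa> / 2 ^ Suc j"
      proof -
        have e: "(8::real) ^ j = 2 ^ j * 2 ^ j * 2 ^ j" by (simp flip: power_mult_distrib)
        show ?thesis unfolding t_def by (simp add: power_divide e field_simps)
      qed
      finally show ?case .
    qed
    have Dm: "\<bar>D (\<tau> m m) (M.a (2 ^ j + i)) - D (\<tau> m m) (A m) / 2 ^ j\<bar> \<le> (1 - (1 / 2) ^ j) * \<kappa> / 2 ^ j"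
      if "m' = m" "i < 2 ^ j" for j i
      using that(2)
    proof (induction j arbitrary: i)
      case 0 then show ?case using M.a0 by simp
    next
      case (Suc j)
      define k where "k = i div 2"
      define l where "l = 2 ^ j + k"
      have k: "k < 2 ^ j" using Suc.prems by (auto simp: k_def)
      have l: "1 \<le> l" "2 ^ j \<le> l" by (simp_all add: l_def Suc_leI)
      have il: "2 ^ Suc j + i = 2 * l \<or> 2 ^ Suc j + i = 2 * l + 1" unfolding l_def k_def power_Suc by presburger
      have "\<bar>D (\<tau> m m) (M.a (2 ^ Suc j + i)) - D (\<tau> m m) (M.a l) / 2\<bar> \<le> t j / 2"
      proof -
        have "\<bar>(v + d) / 2 - v / 2\<bar> \<le> t j / 2" "\<bar>(v - d) / 2 - v / 2\<bar> \<le> t j / 2" if "\<bar>d\<bar> \<le> t j" for v d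
          using that by (simp_all flip: diff_divide_distrib)
        note this[OF bal[OF l(2) that(1)]]
        then show ?thesis using il by (elim disjE) (simp_all only: Dchild[OF l(1)])
      qed
      moreover have "\<bar>D (\<tau> m m) (M.a l) / 2 - D (\<tau> m m) (A m) / 2 ^ Suc j\<bar> \<le> (1 - (1 / 2) ^ j) * \<kappa> / 2 ^ j / 2"
      proof -
        have h: "\<bar>y / 2\<bar> \<le> B / 2" if "\<bar>y\<bar> \<le> B" for y B :: real using that by simp
        have "D (\<tau> m m) (M.a l) / 2 - D (\<tau> m m) (A m) / 2 ^ Suc j = (D (\<tau> m m) (M.a l) - D (\<tau> m m) (A m) / 2 ^ j) / 2"
          by (simp add: field_simps)
        then show ?thesis using h[OF Suc.IH[OF k, folded l_def]] by (simp only:)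
      qed
      moreover have "t j / 2 + (1 - (1 / 2) ^ j) * \<kappa> / 2 ^ j / 2 \<le> (1 - (1 / 2) ^ Suc j) * \<kappa> / 2 ^ Suc j"
      proof -
        have e: "(8::real) ^ j = 2 ^ j * 2 ^ j * 2 ^ j" by (simp flip: power_mult_distrib)
        have "(1 - (1 / 2) ^ Suc j) * \<kappa> / 2 ^ Suc j - (t j / 2 + (1 - (1 / 2) ^ j) * \<kappa> / 2 ^ j / 2)
          = \<kappa> / (2 ^ j * 2 ^ j) * (1 / 4 - 1 / 16 * (1 / 2) ^ j)"
          unfolding t_def by (simp add: power_divide e field_simps)
        moreover have "0 \<le> \<kappa> / (2 ^ j * 2 ^ j) * (1 / 4 - 1 / 16 * (1 / 2) ^ j)"
        proof (rule mult_nonneg_nonneg)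
          have "(1 / 2 :: real) ^ j \<le> 1" by (simp add: power_le_one)
          then show "0 \<le> 1 / 4 - 1 / 16 * (1 / 2 :: real) ^ j" by linarith
        qed (use \<kappa> in simp)
        ultimately show ?thesis by linarith
      qed
      ultimately show ?case by linarith
    qed
    define z where "z = (if m' = m then D (\<tau> m m) (A m) else 0)"
    have column: "(\<Sum>i'<2 ^ j. \<bar>X (2 ^ j + i') (2 ^ j + i) - (if i' = i then z / 2 ^ j else 0)\<bar>) \<le> 4 * \<kappa> / 2 ^ j"
      if i: "i < 2 ^ j" for i j
    proof -
      have "(\<Sum>i'<2 ^ j. \<bar>X (2 ^ j + i') (2 ^ j + i) - (if i' = i then z / 2 ^ j else 0)\<bar>)
        \<le> (\<Sum>i'<2 ^ j. err (2 ^ j + i') (2 ^ j + i) + (if i' = i then \<kappa> / 2 ^ j else 0))"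
      proof (rule sum_mono)
        fix i' assume "i' \<in> {..<(2::nat) ^ j}"
        have "\<bar>dd (2 ^ j + i') (2 ^ j + i) - (if i' = i then z / 2 ^ j else 0)\<bar> \<le> (if i' = i then \<kappa> / 2 ^ j else 0)"
        proof (cases "m' = m \<and> i' = i")
          case True
          have "(1 - (1 / 2) ^ j) * \<kappa> / 2 ^ j \<le> \<kappa> / 2 ^ j" using \<kappa> by (intro divide_right_mono) auto
          then show ?thesis using Dm[OF _ i] True by (simp add: dd_def z_def)
        qed (use \<kappa> in \<open>auto simp: dd_def z_def\<close>)
        then show "\<bar>X (2 ^ j + i') (2 ^ j + i) - (if i' = i then z / 2 ^ j else 0)\<bar>
            \<le> err (2 ^ j + i') (2 ^ j + i) + (if i' = i then \<kappa> / 2 ^ j else 0)"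
          unfolding err_def by linarith
      qed
      also have "\<dots> = R j i + \<kappa> / 2 ^ j" using i by (simp add: sum.distrib R_def)
      also have "\<dots> \<le> 3 * \<kappa> / 2 ^ j + \<kappa> / 2 ^ j"
      proof -
        have "(3 - 2 * (1 / 2) ^ j) * \<kappa> / 2 ^ j \<le> 3 * \<kappa> / 2 ^ j"
          using \<kappa> by (intro divide_right_mono mult_right_mono) auto
        then show ?thesis using R[OF i] by linarith
      qed
      finally show ?thesis by (simp add: field_simps)
    qed
    define \<mu> where "\<mu> = Mean (A m)"
    have \<mu>: "0 < \<mu>" using A(3) by (simp add: \<mu>_def)
    define W where "W x = P m' (T (J m x)) - (z / \<mu>) *\<^sub>R x" for x
    have W: "linear W"
      unfolding W_def[abs_def]
      by (rule linearI) (simp_all add: linear_add[OF J(1)] linear_add[OF P(1)] linear_add[OF T(1)]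
          linear_scale[OF J(1)] linear_scale[OF P(1)] linear_scale[OF T(1)] algebra_simps)
    have Wb: "norm (W x) \<le> (C + \<bar>z / \<mu>\<bar>) * norm x" for x
    proof -
      have C0: "0 \<le> C" by (rule C_nonneg[OF T])
      have "norm (P m' (T (J m x))) \<le> C * norm x"
        using P(2)[of m' "T (J m x)"] T(2)[of "J m x"] mult_left_mono[OF J(2)[of m x] C0] by linarith
      then show ?thesis
        unfolding W_def using norm_triangle_ineq4[of "P m' (T (J m x))" "(z / \<mu>) *\<^sub>R x"]
        by (simp add: algebra_simps)
    qed
    have "norm (W x) \<le> (4 * \<kappa> / \<mu>) * norm x"
    proof (rule norm_le_columns[OF W Wb])
      fix j i :: nat assume i: "i < 2 ^ j"
      have "(\<Sum>i'<2 ^ j. \<bar>E j i' (W (atom j i))\<bar>)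
        = (\<Sum>i'<2 ^ j. (1 / \<mu>) * \<bar>X (2 ^ j + i') (2 ^ j + i) - (if i' = i then z / 2 ^ j else 0)\<bar>)"
      proof (intro sum.cong refl)
        fix i' assume i': "i' \<in> {..<(2::nat) ^ j}"
        have "E j i' (W (atom j i)) = (1 / \<mu>) * (X (2 ^ j + i') (2 ^ j + i) - (if i' = i then z / 2 ^ j else 0))"
          using i i' unfolding W_def
          by (simp add: E_diff E_scale E_atom J(3) P(3) linear_scale[OF T(1)] linear_scale[OF linear_Pr] X_def \<mu>_def
              diff_divide_distrib)
        then show "\<bar>E j i' (W (atom j i))\<bar> = (1 / \<mu>) * \<bar>X (2 ^ j + i') (2 ^ j + i) - (if i' = i then z / 2 ^ j else 0)\<bar>"
          using \<mu> by (simp add: abs_mult)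
      qed
      also have "\<dots> \<le> (1 / \<mu>) * (4 * \<kappa> / 2 ^ j)"
        unfolding sum_distrib_left[symmetric] using \<mu> by (intro mult_left_mono column[OF i]) auto
      finally show "(\<Sum>i'<2 ^ j. \<bar>E j i' (W (atom j i))\<bar>) \<le> 4 * \<kappa> / \<mu> / 2 ^ j" by (simp add: field_simps)
    qed
    moreover have "4 * \<kappa> / \<mu> = 4 * \<delta> * (1 / 8) ^ (m' + m)" using \<mu> by (simp add: \<kappa>_def \<mu>_def)
    moreover have "z / \<mu> = (if m' = m then D (\<tau> m m) (A m) / Mean (A m) else 0)" by (simp add: z_def \<mu>_def)
    ultimately show ?thesis by (simp add: W_def T_def cong: if_cong)
  qed
  then show ?thesis using that[of J P] J(1,2) P(1,2) by blast
qed

end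

section \<open>Factorization in direct sums\<close>

text \<open>
  A Banach space given by a carrier set and a norm function, since \<open>\<ell>\<^sup>p(X)\<close> is not a type. Convergence
  of the sequences with geometrically decreasing steps expresses completeness.
\<close>

locale complete_normed =
  fixes V :: "'v::real_vector set" and N :: "'v \<Rightarrow> real"
  assumes V_zero: "0 \<in> V" and V_add: "x \<in> V \<Longrightarrow> y \<in> V \<Longrightarrow> x + y \<in> V"
    and V_scale: "x \<in> V \<Longrightarrow> c *\<^sub>R x \<in> V"
    and N_nonneg: "x \<in> V \<Longrightarrow> 0 \<le> N x"
    and N_add: "x \<in> V \<Longrightarrow> y \<in> V \<Longrightarrow> N (x + y) \<le> N x + N y"
    and N_scale: "x \<in> V \<Longrightarrow> N (c *\<^sub>R x) = \<bar>c\<bar> * N x"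
    and N_eq_0: "x \<in> V \<Longrightarrow> N x = 0 \<Longrightarrow> x = 0"
    and N_complete: "(\<And>n::nat. Y n \<in> V) \<Longrightarrow> (\<And>n. N (Y (Suc n) - Y n) \<le> K * (1 / 2) ^ n) \<Longrightarrow>
      \<exists>y\<in>V. (\<lambda>n. N (Y n - y)) \<longlonglongrightarrow> 0"
begin

lemma V_minus: "x \<in> V \<Longrightarrow> - x \<in> V"
  using V_scale[of x "-1"] by simp

lemma V_diff: "x \<in> V \<Longrightarrow> y \<in> V \<Longrightarrow> x - y \<in> V"
  using V_add[of x "- y"] V_minus[of y] by simp

lemma N_minus: "x \<in> V \<Longrightarrow> N (- x) = N x"
  using N_scale[of x "-1"] by simp

lemma N_minus_commute: "x \<in> V \<Longrightarrow> y \<in> V \<Longrightarrow> N (x - y) = N (y - x)"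
  using N_minus[of "x - y"] V_diff[of x y] by simp

lemma N_zero: "N 0 = 0"
  using N_scale[OF V_zero, of 0] by simp

lemma N_triangle: "x \<in> V \<Longrightarrow> y \<in> V \<Longrightarrow> z \<in> V \<Longrightarrow> N (x - z) \<le> N (x - y) + N (y - z)"
  using N_add[of "x - y" "y - z"] by (simp add: V_diff)

lemma N_le: "x \<in> V \<Longrightarrow> y \<in> V \<Longrightarrow> N x \<le> N y + N (x - y)"
  using N_add[of y "x - y"] by (simp add: V_diff)

lemma V_sum: "(\<And>i. i \<in> I \<Longrightarrow> f i \<in> V) \<Longrightarrow> sum f I \<in> V"
  by (induction I rule: infinite_finite_induct) (auto simp: V_zero V_add)

lemma N_sum: "(\<And>i. i \<in> I \<Longrightarrow> f i \<in> V) \<Longrightarrow> N (sum f I) \<le> (\<Sum>i\<in>I. N (f i))"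
proof (induction I rule: infinite_finite_induct)
  case (insert i I)
  have "N (f i + sum f I) \<le> N (f i) + N (sum f I)"
    using insert.prems by (intro N_add V_sum) auto
  then show ?case using insert by force
qed (auto simp: N_zero)

lemma limit_unique:
  assumes "\<And>n. Y n \<in> V" "x \<in> V" "y \<in> V" "(\<lambda>n. N (Y n - x)) \<longlonglongrightarrow> 0" "(\<lambda>n. N (Y n - y)) \<longlonglongrightarrow> 0"
  shows "x = y"
proof -
  have "N (x - y) \<le> 0 + 0"
  proof (rule LIMSEQ_le_const)
    show "(\<lambda>n. N (Y n - x) + N (Y n - y)) \<longlonglongrightarrow> 0 + 0" by (intro tendsto_add assms)
    have "N (x - y) \<le> N (Y n - x) + N (Y n - y)" for n
      using N_triangle[OF assms(2,1,3), of n] N_minus_commute[OF assms(2,1), of n] by simp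
    then show "\<exists>M. \<forall>n\<ge>M. N (x - y) \<le> N (Y n - x) + N (Y n - y)" by blast
  qed
  then have "N (x - y) = 0" using N_nonneg[OF V_diff[OF assms(2,3)]] by simp
  then show ?thesis using N_eq_0[OF V_diff[OF assms(2,3)]] by simp
qed

lemma operator_bound:
  assumes "bounded_operator_on V N T"
  obtains C where "0 \<le> C" "\<And>y. y \<in> V \<Longrightarrow> N (T y) \<le> C * N y"
proof -
  from assms have "\<exists>K. \<forall>y\<in>V. N (T y) \<le> K * N y" by (simp add: bounded_operator_on_def)
  then obtain K where K: "\<forall>y\<in>V. N (T y) \<le> K * N y" by blast
  have "N (T y) \<le> \<bar>K\<bar> * N y" if "y \<in> V" for y
    using K that mult_right_mono[OF abs_ge_self N_nonneg[OF that], of K] by fastforce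
  then show ?thesis using that[of "\<bar>K\<bar>"] by simp
qed

lemma operator_compose:
  assumes "bounded_operator_on V N F" "bounded_operator_on V N G"
  shows "bounded_operator_on V N (\<lambda>x. F (G x))"
proof -
  obtain C where C: "0 \<le> C" "\<And>x. x \<in> V \<Longrightarrow> N (F x) \<le> C * N x" using operator_bound[OF assms(1)] by blast
  obtain D where D: "0 \<le> D" "\<And>x. x \<in> V \<Longrightarrow> N (G x) \<le> D * N x" using operator_bound[OF assms(2)] by blast
  have "N (F (G x)) \<le> (C * D) * N x" if x: "x \<in> V" for x
  proof -
    have Gx: "G x \<in> V" using assms(2) x by (auto simp: bounded_operator_on_def)
    show ?thesis using C(2)[OF Gx] mult_left_mono[OF D(2)[OF x] C(1)] by (simp add: mult.assoc)
  qed
  then show ?thesis using assms unfolding bounded_operator_on_def by (auto intro!: exI[of _ "C * D"])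
qed

text \<open>
  The inverse is the sum of the powers of \<open>H = 1 - G\<close>, whose norm is at most \<open>1 / 2\<close>.
\<close>

lemma neumann_left_inverse:
  assumes G: "bounded_operator_on V N G" and close: "\<And>y. y \<in> V \<Longrightarrow> N (G y - y) \<le> 1 / 2 * N y"
  shows "\<exists>G'. bounded_operator_on V N G' \<and> (\<forall>y\<in>V. G' (G y) = y)"
proof -
  have GV: "y \<in> V \<Longrightarrow> G y \<in> V" and G_add: "x \<in> V \<Longrightarrow> y \<in> V \<Longrightarrow> G (x + y) = G x + G y"
    and G_scale: "y \<in> V \<Longrightarrow> G (c *\<^sub>R y) = c *\<^sub>R G y" for x y c
    using G by (auto simp: bounded_operator_on_def)
  define H where "H y = y - G y" for y
  have HV: "y \<in> V \<Longrightarrow> H y \<in> V" for y by (simp add: H_def V_diff GV)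
  have H_add: "x \<in> V \<Longrightarrow> y \<in> V \<Longrightarrow> H (x + y) = H x + H y" for x y by (simp add: H_def G_add)
  have H_scale: "y \<in> V \<Longrightarrow> H (c *\<^sub>R y) = c *\<^sub>R H y" for y c by (simp add: H_def G_scale algebra_simps)
  have H_half: "y \<in> V \<Longrightarrow> N (H y) \<le> 1 / 2 * N y" for y
    unfolding H_def using close[of y] N_minus_commute[of y "G y"] by (simp add: GV)
  have pV: "y \<in> V \<Longrightarrow> (H ^^ k) y \<in> V" for y k by (induction k) (auto simp: HV)
  have pN: "y \<in> V \<Longrightarrow> N ((H ^^ k) y) \<le> N y * (1 / 2) ^ k" for y k
  proof (induction k)
    case (Suc k)
    then show ?case using H_half[OF pV[OF Suc.prems, of k]] by simp
  qed simp
  have p_add: "x \<in> V \<Longrightarrow> y \<in> V \<Longrightarrow> (H ^^ k) (x + y) = (H ^^ k) x + (H ^^ k) y" for x y k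
    by (induction k) (auto simp: H_add pV)
  have p_scale: "y \<in> V \<Longrightarrow> (H ^^ k) (c *\<^sub>R y) = c *\<^sub>R (H ^^ k) y" for y k c
    by (induction k) (auto simp: H_scale pV)
  define Y where "Y y n = (\<Sum>k<n. (H ^^ k) y)" for y n
  have YV: "y \<in> V \<Longrightarrow> Y y n \<in> V" for y n unfolding Y_def by (intro V_sum pV)
  have "\<exists>z\<in>V. (\<lambda>n. N (Y y n - z)) \<longlonglongrightarrow> 0" if y: "y \<in> V" for y
  proof (rule N_complete[where K = "N y"])
    show "Y y n \<in> V" for n by (rule YV[OF y])
    show "N (Y y (Suc n) - Y y n) \<le> N y * (1 / 2) ^ n" for n using pN[OF y, of n] by (simp add: Y_def)
  qed
  then obtain G' where G': "\<And>y. y \<in> V \<Longrightarrow> G' y \<in> V" "\<And>y. y \<in> V \<Longrightarrow> (\<lambda>n. N (Y y n - G' y)) \<longlonglongrightarrow> 0"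
    by metis
  have geo: "(\<Sum>k<n. (1 / 2 :: real) ^ k) = 2 - 2 * (1 / 2) ^ n" for n
    by (induction n) simp_all
  have bound: "N (G' y) \<le> 2 * N y" if y: "y \<in> V" for y
  proof -
    have "N (G' y) \<le> 2 * N y + 0"
    proof (rule LIMSEQ_le_const)
      show "(\<lambda>n. 2 * N y + N (Y y n - G' y)) \<longlonglongrightarrow> 2 * N y + 0" by (intro tendsto_add tendsto_const G' y)
      have "N (G' y) \<le> 2 * N y + N (Y y n - G' y)" for n
      proof -
        have "N (Y y n) \<le> (\<Sum>k<n. N ((H ^^ k) y))" unfolding Y_def by (intro N_sum pV y)
        also have "\<dots> \<le> (\<Sum>k<n. N y * (1 / 2) ^ k)" by (intro sum_mono pN y)
        also have "\<dots> \<le> N y * 2" unfolding sum_distrib_left[symmetric] geo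
          using N_nonneg[OF y] by (intro mult_left_mono) auto
        finally have "N (Y y n) \<le> 2 * N y" by simp
        then show ?thesis
          using N_le[OF G'(1)[OF y] YV[OF y], of n] N_minus_commute[OF G'(1)[OF y] YV[OF y], of n] by simp
      qed
      then show "\<exists>M. \<forall>n\<ge>M. N (G' y) \<le> 2 * N y + N (Y y n - G' y)" by blast
    qed
    then show ?thesis by simp
  qed
  have "bounded_operator_on V N G'"
    unfolding bounded_operator_on_def
  proof (intro conjI ballI allI exI[of _ 2] G'(1) bound)
    fix x y assume x: "x \<in> V" and y: "y \<in> V"
    show "G' (x + y) = G' x + G' y"
    proof (rule limit_unique[of "Y (x + y)"])
      show "(\<lambda>n. N (Y (x + y) n - (G' x + G' y))) \<longlonglongrightarrow> 0"
      proof (rule tendsto_sandwich[OF _ _ tendsto_const])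
        show "(\<lambda>n. N (Y x n - G' x) + N (Y y n - G' y)) \<longlonglongrightarrow> 0"
          using tendsto_add[OF G'(2)[OF x] G'(2)[OF y]] by simp
        have "Y (x + y) n - (G' x + G' y) = (Y x n - G' x) + (Y y n - G' y)" for n
          using x y by (simp add: Y_def p_add sum.distrib algebra_simps)
        then show "\<forall>\<^sub>F n in sequentially. N (Y (x + y) n - (G' x + G' y)) \<le> N (Y x n - G' x) + N (Y y n - G' y)"
          by (intro always_eventually allI) (simp only:, intro N_add V_diff YV G'(1) x y)
        show "\<forall>\<^sub>F n in sequentially. 0 \<le> N (Y (x + y) n - (G' x + G' y))"
          using x y by (intro always_eventually allI N_nonneg V_diff V_add YV G'(1))
      qed
    qed (use x y in \<open>auto intro!: YV V_add G'\<close>)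
  next
    fix c y assume y: "y \<in> V"
    show "G' (c *\<^sub>R y) = c *\<^sub>R G' y"
    proof (rule limit_unique[of "Y (c *\<^sub>R y)"])
      have "Y (c *\<^sub>R y) n - c *\<^sub>R G' y = c *\<^sub>R (Y y n - G' y)" for n
        using y by (simp add: Y_def p_scale scaleR_sum_right algebra_simps)
      then have "N (Y (c *\<^sub>R y) n - c *\<^sub>R G' y) = \<bar>c\<bar> * N (Y y n - G' y)" for n
        using y by (simp add: N_scale V_diff YV G'(1))
      then show "(\<lambda>n. N (Y (c *\<^sub>R y) n - c *\<^sub>R G' y)) \<longlonglongrightarrow> 0"
        using tendsto_mult_left[OF G'(2)[OF y], of "\<bar>c\<bar>"] by simp
    qed (use y in \<open>auto intro!: YV V_scale G'\<close>)
  qed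
  moreover have "G' (G y) = y" if y: "y \<in> V" for y
  proof (rule limit_unique[of "Y (G y)"])
    have "Y (G y) n = y - (H ^^ n) y" for n
    proof -
      have e: "(H ^^ k) (G y) = (H ^^ k) y - (H ^^ Suc k) y" for k
      proof -
        have "(H ^^ k) y = (H ^^ k) (G y + H y)" by (simp add: H_def)
        also have "\<dots> = (H ^^ k) (G y) + (H ^^ k) (H y)" by (intro p_add GV HV y)
        also have "(H ^^ k) (H y) = (H ^^ Suc k) y" by (simp only: funpow_Suc_right o_apply)
        finally show ?thesis by (simp only: eq_diff_eq)
      qed
      show ?thesis unfolding Y_def e by (induction n) (simp_all del: funpow.simps(2))
    qed
    then have "N (Y (G y) n - y) = N ((H ^^ n) y)" for n
      using N_minus[OF pV[OF y, of n]] by simp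
    moreover have "(\<lambda>n. N ((H ^^ n) y)) \<longlonglongrightarrow> 0"
    proof (rule tendsto_sandwich[OF _ _ tendsto_const])
      show "(\<lambda>n. N y * (1 / 2) ^ n) \<longlonglongrightarrow> 0" by (intro tendsto_mult_right_zero LIMSEQ_power_zero) simp
    qed (use pN[OF y] N_nonneg[OF pV[OF y]] in auto)
    ultimately show "(\<lambda>n. N (Y (G y) n - y)) \<longlonglongrightarrow> 0" by simp
  qed (use y in \<open>auto intro!: YV GV G'\<close>)
  ultimately show ?thesis by blast
qed

end

text \<open>
  A space built from copies \<open>\<iota> m\<close> of \<open>X\<close> with coordinate maps \<open>\<pi> m\<close>, for \<open>m \<in> M\<close>, such that families of
  uniformly bounded operators act coordinatewise (\<open>diagonal\<close>). The instances are \<open>X\<close> itself, with a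
  single summand, and \<open>\<ell>\<^sup>p(X)\<close>.
\<close>

locale direct_sum = l1_tree atom E + complete_normed V N
  for atom :: "nat \<Rightarrow> nat \<Rightarrow> 'b::banach" and E and V :: "'v::real_vector set" and N +
  fixes M :: "nat set" and \<iota> :: "nat \<Rightarrow> 'b \<Rightarrow> 'v" and \<pi> :: "nat \<Rightarrow> 'v \<Rightarrow> 'b"
  assumes \<iota>_V: "m \<in> M \<Longrightarrow> \<iota> m a \<in> V" and \<iota>_linear: "m \<in> M \<Longrightarrow> linear (\<iota> m)"
    and \<iota>_norm: "m \<in> M \<Longrightarrow> N (\<iota> m a) \<le> norm a"
    and \<pi>_add: "x \<in> V \<Longrightarrow> y \<in> V \<Longrightarrow> \<pi> m (x + y) = \<pi> m x + \<pi> m y"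
    and \<pi>_scale: "x \<in> V \<Longrightarrow> \<pi> m (c *\<^sub>R x) = c *\<^sub>R \<pi> m x"
    and \<pi>_norm: "x \<in> V \<Longrightarrow> norm (\<pi> m x) \<le> N x"
    and \<pi>_\<iota>: "m \<in> M \<Longrightarrow> m' \<in> M \<Longrightarrow> \<pi> m (\<iota> m' a) = (if m = m' then a else 0)"
    and expand: "y \<in> V \<Longrightarrow> (\<lambda>n. N (y - (\<Sum>m\<in>M \<inter> {..<n}. \<iota> m (\<pi> m y)))) \<longlonglongrightarrow> 0"
    and diagonal: "(\<And>m. linear (F m)) \<Longrightarrow> (\<And>m a. norm (F m a) \<le> C * norm a) \<Longrightarrow> 0 \<le> C \<Longrightarrow> y \<in> V \<Longrightarrow>
      \<exists>z\<in>V. N z \<le> C * N y \<and> (\<forall>m\<in>M. \<pi> m z = F m (\<pi> m y))"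
begin

lemma partial_V: "y \<in> V \<Longrightarrow> (\<Sum>m\<in>M \<inter> {..<n}. \<iota> m (\<pi> m y)) \<in> V"
  by (intro V_sum \<iota>_V) auto

lemma N_le_sum:
  assumes y: "y \<in> V" and B: "\<And>n. (\<Sum>m\<in>M \<inter> {..<n}. norm (\<pi> m y)) \<le> B"
  shows "N y \<le> B"
proof -
  have "N y \<le> B + 0"
  proof (rule LIMSEQ_le_const)
    show "(\<lambda>n. B + N (y - (\<Sum>m\<in>M \<inter> {..<n}. \<iota> m (\<pi> m y)))) \<longlonglongrightarrow> B + 0"
      by (intro tendsto_add tendsto_const expand y)
    have "N y \<le> B + N (y - (\<Sum>m\<in>M \<inter> {..<n}. \<iota> m (\<pi> m y)))" for n
    proof -
      have "N (\<Sum>m\<in>M \<inter> {..<n}. \<iota> m (\<pi> m y)) \<le> (\<Sum>m\<in>M \<inter> {..<n}. N (\<iota> m (\<pi> m y)))"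
        by (intro N_sum \<iota>_V) auto
      also have "\<dots> \<le> (\<Sum>m\<in>M \<inter> {..<n}. norm (\<pi> m y))" by (intro sum_mono \<iota>_norm) auto
      also have "\<dots> \<le> B" by (rule B)
      finally show ?thesis using N_le[OF y partial_V[OF y], of n] by linarith
    qed
    then show "\<exists>k. \<forall>n\<ge>k. N y \<le> B + N (y - (\<Sum>m\<in>M \<inter> {..<n}. \<iota> m (\<pi> m y)))" by blast
  qed
  then show ?thesis by simp
qed

lemma \<pi>_diff: "x \<in> V \<Longrightarrow> y \<in> V \<Longrightarrow> \<pi> m (x - y) = \<pi> m x - \<pi> m y"
  using \<pi>_add[of x "(-1) *\<^sub>R y"] \<pi>_scale[of y m "-1"] V_minus[of y] by simp

lemma \<pi>_inject:
  assumes "x \<in> V" "y \<in> V" "\<And>m. m \<in> M \<Longrightarrow> \<pi> m x = \<pi> m y" shows "x = y"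
proof -
  have "N (x - y) \<le> 0"
    by (rule N_le_sum) (use assms in \<open>auto simp: V_diff \<pi>_diff intro!: sum_nonpos\<close>)
  then have "N (x - y) = 0" using N_nonneg[OF V_diff[OF assms(1,2)]] by simp
  then show ?thesis using N_eq_0[OF V_diff[OF assms(1,2)]] by simp
qed

lemma diagonal_operator:
  assumes F: "\<And>m. linear (F m)" "\<And>m a. norm (F m a) \<le> C * norm a" "0 \<le> C"
  obtains G where "bounded_operator_on V N G" "\<And>m y. m \<in> M \<Longrightarrow> y \<in> V \<Longrightarrow> \<pi> m (G y) = F m (\<pi> m y)"
proof -
  have "\<forall>y\<in>V. \<exists>z. z \<in> V \<and> N z \<le> C * N y \<and> (\<forall>m\<in>M. \<pi> m z = F m (\<pi> m y))"
    using diagonal[where F = F, OF F] by blast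
  then obtain G where G: "\<And>y. y \<in> V \<Longrightarrow> G y \<in> V" "\<And>y. y \<in> V \<Longrightarrow> N (G y) \<le> C * N y"
    "\<And>y m. y \<in> V \<Longrightarrow> m \<in> M \<Longrightarrow> \<pi> m (G y) = F m (\<pi> m y)" by metis
  have "bounded_operator_on V N G"
    unfolding bounded_operator_on_def
  proof (intro conjI ballI allI exI[of _ C] G(1,2))
    fix x y assume "x \<in> V" "y \<in> V"
    then show "G (x + y) = G x + G y"
      by (intro \<pi>_inject) (auto simp: G V_add \<pi>_add linear_add[OF F(1)])
  next
    fix c y assume "y \<in> V"
    then show "G (c *\<^sub>R y) = c *\<^sub>R G y"
      by (intro \<pi>_inject) (auto simp: G V_scale \<pi>_scale linear_scale[OF F(1)])
  qed
  with G(3) show ?thesis using that by blast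
qed

lemma geometric_eighth: "(\<Sum>m\<in>M \<inter> {..<n}. (1 / 8 :: real) ^ m) \<le> 5 / 4"
proof -
  have "(\<Sum>m\<in>M \<inter> {..<n}. (1 / 8 :: real) ^ m) \<le> (\<Sum>m<n. (1 / 8) ^ m)" by (intro sum_mono2) auto
  also have "\<dots> = 8 / 7 - 8 / 7 * (1 / 8) ^ n" by (induction n) simp_all
  also have "\<dots> \<le> 5 / 4" using zero_le_power[of "1 / 8 :: real" n] by linarith
  finally show ?thesis .
qed

text \<open>
  The norm of \<open>V\<close> lies between the supremum and the sum of the norms of the coordinates, so the entries
  can be summed crudely, and \<open>(5 / 4)\<^sup>2 \<le> 2\<close>.
\<close>

lemma almost_zero_matrix:
  assumes H: "bounded_operator_on V N H" and \<epsilon>: "0 \<le> \<epsilon>"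
    and small: "\<And>m m' a. m \<in> M \<Longrightarrow> m' \<in> M \<Longrightarrow> norm (\<pi> m' (H (\<iota> m a))) \<le> \<epsilon> * (1 / 8) ^ (m' + m) * norm a"
    and y: "y \<in> V"
  shows "N (H y) \<le> 2 * \<epsilon> * N y"
proof -
  obtain K where K: "0 \<le> K" "\<And>y. y \<in> V \<Longrightarrow> N (H y) \<le> K * N y" using operator_bound[OF H] by blast
  have HV: "y \<in> V \<Longrightarrow> H y \<in> V" and H_add: "x \<in> V \<Longrightarrow> y \<in> V \<Longrightarrow> H (x + y) = H x + H y" for x y
    using H by (auto simp: bounded_operator_on_def)
  have H_scale: "y \<in> V \<Longrightarrow> H (c *\<^sub>R y) = c *\<^sub>R H y" for y c using H by (auto simp: bounded_operator_on_def)
  have H_sum: "finite I \<Longrightarrow> (\<And>i. i \<in> I \<Longrightarrow> f i \<in> V) \<Longrightarrow> H (sum f I) = (\<Sum>i\<in>I. H (f i))" for f :: "nat \<Rightarrow> 'v" and I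
  proof (induction I rule: finite_induct)
    case empty show ?case using H_scale[OF V_zero, of 0] by simp
  next
    case (insert i I) then show ?case by (simp add: H_add V_sum)
  qed
  have column: "N (H (\<iota> m a)) \<le> 5 / 4 * \<epsilon> * (1 / 8) ^ m * norm a" if m: "m \<in> M" for m a
  proof (rule N_le_sum)
    show "H (\<iota> m a) \<in> V" by (intro HV \<iota>_V m)
    fix n
    have "(\<Sum>m'\<in>M \<inter> {..<n}. norm (\<pi> m' (H (\<iota> m a)))) \<le> (\<Sum>m'\<in>M \<inter> {..<n}. (1 / 8) ^ m' * (\<epsilon> * (1 / 8) ^ m * norm a))"
      using small[OF m] by (intro sum_mono) (auto simp: power_add mult_ac)
    also have "\<dots> \<le> 5 / 4 * (\<epsilon> * (1 / 8) ^ m * norm a)"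
      unfolding sum_distrib_right[symmetric] using \<epsilon> by (intro mult_right_mono geometric_eighth) auto
    finally show "(\<Sum>m'\<in>M \<inter> {..<n}. norm (\<pi> m' (H (\<iota> m a)))) \<le> 5 / 4 * \<epsilon> * (1 / 8) ^ m * norm a" by (simp add: mult.assoc)
  qed
  define Y where "Y n = (\<Sum>m\<in>M \<inter> {..<n}. \<iota> m (\<pi> m y))" for n
  have YV: "Y n \<in> V" for n unfolding Y_def by (rule partial_V[OF y])
  have HY: "N (H (Y n)) \<le> 2 * \<epsilon> * N y" for n
  proof -
    have "N (H (Y n)) \<le> (\<Sum>m\<in>M \<inter> {..<n}. N (H (\<iota> m (\<pi> m y))))"
      unfolding Y_def by (subst H_sum) (auto intro!: N_sum HV \<iota>_V)
    also have "\<dots> \<le> (\<Sum>m\<in>M \<inter> {..<n}. (1 / 8) ^ m * (5 / 4 * \<epsilon> * N y))"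
    proof (rule sum_mono)
      fix m assume "m \<in> M \<inter> {..<n}"
      then have "N (H (\<iota> m (\<pi> m y))) \<le> 5 / 4 * \<epsilon> * (1 / 8) ^ m * norm (\<pi> m y)" by (intro column) auto
      also have "\<dots> \<le> 5 / 4 * \<epsilon> * (1 / 8) ^ m * N y" using \<epsilon> by (intro mult_left_mono \<pi>_norm y) auto
      finally show "N (H (\<iota> m (\<pi> m y))) \<le> (1 / 8) ^ m * (5 / 4 * \<epsilon> * N y)" by (simp add: mult_ac)
    qed
    also have "\<dots> \<le> 5 / 4 * (5 / 4 * \<epsilon> * N y)"
      unfolding sum_distrib_right[symmetric] using \<epsilon> N_nonneg[OF y] by (intro mult_right_mono geometric_eighth) auto
    also have "\<dots> \<le> 2 * \<epsilon> * N y" using mult_nonneg_nonneg[OF \<epsilon> N_nonneg[OF y]] by linarith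
    finally show ?thesis .
  qed
  have "N (H y) \<le> 2 * \<epsilon> * N y + K * 0"
  proof (rule LIMSEQ_le_const)
    show "(\<lambda>n. 2 * \<epsilon> * N y + K * N (y - Y n)) \<longlonglongrightarrow> 2 * \<epsilon> * N y + K * 0"
      unfolding Y_def by (intro tendsto_intros expand y)
    have "N (H y) \<le> 2 * \<epsilon> * N y + K * N (y - Y n)" for n
    proof -
      have "H y = H (Y n) + H (y - Y n)" using H_add[OF YV V_diff[OF y YV], of n n] by simp
      then have "N (H y) \<le> N (H (Y n)) + N (H (y - Y n))" by (simp add: N_add HV YV V_diff y)
      then show ?thesis using HY[of n] K(2)[OF V_diff[OF y YV], of n] by linarith
    qed
    then show "\<exists>k. \<forall>n\<ge>k. N (H y) \<le> 2 * \<epsilon> * N y + K * N (y - Y n)" by blast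
  qed
  then show ?thesis by simp
qed

text \<open>
  With \<open>R\<close> and \<open>Q\<close> the coordinatewise operators \<open>J m\<close> and \<open>P m\<close> of the copies, and \<open>Z\<close> the division by the
  scalars \<open>\<kappa> m\<close> with \<open>\<bar>\<kappa> m\<bar> \<ge> \<gamma>\<close>, the operator \<open>Z Q T R\<close> is close to the identity.
\<close>

theorem identity_factors:
  assumes T: "bounded_operator_on V N T" and \<gamma>: "0 < \<gamma>"
    and cells: "\<And>m. m \<in> M \<Longrightarrow> \<exists>k i. i < 2 ^ k \<and> \<gamma> / 2 ^ k \<le> \<bar>D (\<lambda>a. \<pi> m (T (\<iota> m a))) (cell_ind k i)\<bar>"
  shows "\<exists>R S. bounded_operator_on V N R \<and> bounded_operator_on V N S \<and> (\<forall>x\<in>V. S (T (R x)) = x)"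
proof -
  have TV: "y \<in> V \<Longrightarrow> T y \<in> V" and T_add: "x \<in> V \<Longrightarrow> y \<in> V \<Longrightarrow> T (x + y) = T x + T y" for x y
    using T by (auto simp: bounded_operator_on_def)
  have T_scale: "y \<in> V \<Longrightarrow> T (c *\<^sub>R y) = c *\<^sub>R T y" for y c using T by (auto simp: bounded_operator_on_def)
  obtain C where C: "0 \<le> C" "\<And>y. y \<in> V \<Longrightarrow> N (T y) \<le> C * N y"
    using operator_bound[OF T] by blast
  define \<tau> where "\<tau> m' m = (if m \<in> M \<and> m' \<in> M then (\<lambda>a. \<pi> m' (T (\<iota> m a))) else (\<lambda>_. 0))" for m' m
  have \<tau>1: "linear (\<tau> m' m)" for m' m
    by (rule linearI) (auto simp: \<tau>_def linear_add[OF \<iota>_linear] linear_scale[OF \<iota>_linear] T_add T_scale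
        \<iota>_V TV \<pi>_add \<pi>_scale)
  have \<tau>2: "norm (\<tau> m' m a) \<le> C * norm a" for m' m a
  proof (cases "m \<in> M \<and> m' \<in> M")
    case True
    then have "norm (\<pi> m' (T (\<iota> m a))) \<le> C * N (\<iota> m a)"
      by (intro order_trans[OF \<pi>_norm C(2)] TV \<iota>_V) auto
    also have "\<dots> \<le> C * norm a" using True C(1) by (intro mult_left_mono \<iota>_norm) auto
    finally show ?thesis using True by (simp add: \<tau>_def)
  qed (use C in \<open>auto simp: \<tau>_def\<close>)
  obtain k i where ki: "\<And>m. m \<in> M \<Longrightarrow> i m < (2::nat) ^ k m \<and> \<gamma> / 2 ^ k m \<le> \<bar>D (\<tau> m m) (cell_ind (k m) (i m))\<bar>"
  proof -
    have "\<forall>m. \<exists>k i. m \<in> M \<longrightarrow> i < 2 ^ k \<and> \<gamma> / 2 ^ k \<le> \<bar>D (\<tau> m m) (cell_ind k i)\<bar>"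
      using cells unfolding \<tau>_def by (auto cong: if_cong)
    then show ?thesis using that by metis
  qed
  define n where "n m = (if m \<in> M then k m else 0)" for m
  define A where "A m = (if m \<in> M then cell_ind (k m) (i m) else cell_ind 0 0)" for m
  have A: "step (n m) (A m)" "A m x = 0 \<or> A m x = 1" "0 < Mean (A m)" for m x
  proof -
    show "step (n m) (A m)" by (simp add: A_def n_def step_cell_ind)
    show "0 < Mean (A m)" using ki[of m] by (simp add: A_def Mean_cell_ind)
    show "A m x = 0 \<or> A m x = 1" by (simp add: A_def cell_ind_def)
  qed
  define \<kappa> where "\<kappa> m = D (\<tau> m m) (A m) / Mean (A m)" for m
  have \<kappa>: "\<gamma> \<le> \<bar>\<kappa> m\<bar>" if "m \<in> M" for m
    using ki[OF that] that by (simp add: \<kappa>_def A_def Mean_cell_ind abs_mult field_simps)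
  \<comment> \<open>With this tolerance the entries of \<open>Z Q T R - 1\<close> are bounded by \<open>4 * (\<gamma>
    / 16) / \<gamma> = 1 / 4\<close>, and \<open>almost_zero_matrix\<close> doubles that to \<open>1 /
    2\<close>.\<close>
  have "0 < \<gamma> / 16" using \<gamma> by simp
  obtain J P :: "nat \<Rightarrow> 'b \<Rightarrow> 'b" where J: "\<And>m. linear (J m)" "\<And>m x. norm (J m x) \<le> norm x"
    and P: "\<And>m. linear (P m)" "\<And>m x. norm (P m x) \<le> norm x"
    and block: "\<And>m' m x. norm (P m' (\<tau> m' m (J m x)) - (if m' = m then D (\<tau> m m) (A m) / Mean (A m) else 0) *\<^sub>R x)
        \<le> 4 * (\<gamma> / 16) * (1 / 8) ^ (m' + m) * norm x"
  proof -
    show ?thesis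
      by (rule block_estimate[where \<tau> = \<tau> and C = C and n = n and A = A and \<delta> = "\<gamma> / 16"])
        (fact \<tau>1 \<tau>2 A \<open>0 < \<gamma> / 16\<close> that)+
  qed
  obtain R where R: "bounded_operator_on V N R" "\<And>m y. m \<in> M \<Longrightarrow> y \<in> V \<Longrightarrow> \<pi> m (R y) = J m (\<pi> m y)"
    by (rule diagonal_operator[of J 1]) (use J in auto)
  obtain Q where Q: "bounded_operator_on V N Q" "\<And>m y. m \<in> M \<Longrightarrow> y \<in> V \<Longrightarrow> \<pi> m (Q y) = P m (\<pi> m y)"
    by (rule diagonal_operator[of P 1]) (use P in auto)
  obtain Z where Z: "bounded_operator_on V N Z"
    "\<And>m y. m \<in> M \<Longrightarrow> y \<in> V \<Longrightarrow> \<pi> m (Z y) = (if m \<in> M then 1 / \<kappa> m else 0) *\<^sub>R \<pi> m y"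
  proof (rule diagonal_operator[of "\<lambda>m a. (if m \<in> M then 1 / \<kappa> m else 0) *\<^sub>R a" "1 / \<gamma>"])
    show "linear (\<lambda>a. (if m \<in> M then 1 / \<kappa> m else 0) *\<^sub>R a)" for m
      by (rule linearI) (simp_all add: algebra_simps)
    show "norm ((if m \<in> M then 1 / \<kappa> m else 0) *\<^sub>R a) \<le> 1 / \<gamma> * norm a" for m a
      using \<kappa>[of m] \<gamma> by (auto simp del: times_divide_eq_left intro!: mult_right_mono simp: frac_le)
  qed (use \<gamma> in auto)
  define G where "G y = Z (Q (T (R y)))" for y
  have Gop: "bounded_operator_on V N G"
    unfolding G_def by (rule operator_compose[OF Z(1) operator_compose[OF Q(1) operator_compose[OF T R(1)]]])
  have V: "y \<in> V \<Longrightarrow> R y \<in> V" "y \<in> V \<Longrightarrow> Q y \<in> V" "y \<in> V \<Longrightarrow> Z y \<in> V" "y \<in> V \<Longrightarrow> G y \<in> V" for y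
    using R(1) Q(1) Z(1) Gop by (auto simp: bounded_operator_on_def)
  have "N (G y - y) \<le> 2 * (1 / 4) * N y" if y: "y \<in> V" for y
  proof (rule almost_zero_matrix[where H = "\<lambda>y. G y - y"])
    obtain K where K: "0 \<le> K" "\<And>y. y \<in> V \<Longrightarrow> N (G y) \<le> K * N y" using operator_bound[OF Gop] by blast
    have "N (G y - y) \<le> (K + 1) * N y" if "y \<in> V" for y
      using N_add[OF V(4)[OF that] V_minus[OF that]] K(2)[OF that] N_minus[OF that] by (simp add: algebra_simps)
    then show "bounded_operator_on V N (\<lambda>y. G y - y)"
      using Gop unfolding bounded_operator_on_def by (auto simp: V_diff algebra_simps intro!: exI[of _ "K + 1"])
    fix m m' a assume m: "m \<in> M" "m' \<in> M"
    have Rm: "R (\<iota> m a) = \<iota> m (J m a)"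
      by (rule \<pi>_inject) (use m in \<open>auto simp: V \<iota>_V R \<pi>_\<iota> linear_0[OF J(1)]\<close>)
    have "\<pi> m' (G (\<iota> m a) - \<iota> m a) = (1 / \<kappa> m') *\<^sub>R P m' (\<tau> m' m (J m a)) - (if m' = m then a else 0)"
      using m by (simp add: \<pi>_diff V \<iota>_V TV G_def Z(2) Q(2) Rm \<tau>_def \<pi>_\<iota>)
    also have "\<dots> = (1 / \<kappa> m') *\<^sub>R (P m' (\<tau> m' m (J m a)) - (if m' = m then D (\<tau> m m) (A m) / Mean (A m) else 0) *\<^sub>R a)"
      using \<kappa>[OF m(1)] \<gamma> by (auto simp: \<kappa>_def[symmetric] algebra_simps)
    finally have "norm (\<pi> m' (G (\<iota> m a) - \<iota> m a)) = 1 / \<bar>\<kappa> m'\<bar> *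
      norm (P m' (\<tau> m' m (J m a)) - (if m' = m then D (\<tau> m m) (A m) / Mean (A m) else 0) *\<^sub>R a)" by simp
    also have "\<dots> \<le> 1 / \<gamma> * (4 * (\<gamma> / 16) * (1 / 8) ^ (m' + m) * norm a)"
      using \<kappa>[OF m(2)] \<gamma> by (intro mult_mono block) (auto simp: frac_le)
    also have "\<dots> = 1 / 4 * (1 / 8) ^ (m' + m) * norm a" using \<gamma> by simp
    finally show "norm (\<pi> m' (G (\<iota> m a) - \<iota> m a)) \<le> 1 / 4 * (1 / 8) ^ (m' + m) * norm a" .
  qed (use y in auto)
  then obtain G' where G': "bounded_operator_on V N G'" "\<And>y. y \<in> V \<Longrightarrow> G' (G y) = y"
    using neumann_left_inverse[OF Gop] by auto
  show ?thesis
  proof (intro exI conjI ballI)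
    show "bounded_operator_on V N R" by fact
    show "bounded_operator_on V N (\<lambda>y. G' (Z (Q y)))" by (rule operator_compose[OF G'(1) operator_compose[OF Z(1) Q(1)]])
    show "G' (Z (Q (T (R x)))) = x" if "x \<in> V" for x using G'(2)[OF that] by (simp add: G_def)
  qed
qed

end

section \<open>The space of integrable functions of a tree of cells\<close>

lemma to_L1_add: "integrable cube_measure f \<Longrightarrow> integrable cube_measure g \<Longrightarrow> to_L1 f + to_L1 g = to_L1 (\<lambda>x. f x + g x)"
  by (simp add: plus_L1.abs_eq L1_rel_def)

lemma to_L1_diff: "integrable cube_measure f \<Longrightarrow> integrable cube_measure g \<Longrightarrow> to_L1 f - to_L1 g = to_L1 (\<lambda>x. f x - g x)"
  by (simp add: minus_L1.abs_eq L1_rel_def)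

lemma to_L1_scale: "integrable cube_measure f \<Longrightarrow> c *\<^sub>R to_L1 f = to_L1 (\<lambda>x. c * f x)"
  by (simp add: scaleR_L1.abs_eq L1_rel_def)

lemma to_L1_zero: "to_L1 (\<lambda>_. 0) = 0"
  by (simp add: zero_L1_def)

lemma to_L1_sum:
  "finite I \<Longrightarrow> (\<And>i. i \<in> I \<Longrightarrow> integrable cube_measure (f i)) \<Longrightarrow>
    (\<Sum>i\<in>I. to_L1 (f i)) = to_L1 (\<lambda>x. \<Sum>i\<in>I. f i x)"
  by (induction I rule: finite_induct) (simp_all add: to_L1_zero to_L1_add)

lemma to_L1_cong:
  "integrable cube_measure f \<Longrightarrow> integrable cube_measure g \<Longrightarrow> (AE x in cube_measure. f x = g x) \<Longrightarrow> to_L1 f = to_L1 g"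
  by (simp add: to_L1_eq_iff)

lemma rep_L1: "integrable cube_measure (rep_L1 F)" "to_L1 (rep_L1 F) = F"
  using Quotient_rep_reflp[OF Quotient_L1, of F] Quotient_abs_rep[OF Quotient_L1, of F]
  by (auto simp: L1_rel_def)

lemma norm_rep_L1: "norm F = (LINT x|cube_measure. \<bar>rep_L1 F x\<bar>)"
  using norm_to_L1[OF rep_L1(1)[of F]] by (simp add: rep_L1(2))

definition bounded_borel :: "('a::euclidean_space \<Rightarrow> real) \<Rightarrow> bool" where
  "bounded_borel g \<longleftrightarrow> g \<in> borel_measurable borel \<and> (\<exists>B. \<forall>x. \<bar>g x\<bar> \<le> B)"

lemma bounded_borel_indicator: "A \<in> sets borel \<Longrightarrow> bounded_borel (indicator A)"
  by (auto simp: bounded_borel_def intro!: exI[of _ 1] simp: indicator_def)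

lemma bounded_borel_const: "bounded_borel (\<lambda>_. c)"
  by (auto simp: bounded_borel_def)

lemma bounded_borel_add: "bounded_borel f \<Longrightarrow> bounded_borel g \<Longrightarrow> bounded_borel (\<lambda>x. f x + g x)"
  unfolding bounded_borel_def by (auto intro!: borel_measurable_add) (meson abs_triangle_ineq add_mono order_trans)

lemma bounded_borel_mult: "bounded_borel f \<Longrightarrow> bounded_borel g \<Longrightarrow> bounded_borel (\<lambda>x. f x * g x)"
  unfolding bounded_borel_def
proof (elim conjE exE, intro conjI exI allI)
  fix B C x assume "\<forall>x. \<bar>f x\<bar> \<le> B" "\<forall>x. \<bar>g x\<bar> \<le> C"
  then show "\<bar>f x * g x\<bar> \<le> B * C"
    unfolding abs_mult by (intro mult_mono) (auto intro: order_trans[OF abs_ge_zero])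
qed auto

lemma bounded_borel_scale: "bounded_borel f \<Longrightarrow> bounded_borel (\<lambda>x. c * f x)"
  by (rule bounded_borel_mult[OF bounded_borel_const])

lemma bounded_borel_sum: "(\<And>i. i \<in> I \<Longrightarrow> bounded_borel (f i)) \<Longrightarrow> bounded_borel (\<lambda>x. \<Sum>i\<in>I. f i x)"
  by (induction I rule: infinite_finite_induct) (auto simp: bounded_borel_const bounded_borel_add)

lemma borel_cube: "g \<in> borel_measurable borel \<Longrightarrow> g \<in> borel_measurable cube_measure"
  unfolding cube_measure_def by (intro measurable_restrict_space1) simp

lemma integrable_bounded_borel: "bounded_borel g \<Longrightarrow> integrable cube_measure g"
  unfolding bounded_borel_def using integrable_cube_bounded by blast

lemma integrable_bounded_mult:
  assumes "bounded_borel g" "integrable cube_measure f" shows "integrable cube_measure (\<lambda>x. g x * f x)"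
proof -
  obtain B where B: "\<And>x. \<bar>g x\<bar> \<le> B" using assms(1) by (auto simp: bounded_borel_def)
  have g: "g \<in> borel_measurable cube_measure" using assms(1) by (auto simp: bounded_borel_def intro: borel_cube)
  show ?thesis
  proof (rule Bochner_Integration.integrable_bound[OF integrable_mult_right[OF integrable_abs[OF assms(2)], of B]])
    show "(\<lambda>x. g x * f x) \<in> borel_measurable cube_measure"
      using g assms(2) by auto
    show "AE x in cube_measure. norm (g x * f x) \<le> norm (B * \<bar>f x\<bar>)"
    proof (rule AE_I2)
      fix x show "norm (g x * f x) \<le> norm (B * \<bar>f x\<bar>)"
        using mult_right_mono[OF B[of x] abs_ge_zero[of "f x"]] B[of x]
        by (auto simp: abs_mult)
    qed
  qed
qed

definition pairing :: "('a::euclidean_space \<Rightarrow> real) \<Rightarrow> 'a L1 \<Rightarrow> real" where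
  "pairing g F = (LINT x|cube_measure. g x * rep_L1 F x)"

lemma pairing_to_L1:
  assumes "bounded_borel g" "integrable cube_measure f"
  shows "pairing g (to_L1 f) = (LINT x|cube_measure. g x * f x)"
proof -
  have "AE x in cube_measure. rep_L1 (to_L1 f) x = f x"
    using to_L1_eq_iff[OF rep_L1(1)[of "to_L1 f"] assms(2)] by (simp add: rep_L1(2))
  then show ?thesis
    unfolding pairing_def
    using integrable_bounded_mult[OF assms(1) rep_L1(1)[of "to_L1 f"]] integrable_bounded_mult[OF assms]
    by (intro integral_cong_AE borel_measurable_integrable) (auto elim!: eventually_mono)
qed

lemma linear_pairing:
  assumes g: "bounded_borel g" shows "linear (pairing g)"
proof (rule linearI)
  fix F G :: "'a L1" and c :: real
  note i = rep_L1(1)[of F] rep_L1(1)[of G]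
  note j = integrable_bounded_mult[OF g i(1)] integrable_bounded_mult[OF g i(2)]
  have "pairing g (to_L1 (rep_L1 F) + to_L1 (rep_L1 G)) = pairing g F + pairing g G"
    unfolding to_L1_add[OF i] pairing_to_L1[OF g Bochner_Integration.integrable_add[OF i]]
    using j by (simp add: pairing_def algebra_simps)
  then show "pairing g (F + G) = pairing g F + pairing g G" by (simp only: rep_L1(2))
  have "pairing g (c *\<^sub>R to_L1 (rep_L1 F)) = c * pairing g F"
    unfolding to_L1_scale[OF i(1)] pairing_to_L1[OF g integrable_mult_right[OF i(1)]]
    by (simp add: pairing_def mult.left_commute)
  then show "pairing g (c *\<^sub>R F) = c *\<^sub>R pairing g F" by (simp add: rep_L1(2))
qed

lemma pairing_sum:
  assumes "\<And>i. i \<in> I \<Longrightarrow> bounded_borel (g i)"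
  shows "pairing (\<lambda>x. \<Sum>i\<in>I. g i x) F = (\<Sum>i\<in>I. pairing (g i) F)"
  unfolding pairing_def sum_distrib_right
  by (intro Bochner_Integration.integral_sum integrable_bounded_mult rep_L1 assms)

lemma pairing_add: "bounded_borel f \<Longrightarrow> bounded_borel g \<Longrightarrow> pairing (\<lambda>x. f x + g x) F = pairing f F + pairing g F"
  unfolding pairing_def distrib_right
  by (intro Bochner_Integration.integral_add integrable_bounded_mult rep_L1)

lemma pairing_diff: "bounded_borel f \<Longrightarrow> bounded_borel g \<Longrightarrow> pairing (\<lambda>x. f x - g x) F = pairing f F - pairing g F"
  unfolding pairing_def left_diff_distrib
  by (intro Bochner_Integration.integral_diff integrable_bounded_mult rep_L1)

lemma pairing_scale: "pairing (\<lambda>x. c * g x) F = c * pairing g F"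
  unfolding pairing_def by (simp add: mult.assoc)

lemma sum_abs_pairing_le:
  assumes g: "\<And>i. i \<in> I \<Longrightarrow> bounded_borel (g i)" and B: "\<And>x. (\<Sum>i\<in>I. \<bar>g i x\<bar>) \<le> B"
  shows "(\<Sum>i\<in>I. \<bar>pairing (g i) F\<bar>) \<le> B * norm F"
proof -
  have i: "integrable cube_measure (\<lambda>x. \<bar>g i x * rep_L1 F x\<bar>)" if "i \<in> I" for i
    by (intro integrable_abs integrable_bounded_mult g that rep_L1)
  have "(\<Sum>i\<in>I. \<bar>pairing (g i) F\<bar>) \<le> (\<Sum>i\<in>I. integral\<^sup>L cube_measure (\<lambda>x. \<bar>g i x * rep_L1 F x\<bar>))"
    unfolding pairing_def by (intro sum_mono integral_abs_bound)
  also have "\<dots> = integral\<^sup>L cube_measure (\<lambda>x. \<Sum>i\<in>I. \<bar>g i x * rep_L1 F x\<bar>)"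
    using i by (simp add: Bochner_Integration.integral_sum)
  also have "\<dots> \<le> integral\<^sup>L cube_measure (\<lambda>x. B * \<bar>rep_L1 F x\<bar>)"
  proof (rule integral_mono)
    show "integrable cube_measure (\<lambda>x. \<Sum>i\<in>I. \<bar>g i x * rep_L1 F x\<bar>)" using i by (intro Bochner_Integration.integrable_sum)
    show "integrable cube_measure (\<lambda>x. B * \<bar>rep_L1 F x\<bar>)" by (intro integrable_mult_right integrable_abs rep_L1)
    show "(\<Sum>i\<in>I. \<bar>g i x * rep_L1 F x\<bar>) \<le> B * \<bar>rep_L1 F x\<bar>" for x
      unfolding abs_mult sum_distrib_right[symmetric] by (intro mult_right_mono B) auto
  qed
  finally show ?thesis by (simp add: norm_rep_L1)
qed

lemma abs_pairing_le:
  "bounded_borel g \<Longrightarrow> (\<And>x. \<bar>g x\<bar> \<le> B) \<Longrightarrow> \<bar>pairing g F\<bar> \<le> B * norm F"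
  using sum_abs_pairing_le[of "{()}" "\<lambda>_. g" B F] by simp

lemma tendsto_to_L1:
  fixes f w :: "'a::euclidean_space \<Rightarrow> real" and s :: "nat \<Rightarrow> 'a \<Rightarrow> real"
  assumes s: "\<And>n. integrable cube_measure (s n)" and f: "integrable cube_measure f"
    and w: "integrable cube_measure w" and bound: "\<And>n. AE x in cube_measure. \<bar>s n x\<bar> \<le> w x"
    and lim: "AE x in cube_measure. (\<lambda>n. s n x) \<longlonglongrightarrow> f x"
  shows "(\<lambda>n. to_L1 (s n)) \<longlonglongrightarrow> to_L1 f"
proof -
  have "(\<lambda>n. LINT x|cube_measure. \<bar>s n x - f x\<bar>) \<longlonglongrightarrow> (LINT x|(cube_measure :: 'a measure). 0)"
  proof (rule integral_dominated_convergence[where w = "\<lambda>x. w x + \<bar>f x\<bar>"])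
    show "integrable cube_measure (\<lambda>x. w x + \<bar>f x\<bar>)" using w f by auto
    show "AE x in cube_measure. (\<lambda>n. \<bar>s n x - f x\<bar>) \<longlonglongrightarrow> 0"
      using lim by (rule eventually_mono) (auto intro!: tendsto_rabs_zero simp: LIM_zero)
    show "AE x in cube_measure. norm \<bar>s n x - f x\<bar> \<le> w x + \<bar>f x\<bar>" for n
      using bound[of n] by (rule eventually_mono) auto
  qed (use s f in auto)
  then have "(\<lambda>n. norm (to_L1 (s n) - to_L1 f)) \<longlonglongrightarrow> 0"
    using s f by (simp add: to_L1_diff norm_to_L1)
  then show ?thesis by (simp add: tendsto_norm_zero_iff LIM_zero_iff)
qed

lemma subspace_closure:
  fixes S :: "'a::real_normed_vector set"
  assumes S: "subspace S" shows "subspace (closure S)"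
proof (rule subspaceI)
  show "0 \<in> closure S" using subspace_0[OF S] closure_subset by blast
  fix x y assume "x \<in> closure S" "y \<in> closure S"
  then obtain a b where a: "\<And>n. a n \<in> S" "a \<longlonglongrightarrow> x" and b: "\<And>n. b n \<in> S" "b \<longlonglongrightarrow> y"
    unfolding closure_sequential by blast
  then show "x + y \<in> closure S"
    unfolding closure_sequential
    by (intro exI[of _ "\<lambda>n. a n + b n"]) (auto intro: tendsto_add subspace_add[OF S])
next
  fix c x assume "x \<in> closure S"
  then obtain a where a: "\<And>n. a n \<in> S" "a \<longlonglongrightarrow> x" unfolding closure_sequential by blast
  then show "c *\<^sub>R x \<in> closure S"
    unfolding closure_sequential
    by (intro exI[of _ "\<lambda>n. c *\<^sub>R a n"]) (auto intro: tendsto_scaleR subspace_scale[OF S])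
qed

text \<open>
  The lower orthants \<open>{..a}\<close> generate the Borel sets and are stable under intersection, so the class of
  Borel sets with indicator in \<open>C\<close> contains all of them; the step to integrable functions is dominated
  convergence.
\<close>

lemma L1_subspace_UNIV:
  fixes C :: "'a::ordered_euclidean_space L1 set"
  assumes C: "subspace C" "closed C" and rect: "\<And>a::'a. to_L1 (indicator {..a}) \<in> C"
    and one: "to_L1 (\<lambda>_. 1) \<in> C"
  shows "C = UNIV"
proof -
  have ii: "integrable cube_measure (indicator A :: 'a \<Rightarrow> real)" if "A \<in> sets borel" for A
    by (intro integrable_bounded_borel bounded_borel_indicator that)
  have one_i: "integrable cube_measure (\<lambda>_::'a. 1 :: real)"
    by (intro integrable_bounded_borel bounded_borel_const)
  have borel: "to_L1 (indicator A) \<in> C" if "A \<in> sets borel" for A :: "'a set"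
  proof -
    have sets: "sigma_sets UNIV (range (\<lambda>a::'a. {..a})) = sets borel"
      by (subst borel_eq_atMost) simp
    have A: "A \<in> sigma_sets UNIV (range (\<lambda>a::'a. {..a}))" using that by (simp only: sets)
    have "Int_stable (range (\<lambda>a::'a. {..a}))"
    proof (rule Int_stableI)
      fix B B' assume "B \<in> range (\<lambda>a::'a. {..a})" "B' \<in> range (\<lambda>a::'a. {..a})"
      then obtain a a' where "B = {..a}" "B' = {..a'}" by auto
      then have "B \<inter> B' = {..inf a a'}" by auto
      then show "B \<inter> B' \<in> range (\<lambda>a::'a. {..a})" by simp
    qed
    moreover have "range (\<lambda>a::'a. {..a}) \<subseteq> Pow UNIV" by simp
    ultimately show ?thesis using A
    proof (induction rule: sigma_sets_induct_disjoint)
      case (basic A) then show ?case using rect by auto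
    next
      case empty
      have "indicator {} = (\<lambda>_::'a. 0::real)" by auto
      then show ?case using subspace_0[OF C(1)] by (simp add: to_L1_zero)
    next
      case (compl A)
      then have "A \<in> sets borel" by (simp add: sets)
      then have "to_L1 (\<lambda>_. 1) - to_L1 (indicator A) = to_L1 (\<lambda>x. 1 - indicator A x)"
        by (intro to_L1_diff one_i ii)
      also have "(\<lambda>x. 1 - indicator A x) = (indicator (UNIV - A) :: 'a \<Rightarrow> real)"
        by (auto simp: indicator_def)
      finally show ?case using subspace_diff[OF C(1) one compl(2)] by simp
    next
      case (union A)
      have A: "A i \<in> sets borel" for i using union(2) by (auto simp: sets)
      have L: "(\<lambda>n. to_L1 (\<lambda>x. \<Sum>i<n. indicator (A i) x)) \<longlonglongrightarrow> to_L1 (indicator (\<Union>i. A i))"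
      proof (rule tendsto_to_L1[OF _ ii one_i])
        show "integrable cube_measure (\<lambda>x. \<Sum>i<n. indicator (A i) x :: real)" for n
          by (intro Bochner_Integration.integrable_sum ii A)
        show "(\<Union>i. A i) \<in> sets borel" using A by auto
        have e: "(\<Sum>i<n. indicator (A i) x :: real) = indicator (\<Union>i<n. A i) x" for n x
          using union(1) by (intro indicator_UN_disjoint[symmetric]) (auto simp: disjoint_family_on_def)
        then show "AE x in cube_measure. \<bar>\<Sum>i<n. indicator (A i) x :: real\<bar> \<le> 1" for n
          by (simp add: indicator_def)
        show "AE x in cube_measure. (\<lambda>n. \<Sum>i<n. indicator (A i) x) \<longlonglongrightarrow> (indicator (\<Union>i. A i) x :: real)"
          unfolding e by (intro AE_I2 LIMSEQ_indicator_UN)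
      qed
      have S: "to_L1 (\<lambda>x. \<Sum>i<n. indicator (A i) x) \<in> C" for n
        using subspace_sum[OF C(1), of "{..<n}" "\<lambda>i. to_L1 (indicator (A i))"] union(3)
        by (simp add: to_L1_sum ii A)
      show ?case by (rule closed_sequentially[OF C(2) S L])
    qed
  qed
  have "to_L1 f \<in> C" if "integrable cube_measure f" for f :: "'a \<Rightarrow> real"
    using that
  proof (induction rule: integrable_induct)
    case (base A c)
    then obtain B where B: "A = B \<inter> cbox 0 One" "B \<in> sets borel"
      by (auto simp: cube_measure_def sets_restrict_space)
    then have A: "A \<in> sets borel" by auto
    show ?case using subspace_scale[OF C(1) borel[OF A], of c] to_L1_scale[OF ii[OF A], of c]
      by (simp add: mult.commute)
  next
    case (add f g) then show ?case using subspace_add[OF C(1) add(3,4)] add(1,2) by (simp add: to_L1_add)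
  next
    case (lim f s)
    have "(\<lambda>n. to_L1 (s n)) \<longlonglongrightarrow> to_L1 f"
      by (rule tendsto_to_L1[OF lim(1,4), of "\<lambda>x. 2 * \<bar>f x\<bar>"]) (use lim(2-4) in auto)
    then show ?case by (rule closed_sequentially[OF C(2) lim(5)])
  qed
  then show ?thesis using to_L1_surj by (metis UNIV_eq_I)
qed

text \<open>
  A corner of a cell is a lower bound of it, and the corners of cells around a point converge to that
  point. Hence unions of cells approximate orthants.
\<close>

locale partition_tree =
  fixes cell :: "nat \<Rightarrow> nat \<Rightarrow> 'a::ordered_euclidean_space set" and corner :: "nat \<Rightarrow> nat \<Rightarrow> 'a"
  assumes cell_borel: "cell n i \<in> sets borel"
    and cell_measure: "i < 2 ^ n \<Longrightarrow> emeasure lborel (cell n i) = ennreal (1 / 2 ^ n)"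
    and cell_cube: "i < 2 ^ n \<Longrightarrow> cell n i \<subseteq> cbox 0 One"
    and cell_split: "i < 2 ^ n \<Longrightarrow> cell n i = cell (Suc n) (2 * i) \<union> cell (Suc n) (2 * i + 1)"
    and cell_disjoint: "i < 2 ^ n \<Longrightarrow> k < 2 ^ n \<Longrightarrow> i \<noteq> k \<Longrightarrow> cell n i \<inter> cell n k = {}"
    and corner_le: "x \<in> cell n i \<Longrightarrow> corner n i \<le> x"
    and corner_tendsto: "(\<And>n. x \<in> cell n (j n)) \<Longrightarrow> (\<lambda>n. corner n (j n)) \<longlonglongrightarrow> x"
begin

definition atom :: "nat \<Rightarrow> nat \<Rightarrow> 'a L1" where "atom n i = to_L1 (indicator (cell n i))"
definition E :: "nat \<Rightarrow> nat \<Rightarrow> 'a L1 \<Rightarrow> real" where "E n i = pairing (indicator (cell n i))"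

lemma bounded_borel_cell: "bounded_borel (indicator (cell n i))" by (intro bounded_borel_indicator cell_borel)
lemma integrable_cell: "integrable cube_measure (indicator (cell n i) :: 'a \<Rightarrow> real)" by (intro integrable_bounded_borel bounded_borel_cell)

lemma integral_cell: "i < 2 ^ n \<Longrightarrow> (LINT x|cube_measure. indicator (cell n i) x) = (1 / 2 ^ n :: real)"
proof -
  assume i: "i < 2 ^ n"
  have "(LINT x|cube_measure. indicator (cell n i) x) = (measure cube_measure (cell n i) :: real)"
    using cell_cube[OF i] by (subst Bochner_Integration.integral_indicator)
      (simp add: cube_measure_def space_restrict_space Int_absorb2)
  also have "\<dots> = measure lborel (cell n i)"
    unfolding cube_measure_def by (rule measure_restrict_space) (use cell_cube[OF i] in auto)
  also have "\<dots> = 1 / 2 ^ n" using cell_measure[OF i] by (simp add: measure_def)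
  finally show ?thesis .
qed

lemma cell_cover: "(\<Union>i<2 ^ n. cell n i) = cell 0 0"
proof (induction n)
  case (Suc n)
  have "(\<Union>i<2 ^ Suc n. cell (Suc n) i) = (\<Union>i<2 ^ n. cell n i)"
  proof (intro equalityI subsetI)
    fix x assume "x \<in> (\<Union>i<2 ^ Suc n. cell (Suc n) i)"
    then obtain i where i: "i < 2 ^ Suc n" "x \<in> cell (Suc n) i" by auto
    then have "i div 2 < 2 ^ n" "i = 2 * (i div 2) \<or> i = 2 * (i div 2) + 1" by auto
    then have "x \<in> cell n (i div 2)" using i(2) cell_split[of "i div 2" n] by (metis UnCI)
    then show "x \<in> (\<Union>i<2 ^ n. cell n i)" using \<open>i div 2 < 2 ^ n\<close> by blast
  next
    fix x assume "x \<in> (\<Union>i<2 ^ n. cell n i)"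
    then obtain i where i: "i < 2 ^ n" "x \<in> cell n i" by auto
    then have "2 * i < 2 ^ Suc n" "2 * i + 1 < 2 ^ Suc n" "x \<in> cell (Suc n) (2 * i) \<or> x \<in> cell (Suc n) (2 * i + 1)"
      using cell_split[OF i(1)] by auto
    then show "x \<in> (\<Union>i<2 ^ Suc n. cell (Suc n) i)" by blast
  qed
  then show ?case using Suc by simp
qed (simp add: lessThan_Suc)

lemma AE_cell: "AE x in cube_measure. x \<in> cell 0 0"
proof -
  have "emeasure lborel (cbox 0 One - cell 0 0) = emeasure lborel (cbox 0 (One::'a)) - emeasure lborel (cell 0 0)"
    using cell_measure[of 0 0] cell_cube[of 0 0] cell_borel by (intro emeasure_Diff) auto
  also have "\<dots> = 0" using cell_measure[of 0 0] by (simp add: emeasure_lborel_cbox_eq inner_Basis)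
  finally have "cbox 0 One - cell 0 0 \<in> null_sets lborel" using cell_borel by (auto intro!: null_setsI)
  then have "AE x in lborel. x \<notin> cbox 0 One - cell 0 0" by (rule AE_not_in)
  then show ?thesis unfolding cube_measure_def by (subst AE_restrict_space_iff) auto
qed

lemma indicator_split:
  assumes "i < 2 ^ n"
  shows "indicator (cell n i) x = (indicator (cell (Suc n) (2 * i)) x + indicator (cell (Suc n) (2 * i + 1)) x :: real)"
proof -
  have "cell (Suc n) (2 * i) \<inter> cell (Suc n) (2 * i + 1) = {}" using assms by (intro cell_disjoint) auto
  then show ?thesis unfolding cell_split[OF assms] by (rule indicator_add[symmetric])
qed

lemma sum_indicator: "(\<Sum>i<2 ^ n. indicator (cell n i) x) = (indicator (cell 0 0) x :: real)"
  unfolding cell_cover[of n, symmetric]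
  by (rule indicator_UN_disjoint[symmetric]) (auto simp: disjoint_family_on_def cell_disjoint)

text \<open>
  The indicator of \<open>{..a}\<close> is approximated by the union of the cells whose corner lies in \<open>{..a}\<close>. At a
  point below \<open>a\<close> all corners lie below \<open>a\<close>; at any other point the corners finally leave the closed
  set \<open>{..a}\<close>.
\<close>

lemma atoms_dense: "closure (span {atom n i | n i. i < 2 ^ n}) = UNIV"
proof (rule L1_subspace_UNIV)
  let ?C = "closure (span {atom n i | n i. i < 2 ^ n})"
  show "subspace ?C" by (rule subspace_closure) simp
  have aC: "atom n i \<in> ?C" if "i < 2 ^ n" for n i
    using that by (intro subsetD[OF closure_subset] span_base) auto
  have "to_L1 (\<lambda>_. 1) = atom 0 0"
    unfolding atom_def
    by (intro to_L1_cong integrable_cell integrable_bounded_borel bounded_borel_const) (use AE_cell in \<open>auto elim!: eventually_mono\<close>)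
  then show "to_L1 (\<lambda>_. 1) \<in> ?C" using aC[of 0 0] by simp
  fix a :: 'a
  define s where "s n x = (\<Sum>i<2 ^ n. indicator {..a} (corner n i) * indicator (cell n i) x :: real)" for n x
  have s_val: "s n x = indicator {..a} (corner n i)" if "i < 2 ^ n" "x \<in> cell n i" for n i x
  proof -
    have "s n x = (\<Sum>k<2 ^ n. if k = i then indicator {..a} (corner n i) else 0)"
      unfolding s_def
    proof (intro sum.cong refl)
      fix k assume "k \<in> {..<(2::nat) ^ n}"
      then show "indicator {..a} (corner n k) * indicator (cell n k) x = (if k = i then indicator {..a} (corner n i) else 0 :: real)"
        using that cell_disjoint[of k n i] by (auto simp: indicator_def)
    qed
    then show ?thesis using that by simp
  qed
  have L: "(\<lambda>n. to_L1 (s n)) \<longlonglongrightarrow> to_L1 (indicator {..a})"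
  proof (rule tendsto_to_L1)
    show "integrable cube_measure (s n)" for n
      unfolding s_def[abs_def] by (intro integrable_bounded_borel bounded_borel_sum bounded_borel_scale bounded_borel_cell)
    show "integrable cube_measure (indicator {..a} :: 'a \<Rightarrow> real)"
      by (intro integrable_bounded_borel bounded_borel_indicator) auto
    show "integrable cube_measure (\<lambda>_. 1 :: real)" by (intro integrable_bounded_borel bounded_borel_const)
    have pt: "\<exists>i<2 ^ n. x \<in> cell n i" if "x \<in> cell 0 0" for x n using that cell_cover[of n] by blast
    show "AE x in cube_measure. \<bar>s n x\<bar> \<le> 1" for n
      using AE_cell
    proof (rule eventually_mono)
      fix x assume "x \<in> cell 0 0"
      then show "\<bar>s n x\<bar> \<le> 1" using pt[of x n] s_val by (auto simp: indicator_def)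
    qed
    show "AE x in cube_measure. (\<lambda>n. s n x) \<longlonglongrightarrow> indicator {..a} x"
      using AE_cell
    proof (rule eventually_mono)
      fix x assume "x \<in> cell 0 0"
      then have "\<forall>n. \<exists>i. i < 2 ^ n \<and> x \<in> cell n i" using pt by blast
      then obtain i where i: "\<And>n. i n < 2 ^ n" "\<And>n. x \<in> cell n (i n)" by metis
      have "\<forall>\<^sub>F n in sequentially. s n x = indicator {..a} x"
      proof (cases "x \<le> a")
        case True
        then have "corner n (i n) \<le> a" for n using corner_le[OF i(2)[of n]] by (rule order_trans[rotated])
        then show ?thesis using True by (auto simp: s_val[OF i] indicator_def)
      next
        case False
        have "open (- {..a})" by (intro open_Compl closed_eucl_atMost)
        then have "\<forall>\<^sub>F n in sequentially. corner n (i n) \<in> - {..a}"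
          using corner_tendsto[OF i(2)] False by (intro topological_tendstoD) auto
        then show ?thesis using False by (elim eventually_mono) (auto simp: s_val[OF i] indicator_def)
      qed
      then show "(\<lambda>n. s n x) \<longlonglongrightarrow> indicator {..a} x" by (rule tendsto_eventually)
    qed
  qed
  have S: "to_L1 (s n) \<in> ?C" for n
  proof -
    have "to_L1 (s n) = (\<Sum>i<2 ^ n. indicator {..a} (corner n i) *\<^sub>R atom n i)"
      unfolding s_def[abs_def] atom_def to_L1_scale[OF integrable_cell]
      by (subst to_L1_sum) (auto intro!: integrable_mult_right integrable_cell)
    then show ?thesis
      using \<open>subspace ?C\<close> aC by (auto intro!: subspace_sum subspace_scale)
  qed
  show "to_L1 (indicator {..a}) \<in> ?C" by (rule closed_sequentially[OF closed_closure S L])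
qed simp

sublocale l1_tree atom E
proof (rule l1_tree.intro)
  show "linear (E n i)" for n i unfolding E_def by (rule linear_pairing[OF bounded_borel_cell])
  show "E n i x = E (Suc n) (2 * i) x + E (Suc n) (2 * i + 1) x" if "i < 2 ^ n" for n i x
    unfolding E_def indicator_split[OF that, abs_def] by (rule pairing_add[OF bounded_borel_cell bounded_borel_cell])
  show "(\<Sum>i<2 ^ n. \<bar>E n i x\<bar>) \<le> norm x" for n x
  proof -
    have "(\<Sum>i<2 ^ n. \<bar>E n i x\<bar>) \<le> 1 * norm x"
      unfolding E_def by (rule sum_abs_pairing_le) (auto simp: bounded_borel_cell sum_indicator)
    then show ?thesis by simp
  qed
  show "atom n i = atom (Suc n) (2 * i) + atom (Suc n) (2 * i + 1)" if "i < 2 ^ n" for n i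
    unfolding atom_def to_L1_add[OF integrable_cell integrable_cell] using indicator_split[OF that] by presburger
  show "norm (atom n i) \<le> 1 / 2 ^ n" if "i < 2 ^ n" for n i
    unfolding atom_def norm_to_L1[OF integrable_cell] using integral_cell[OF that] by simp
  show "E n i (atom n k) = (if i = k then 1 / 2 ^ n else 0)" if "i < 2 ^ n" "k < 2 ^ n" for n i k
  proof -
    have "E n i (atom n k) = (LINT x|cube_measure. indicator (cell n i) x * indicator (cell n k) x)"
      unfolding E_def atom_def by (rule pairing_to_L1[OF bounded_borel_cell integrable_cell])
    also have "\<dots> = (if i = k then LINT x|cube_measure. indicator (cell n i) x else 0)"
      using cell_disjoint[OF that] by (auto simp flip: indicator_inter_arith)
    finally show ?thesis unfolding integral_cell[OF that(1)] .
  qed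
qed (rule atoms_dense)

end

section \<open>Sequence spaces as direct sums\<close>

lemma UNIV_complete_normed: "complete_normed (UNIV :: 'b::banach set) norm"
proof
  fix Y :: "nat \<Rightarrow> 'b" and K :: real
  assume Y: "\<And>n. norm (Y (Suc n) - Y n) \<le> K * (1 / 2) ^ n"
  have "summable (\<lambda>n. Y (Suc n) - Y n)"
    by (rule summable_comparison_test'[OF summable_mult[OF summable_geometric], of "1 / 2" 0]) (use Y in auto)
  then have "convergent Y" by (simp add: summable_iff_convergent sum_lessThan_telescope convergent_diff_const_right_iff)
  then show "\<exists>y\<in>UNIV. (\<lambda>n. norm (Y n - y)) \<longlonglongrightarrow> 0"
    unfolding convergent_def by (auto intro!: tendsto_norm_zero LIM_zero)
qed (auto intro: norm_triangle_ineq)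

lemma (in l1_tree) direct_sum_UNIV: "direct_sum atom E UNIV norm {0} (\<lambda>_ a. a) (\<lambda>_ a. a)"
proof -
  interpret complete_normed "UNIV :: 'b set" norm by (rule UNIV_complete_normed)
  show ?thesis
  proof (intro direct_sum.intro direct_sum_axioms.intro)
    show "l1_tree atom E" by (rule l1_tree_axioms)
    show "complete_normed (UNIV :: 'b set) norm" by (rule UNIV_complete_normed)
    show "linear (\<lambda>a::'b. a)" by (rule linear_ident)
    show "(\<lambda>n. norm (y - (\<Sum>m\<in>{0} \<inter> {..<n}. y))) \<longlonglongrightarrow> 0" for y :: 'b
    proof (rule tendsto_eventually)
      have "norm (y - (\<Sum>m\<in>{0} \<inter> {..<n}. y)) = 0" if "1 \<le> n" for n :: nat
        using that by (simp add: Int_absorb2)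
      then show "\<forall>\<^sub>F n in sequentially. norm (y - (\<Sum>m\<in>{0} \<inter> {..<n}. y)) = 0"
        unfolding eventually_sequentially by blast
    qed
  qed auto
qed

lemma squeeze_zero:
  fixes f h :: "nat \<Rightarrow> real"
  assumes "\<And>n. 0 \<le> f n" "\<And>n. f n \<le> h n" "h \<longlonglongrightarrow> 0" shows "f \<longlonglongrightarrow> 0"
  by (rule tendsto_sandwich[OF _ _ tendsto_const assms(3)]) (simp_all add: assms(1,2))

lemma sum_apply: "(\<Sum>i\<in>I. f i) x = (\<Sum>i\<in>I. f i x)"
  for f :: "'i \<Rightarrow> 'a \<Rightarrow> 'b::comm_monoid_add"
  by (induction I rule: infinite_finite_induct) auto

text \<open>
  Convexity of \<open>x powr p\<close> on the open half-line, extended to the boundary point 0.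
\<close>

lemma powr_convex_nonneg:
  fixes x y u v p :: real
  assumes p: "1 \<le> p" and "0 \<le> x" "0 \<le> y" "0 < u" "0 < v" "u + v = 1"
  shows "(u * x + v * y) powr p \<le> u * x powr p + v * y powr p"
proof -
  have small: "(w * z) powr p \<le> w * z powr p" if "0 < w" "w \<le> 1" "0 \<le> z" for w z :: real
  proof -
    have "w powr p \<le> w powr 1" using that p by (intro powr_mono') auto
    then have "w powr p * z powr p \<le> w * z powr p" using that by (intro mult_right_mono) auto
    then show ?thesis using that by (simp add: powr_mult)
  qed
  show ?thesis
  proof (cases "x = 0 \<or> y = 0")
    case True
    have scale_x: "(u * x) powr p \<le> u * x powr p" and scale_y: "(v * y) powr p \<le> v * y powr p"
      using assms(2-6) by (intro small; linarith)+
    have nn: "0 \<le> u * x powr p" "0 \<le> v * y powr p" using assms by simp_all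
    from True show ?thesis
    proof
      assume "x = 0"
      then have "u * x + v * y = v * y" by simp
      then have "(u * x + v * y) powr p = (v * y) powr p" by (rule arg_cong)
      then show ?thesis using scale_y nn(1) by linarith
    next
      assume "y = 0"
      then have "u * x + v * y = u * x" by simp
      then have "(u * x + v * y) powr p = (u * x) powr p" by (rule arg_cong)
      then show ?thesis using scale_x nn(2) by linarith
    qed
  next
    case False
    have "convex_on {0<..} (\<lambda>x. x powr p)" by (rule powr_convex[OF p])
    then have "((1 - v) *\<^sub>R x + v *\<^sub>R y) powr p \<le> (1 - v) * x powr p + v * y powr p"
      using False assms by (intro convex_onD[of "{0<..}" "\<lambda>x. x powr p" v x y]) auto
    moreover have "1 - v = u" using assms(6) by simp
    ultimately show ?thesis by simp
  qed
qed

text \<open>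
  After division by \<open>A + B\<close> each \<open>f i + g i\<close> is a convex combination of \<open>f i / A\<close> and \<open>g i / B\<close>.
\<close>

lemma minkowski_finite:
  fixes f g :: "'i \<Rightarrow> real"
  assumes p: "1 \<le> p" and I: "finite I" and nn: "\<And>i. 0 \<le> f i" "\<And>i. 0 \<le> g i" and AB: "0 \<le> A" "0 \<le> B"
    and f: "(\<Sum>i\<in>I. f i powr p) \<le> A powr p" and g: "(\<Sum>i\<in>I. g i powr p) \<le> B powr p"
  shows "(\<Sum>i\<in>I. (f i + g i) powr p) \<le> (A + B) powr p"
proof -
  have z: "h i = 0" if "(\<Sum>i\<in>I. h i powr p) \<le> 0 powr p" "i \<in> I" "\<And>i. 0 \<le> h i" for h :: "'i \<Rightarrow> real" and i
  proof -
    have "h i powr p \<le> (\<Sum>i\<in>I. h i powr p)" using I that by (intro member_le_sum) auto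
    from order_trans[OF this that(1)] show ?thesis by simp
  qed
  consider "A = 0" | "B = 0" | "0 < A" "0 < B" using AB by linarith
  then show ?thesis
  proof cases
    case 1
    then have "(\<Sum>i\<in>I. (f i + g i) powr p) = (\<Sum>i\<in>I. g i powr p)" using z[of f] f nn by (intro sum.cong) auto
    then show ?thesis using g 1 by simp
  next
    case 2
    then have "(\<Sum>i\<in>I. (f i + g i) powr p) = (\<Sum>i\<in>I. f i powr p)" using z[of g] g nn by (intro sum.cong) auto
    then show ?thesis using f 2 by simp
  next
    case 3
    define S where "S = A + B"
    have S: "0 < S" using 3 by (simp add: S_def)
    have termwise: "(f i + g i) powr p \<le> S powr p * (A / S * (f i powr p / A powr p) + B / S * (g i powr p / B powr p))" for i
    proof -
      have "(A / S * (f i / A) + B / S * (g i / B)) powr p \<le> A / S * (f i / A) powr p + B / S * (g i / B) powr p"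
        using 3 S nn by (intro powr_convex_nonneg p) (auto simp: S_def add_divide_distrib[symmetric])
      moreover have "f i + g i = S * (A / S * (f i / A) + B / S * (g i / B))" using 3 S by (simp add: field_simps)
      moreover have "(S * (A / S * (f i / A) + B / S * (g i / B))) powr p
        = S powr p * (A / S * (f i / A) + B / S * (g i / B)) powr p"
        by (rule powr_mult)
      ultimately have "(f i + g i) powr p \<le> S powr p * (A / S * (f i / A) powr p + B / S * (g i / B) powr p)"
        using S by (simp only: mult_left_mono powr_ge_zero)
      then show ?thesis using 3 nn by (simp add: powr_divide)
    qed
    have "(\<Sum>i\<in>I. (f i + g i) powr p) \<le> (\<Sum>i\<in>I. S powr p * (A / S * (f i powr p / A powr p) + B / S * (g i powr p / B powr p)))"
      by (intro sum_mono termwise)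
    also have "\<dots> = S powr p * (A / S * ((\<Sum>i\<in>I. f i powr p) / A powr p) + B / S * ((\<Sum>i\<in>I. g i powr p) / B powr p))"
      by (simp only: sum_distrib_left[symmetric] sum.distrib sum_divide_distrib)
    also have "\<dots> \<le> S powr p * (A / S * 1 + B / S * 1)"
      using 3 S f g by (intro mult_left_mono add_mono) auto
    also have "\<dots> = S powr p" using S by (simp add: S_def add_divide_distrib[symmetric])
    finally show ?thesis by (simp add: S_def)
  qed
qed

context
  fixes p :: real assumes p: "1 \<le> p"
begin

lemma lp_le_iff:
  fixes f :: "nat \<Rightarrow> 'b::real_normed_vector"
  assumes "0 \<le> B"
  shows "f \<in> lp_carrier p \<and> lp_norm p f \<le> B \<longleftrightarrow> (\<forall>n. (\<Sum>m<n. norm (f m) powr p) \<le> B powr p)"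
proof
  assume f: "f \<in> lp_carrier p \<and> lp_norm p f \<le> B"
  then have s: "summable (\<lambda>n. norm (f n) powr p)" by (simp add: lp_carrier_def)
  have "(\<Sum>n. norm (f n) powr p) = lp_norm p f powr p"
    unfolding lp_norm_def powr_powr using p suminf_nonneg[OF s] by simp
  also have "\<dots> \<le> B powr p" using f p by (intro powr_mono2) (auto simp: lp_norm_def)
  finally show "\<forall>n. (\<Sum>m<n. norm (f m) powr p) \<le> B powr p"
    using sum_le_suminf[OF s] by (meson finite_lessThan order_trans powr_ge_zero)
next
  assume f: "\<forall>n. (\<Sum>m<n. norm (f m) powr p) \<le> B powr p"
  have s: "summable (\<lambda>n. norm (f n) powr p)"
    by (rule summableI_nonneg_bounded[of _ "B powr p"]) (use f in auto)
  have "(\<Sum>n. norm (f n) powr p) \<le> B powr p" by (rule suminf_le_const[OF s]) (use f in auto)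
  then have "lp_norm p f \<le> (B powr p) powr (1 / p)"
    unfolding lp_norm_def using p suminf_nonneg[OF s] by (intro powr_mono2) auto
  also have "\<dots> = B" using p assms by (simp add: powr_powr)
  finally show "f \<in> lp_carrier p \<and> lp_norm p f \<le> B" using s by (simp add: lp_carrier_def)
qed

lemma lp_nonneg: "0 \<le> lp_norm p f" by (simp add: lp_norm_def)

lemma lp_sums: "f \<in> lp_carrier p \<Longrightarrow> (\<Sum>m<n. norm (f m) powr p) \<le> lp_norm p f powr p"
  using lp_le_iff[OF lp_nonneg, of f f] by blast

lemma lpI:
  assumes "0 \<le> B" "\<And>n. (\<Sum>m<n. norm (f m) powr p) \<le> B powr p"
  shows "f \<in> lp_carrier p" "lp_norm p f \<le> B"
  using lp_le_iff[OF assms(1), of f] assms(2) by blast+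

lemma lp_component: "f \<in> lp_carrier p \<Longrightarrow> norm (f m) \<le> lp_norm p f"
proof -
  assume f: "f \<in> lp_carrier p"
  have "norm (f m) powr p \<le> (\<Sum>m<Suc m. norm (f m) powr p)" by (intro member_le_sum) auto
  also have "\<dots> \<le> lp_norm p f powr p" by (rule lp_sums[OF f])
  finally show ?thesis using powr_less_mono2[of p "lp_norm p f" "norm (f m)"] p lp_nonneg[of f] by force
qed

lemma lp_mono:
  assumes "f \<in> lp_carrier p" "0 \<le> C" "\<And>m. norm (g m) \<le> C * norm (f m)"
  shows "g \<in> lp_carrier p" "lp_norm p g \<le> C * lp_norm p f"
proof -
  have le: "(\<Sum>m<n. norm (g m) powr p) \<le> (C * lp_norm p f) powr p" for n
  proof -
    have "(\<Sum>m<n. norm (g m) powr p) \<le> (\<Sum>m<n. (C * norm (f m)) powr p)"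
      using assms p by (intro sum_mono powr_mono2) auto
    also have "\<dots> = C powr p * (\<Sum>m<n. norm (f m) powr p)"
      using assms by (simp add: powr_mult sum_distrib_left)
    also have "\<dots> \<le> C powr p * lp_norm p f powr p" by (intro mult_left_mono lp_sums assms) auto
    finally show ?thesis using assms lp_nonneg by (simp add: powr_mult)
  qed
  show "g \<in> lp_carrier p" "lp_norm p g \<le> C * lp_norm p f"
    by (rule lpI[OF mult_nonneg_nonneg[OF assms(2) lp_nonneg] le])+
qed

lemma lp_add:
  assumes "f \<in> lp_carrier p" "g \<in> lp_carrier p"
  shows "f + g \<in> lp_carrier p" "lp_norm p (f + g) \<le> lp_norm p f + lp_norm p g"
proof -
  have le: "(\<Sum>m<n. norm ((f + g) m) powr p) \<le> (lp_norm p f + lp_norm p g) powr p" for n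
  proof -
    have "(\<Sum>m<n. norm ((f + g) m) powr p) \<le> (\<Sum>m<n. (norm (f m) + norm (g m)) powr p)"
      using p by (intro sum_mono powr_mono2) (auto intro: norm_triangle_ineq)
    also have "\<dots> \<le> (lp_norm p f + lp_norm p g) powr p"
      by (intro minkowski_finite p lp_sums assms lp_nonneg) auto
    finally show ?thesis .
  qed
  show "f + g \<in> lp_carrier p" "lp_norm p (f + g) \<le> lp_norm p f + lp_norm p g"
    by (rule lpI[OF add_nonneg_nonneg[OF lp_nonneg lp_nonneg] le])+
qed

lemma lp_scale:
  assumes "f \<in> lp_carrier p" shows "c *\<^sub>R f \<in> lp_carrier p" "lp_norm p (c *\<^sub>R f) = \<bar>c\<bar> * lp_norm p f"
proof -
  have le: "d *\<^sub>R g \<in> lp_carrier p" "lp_norm p (d *\<^sub>R g) \<le> \<bar>d\<bar> * lp_norm p g" if "g \<in> lp_carrier p" for d and g :: "nat \<Rightarrow> 'b::real_normed_vector"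
    using lp_mono[OF that, of "\<bar>d\<bar>" "d *\<^sub>R g"] by (auto simp: scaleR_fun_def)
  show "c *\<^sub>R f \<in> lp_carrier p" by (rule le(1)[OF assms])
  show "lp_norm p (c *\<^sub>R f) = \<bar>c\<bar> * lp_norm p f"
  proof (cases "c = 0")
    case True
    then show ?thesis using le(2)[OF assms, of 0] lp_nonneg[of "0 *\<^sub>R f"] by simp
  next
    case False
    have "lp_norm p f \<le> \<bar>inverse c\<bar> * lp_norm p (c *\<^sub>R f)"
      using le(2)[OF le(1)[OF assms, of c], of "inverse c"] False by simp
    then have "\<bar>c\<bar> * lp_norm p f \<le> \<bar>c\<bar> * (\<bar>inverse c\<bar> * lp_norm p (c *\<^sub>R f))" by (intro mult_left_mono) auto
    also have "\<dots> = lp_norm p (c *\<^sub>R f)" using False by (simp add: abs_inverse)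
    finally show ?thesis using le(2)[OF assms, of c] by linarith
  qed
qed

lemma lp_zero: "(0 :: nat \<Rightarrow> 'b::real_normed_vector) \<in> lp_carrier p"
  using lpI(1)[of 0 "0 :: nat \<Rightarrow> 'b"] by simp

lemma lp_closed:
  fixes Y :: "nat \<Rightarrow> nat \<Rightarrow> 'b::real_normed_vector"
  assumes Y: "\<And>k. Y k \<in> lp_carrier p" "\<And>k. lp_norm p (Y k) \<le> B" and lim: "\<And>m. (\<lambda>k. Y k m) \<longlonglongrightarrow> z m"
  shows "z \<in> lp_carrier p" "lp_norm p z \<le> B"
proof -
  have B: "0 \<le> B" using Y(2)[of 0] lp_nonneg[of "Y 0"] by simp
  have "(\<Sum>m<n. norm (z m) powr p) \<le> B powr p" for n
  proof (rule LIMSEQ_le_const2)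
    show "(\<lambda>k. \<Sum>m<n. norm (Y k m) powr p) \<longlonglongrightarrow> (\<Sum>m<n. norm (z m) powr p)"
      using p by (intro tendsto_sum tendsto_powr' tendsto_norm lim tendsto_const) auto
    show "\<exists>N. \<forall>k\<ge>N. (\<Sum>m<n. norm (Y k m) powr p) \<le> B powr p"
      using lp_le_iff[OF B] Y by blast
  qed
  then show "z \<in> lp_carrier p" "lp_norm p z \<le> B" using lpI[OF B] by blast+
qed

lemma lp_complete_normed: "complete_normed (lp_carrier p :: (nat \<Rightarrow> 'b::banach) set) (lp_norm p)"
proof
  show "f = 0" if f: "f \<in> lp_carrier p" "lp_norm p f = 0" for f :: "nat \<Rightarrow> 'b"
    using lp_component[OF f(1)] f(2) by (auto simp: fun_eq_iff)
  fix Y :: "nat \<Rightarrow> nat \<Rightarrow> 'b" and K :: real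
  assume Y: "\<And>n. Y n \<in> lp_carrier p" "\<And>n. lp_norm p (Y (Suc n) - Y n) \<le> K * (1 / 2) ^ n"
  have diff: "f - g \<in> lp_carrier p" if "f \<in> lp_carrier p" "g \<in> lp_carrier p" for f g :: "nat \<Rightarrow> 'b"
    using lp_add(1)[OF that(1) lp_scale(1)[OF that(2), of "-1"]] by (simp add: scaleR_minus1_left)
  have K: "0 \<le> K" using Y(2)[of 0] lp_nonneg[of "Y (Suc 0) - Y 0"] by simp
  have far: "lp_norm p (Y (n + k) - Y n) \<le> 2 * K * (1 / 2) ^ n - 2 * K * (1 / 2) ^ (n + k)" for n k
  proof (induction k)
    case 0
    have "lp_norm p (0 *\<^sub>R (0 :: nat \<Rightarrow> 'b)) = \<bar>0\<bar> * lp_norm p (0 :: nat \<Rightarrow> 'b)" by (rule lp_scale(2)[OF lp_zero])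
    then have "lp_norm p (0 :: nat \<Rightarrow> 'b) = 0" by (simp only: scaleR_zero_left abs_zero mult_zero_left)
    then show ?case by (simp only: add_0_right diff_self)
  next
    case (Suc k)
    have "Y (n + Suc k) - Y n = (Y (Suc (n + k)) - Y (n + k)) + (Y (n + k) - Y n)" by simp
    then have "lp_norm p (Y (n + Suc k) - Y n) \<le> K * (1 / 2) ^ (n + k) + lp_norm p (Y (n + k) - Y n)"
      using lp_add(2)[OF diff[OF Y(1) Y(1)] diff[OF Y(1) Y(1)], of "Suc (n + k)" "n + k" "n + k" n] Y(2)[of "n + k"] by simp
    moreover have "2 * K * (1 / 2) ^ (n + Suc k) = K * (1 / 2) ^ (n + k)" "2 * K * (1 / 2) ^ (n + k) = 2 * (K * (1 / 2) ^ (n + k))"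
      by simp_all
    ultimately show ?case using Suc.IH by linarith
  qed
  have far': "lp_norm p (Y (k + n) - Y n) \<le> 2 * K * (1 / 2) ^ n" for n k
    using far[of n k] K by (simp add: add.commute) (smt (verit) mult_nonneg_nonneg zero_le_power divide_nonneg_nonneg)
  have "convergent (\<lambda>n. Y n m)" for m
  proof -
    have b: "norm (Y (Suc n) m - Y n m) \<le> K * (1 / 2) ^ n" for n
      using lp_component[OF diff[OF Y(1) Y(1)], of "Suc n" n m] Y(2)[of n] by simp
    have "summable (\<lambda>n. Y (Suc n) m - Y n m)"
      by (rule summable_comparison_test'[OF summable_mult[OF summable_geometric], of "1 / 2" 0]) (use b in auto)
    then show ?thesis by (simp add: summable_iff_convergent sum_lessThan_telescope[of "\<lambda>n. Y n m"] convergent_diff_const_right_iff)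
  qed
  then obtain z where z: "\<And>m. (\<lambda>n. Y n m) \<longlonglongrightarrow> z m" unfolding convergent_def by metis
  have zn: "z - Y n \<in> lp_carrier p" "lp_norm p (z - Y n) \<le> 2 * K * (1 / 2) ^ n" for n
  proof -
    have "(\<lambda>k. (Y (k + n) - Y n) m) \<longlonglongrightarrow> (z - Y n) m" for m
      using LIMSEQ_ignore_initial_segment[OF z[of m], of n] by (simp add: tendsto_diff)
    then show "z - Y n \<in> lp_carrier p" "lp_norm p (z - Y n) \<le> 2 * K * (1 / 2) ^ n"
      using lp_closed[of "\<lambda>k. Y (k + n) - Y n" "2 * K * (1 / 2) ^ n" "z - Y n"] diff[OF Y(1) Y(1)] far' by blast+
  qed
  have "z = (z - Y 0) + Y 0" by simp
  then have zV: "z \<in> lp_carrier p" using lp_add(1)[OF zn(1)[of 0] Y(1)[of 0]] by simp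
  have "lp_norm p (Y n - z) \<le> 2 * K * (1 / 2) ^ n" for n
  proof -
    have "Y n - z = (-1) *\<^sub>R (z - Y n)" by simp
    then have "lp_norm p (Y n - z) = \<bar>-1\<bar> * lp_norm p (z - Y n)" by (simp only: lp_scale(2)[OF zn(1)])
    then show ?thesis using zn(2)[of n] by simp
  qed
  then have "(\<lambda>n. lp_norm p (Y n - z)) \<longlonglongrightarrow> 0"
  proof (rule squeeze_zero[OF lp_nonneg])
    show "(\<lambda>n. 2 * K * (1 / 2) ^ n) \<longlonglongrightarrow> 0" by (rule tendsto_mult_right_zero[OF LIMSEQ_power_zero]) simp
  qed
  with zV show "\<exists>y\<in>lp_carrier p. (\<lambda>n. lp_norm p (Y n - y)) \<longlonglongrightarrow> 0" by blast
qed (auto simp: lp_zero lp_add lp_scale lp_nonneg)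

lemma unit_tensor_lp:
  "unit_tensor m a \<in> lp_carrier p" "lp_norm p (unit_tensor m a) = norm a" for a :: "'b::real_normed_vector"
proof -
  have "(\<Sum>k<n. norm (unit_tensor m a k) powr p) \<le> norm a powr p" for n
  proof -
    have "(\<Sum>k<n. norm (unit_tensor m a k) powr p) = (\<Sum>k<n. if k = m then norm a powr p else 0)"
      using p by (intro sum.cong) (auto simp: unit_tensor_def)
    then show ?thesis by simp
  qed
  then have *: "unit_tensor m a \<in> lp_carrier p" "lp_norm p (unit_tensor m a) \<le> norm a"
    using lpI[of "norm a" "unit_tensor m a"] by auto
  moreover have "norm a \<le> lp_norm p (unit_tensor m a)"
    using lp_component[OF *(1), of m] by (simp add: unit_tensor_def)
  ultimately show "unit_tensor m a \<in> lp_carrier p" "lp_norm p (unit_tensor m a) = norm a" by auto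
qed

lemma lp_expand:
  fixes y :: "nat \<Rightarrow> 'b::real_normed_vector"
  assumes y: "y \<in> lp_carrier p"
  shows "(\<lambda>n. lp_norm p (y - (\<Sum>m<n. unit_tensor m (y m)))) \<longlonglongrightarrow> 0"
proof -
  define t where "t n = (\<Sum>k. norm (y (k + n)) powr p)" for n
  have s: "summable (\<lambda>n. norm (y n) powr p)" using y by (simp add: lp_carrier_def)
  have t0: "0 \<le> t n" for n unfolding t_def by (intro suminf_nonneg summable_ignore_initial_segment s) auto
  have "lp_norm p (y - (\<Sum>m<n. unit_tensor m (y m))) \<le> t n powr (1 / p)" for n
  proof (rule lpI(2))
    fix k
    have v: "(y - (\<Sum>m<n. unit_tensor m (y m))) j = (if j < n then 0 else y j)" for j
      by (simp add: sum_apply unit_tensor_def)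
    have "(\<Sum>j<k. norm ((y - (\<Sum>m<n. unit_tensor m (y m))) j) powr p) \<le> (\<Sum>j<n + k. if j < n then 0 else norm (y j) powr p)"
      unfolding v by (intro order_trans[OF sum_mono sum_mono2]) (use p in auto)
    also have "\<dots> = (\<Sum>j<k. norm (y (j + n)) powr p)"
      by (subst sum_lessThan_add) (simp add: add.commute)
    also have "\<dots> \<le> t n" unfolding t_def by (intro sum_le_suminf summable_ignore_initial_segment s) auto
    also have "\<dots> = (t n powr (1 / p)) powr p" using p t0[of n] by (simp add: powr_powr)
    finally show "(\<Sum>j<k. norm ((y - (\<Sum>m<n. unit_tensor m (y m))) j) powr p) \<le> (t n powr (1 / p)) powr p" .
  qed simp
  moreover have "(\<lambda>n. t n powr (1 / p)) \<longlonglongrightarrow> 0 powr (1 / p)"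
    using p t0 by (intro tendsto_powr' tendsto_const) (auto simp: t_def intro: suminf_exist_split2[OF s])
  then have "(\<lambda>n. t n powr (1 / p)) \<longlonglongrightarrow> 0" by simp
  ultimately show ?thesis by (rule squeeze_zero[OF lp_nonneg])
qed

lemma direct_sum_lp:
  assumes "l1_tree atom E"
  shows "direct_sum atom E (lp_carrier p) (lp_norm p) UNIV unit_tensor (\<lambda>m f. f m)"
proof (intro direct_sum.intro direct_sum_axioms.intro assms lp_complete_normed)
  show "linear (unit_tensor m)" for m
    by (rule linearI) (auto simp: unit_tensor_def scaleR_fun_def)
  show "(\<lambda>n. lp_norm p (y - (\<Sum>m\<in>UNIV \<inter> {..<n}. unit_tensor m (y m)))) \<longlonglongrightarrow> 0" if "y \<in> lp_carrier p" for y :: "nat \<Rightarrow> 'a"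
    using lp_expand[OF that] by simp
  show "\<exists>z\<in>lp_carrier p. lp_norm p z \<le> C * lp_norm p y \<and> (\<forall>m\<in>UNIV. z m = F m (y m))"
    if "\<And>m a. norm (F m a) \<le> C * norm a" "0 \<le> C" "y \<in> lp_carrier p" for F C and y :: "nat \<Rightarrow> 'a"
    using lp_mono[OF that(3,2), of "\<lambda>m. F m (y m)"] that(1) by (intro bexI[of _ "\<lambda>m. F m (y m)"]) auto
  show "unit_tensor m a \<in> lp_carrier p" "lp_norm p (unit_tensor m a) \<le> norm a" for m and a :: 'a
    by (simp_all add: unit_tensor_lp)
qed (auto simp: lp_component scaleR_fun_def unit_tensor_def)

end

section \<open>Dyadic cells of the interval and of the square\<close>

definition dcell :: "nat \<Rightarrow> nat \<Rightarrow> real set" where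
  "dcell n i = {real i / 2 ^ n ..< real (Suc i) / 2 ^ n}"

lemma dcell_iff: "x \<in> dcell n i \<longleftrightarrow> 0 \<le> x \<and> cell_index n x = i"
proof
  assume "x \<in> dcell n i"
  then have x: "real i \<le> 2 ^ n * x" "2 ^ n * x < real i + 1" by (auto simp: dcell_def field_simps)
  then have "\<lfloor>2 ^ n * x\<rfloor> = int i" by (intro floor_unique) auto
  moreover have "0 \<le> x" using order_trans[OF of_nat_0_le_iff x(1)] mult_le_cancel_left_pos[of "2 ^ n" 0 x] by simp
  ultimately show "0 \<le> x \<and> cell_index n x = i" by (simp add: cell_index_def)
next
  assume x: "0 \<le> x \<and> cell_index n x = i"
  then have "\<lfloor>2 ^ n * x\<rfloor> = int i" unfolding cell_index_def by (metis floor_less_zero mult_nonneg_nonneg nat_eq_iff2 nat_0_le not_le zero_le_numeral zero_le_power)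
  then have "real i \<le> 2 ^ n * x" "2 ^ n * x < real i + 1" by (simp_all add: floor_eq_iff)
  then show "x \<in> dcell n i" by (auto simp: dcell_def field_simps)
qed

lemma cell_index_coarser:
  assumes "0 \<le> x" "n \<le> m" shows "cell_index n x = cell_index m x div 2 ^ (m - n)"
proof -
  have "2 ^ n * x = (2 ^ m * x) / real_of_int (2 ^ (m - n))"
    using assms(2) by (auto simp: le_iff_add power_add)
  then have "\<lfloor>2 ^ n * x\<rfloor> = \<lfloor>2 ^ m * x\<rfloor> div 2 ^ (m - n)"
    using floor_divide_real_eq_div[of "2 ^ (m - n)" "2 ^ m * x"] by simp
  then show ?thesis using assms(1) by (simp add: cell_index_def nat_div_distrib nat_power_eq)
qed

lemma dcell_indicator: "indicator (dcell n i) x = (if 0 \<le> x \<and> cell_index n x = i then 1 else 0 :: real)"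
  by (simp add: indicator_def dcell_iff)

lemma dcell_split: "dcell n i = dcell (Suc n) (2 * i) \<union> dcell (Suc n) (2 * i + 1)"
proof (rule set_eqI)
  fix x
  show "x \<in> dcell n i \<longleftrightarrow> x \<in> dcell (Suc n) (2 * i) \<union> dcell (Suc n) (2 * i + 1)"
  proof (cases "0 \<le> x")
    case True
    then have "cell_index n x = cell_index (Suc n) x div 2" using cell_index_coarser[of x n "Suc n"] by simp
    then show ?thesis using True by (auto simp: dcell_iff)
  qed (auto simp: dcell_iff)
qed

lemma dcell_disjoint: "i \<noteq> k \<Longrightarrow> dcell n i \<inter> dcell n k = {}"
  by (auto simp: dcell_iff)

lemma dcell_borel: "dcell n i \<in> sets borel" by (simp add: dcell_def)

lemma dcell_measure: "emeasure lborel (dcell n i) = ennreal (1 / 2 ^ n)"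
proof -
  have "real (Suc i) / 2 ^ n - real i / 2 ^ n = 1 / 2 ^ n" by (simp add: field_simps)
  moreover have "real i / 2 ^ n \<le> real (Suc i) / 2 ^ n" by (intro divide_right_mono) auto
  ultimately show ?thesis unfolding dcell_def by simp
qed

lemma dcell_unit: "i < 2 ^ n \<Longrightarrow> dcell n i \<subseteq> {0..1}"
proof
  fix x assume i: "i < 2 ^ n" and "x \<in> dcell n i"
  then have x: "real i / 2 ^ n \<le> x" "x < real (Suc i) / 2 ^ n" by (auto simp: dcell_def)
  have "real (Suc i) \<le> real (2 ^ n)" using i by (intro of_nat_mono) simp
  then have "real (Suc i) / 2 ^ n \<le> 1" by simp
  moreover have "0 \<le> real i / 2 ^ n" by simp
  ultimately have "0 \<le> x" "x \<le> 1" using x by linarith+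
  then show "x \<in> {0..1}" by simp
qed

lemma dcell_corner: "x \<in> dcell n i \<Longrightarrow> real i / 2 ^ n \<le> x" "x \<in> dcell n i \<Longrightarrow> \<bar>real i / 2 ^ n - x\<bar> \<le> 1 / 2 ^ n"
proof -
  have "real (Suc i) / 2 ^ n = real i / 2 ^ n + 1 / 2 ^ n" by (simp add: add_divide_distrib)
  then show "x \<in> dcell n i \<Longrightarrow> real i / 2 ^ n \<le> x" "x \<in> dcell n i \<Longrightarrow> \<bar>real i / 2 ^ n - x\<bar> \<le> 1 / 2 ^ n"
    by (auto simp: dcell_def abs_le_iff)
qed

interpretation unit: partition_tree dcell "\<lambda>n i. real i / 2 ^ n"
proof
  fix n i k :: nat
  show "dcell n i \<subseteq> cbox 0 One" if "i < 2 ^ n" using dcell_unit[OF that] by (simp add: cbox_interval)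
  show "(\<lambda>n. real (j n) / 2 ^ n) \<longlonglongrightarrow> x" if "\<And>n. x \<in> dcell n (j n)" for x and j :: "nat \<Rightarrow> nat"
  proof -
    have "(\<lambda>n. \<bar>real (j n) / 2 ^ n - x\<bar>) \<longlonglongrightarrow> 0"
    proof (rule squeeze_zero)
      show "\<bar>real (j n) / 2 ^ n - x\<bar> \<le> 1 / 2 ^ n" for n by (rule dcell_corner(2)[OF that])
      show "(\<lambda>n. 1 / 2 ^ n :: real) \<longlonglongrightarrow> 0" by real_asymp
    qed simp
    then show ?thesis by (simp add: tendsto_rabs_zero_iff LIM_zero_iff)
  qed
  show "dcell n i = dcell (Suc n) (2 * i) \<union> dcell (Suc n) (2 * i + 1)" by (rule dcell_split)
qed (simp_all add: dcell_borel dcell_measure dcell_disjoint dcell_corner(1))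

text \<open>
  The binary digits of \<open>i\<close> are dealt alternately to the two coordinates, so the step from level \<open>n\<close> to
  \<open>n + 1\<close> halves a cell in the first direction if \<open>n\<close> is even and in the second if \<open>n\<close> is odd. The cells
  of level \<open>2 * n\<close> are the dyadic squares of side \<open>1 / 2 ^ n\<close>.
\<close>

fun cell_column :: "nat \<Rightarrow> nat \<Rightarrow> nat" where
  "cell_column 0 i = 0"
| "cell_column (Suc n) i = (if even n then 2 * cell_column n (i div 2) + i mod 2 else cell_column n (i div 2))"

fun cell_row :: "nat \<Rightarrow> nat \<Rightarrow> nat" where
  "cell_row 0 i = 0"
| "cell_row (Suc n) i = (if even n then cell_row n (i div 2) else 2 * cell_row n (i div 2) + i mod 2)"

definition sqcell :: "nat \<Rightarrow> nat \<Rightarrow> (real \<times> real) set" where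
  "sqcell n i = dcell (Suc n div 2) (cell_column n i) \<times> dcell (n div 2) (cell_row n i)"

lemma cell_column_row_less: "i < 2 ^ n \<Longrightarrow> cell_column n i < 2 ^ (Suc n div 2) \<and> cell_row n i < 2 ^ (n div 2)"
proof (induction n arbitrary: i)
  case (Suc n)
  then have IH: "cell_column n (i div 2) < 2 ^ (Suc n div 2)" "cell_row n (i div 2) < 2 ^ (n div 2)"
    using Suc.IH[of "i div 2"] by auto
  have m: "i mod 2 \<le> 1" by simp
  show ?case
  proof (cases "even n")
    case True
    then have "Suc n div 2 = n div 2" "Suc (Suc n) div 2 = Suc (n div 2)" by auto
    then show ?thesis using IH m True by simp
  next
    case False
    then have "Suc n div 2 = Suc (n div 2)" "Suc (Suc n) div 2 = Suc (n div 2)" by auto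
    then show ?thesis using IH m False by simp
  qed
qed simp

lemma cell_column_row_inj: "i < 2 ^ n \<Longrightarrow> k < 2 ^ n \<Longrightarrow> cell_column n i = cell_column n k \<Longrightarrow> cell_row n i = cell_row n k \<Longrightarrow> i = k"
proof (induction n arbitrary: i k)
  case (Suc n)
  have "cell_column n (i div 2) = cell_column n (k div 2) \<and> cell_row n (i div 2) = cell_row n (k div 2) \<and> i mod 2 = k mod 2"
  proof -
    have *: "a = b \<and> c = d" if "2 * a + c = 2 * b + d" "c \<le> 1" "d \<le> 1" for a b c d :: nat
      using that by presburger
    show ?thesis
      using Suc.prems(3,4) *[of "cell_column n (i div 2)" "i mod 2" "cell_column n (k div 2)" "k mod 2"]
        *[of "cell_row n (i div 2)" "i mod 2" "cell_row n (k div 2)" "k mod 2"]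
      by (auto split: if_splits)
  qed
  moreover have "i div 2 < 2 ^ n" "k div 2 < 2 ^ n" using Suc.prems(1,2) by auto
  ultimately have "i div 2 = k div 2" "i mod 2 = k mod 2" using Suc.IH[of "i div 2" "k div 2"] by blast+
  then show ?case by (metis mult_div_mod_eq)
qed simp

lemma sqcell_split: "sqcell n i = sqcell (Suc n) (2 * i) \<union> sqcell (Suc n) (2 * i + 1)"
proof -
  have d: "(2 * i + 1) div 2 = i" "(2 * i + 1) mod 2 = 1" by simp_all
  show ?thesis
  proof (cases "even n")
    case True
    then have "Suc n div 2 = n div 2" "Suc (Suc n) div 2 = Suc (n div 2)" by auto
    then show ?thesis using True d dcell_split[of "n div 2" "cell_column n i"]
      by (simp add: sqcell_def Sigma_Un_distrib1[symmetric] del: Suc_eq_plus1)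
  next
    case False
    then have "Suc n div 2 = Suc (n div 2)" "Suc (Suc n) div 2 = Suc (n div 2)" by auto
    then show ?thesis using False d dcell_split[of "n div 2" "cell_row n i"]
      by (simp add: sqcell_def Sigma_Un_distrib2[symmetric] del: Suc_eq_plus1)
  qed
qed

interpretation square: partition_tree sqcell "\<lambda>n i. (real (cell_column n i) / 2 ^ (Suc n div 2), real (cell_row n i) / 2 ^ (n div 2))"
proof
  fix n i k :: nat
  show "sqcell n i \<in> sets borel"
    unfolding sqcell_def by (intro borel_Times dcell_borel)
  show "emeasure lborel (sqcell n i) = ennreal (1 / 2 ^ n)" if "i < 2 ^ n"
  proof -
    have "emeasure lborel (sqcell n i) = emeasure lborel (dcell (Suc n div 2) (cell_column n i)) * emeasure lborel (dcell (n div 2) (cell_row n i))"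
      unfolding sqcell_def lborel_prod[symmetric]
      by (intro lborel.emeasure_pair_measure_Times) (auto simp: dcell_borel)
    also have "\<dots> = ennreal (1 / 2 ^ (Suc n div 2) * (1 / 2 ^ (n div 2)))"
      by (simp only: dcell_measure) (simp flip: ennreal_mult)
    also have "1 / 2 ^ (Suc n div 2) * (1 / 2 ^ (n div 2)) = (1 / 2 ^ n :: real)"
    proof -
      have "Suc n div 2 + n div 2 = n" by presburger
      then show ?thesis by (metis mult_1 power_add times_divide_times_eq)
    qed
    finally show ?thesis .
  qed
  show "sqcell n i \<subseteq> cbox 0 One" if "i < 2 ^ n"
    using dcell_unit cell_column_row_less[OF that] unfolding cube_real2 sqcell_def by blast
  show "sqcell n i = sqcell (Suc n) (2 * i) \<union> sqcell (Suc n) (2 * i + 1)" by (rule sqcell_split)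
  show "sqcell n i \<inter> sqcell n k = {}" if "i < 2 ^ n" "k < 2 ^ n" "i \<noteq> k"
    using cell_column_row_inj[OF that(1,2)] that(3) dcell_disjoint unfolding sqcell_def by blast
  show "(real (cell_column n i) / 2 ^ (Suc n div 2), real (cell_row n i) / 2 ^ (n div 2)) \<le> z" if "z \<in> sqcell n i" for z
    using that dcell_corner(1) by (auto simp: sqcell_def less_eq_prod_def)
  show "(\<lambda>n. (real (cell_column n (j n)) / 2 ^ (Suc n div 2), real (cell_row n (j n)) / 2 ^ (n div 2))) \<longlonglongrightarrow> z"
    if "\<And>n. z \<in> sqcell n (j n)" for z and j :: "nat \<Rightarrow> nat"
  proof -
    obtain s t where z: "z = (s, t)" by force
    have c: "s \<in> dcell (Suc n div 2) (cell_column n (j n))" "t \<in> dcell (n div 2) (cell_row n (j n))" for n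
      using that[of n] z by (auto simp: sqcell_def)
    have l2: "(\<lambda>n. 1 / 2 ^ (n div 2) :: real) \<longlonglongrightarrow> 0"
    proof -
      have "filterlim (\<lambda>n::nat. n div 2) at_top at_top"
        unfolding filterlim_at_top eventually_sequentially
      proof (intro allI)
        fix Z :: nat
        show "\<exists>N. \<forall>n\<ge>N. Z \<le> n div 2" by (rule exI[of _ "2 * Z"]) auto
      qed
      moreover have "(\<lambda>n. 1 / 2 ^ n :: real) \<longlonglongrightarrow> 0" by real_asymp
      ultimately show ?thesis by (rule filterlim_compose[rotated])
    qed
    have l1: "(\<lambda>n. 1 / 2 ^ (Suc n div 2) :: real) \<longlonglongrightarrow> 0" using LIMSEQ_Suc[OF l2] by simp
    have "(\<lambda>n. \<bar>real (cell_column n (j n)) / 2 ^ (Suc n div 2) - s\<bar>) \<longlonglongrightarrow> 0"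
      by (rule squeeze_zero[OF _ dcell_corner(2)[OF c(1)] l1]) simp
    then have 1: "(\<lambda>n. real (cell_column n (j n)) / 2 ^ (Suc n div 2)) \<longlonglongrightarrow> s"
      by (simp add: tendsto_rabs_zero_iff LIM_zero_iff)
    have "(\<lambda>n. \<bar>real (cell_row n (j n)) / 2 ^ (n div 2) - t\<bar>) \<longlonglongrightarrow> 0"
      by (rule squeeze_zero[OF _ dcell_corner(2)[OF c(2)] l2]) simp
    then have 2: "(\<lambda>n. real (cell_row n (j n)) / 2 ^ (n div 2)) \<longlonglongrightarrow> t"
      by (simp add: tendsto_rabs_zero_iff LIM_zero_iff)
    show ?thesis unfolding z by (rule tendsto_Pair[OF 1 2])
  qed
qed

section \<open>Haar functions\<close>

text \<open>
  The heap order of the dyadic intervals: 0 for the empty set and \<open>2 ^ j + i\<close> for the interval \<open>i\<close> of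
  length \<open>1 / 2 ^ j\<close>.
\<close>

definition node :: "nat \<Rightarrow> real set" where
  "node l = (if l = 0 then {} else dcell (floor_log l) (l - 2 ^ floor_log l))"

definition haar_fn :: "nat \<Rightarrow> real \<Rightarrow> real" where "haar_fn l = haar (node l)"

definition node_level :: "nat \<Rightarrow> nat" where "node_level l = floor_log l"

lemma node_level_0 [simp]: "node_level 0 = 0" by (simp add: node_level_def)

lemma node_level_node: "i < 2 ^ j \<Longrightarrow> node_level (2 ^ j + i) = j"
  unfolding node_level_def by (rule floor_log_eqI) auto

lemma node_pos: "i < 2 ^ j \<Longrightarrow> node (2 ^ j + i) = dcell j i"
  using node_level_node[of i j] by (simp add: node_def node_level_def)

lemma node_cases:
  assumes "0 < l" obtains j i :: nat where "l = 2 ^ j + i" "i < 2 ^ j"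
proof -
  have "2 ^ floor_log l \<le> l" "l < 2 * 2 ^ floor_log l"
    using floor_log_exp2_le[OF assms] floor_log_exp2_gt[of l] by auto
  then show ?thesis using that[of "floor_log l" "l - 2 ^ floor_log l"] by auto
qed

lemma dcell_halves: "left_half (dcell j i) = dcell (Suc j) (2 * i)" "right_half (dcell j i) = dcell (Suc j) (2 * i + 1)"
proof -
  have lt: "real i / 2 ^ j < real (Suc i) / 2 ^ j" by (intro divide_strict_right_mono) auto
  have m: "(Inf (dcell j i) + Sup (dcell j i)) / 2 = real (2 * i + 1) / 2 ^ Suc j"
    unfolding dcell_def using lt by (simp add: cInf_atLeastLessThan cSup_atLeastLessThan field_simps)
  have e: "real i / 2 ^ j = real (2 * i) / 2 ^ Suc j" "real (Suc i) / 2 ^ j = real (Suc (2 * i + 1)) / 2 ^ Suc j"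
    by (simp_all add: field_simps)
  have o: "real (2 * i) / 2 ^ Suc j \<le> real (2 * i + 1) / 2 ^ Suc j" "real (2 * i + 1) / 2 ^ Suc j \<le> real (Suc (2 * i + 1)) / 2 ^ Suc j"
    by (intro divide_right_mono; simp)+
  show "left_half (dcell j i) = dcell (Suc j) (2 * i)"
    unfolding left_half_def m using o unfolding dcell_def e by auto
  show "right_half (dcell j i) = dcell (Suc j) (2 * i + 1)"
    unfolding right_half_def m using o unfolding dcell_def e by auto
qed

lemma dcell_nonempty: "real i / 2 ^ n \<in> dcell n i"
  by (simp add: dcell_iff)

lemma haar_dcell: "haar (dcell j i) x = indicator (dcell (Suc j) (2 * i)) x - indicator (dcell (Suc j) (2 * i + 1)) x"
  using dcell_nonempty[of i j] by (auto simp: haar_def dcell_halves)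

lemma haar_fn_0: "haar_fn 0 = indicator (dcell 0 0)"
  by (simp add: haar_fn_def node_def haar_def dcell_def)

lemma haar_fn_node: "i < 2 ^ j \<Longrightarrow> haar_fn (2 ^ j + i) x = indicator (dcell (Suc j) (2 * i)) x - indicator (dcell (Suc j) (2 * i + 1)) x"
  by (simp only: haar_fn_def node_pos haar_dcell)

lemma dcell_inject: "dcell j i = dcell j' i' \<Longrightarrow> j = j' \<and> i = i'"
proof -
  assume eq: "dcell j i = dcell j' i'"
  have "emeasure lborel (dcell j i) = emeasure lborel (dcell j' i')" using eq by simp
  then have "(1 / 2 ^ j :: real) = 1 / 2 ^ j'" unfolding dcell_measure by simp
  then have j: "j = j'" by simp
  then have "real i / 2 ^ j \<in> dcell j i'" using dcell_nonempty[of i j] eq by simp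
  then show ?thesis using j by (simp add: dcell_iff)
qed

lemma bij_node: "bij_betw node UNIV dyadic_plus"
proof (rule bij_betwI')
  show "(node l = node k) = (l = k)" for l k
  proof
    assume eq: "node l = node k"
    have ne: "node l \<noteq> {}" if "0 < l" for l
      using node_cases[OF that] node_pos dcell_nonempty by (metis empty_iff)
    consider "l = 0" "k = 0" | "0 < l" "0 < k" using eq ne[of l] ne[of k] by (cases l; cases k) (auto simp: node_def)
    then show "l = k"
    proof cases
      case 2
      then obtain j i j' i' where "l = 2 ^ j + i" "i < 2 ^ j" "k = 2 ^ j' + i'" "i' < 2 ^ j'" using node_cases by metis
      then show ?thesis using eq dcell_inject[of j i j' i'] by (simp add: node_pos)
    qed simp
  qed simp
  show "node l \<in> dyadic_plus" for l
  proof (cases "l = 0")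
    case False
    then obtain j i where l: "l = 2 ^ j + i" "i < 2 ^ j" using node_cases by blast
    have "node l = {(real (Suc i) - 1) / 2 ^ j..<real (Suc i) / 2 ^ j}"
      unfolding l(1) node_pos[OF l(2)] by (simp add: dcell_def)
    moreover have "1 \<le> Suc i" "Suc i \<le> 2 ^ j" using l(2) by auto
    ultimately have "node l \<in> dyadic" unfolding dyadic_def by blast
    then show ?thesis by (simp add: dyadic_plus_def)
  qed (simp add: node_def dyadic_plus_def)
  show "\<exists>l\<in>UNIV. I = node l" if "I \<in> dyadic_plus" for I
  proof (cases "I = {}")
    case True then show ?thesis by (intro bexI[of _ 0]) (auto simp: node_def)
  next
    case False
    then have "I \<in> dyadic" using that by (simp add: dyadic_plus_def)
    then obtain i j where I: "I = {(real i - 1) / 2 ^ j ..< real i / 2 ^ j}" "1 \<le> i" "i \<le> 2 ^ j" by (auto simp: dyadic_def)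
    have "i - 1 < 2 ^ j" using I(2,3) by linarith
    then have "I = node (2 ^ j + (i - 1))" unfolding node_pos[OF \<open>i - 1 < 2 ^ j\<close>]
      using I(1,2) by (simp add: dcell_def of_nat_diff)
    then show ?thesis by blast
  qed
qed

lemma node_dyadic_plus: "node l \<in> dyadic_plus" using bij_node by (auto simp: bij_betw_def)

lemma bounded_borel_haar_fn: "bounded_borel (haar_fn l)"
  unfolding haar_fn_def bounded_borel_def using haar_measurable[OF node_dyadic_plus] abs_haar_le_1 by blast

lemma abs_haar_fn_le_1: "\<bar>haar_fn l x\<bar> \<le> 1" unfolding haar_fn_def by (rule abs_haar_le_1)

lemma haar_fn_constant:
  assumes "l < 2 ^ j" "x \<in> dcell j i" shows "haar_fn l x = haar_fn l (real i / 2 ^ j)"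
proof -
  have x: "0 \<le> x" "cell_index j x = i" using assms(2) by (auto simp: dcell_iff)
  have same: "cell_index n x = cell_index n (real i / 2 ^ j)" if "n \<le> j" for n
    using cell_index_coarser[OF x(1) that] x(2) cell_index_dyadic[OF that] by simp
  have ind: "indicator (dcell n k) x = (indicator (dcell n k) (real i / 2 ^ j) :: real)" if "n \<le> j" for n k
    using same[OF that] x(1) by (simp add: dcell_indicator)
  show ?thesis
  proof (cases "l = 0")
    case True then show ?thesis by (simp add: haar_fn_0 ind)
  next
    case False
    then obtain j' i' where l: "l = 2 ^ j' + i'" "i' < 2 ^ j'" using node_cases by blast
    have "(2::nat) ^ j' < 2 ^ j" using assms(1) l(1) by linarith
    then have "Suc j' \<le> j" by simp
    then show ?thesis by (simp only: l(1) haar_fn_node[OF l(2)] ind)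
  qed
qed

lemma sum_dcell_le: "(\<Sum>i<2 ^ j. indicator (dcell j i) x) \<le> (1 :: real)"
  by (subst unit.sum_indicator) (simp add: indicator_def)

lemma abs_haar_fn_node: "i < 2 ^ j \<Longrightarrow> \<bar>haar_fn (2 ^ j + i) x\<bar> = indicator (dcell j i) x"
  unfolding haar_fn_node unit.indicator_split by (auto simp: dcell_indicator)

lemma integral_haar_fn_node: "i < 2 ^ j \<Longrightarrow> (LINT x|cube_measure. haar_fn (2 ^ j + i) x) = 0"
proof -
  assume i: "i < 2 ^ j"
  then have "2 * i < 2 ^ Suc j" "2 * i + 1 < 2 ^ Suc j" by auto
  then show ?thesis
    unfolding haar_fn_node[OF i] Bochner_Integration.integral_diff[OF unit.integrable_cell unit.integrable_cell]
    by (simp only: unit.integral_cell diff_self)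
qed

lemma integral_abs_haar_fn: "(LINT x|cube_measure. \<bar>haar_fn l x\<bar>) = 1 / 2 ^ node_level l"
proof (cases "l = 0")
  case True
  then have "(LINT x|cube_measure. \<bar>haar_fn l x\<bar>) = (LINT x|cube_measure. indicator (dcell 0 0) x)" by (simp add: haar_fn_0)
  then show ?thesis using True unit.integral_cell[of 0 0] by simp
next
  case False
  then obtain j i where l: "l = 2 ^ j + i" "i < 2 ^ j" using node_cases by blast
  then show ?thesis using unit.integral_cell[OF l(2)] by (simp only: abs_haar_fn_node node_level_node)
qed

lemma haar_fn_orthogonal: "(LINT x|cube_measure. haar_fn l x * haar_fn k x) = (if l = k then 1 / 2 ^ node_level l else 0)"
proof -
  have lt: "(LINT x|cube_measure. haar_fn l x * haar_fn k x) = 0" if "l < k" for l k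
  proof -
    have "0 < k" using that by simp
    then obtain j i where k: "k = 2 ^ j + i" "i < 2 ^ j" using node_cases by blast
    show ?thesis
    proof (cases "l < 2 ^ j")
      case True
      have "haar_fn l x * haar_fn k x = haar_fn l (real i / 2 ^ j) * haar_fn k x" for x
      proof (cases "x \<in> dcell j i")
        case False
        then have "\<bar>haar_fn k x\<bar> = 0" using abs_haar_fn_node[OF k(2)] k(1) by simp
        then show ?thesis by simp
      qed (simp add: haar_fn_constant[OF True])
      then have "(LINT x|cube_measure. haar_fn l x * haar_fn k x) = haar_fn l (real i / 2 ^ j) * (LINT x|cube_measure. haar_fn k x)"
        by (simp only: integral_mult_right_zero)
      then show ?thesis using integral_haar_fn_node[OF k(2)] k(1) by simp
    next
      case False
      define i' where "i' = l - 2 ^ j"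
      have l: "l = 2 ^ j + i'" "i' < 2 ^ j" "i' \<noteq> i" using False that k by (auto simp: i'_def)
      have "haar_fn l x * haar_fn k x = 0" for x
      proof -
        have "\<bar>haar_fn l x * haar_fn k x\<bar> = 0"
          unfolding abs_mult l(1) k(1) abs_haar_fn_node[OF l(2)] abs_haar_fn_node[OF k(2)] using l(3) by (simp add: dcell_indicator)
        then show ?thesis by simp
      qed
      then show ?thesis by (simp only:) simp
    qed
  qed
  consider "l < k" | "k < l" | "l = k" by linarith
  then show ?thesis
  proof cases
    case 1 then show ?thesis using lt[OF 1] by simp
  next
    case 2 then show ?thesis using lt[OF 2] by (simp add: mult.commute)
  next
    case 3
    have "haar_fn k x * haar_fn k x = \<bar>haar_fn k x\<bar>" for x
    proof -
      have "\<bar>haar_fn k x\<bar> = 0 \<or> \<bar>haar_fn k x\<bar> = 1"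
      proof (cases "k = 0")
        case True then show ?thesis by (simp add: haar_fn_0 indicator_def)
      next
        case False
        then obtain j i where k: "k = 2 ^ j + i" "i < 2 ^ j" using node_cases by blast
        then show ?thesis by (simp only: abs_haar_fn_node) (simp add: indicator_def)
      qed
      then show ?thesis by (auto simp: abs_if split: if_splits)
    qed
    then show ?thesis using 3 integral_abs_haar_fn[of k] by simp
  qed
qed

section \<open>Kernels of Haar partial sums\<close>

text \<open>
  The first \<open>2 ^ j\<close> Haar functions span the functions that are constant on the cells of level \<open>j\<close>, and
  both sides are the kernel of the conditional expectation onto this space.
\<close>

lemma kernel_dyadic:
  "(\<Sum>l<2 ^ j. 2 ^ node_level l * haar_fn l s * haar_fn l t) = 2 ^ j * (\<Sum>i<2 ^ j. indicator (dcell j i) s * indicator (dcell j i) t)"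
proof (induction j)
  case 0 then show ?case by (simp add: haar_fn_0)
next
  case (Suc j)
  have split: "(\<Sum>l<2 ^ Suc j. g l) = (\<Sum>l<2 ^ j. g l) + (\<Sum>i<2 ^ j. g (2 ^ j + i))" for g :: "nat \<Rightarrow> real"
    using sum_lessThan_add[of g "2 ^ j" "2 ^ j"] by (simp add: mult_2)
  have "(\<Sum>l<2 ^ Suc j. 2 ^ node_level l * haar_fn l s * haar_fn l t) =
     (\<Sum>i<2 ^ j. 2 ^ j * (indicator (dcell j i) s * indicator (dcell j i) t) + 2 ^ j * (haar_fn (2 ^ j + i) s * haar_fn (2 ^ j + i) t))"
    unfolding split Suc.IH sum_distrib_left sum.distrib
    by (intro arg_cong2[where f = "(+)"] sum.cong refl) (auto simp: node_level_node)
  also have "\<dots> = (\<Sum>i<2 ^ j. 2 ^ Suc j * (indicator (dcell (Suc j) (2 * i)) s * indicator (dcell (Suc j) (2 * i)) t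
      + indicator (dcell (Suc j) (2 * i + 1)) s * indicator (dcell (Suc j) (2 * i + 1)) t))"
  proof (intro sum.cong refl)
    fix i assume i: "i \<in> {..<(2::nat) ^ j}"
    have "P * ((a + b) * (c + d)) + P * ((a - b) * (c - d)) = 2 * P * (a * c + b * d)" for P a b c d :: real
      by (simp add: algebra_simps)
    then show "2 ^ j * (indicator (dcell j i) s * indicator (dcell j i) t) + 2 ^ j * (haar_fn (2 ^ j + i) s * haar_fn (2 ^ j + i) t)
      = (2 ^ Suc j * (indicator (dcell (Suc j) (2 * i)) s * indicator (dcell (Suc j) (2 * i)) t
      + indicator (dcell (Suc j) (2 * i + 1)) s * indicator (dcell (Suc j) (2 * i + 1)) t) :: real)"
      using i by (simp only: lessThan_iff haar_fn_node unit.indicator_split[of i j] power_Suc)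
  qed
  also have "\<dots> = 2 ^ Suc j * (\<Sum>i<2 ^ Suc j. indicator (dcell (Suc j) i) s * indicator (dcell (Suc j) i) t)"
    unfolding power_Suc[of "2::nat"] sum_lessThan_double sum_distrib_left ..
  finally show ?case .
qed

text \<open>
  Between the levels \<open>j\<close> and \<open>j + 1\<close> the Haar functions of index below \<open>2 ^ j\<close> are replaced by the cells
  of level \<open>j\<close>. This keeps the kernel, but now all functions have the same size of support, and at most
  two of them overlap.
\<close>

definition adapted :: "nat \<Rightarrow> nat \<Rightarrow> real \<Rightarrow> real" where
  "adapted j l = (if l < 2 ^ j then indicator (dcell j l) else haar_fn l)"

lemma kernel_adapted:
  assumes "2 ^ j \<le> n" "n \<le> 2 ^ Suc j"
  shows "(\<Sum>l<n. 2 ^ node_level l * haar_fn l s * haar_fn l t) = 2 ^ j * (\<Sum>l<n. adapted j l s * adapted j l t)"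
proof -
  obtain k where k: "n = 2 ^ j + k" "k \<le> 2 ^ j" using assms by (auto simp: le_iff_add)
  have "(\<Sum>i<k. 2 ^ node_level (2 ^ j + i) * haar_fn (2 ^ j + i) s * haar_fn (2 ^ j + i) t) = (\<Sum>i<k. 2 ^ j * (adapted j (2 ^ j + i) s * adapted j (2 ^ j + i) t))"
    using k by (intro sum.cong) (auto simp: node_level_node adapted_def)
  moreover have "(\<Sum>l<2 ^ j. adapted j l s * adapted j l t) = (\<Sum>i<2 ^ j. indicator (dcell j i) s * indicator (dcell j i) t)"
    by (intro sum.cong) (auto simp: adapted_def)
  ultimately show ?thesis
    unfolding k(1) sum_lessThan_add kernel_dyadic by (simp add: sum_distrib_left algebra_simps)
qed

lemma bounded_borel_adapted: "bounded_borel (adapted j l)"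
  by (simp add: adapted_def bounded_borel_haar_fn unit.bounded_borel_cell)

lemma abs_adapted: "l < 2 ^ Suc j \<Longrightarrow> \<bar>adapted j l x\<bar> = indicator (dcell j (if l < 2 ^ j then l else l - 2 ^ j)) x"
  using abs_haar_fn_node[of "l - 2 ^ j" j x] by (auto simp: adapted_def)

lemma sum_adapted_le:
  assumes "n \<le> 2 ^ Suc j" shows "(\<Sum>l<n. \<bar>adapted j l x\<bar>) \<le> 2"
proof -
  have "(\<Sum>l<n. \<bar>adapted j l x\<bar>) \<le> (\<Sum>l<2 ^ j + 2 ^ j. \<bar>adapted j l x\<bar>)" using assms by (intro sum_mono2) auto
  also have "\<dots> = (\<Sum>i<2 ^ j. indicator (dcell j i) x) + (\<Sum>i<2 ^ j. indicator (dcell j i) x)"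
    unfolding sum_lessThan_add by (intro arg_cong2[where f = "(+)"] sum.cong refl) (auto simp: abs_adapted)
  also have "\<dots> \<le> 1 + 1" by (intro add_mono sum_dcell_le)
  finally show ?thesis by simp
qed

lemma integral_abs_adapted: "l < 2 ^ Suc j \<Longrightarrow> (LINT x|cube_measure. \<bar>adapted j l x\<bar>) = 1 / 2 ^ j"
  by (simp only: abs_adapted) (rule unit.integral_cell, auto)

lemma dcell_expansion:
  assumes "i < 2 ^ j"
  shows "indicator (dcell j i) t = (\<Sum>l<2 ^ j. (2 ^ node_level l * haar_fn l (real i / 2 ^ j) / 2 ^ j) * haar_fn l t)"
proof -
  have "(\<Sum>k<2 ^ j. indicator (dcell j k) (real i / 2 ^ j) * indicator (dcell j k) t) = (indicator (dcell j i) t :: real)"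
  proof -
    have "(\<Sum>k<2 ^ j. indicator (dcell j k) (real i / 2 ^ j) * indicator (dcell j k) t)
       = (\<Sum>k<2 ^ j. if k = i then indicator (dcell j i) t else (0 :: real))"
      by (intro sum.cong) (auto simp: dcell_indicator)
    then show ?thesis using assms by simp
  qed
  with kernel_dyadic[where j = j and s = "real i / 2 ^ j" and t = t] show ?thesis
    by (simp add: sum_divide_distrib[symmetric] field_simps)
qed

section \<open>A criterion for Schauder bases\<close>

context complete_normed
begin

text \<open>
  The partial sums of a finite linear combination of the \<open>e k\<close> are eventually the vector itself, and
  uniform boundedness carries convergence over to the closure.
\<close>

lemma schauder_criterion:
  fixes e :: "nat \<Rightarrow> 'v" and f :: "nat \<Rightarrow> 'v \<Rightarrow> real"
  assumes e: "\<And>k. e k \<in> V" "\<And>k. N (e k) = 1"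
    and f_add: "\<And>k x y. x \<in> V \<Longrightarrow> y \<in> V \<Longrightarrow> f k (x + y) = f k x + f k y"
    and f_scale: "\<And>k c x. x \<in> V \<Longrightarrow> f k (c *\<^sub>R x) = c * f k x"
    and f_bound: "\<And>k x. x \<in> V \<Longrightarrow> \<bar>f k x\<bar> \<le> C * N x"
    and f_e: "\<And>k l. f k (e l) = (if k = l then 1 else 0)"
    and partial: "\<And>n x. x \<in> V \<Longrightarrow> N (\<Sum>k<n. f k x *\<^sub>R e k) \<le> K * N x"
    and dense: "\<And>x \<epsilon>. x \<in> V \<Longrightarrow> 0 < \<epsilon> \<Longrightarrow> \<exists>y\<in>span (range e). N (x - y) < \<epsilon>"
  shows "normalized_schauder_basis V N e" "x \<in> V \<Longrightarrow> coordinate N e k x = f k x"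
proof -
  define S where "S n x = (\<Sum>k<n. f k x *\<^sub>R e k)" for n x
  have SV: "S n x \<in> V" for n x unfolding S_def by (intro V_sum V_scale e)
  have span_V: "y \<in> V" if "y \<in> span (range e)" for y
    using that by (induction rule: span_induct_alt) (auto simp: V_zero V_add V_scale e)
  have "y \<in> V \<and> (\<exists>n0. \<forall>n\<ge>n0. S n y = y)" if "y \<in> span (range e)" for y
    using that
  proof (induction rule: span_induct_alt)
    case base
    have "f k 0 = 0" for k using f_scale[OF V_zero, of k 0] by simp
    then show ?case by (simp add: S_def V_zero)
  next
    case (step c x y)
    then obtain l n0 where l: "x = e l" and y: "y \<in> V" and n0: "\<And>n. n0 \<le> n \<Longrightarrow> S n y = y" by blast
    have "S n (c *\<^sub>R x + y) = c *\<^sub>R x + y" if "max n0 (Suc l) \<le> n" for n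
    proof -
      have "S n (c *\<^sub>R x + y) = c *\<^sub>R (\<Sum>k<n. f k x *\<^sub>R e k) + S n y"
        unfolding S_def l using e y
        by (simp add: f_add f_scale V_scale scaleR_add_left sum.distrib scaleR_sum_right)
      also have "(\<Sum>k<n. f k x *\<^sub>R e k) = x"
        unfolding l f_e using that by (simp add: if_distrib[where f = "\<lambda>a. a *\<^sub>R _"] cong: if_cong)
      finally show ?thesis using n0 that by simp
    qed
    moreover have "c *\<^sub>R x + y \<in> V" using l y by (simp add: V_add V_scale e)
    ultimately show ?case by blast
  qed
  then have S_fixed: "\<exists>n0. \<forall>n\<ge>n0. S n y = y" if "y \<in> span (range e)" for y using that by blast
  have S_diff: "S n (x - y) = S n x - S n y" if "x \<in> V" "y \<in> V" for n x y
  proof -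
    have "f k (x - y) = f k x - f k y" for k
      using f_add[OF that(1) V_minus[OF that(2)], of k] f_scale[OF that(2), of k "-1"] by simp
    then show ?thesis by (simp only: S_def scaleR_diff_left sum_subtractf)
  qed
  have K: "0 \<le> K"
  proof -
    have "0 \<le> N (\<Sum>k<0. f k (e 0) *\<^sub>R e k)" by (simp add: N_zero)
    then show ?thesis using order_trans[OF _ partial[OF e(1)[of 0], of 0]] e(2)[of 0] by simp
  qed
  have conv: "is_expansion N e x (\<lambda>k. f k x)" if x: "x \<in> V" for x
    unfolding is_expansion_def
  proof (rule LIMSEQ_I)
    fix r :: real assume r: "0 < r"
    then have "0 < r / (K + 2)" using K by simp
    then obtain y where y: "y \<in> span (range e)" "N (x - y) < r / (K + 2)" using dense[OF x] by blast
    obtain n0 where n0: "\<And>n. n0 \<le> n \<Longrightarrow> S n y = y" using S_fixed[OF y(1)] by blast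
    have yV: "y \<in> V" by (rule span_V[OF y(1)])
    have "norm (N (x - S n x) - 0) < r" if "n0 \<le> n" for n
    proof -
      have "N (x - S n x) \<le> N (x - y) + N (y - S n x)" by (rule N_triangle[OF x yV SV])
      also have "N (y - S n x) = N (S n (y - x))" using n0[OF that] by (simp add: S_diff yV x)
      also have "\<dots> \<le> K * N (y - x)" unfolding S_def by (rule partial) (simp add: V_diff yV x)
      also have "N (y - x) = N (x - y)" by (rule N_minus_commute[OF yV x])
      finally have "N (x - S n x) \<le> (K + 1) * N (x - y)" by (simp add: algebra_simps)
      also have "\<dots> \<le> (K + 1) * (r / (K + 2))" using y(2) K by (intro mult_left_mono) auto
      also have "\<dots> < r" using r K by (simp add: field_simps)
      finally show ?thesis using N_nonneg[OF V_diff[OF x SV[of n x]]] by simp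
    qed
    then show "\<exists>n0. \<forall>n\<ge>n0. norm (N (x - (\<Sum>k<n. f k x *\<^sub>R e k)) - 0) < r" unfolding S_def by blast
  qed
  have unique: "a = (\<lambda>k. f k x)" if x: "x \<in> V" and a: "is_expansion N e x a" for x a
  proof
    fix k
    define Y where "Y n = (\<Sum>k<n. a k *\<^sub>R e k)" for n
    have YV: "Y n \<in> V" for n unfolding Y_def by (intro V_sum V_scale e)
    have fY: "f k (Y n) = a k" if "Suc k \<le> n" for n
    proof -
      have "f k (sum g {..<n}) = (\<Sum>i<n. f k (g i))" if "\<And>i. g i \<in> V" for g :: "nat \<Rightarrow> 'v" and n
        using f_scale[OF V_zero, of k 0] by (induction n) (simp_all add: f_add V_sum that)
      then have "f k (Y n) = (\<Sum>i<n. a i * f k (e i))" unfolding Y_def by (simp add: V_scale e f_scale)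
      then show ?thesis using that by (simp add: f_e if_distrib[where f = "\<lambda>b. _ * b"] cong: if_cong)
    qed
    have "\<bar>f k x - a k\<bar> \<le> C * 0"
    proof (rule LIMSEQ_le_const)
      show "(\<lambda>n. C * N (x - Y n)) \<longlonglongrightarrow> C * 0"
        using a unfolding is_expansion_def Y_def by (intro tendsto_mult_left)
      have "\<bar>f k x - a k\<bar> \<le> C * N (x - Y n)" if "Suc k \<le> n" for n
      proof -
        have "f k (x - Y n) = f k x - f k (Y n)"
          using f_add[OF x V_minus[OF YV[of n]], of k] f_scale[OF YV[of n], of k "-1"] by simp
        then show ?thesis using f_bound[OF V_diff[OF x YV[of n]], of k] fY[OF that] by simp
      qed
      then show "\<exists>n0. \<forall>n\<ge>n0. \<bar>f k x - a k\<bar> \<le> C * N (x - Y n)" by blast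
    qed
    then show "a k = f k x" by simp
  qed
  show "normalized_schauder_basis V N e"
    unfolding normalized_schauder_basis_def using e conv unique by blast
  show "coordinate N e k x = f k x" if "x \<in> V"
  proof -
    have "(THE a. is_expansion N e x a) = (\<lambda>k. f k x)"
      by (rule the_equality) (use conv unique that in auto)
    then show ?thesis by (simp add: coordinate_def)
  qed
qed

end

lemma factorization_propertyI:
  assumes basis: "normalized_schauder_basis V N e"
    and coord: "\<And>x k. x \<in> V \<Longrightarrow> coordinate N e k x = f k x"
    and factor: "\<And>T \<delta>. bounded_operator_on V N T \<Longrightarrow> 0 < \<delta> \<Longrightarrow> (\<And>k. \<delta> \<le> \<bar>f k (T (e k))\<bar>) \<Longrightarrow>
      \<exists>R S. bounded_operator_on V N R \<and> bounded_operator_on V N S \<and> (\<forall>x\<in>V. S (T (R x)) = x)"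
  shows "factorization_property V N e"
  unfolding factorization_property_def
proof (intro conjI allI impI basis)
  fix T assume T: "bounded_operator_on V N T \<and> 0 < (INF k. \<bar>coordinate N e k (T (e k))\<bar>)"
  define \<delta> where "\<delta> = (INF k. \<bar>coordinate N e k (T (e k))\<bar>)"
  have "\<delta> \<le> \<bar>f k (T (e k))\<bar>" for k
  proof -
    have "T (e k) \<in> V" using T basis by (auto simp: bounded_operator_on_def normalized_schauder_basis_def)
    moreover have "\<delta> \<le> \<bar>coordinate N e k (T (e k))\<bar>"
      unfolding \<delta>_def by (rule cINF_lower) (auto intro!: bdd_belowI2[of _ 0])
    ultimately show ?thesis by (simp add: coord)
  qed
  then show "\<exists>R S. bounded_operator_on V N R \<and> bounded_operator_on V N S \<and> (\<forall>x\<in>V. S (T (R x)) = x)"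
    using T factor[of T \<delta>] unfolding \<delta>_def by blast
qed

lemma closure_approx:
  fixes S :: "'b::real_normed_vector set"
  assumes "closure S = UNIV" "0 < \<epsilon>" shows "\<exists>y\<in>S. norm (x - y) < \<epsilon>"
proof -
  have "x \<in> closure S" using assms(1) by simp
  then obtain y where "y \<in> S" "dist y x < \<epsilon>" using assms(2) unfolding closure_approachable by blast
  then show ?thesis by (auto simp: dist_norm norm_minus_commute)
qed

text \<open>
  A finite rank operator depends only on its kernel, not on the way the kernel is written as a sum of
  products.
\<close>

lemma kernel_operator:
  fixes u v u' v' :: "'i \<Rightarrow> 'a::euclidean_space \<Rightarrow> real"
  assumes "finite I" "finite I'"
    and u: "\<And>i. i \<in> I \<Longrightarrow> bounded_borel (u i)" "\<And>i. i \<in> I \<Longrightarrow> bounded_borel (v i)"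
    and u': "\<And>i. i \<in> I' \<Longrightarrow> bounded_borel (u' i)" "\<And>i. i \<in> I' \<Longrightarrow> bounded_borel (v' i)"
    and eq: "\<And>s t. (\<Sum>i\<in>I. u i s * v i t) = (\<Sum>i\<in>I'. u' i s * v' i t)"
  shows "(\<Sum>i\<in>I. pairing (u i) F *\<^sub>R to_L1 (v i)) = (\<Sum>i\<in>I'. pairing (u' i) F *\<^sub>R to_L1 (v' i))"
proof -
  have *: "(\<Sum>i\<in>I. pairing (u i) F *\<^sub>R to_L1 (v i)) = to_L1 (\<lambda>t. pairing (\<lambda>s. \<Sum>i\<in>I. u i s * v i t) F)"
    if "finite I" "\<And>i. i \<in> I \<Longrightarrow> bounded_borel (u i)" "\<And>i. i \<in> I \<Longrightarrow> bounded_borel (v i)"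
    for I and u v :: "'i \<Rightarrow> 'a \<Rightarrow> real"
  proof -
    have "(\<Sum>i\<in>I. pairing (u i) F *\<^sub>R to_L1 (v i)) = (\<Sum>i\<in>I. to_L1 (\<lambda>t. pairing (u i) F * v i t))"
      by (intro sum.cong refl to_L1_scale integrable_bounded_borel that)
    also have "\<dots> = to_L1 (\<lambda>t. \<Sum>i\<in>I. pairing (u i) F * v i t)"
      by (intro to_L1_sum that(1) integrable_bounded_borel bounded_borel_scale that(3))
    also have "(\<lambda>t. \<Sum>i\<in>I. pairing (u i) F * v i t) = (\<lambda>t. pairing (\<lambda>s. \<Sum>i\<in>I. u i s * v i t) F)"
    proof
      fix t
      have "pairing (\<lambda>s. \<Sum>i\<in>I. v i t * u i s) F = (\<Sum>i\<in>I. pairing (\<lambda>s. v i t * u i s) F)"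
        by (intro pairing_sum bounded_borel_scale that)
      also have "\<dots> = (\<Sum>i\<in>I. v i t * pairing (u i) F)" by (simp only: pairing_scale)
      finally show "(\<Sum>i\<in>I. pairing (u i) F * v i t) = pairing (\<lambda>s. \<Sum>i\<in>I. u i s * v i t) F"
        by (simp add: mult.commute)
    qed
    finally show ?thesis .
  qed
  show ?thesis using *[OF assms(1) u] *[OF assms(2) u'] eq by simp
qed

section \<open>The Haar system on the interval\<close>

definition haar_vec :: "nat \<Rightarrow> real L1" where "haar_vec l = 2 ^ node_level l *\<^sub>R to_L1 (haar_fn l)"

lemma integrable_haar_fn: "integrable cube_measure (haar_fn l)" by (rule integrable_bounded_borel[OF bounded_borel_haar_fn])

lemma norm_to_L1_haar_fn: "norm (to_L1 (haar_fn l)) = 1 / 2 ^ node_level l"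
  by (simp add: norm_to_L1[OF integrable_haar_fn] integral_abs_haar_fn)

lemma normalized_haar_node: "normalized_haar (node l) = haar_vec l"
  unfolding normalized_haar_def haar_fn_def[symmetric] norm_to_L1_haar_fn haar_vec_def by simp

lemma norm_haar_vec: "norm (haar_vec l) = 1"
  by (simp add: haar_vec_def norm_to_L1_haar_fn)

lemma pairing_haar_vec: "pairing (haar_fn k) (haar_vec l) = (if k = l then 1 else 0)"
  unfolding haar_vec_def linear_scale[OF linear_pairing[OF bounded_borel_haar_fn]] pairing_to_L1[OF bounded_borel_haar_fn integrable_haar_fn] haar_fn_orthogonal
  by simp

text \<open>
  With the adapted functions in place of the Haar functions the bound is the overlap of their supports.
\<close>

lemma haar_vec_partial_sum: "norm (\<Sum>l<n. pairing (haar_fn l) F *\<^sub>R haar_vec l) \<le> 2 * norm F"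
proof (cases "n = 0")
  case False
  define j where "j = floor_log n"
  have j: "2 ^ j \<le> n" "n \<le> 2 ^ Suc j"
    using floor_log_exp2_le[of n] floor_log_exp2_gt[of n] False by (auto simp: j_def)
  have "(\<Sum>l<n. pairing (haar_fn l) F *\<^sub>R haar_vec l) = (\<Sum>l<n. pairing (\<lambda>s. 2 ^ node_level l * haar_fn l s) F *\<^sub>R to_L1 (haar_fn l))"
    by (simp only: haar_vec_def pairing_scale scaleR_scaleR) (simp only: mult.commute)
  also have "\<dots> = (\<Sum>l<n. pairing (\<lambda>s. 2 ^ j * adapted j l s) F *\<^sub>R to_L1 (adapted j l))"
    by (rule kernel_operator) (use kernel_adapted[OF j] in \<open>auto simp: bounded_borel_haar_fn bounded_borel_adapted bounded_borel_scale
        sum_distrib_left mult.assoc\<close>)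
  also have "norm \<dots> \<le> (\<Sum>l<n. \<bar>pairing (adapted j l) F\<bar>)"
  proof (rule order_trans[OF norm_sum], rule sum_mono)
    fix l assume "l \<in> {..<n}"
    then have "norm (to_L1 (adapted j l)) = 1 / 2 ^ j"
      using j by (simp add: norm_to_L1 integrable_bounded_borel bounded_borel_adapted integral_abs_adapted)
    then show "norm (pairing (\<lambda>s. 2 ^ j * adapted j l s) F *\<^sub>R to_L1 (adapted j l)) \<le> \<bar>pairing (adapted j l) F\<bar>"
      by (simp add: pairing_scale abs_mult)
  qed
  also have "\<dots> \<le> 2 * norm F" by (rule sum_abs_pairing_le) (auto simp: bounded_borel_adapted sum_adapted_le[OF j(2)])
  finally show ?thesis .
qed simp

lemma atom_in_span: "i < 2 ^ j \<Longrightarrow> unit.atom j i \<in> span (range haar_vec)"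
proof -
  assume i: "i < 2 ^ j"
  have "unit.atom j i = to_L1 (\<lambda>t. \<Sum>l<2 ^ j. (2 ^ node_level l * haar_fn l (real i / 2 ^ j) / 2 ^ j) * haar_fn l t)"
    unfolding unit.atom_def using dcell_expansion[OF i] by presburger
  also have "\<dots> = (\<Sum>l<2 ^ j. (2 ^ node_level l * haar_fn l (real i / 2 ^ j) / 2 ^ j) *\<^sub>R to_L1 (haar_fn l))"
    by (simp only: to_L1_scale[OF integrable_haar_fn]) (rule to_L1_sum[symmetric], auto intro!: integrable_mult_right integrable_haar_fn simp del: times_divide_eq_left)
  also have "\<dots> = (\<Sum>l<2 ^ j. (haar_fn l (real i / 2 ^ j) / 2 ^ j) *\<^sub>R haar_vec l)"
    by (simp add: haar_vec_def mult.commute)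
  also have "\<dots> \<in> span (range haar_vec)" by (intro span_sum span_scale span_base) auto
  finally show ?thesis .
qed

lemma haar_vec_dense: "closure (span (range haar_vec)) = UNIV"
proof -
  have "span {unit.atom n i | n i. i < 2 ^ n} \<subseteq> span (range haar_vec)"
    by (rule span_minimal) (auto simp: atom_in_span)
  from closure_mono[OF this] show ?thesis unfolding unit.atoms_dense by auto
qed

lemma haar_vec_schauder:
  "normalized_schauder_basis UNIV norm haar_vec" "coordinate norm haar_vec k F = pairing (haar_fn k) F"
proof -
  interpret complete_normed "UNIV :: real L1 set" norm by (rule UNIV_complete_normed)
  note lin = linear_pairing[OF bounded_borel_haar_fn]
  note S = schauder_criterion[of haar_vec "\<lambda>k. pairing (haar_fn k)" 1 2]
  show "normalized_schauder_basis UNIV norm haar_vec"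
    by (rule S(1)) (auto simp: norm_haar_vec linear_add[OF lin] linear_scale[OF lin] pairing_haar_vec haar_vec_partial_sum
        abs_pairing_le[OF bounded_borel_haar_fn abs_haar_fn_le_1, simplified] intro: closure_approx[OF haar_vec_dense])
  show "coordinate norm haar_vec k F = pairing (haar_fn k) F"
    by (rule S(2)) (auto simp: norm_haar_vec linear_add[OF lin] linear_scale[OF lin] pairing_haar_vec haar_vec_partial_sum
        abs_pairing_le[OF bounded_borel_haar_fn abs_haar_fn_le_1, simplified] intro: closure_approx[OF haar_vec_dense])
qed

text \<open>
  The Haar function of a cell is a block of depth 1 with alternating signs.
\<close>

lemma unit_haar_cells:
  assumes \<tau>: "linear \<tau>" "\<And>F. norm (\<tau> F) \<le> C * norm F" and \<delta>: "0 < \<delta>"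
    and diag: "\<And>l. \<delta> \<le> \<bar>pairing (haar_fn l) (\<tau> (haar_vec l))\<bar>"
  shows "\<exists>k i. i < 2 ^ k \<and> \<delta> / 2 / 2 ^ k \<le> \<bar>unit.D \<tau> (unit.cell_ind k i)\<bar>"
proof (rule unit.good_cell[OF \<tau> \<delta>])
  fix n :: nat
  have two: "(\<Sum>u<2. g u) = g 0 + g (1::nat)" for g :: "nat \<Rightarrow> 'z::comm_monoid_add"
    by (simp add: numeral_2_eq_2)
  have "\<delta> / 2 ^ n \<le> \<bar>\<Sum>u<2 ^ 1. (- 1) ^ (2 ^ 1 * i + u) * unit.E (n + 1) (2 ^ 1 * i + u)
          (\<tau> (\<Sum>v<2 ^ 1. (- 1) ^ (2 ^ 1 * i + v) *\<^sub>R unit.atom (n + 1) (2 ^ 1 * i + v)))\<bar>" if i: "i < 2 ^ n" for i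
  proof -
    have h: "haar_fn (2 ^ n + i) = (\<lambda>x. indicator (dcell (Suc n) (2 * i)) x - indicator (dcell (Suc n) (2 * i + 1)) x)"
      using haar_fn_node[OF i] by blast
    have a: "(\<Sum>v<2 ^ 1. (- 1) ^ (2 ^ 1 * i + v) *\<^sub>R unit.atom (n + 1) (2 ^ 1 * i + v)) = to_L1 (haar_fn (2 ^ n + i))"
      by (simp add: two h unit.atom_def to_L1_diff[OF unit.integrable_cell unit.integrable_cell])
    have e: "(\<Sum>u<2 ^ 1. (- 1) ^ (2 ^ 1 * i + u) * unit.E (n + 1) (2 ^ 1 * i + u) G) = pairing (haar_fn (2 ^ n + i)) G" for G
      by (simp add: two h unit.E_def pairing_diff[OF unit.bounded_borel_cell unit.bounded_borel_cell])
    have "\<delta> \<le> 2 ^ n * \<bar>pairing (haar_fn (2 ^ n + i)) (\<tau> (to_L1 (haar_fn (2 ^ n + i))))\<bar>"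
      using diag[of "2 ^ n + i"] unfolding haar_vec_def node_level_node[OF i] linear_scale[OF \<tau>(1)]
        linear_scale[OF linear_pairing[OF bounded_borel_haar_fn]] by (simp add: abs_mult)
    then show ?thesis unfolding a e by (simp add: field_simps)
  qed
  moreover have "\<bar>(- 1 :: real) ^ u\<bar> = 1" for u :: nat by simp
  ultimately show "\<exists>k\<ge>n. \<exists>r \<theta>. (\<forall>u. \<bar>\<theta> u\<bar> = 1) \<and> (\<forall>i<2 ^ k. \<delta> / 2 ^ k \<le>
      \<bar>\<Sum>u<2 ^ r. \<theta> (2 ^ r * i + u) * unit.E (k + r) (2 ^ r * i + u)
          (\<tau> (\<Sum>v<2 ^ r. \<theta> (2 ^ r * i + v) *\<^sub>R unit.atom (k + r) (2 ^ r * i + v)))\<bar>)"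
    by (intro exI[of _ n] conjI order_refl exI[of _ 1] exI[of _ "\<lambda>u. (- 1) ^ u"] allI impI) blast+
qed

lemma L1_factorization: "factorization_property UNIV norm haar_vec"
proof (rule factorization_propertyI[OF haar_vec_schauder(1), of "\<lambda>k. pairing (haar_fn k)"])
  interpret direct_sum unit.atom unit.E UNIV norm "{0}" "\<lambda>_ a. a" "\<lambda>_ a. a"
    by (rule unit.direct_sum_UNIV)
  fix T :: "real L1 \<Rightarrow> real L1" and \<delta> :: real
  assume T: "bounded_operator_on UNIV norm T" and \<delta>: "0 < \<delta>" and diag: "\<And>k. \<delta> \<le> \<bar>pairing (haar_fn k) (T (haar_vec k))\<bar>"
  have bl: "bounded_linear T" using T by (simp add: bounded_operator_on_UNIV)
  obtain C where C: "\<And>F. norm (T F) \<le> C * norm F" using bounded_linear.bounded[OF bl] by (auto simp: mult.commute)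
  have "\<exists>k i. i < 2 ^ k \<and> \<delta> / 2 / 2 ^ k \<le> \<bar>unit.D T (unit.cell_ind k i)\<bar>"
    by (rule unit_haar_cells[OF _ C \<delta> diag]) (use bl in \<open>simp add: bounded_linear.linear\<close>)
  then show "\<exists>R S. bounded_operator_on UNIV norm R \<and> bounded_operator_on UNIV norm S \<and> (\<forall>x\<in>UNIV. S (T (R x)) = x)"
    by (intro identity_factors[OF T, of "\<delta> / 2"]) (use \<delta> in auto)
qed (rule haar_vec_schauder(2))

section \<open>The Haar system in sequence spaces\<close>

definition lp_vec :: "nat \<Rightarrow> nat \<Rightarrow> real L1" where
  "lp_vec q = (case prod_decode q of (m, l) \<Rightarrow> unit_tensor m (haar_vec l))"

definition lp_coord :: "nat \<Rightarrow> (nat \<Rightarrow> real L1) \<Rightarrow> real" where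
  "lp_coord q y = (case prod_decode q of (m, l) \<Rightarrow> pairing (haar_fn l) (y m))"

lemma prod_encode_initial: "\<exists>L. {l. prod_encode (m, l) < n} = {..<L}"
proof -
  define L where "L = (LEAST l. n \<le> prod_encode (m, l))"
  have ex: "n \<le> prod_encode (m, n)" by (rule le_prod_encode_2)
  have "prod_encode (m, l) < n \<longleftrightarrow> l < L" for l
  proof
    assume "l < L" then show "prod_encode (m, l) < n" unfolding L_def using not_less_Least by (meson not_le)
  next
    assume lt: "prod_encode (m, l) < n"
    have "n \<le> prod_encode (m, L)" unfolding L_def by (rule LeastI[of _ n]) (rule ex)
    then show "l < L" using lt prod_encode_mono[of L l m] by (cases "L = l") (auto simp: not_le[symmetric] not_less)
  qed
  then show ?thesis by blast
qed

text \<open>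
  In each coordinate a partial sum is one of the Haar expansion, since \<open>prod_encode\<close> is increasing in
  its second argument.
\<close>

lemma lp_partial_component: "\<exists>L. (\<Sum>k<n. lp_coord k x *\<^sub>R lp_vec k) m = (\<Sum>l<L. pairing (haar_fn l) (x m) *\<^sub>R haar_vec l)"
proof -
  obtain L where L: "{l. prod_encode (m, l) < n} = {..<L}" using prod_encode_initial by blast
  let ?I = "{k. k < n \<and> fst (prod_decode k) = m}"
  have I: "?I = (\<lambda>l. prod_encode (m, l)) ` {..<L}"
  proof (rule set_eqI)
    fix k
    have "k \<in> ?I \<longleftrightarrow> (\<exists>l. k = prod_encode (m, l) \<and> prod_encode (m, l) < n)"
      by (auto simp: split_paired_all) (metis prod.collapse prod_decode_inverse)
    then show "k \<in> ?I \<longleftrightarrow> k \<in> (\<lambda>l. prod_encode (m, l)) ` {..<L}" unfolding L[symmetric] by auto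
  qed
  have "(\<Sum>k<n. lp_coord k x *\<^sub>R lp_vec k) m = (\<Sum>k<n. if fst (prod_decode k) = m then lp_coord k x *\<^sub>R lp_vec k m else 0)"
    unfolding sum_apply by (intro sum.cong) (auto simp: scaleR_fun_def lp_vec_def unit_tensor_def split: prod.splits)
  also have "\<dots> = (\<Sum>k\<in>?I. lp_coord k x *\<^sub>R lp_vec k m)"
    by (subst sum.inter_filter[symmetric]) (auto intro!: sum.cong)
  also have "\<dots> = (\<Sum>l<L. lp_coord (prod_encode (m, l)) x *\<^sub>R lp_vec (prod_encode (m, l)) m)"
    unfolding I by (subst sum.reindex) (auto simp: inj_on_def)
  also have "\<dots> = (\<Sum>l<L. pairing (haar_fn l) (x m) *\<^sub>R haar_vec l)"
    by (simp add: lp_coord_def lp_vec_def unit_tensor_def)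
  finally show ?thesis by blast
qed

context
  fixes p :: real assumes p: "1 \<le> p"
begin

lemma lp_schauder:
  "normalized_schauder_basis (lp_carrier p) (lp_norm p) lp_vec"
  "y \<in> lp_carrier p \<Longrightarrow> coordinate (lp_norm p) lp_vec k y = lp_coord k y"
proof -
  interpret complete_normed "lp_carrier p :: (nat \<Rightarrow> real L1) set" "lp_norm p" by (rule lp_complete_normed[OF p])
  note lin = linear_pairing[OF bounded_borel_haar_fn]
  have ut_linear: "linear (unit_tensor m :: real L1 \<Rightarrow> _)" for m
    by (rule linearI) (auto simp: unit_tensor_def scaleR_fun_def)
  have e: "lp_vec k \<in> lp_carrier p" "lp_norm p (lp_vec k) = 1" for k
    by (auto simp: lp_vec_def unit_tensor_lp[OF p] norm_haar_vec split: prod.split)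
  have add: "lp_coord k (x + y) = lp_coord k x + lp_coord k y" for k x y
    by (simp add: lp_coord_def linear_add[OF lin] split: prod.split)
  have scale: "lp_coord k (c *\<^sub>R x) = c * lp_coord k x" for k c x
    by (simp add: lp_coord_def scaleR_fun_def linear_scale[OF lin] split: prod.split)
  have bound: "\<bar>lp_coord k x\<bar> \<le> 1 * lp_norm p x" if x: "x \<in> lp_carrier p" for k x
  proof -
    obtain m l where ml: "prod_decode k = (m, l)" by force
    have "\<bar>pairing (haar_fn l) (x m)\<bar> \<le> 1 * norm (x m)" by (rule abs_pairing_le[OF bounded_borel_haar_fn abs_haar_fn_le_1])
    then show ?thesis using lp_component[OF p x, of m] by (simp add: lp_coord_def ml)
  qed
  have biorth: "lp_coord k (lp_vec l) = (if k = l then 1 else 0)" for k l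
  proof -
    obtain m i m' i' where d: "prod_decode k = (m, i)" "prod_decode l = (m', i')" by force
    have "k = l \<longleftrightarrow> (m, i) = (m', i')" using d by (metis prod_decode_inverse)
    then show ?thesis by (auto simp: lp_coord_def lp_vec_def d unit_tensor_def pairing_haar_vec linear_0[OF lin])
  qed
  have partial: "lp_norm p (\<Sum>k<n. lp_coord k x *\<^sub>R lp_vec k) \<le> 2 * lp_norm p x" if x: "x \<in> lp_carrier p" for n x
  proof (rule lp_mono(2)[OF p x])
    fix m
    obtain L where "(\<Sum>k<n. lp_coord k x *\<^sub>R lp_vec k) m = (\<Sum>l<L. pairing (haar_fn l) (x m) *\<^sub>R haar_vec l)"
      using lp_partial_component by blast
    then show "norm ((\<Sum>k<n. lp_coord k x *\<^sub>R lp_vec k) m) \<le> 2 * norm (x m)" using haar_vec_partial_sum by simp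
  qed simp
  have dense: "\<exists>y\<in>span (range lp_vec). lp_norm p (x - y) < \<epsilon>" if x: "x \<in> lp_carrier p" and \<epsilon>: "0 < \<epsilon>" for x \<epsilon>
  proof -
    have "\<forall>\<^sub>F n in sequentially. lp_norm p (x - (\<Sum>m<n. unit_tensor m (x m))) < \<epsilon> / 2"
      using order_tendstoD(2)[OF lp_expand[OF p x], of "\<epsilon> / 2"] \<epsilon> by simp
    then obtain n where n: "lp_norm p (x - (\<Sum>m<n. unit_tensor m (x m))) < \<epsilon> / 2"
      unfolding eventually_sequentially by blast
    define \<delta> where "\<delta> = \<epsilon> / (2 * real (Suc n))"
    have \<delta>: "0 < \<delta>" using \<epsilon> by (simp add: \<delta>_def)
    have "\<forall>m. \<exists>z\<in>span (range haar_vec). norm (x m - z) < \<delta>" using closure_approx[OF haar_vec_dense \<delta>] by blast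
    then obtain z where z: "\<And>m. z m \<in> span (range haar_vec)" "\<And>m. norm (x m - z m) < \<delta>" by metis
    define y where "y = (\<Sum>m<n. unit_tensor m (z m))"
    have "unit_tensor m (z m) \<in> span (range lp_vec)" for m
    proof -
      have "unit_tensor m (z m) \<in> unit_tensor m ` span (range haar_vec)" using z(1) by blast
      also have "\<dots> = span (unit_tensor m ` range haar_vec)" by (rule linear_span_image[OF ut_linear, symmetric])
      also have "\<dots> \<subseteq> span (range lp_vec)"
      proof (rule span_mono, rule image_subsetI)
        fix v assume "v \<in> range haar_vec"
        then obtain l where "v = haar_vec l" by blast
        then have "unit_tensor m v = lp_vec (prod_encode (m, l))" by (simp add: lp_vec_def)
        then show "unit_tensor m v \<in> range lp_vec" by blast
      qed
      finally show ?thesis .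
    qed
    then have yS: "y \<in> span (range lp_vec)" unfolding y_def by (intro span_sum)
    have V: "(\<Sum>m<n. unit_tensor m (w m)) \<in> lp_carrier p" for w :: "nat \<Rightarrow> real L1"
      by (intro V_sum unit_tensor_lp[OF p])
    have "lp_norm p ((\<Sum>m<n. unit_tensor m (x m)) - y) = lp_norm p (\<Sum>m<n. unit_tensor m (x m - z m))"
      unfolding y_def by (simp only: sum_subtractf linear_diff[OF ut_linear])
    also have "\<dots> \<le> (\<Sum>m<n. lp_norm p (unit_tensor m (x m - z m)))" by (intro N_sum unit_tensor_lp[OF p])
    also have "\<dots> \<le> (\<Sum>m<n. \<delta>)" using z(2) by (intro sum_mono) (simp add: unit_tensor_lp[OF p] less_imp_le)
    also have "\<dots> < \<epsilon> / 2" using \<epsilon> by (simp add: \<delta>_def field_simps)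
    finally have "lp_norm p (x - y) < \<epsilon>"
      using N_triangle[OF x V[of x] V[of z], folded y_def] n by linarith
    with yS show ?thesis by blast
  qed
  note S = schauder_criterion[of lp_vec lp_coord 1 2, OF e add scale bound biorth partial dense]
  show "normalized_schauder_basis (lp_carrier p) (lp_norm p) lp_vec" by (rule S(1))
  show "coordinate (lp_norm p) lp_vec k y = lp_coord k y" if "y \<in> lp_carrier p" by (rule S(2)) (use that in auto)
qed

lemma lp_factorization: "factorization_property (lp_carrier p) (lp_norm p) lp_vec"
proof (rule factorization_propertyI[OF lp_schauder(1), of lp_coord])
  interpret direct_sum unit.atom unit.E "lp_carrier p" "lp_norm p" UNIV unit_tensor "\<lambda>m f. f m"
    by (rule direct_sum_lp[OF p unit.l1_tree_axioms])
  fix T :: "(nat \<Rightarrow> real L1) \<Rightarrow> nat \<Rightarrow> real L1" and \<delta> :: real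
  assume T: "bounded_operator_on (lp_carrier p) (lp_norm p) T" and \<delta>: "0 < \<delta>"
    and diag: "\<And>k. \<delta> \<le> \<bar>lp_coord k (T (lp_vec k))\<bar>"
  have T_add: "T (x + y) = T x + T y" if "x \<in> lp_carrier p" "y \<in> lp_carrier p" for x y
    using T that by (auto simp: bounded_operator_on_def)
  have T_scale: "T (c *\<^sub>R x) = c *\<^sub>R T x" if "x \<in> lp_carrier p" for c x
    using T that by (auto simp: bounded_operator_on_def)
  have TV: "T x \<in> lp_carrier p" if "x \<in> lp_carrier p" for x using T that by (auto simp: bounded_operator_on_def)
  obtain C where C: "0 \<le> C" "\<And>y. y \<in> lp_carrier p \<Longrightarrow> lp_norm p (T y) \<le> C * lp_norm p y"
    using operator_bound[OF T] by blast
  have "\<exists>k i. i < 2 ^ k \<and> \<delta> / 2 / 2 ^ k \<le> \<bar>unit.D (\<lambda>a. T (unit_tensor m a) m) (unit.cell_ind k i)\<bar>" for m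
  proof (rule unit_haar_cells[OF _ _ \<delta>])
    show "linear (\<lambda>a. T (unit_tensor m a) m)"
    proof (rule linearI)
      show "T (unit_tensor m (a + b)) m = T (unit_tensor m a) m + T (unit_tensor m b) m" for a b
        by (simp add: linear_add[OF \<iota>_linear] T_add \<iota>_V)
      have "T (unit_tensor m (c *\<^sub>R a)) = c *\<^sub>R T (unit_tensor m a)" for c a
        by (simp add: linear_scale[OF \<iota>_linear] T_scale \<iota>_V)
      then show "T (unit_tensor m (c *\<^sub>R a)) m = c *\<^sub>R T (unit_tensor m a) m" for c a
        by (simp add: scaleR_fun_def)
    qed
    show "norm (T (unit_tensor m a) m) \<le> C * norm a" for a
    proof -
      have "norm (T (unit_tensor m a) m) \<le> lp_norm p (T (unit_tensor m a))" by (intro lp_component[OF p] TV \<iota>_V) simp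
      also have "\<dots> \<le> C * norm a" using C(2)[OF \<iota>_V, of m a] by (simp add: unit_tensor_lp[OF p])
      finally show ?thesis .
    qed
    show "\<delta> \<le> \<bar>pairing (haar_fn l) (T (unit_tensor m (haar_vec l)) m)\<bar>" for l
      using diag[of "prod_encode (m, l)"] by (simp add: lp_coord_def lp_vec_def)
  qed
  then show "\<exists>R S. bounded_operator_on (lp_carrier p) (lp_norm p) R \<and> bounded_operator_on (lp_carrier p) (lp_norm p) S \<and>
      (\<forall>x\<in>lp_carrier p. S (T (R x)) = x)"
    by (intro identity_factors[OF T, of "\<delta> / 2"]) (use \<delta> in auto)
qed (rule lp_schauder(2))

end

section \<open>The bi-parameter Haar system\<close>

definition tens :: "(real \<Rightarrow> real) \<Rightarrow> (real \<Rightarrow> real) \<Rightarrow> real \<times> real \<Rightarrow> real" where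
  "tens f g z = f (fst z) * g (snd z)"

lemma bounded_borel_tens:
  assumes "bounded_borel f" "bounded_borel g" shows "bounded_borel (tens f g)"
proof -
  have 1: "bounded_borel (\<lambda>z. f (fst z))" if "bounded_borel f" for f :: "real \<Rightarrow> real"
    using that measurable_compose[OF borel_measurable_continuous_onI[OF continuous_on_fst[OF continuous_on_id]], of f]
    by (auto simp: bounded_borel_def)
  have 2: "bounded_borel (\<lambda>z. f (snd z))" if "bounded_borel f" for f :: "real \<Rightarrow> real"
    using that measurable_compose[OF borel_measurable_continuous_onI[OF continuous_on_snd[OF continuous_on_id]], of f]
    by (auto simp: bounded_borel_def)
  show ?thesis unfolding tens_def[abs_def] by (intro bounded_borel_mult 1 2 assms)
qed

lemma integrable_tens: "bounded_borel f \<Longrightarrow> bounded_borel g \<Longrightarrow> integrable cube_measure (tens f g)"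
  by (intro integrable_bounded_borel bounded_borel_tens)

lemma integral_tens:
  assumes f: "bounded_borel f" and g: "bounded_borel g"
  shows "(LINT z|cube_measure. tens f g z) = (LINT s|cube_measure. f s) * (LINT t|cube_measure. g t)"
proof -
  let ?I = "indicator {0..1} :: real \<Rightarrow> real"
  have cube1: "(LINT s|cube_measure. h s) = (LINT s|lborel. ?I s * h s)" for h :: "real \<Rightarrow> real"
    unfolding cube_measure_def cube_real by (subst integral_restrict_space) auto
  have ind: "indicator ({0..1} \<times> {0..1}) z = ?I (fst z) * ?I (snd z)" for z :: "real \<times> real"
    by (cases z) (simp add: indicator_times)
  have int: "integrable (lborel \<Otimes>\<^sub>M lborel) (\<lambda>(s, t). (?I s * f s) * (?I t * g t))"
  proof -
    have "integrable (restrict_space lborel (cbox 0 One)) (tens f g)"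
      using integrable_tens[OF f g] by (simp add: cube_measure_def)
    then have "integrable lborel (\<lambda>z. indicator (cbox 0 One) z *\<^sub>R tens f g z)"
      by (subst (asm) integrable_restrict_space) auto
    moreover have "(\<lambda>z. indicator (cbox 0 One) z *\<^sub>R tens f g z) = (\<lambda>(s, t). (?I s * f s) * (?I t * g t))"
      by (auto simp: cube_real2 ind tens_def mult_ac)
    ultimately show ?thesis unfolding lborel_prod by simp
  qed
  have "(LINT z|cube_measure. tens f g z) = (LINT z|lborel. indicator ({0..1} \<times> {0..1}) z *\<^sub>R tens f g z)"
    unfolding cube_measure_def cube_real2 by (subst integral_restrict_space) (auto intro!: borel_closed closed_Times)
  also have "\<dots> = (LINT z|(lborel \<Otimes>\<^sub>M lborel). (case z of (s, t) \<Rightarrow> (?I s * f s) * (?I t * g t)))"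
    unfolding lborel_prod ind by (intro Bochner_Integration.integral_cong) (auto simp: tens_def mult_ac)
  also have "\<dots> = (LINT s|lborel. LINT t|lborel. (?I s * f s) * (?I t * g t))"
    using lborel_pair.integral_fst'[OF int] by simp
  also have "\<dots> = (LINT s|cube_measure. f s) * (LINT t|cube_measure. g t)"
    unfolding cube1 by simp
  finally show ?thesis .
qed

definition haar2_fn :: "nat \<times> nat \<Rightarrow> real \<times> real \<Rightarrow> real" where "haar2_fn = (\<lambda>(i, j). tens (haar_fn i) (haar_fn j))"
definition haar2_vec :: "nat \<times> nat \<Rightarrow> (real \<times> real) L1" where
  "haar2_vec = (\<lambda>(i, j). (2 ^ node_level i * 2 ^ node_level j) *\<^sub>R to_L1 (haar2_fn (i, j)))"

lemma haar2_fn_haar: "haar2_fn (i, j) = haar_tensor (node i) (node j)"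
  by (auto simp: haar2_fn_def haar_tensor_def tens_def haar_fn_def)

lemma bounded_borel_haar2_fn: "bounded_borel (haar2_fn ij)"
  by (cases ij) (simp add: haar2_fn_def bounded_borel_tens bounded_borel_haar_fn)

lemma integrable_haar2_fn: "integrable cube_measure (haar2_fn ij)" by (rule integrable_bounded_borel[OF bounded_borel_haar2_fn])

lemma abs_haar2_fn_le_1: "\<bar>haar2_fn ij z\<bar> \<le> 1"
  by (cases ij) (auto simp: haar2_fn_def tens_def abs_mult intro: mult_le_one abs_haar_fn_le_1)

lemma bounded_borel_abs: "bounded_borel f \<Longrightarrow> bounded_borel (\<lambda>x. \<bar>f x\<bar>)"
  by (auto simp: bounded_borel_def)

lemma norm_to_L1_tens:
  assumes "bounded_borel f" "bounded_borel g"
  shows "norm (to_L1 (tens f g)) = (LINT s|cube_measure. \<bar>f s\<bar>) * (LINT t|cube_measure. \<bar>g t\<bar>)"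
proof -
  have "(\<lambda>z. \<bar>tens f g z\<bar>) = tens (\<lambda>s. \<bar>f s\<bar>) (\<lambda>t. \<bar>g t\<bar>)" by (auto simp: tens_def abs_mult)
  then show ?thesis using integral_tens[OF bounded_borel_abs[OF assms(1)] bounded_borel_abs[OF assms(2)]]
    by (simp add: norm_to_L1[OF integrable_tens[OF assms]])
qed

lemma norm_to_L1_haar2_fn: "norm (to_L1 (haar2_fn (i, j))) = 1 / (2 ^ node_level i * 2 ^ node_level j)"
  by (simp add: haar2_fn_def norm_to_L1_tens bounded_borel_haar_fn integral_abs_haar_fn)

lemma normalized_haar2_node: "normalized_haar2 (node i, node j) = haar2_vec (i, j)"
  unfolding normalized_haar2_def prod.case haar2_fn_haar[symmetric] norm_to_L1_haar2_fn haar2_vec_def by simp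

lemma norm_haar2_vec: "norm (haar2_vec ij) = 1"
  by (cases ij) (simp add: haar2_vec_def norm_to_L1_haar2_fn)

lemma pairing_haar2_vec: "pairing (haar2_fn ij) (haar2_vec kl) = (if ij = kl then 1 else 0)"
proof -
  obtain i j k l where ij: "ij = (i, j)" "kl = (k, l)" by force
  have "(LINT z|cube_measure. haar2_fn (i, j) z * haar2_fn (k, l) z) = (LINT z|cube_measure. tens (\<lambda>s. haar_fn i s * haar_fn k s) (\<lambda>t. haar_fn j t * haar_fn l t) z)"
    by (simp add: haar2_fn_def tens_def mult_ac)
  also have "\<dots> = (if i = k then 1 / 2 ^ node_level i else 0) * (if j = l then 1 / 2 ^ node_level j else 0)"
    by (simp add: integral_tens bounded_borel_mult bounded_borel_haar_fn haar_fn_orthogonal)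
  finally have "(LINT z|cube_measure. haar2_fn (i, j) z * haar2_fn (k, l) z) = (if i = k then 1 / 2 ^ node_level i else 0) * (if j = l then 1 / 2 ^ node_level j else 0)" .
  then show ?thesis
    unfolding ij haar2_vec_def prod.case linear_scale[OF linear_pairing[OF bounded_borel_haar2_fn]] pairing_to_L1[OF bounded_borel_haar2_fn integrable_haar2_fn]
    by auto
qed

text \<open>
  The kernel is a product of two kernels of Haar partial sums, so it can be rewritten with tensors of
  adapted functions, at most \<open>2 * 2\<close> of which overlap.
\<close>

lemma rectangle_sum: "norm (\<Sum>ij\<in>{..<A} \<times> {..<B}. pairing (haar2_fn ij) F *\<^sub>R haar2_vec ij) \<le> 4 * norm F"
proof (cases "A = 0 \<or> B = 0")
  case False
  define a b where "a = floor_log A" and "b = floor_log B"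
  have a: "2 ^ a \<le> A" "A \<le> 2 ^ Suc a" and b: "2 ^ b \<le> B" "B \<le> 2 ^ Suc b"
    using floor_log_exp2_le[of A] floor_log_exp2_gt[of A] floor_log_exp2_le[of B] floor_log_exp2_gt[of B] False
    by (auto simp: a_def b_def)
  define pr where "pr = (\<lambda>(i, j). tens (adapted a i) (adapted b j))"
  have pr: "bounded_borel (pr ij)" for ij by (cases ij) (simp add: pr_def bounded_borel_tens bounded_borel_adapted)
  let ?I = "{..<A} \<times> {..<B}"
  define ww where "ww = (\<lambda>(i, j). 2 ^ node_level i * 2 ^ node_level j :: real)"
  have "(\<Sum>ij\<in>?I. pairing (haar2_fn ij) F *\<^sub>R haar2_vec ij) = (\<Sum>ij\<in>?I. pairing (\<lambda>z. ww ij * haar2_fn ij z) F *\<^sub>R to_L1 (haar2_fn ij))"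
    unfolding pairing_scale by (intro sum.cong refl) (auto simp: haar2_vec_def ww_def mult_ac)
  also have "\<dots> = (\<Sum>ij\<in>?I. pairing (\<lambda>z. (2 ^ a * 2 ^ b) * pr ij z) F *\<^sub>R to_L1 (pr ij))"
  proof (rule kernel_operator)
    fix z w :: "real \<times> real"
    have prod: "(\<Sum>ij\<in>?I. (case ij of (i, j) \<Rightarrow> g i * h j)) = (\<Sum>i<A. g i) * (\<Sum>j<B. h j)" for g h :: "nat \<Rightarrow> real"
      by (simp add: sum_product sum.cartesian_product)
    have "(\<Sum>ij\<in>?I. (ww ij * haar2_fn ij z) * haar2_fn ij w) = (\<Sum>ij\<in>?I. (case ij of (i, j) \<Rightarrow>
        (2 ^ node_level i * haar_fn i (fst z) * haar_fn i (fst w)) * (2 ^ node_level j * haar_fn j (snd z) * haar_fn j (snd w))))"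
      by (intro sum.cong refl) (auto simp: ww_def haar2_fn_def tens_def mult_ac)
    also have "\<dots> = (2 ^ a * (\<Sum>i<A. adapted a i (fst z) * adapted a i (fst w))) * (2 ^ b * (\<Sum>j<B. adapted b j (snd z) * adapted b j (snd w)))"
      unfolding prod kernel_adapted[OF a] kernel_adapted[OF b] ..
    also have "\<dots> = (2 ^ a * 2 ^ b) * (\<Sum>ij\<in>?I. (case ij of (i, j) \<Rightarrow>
        (adapted a i (fst z) * adapted a i (fst w)) * (adapted b j (snd z) * adapted b j (snd w))))"
      unfolding prod by (simp only: mult_ac)
    also have "\<dots> = (\<Sum>ij\<in>?I. ((2 ^ a * 2 ^ b) * pr ij z) * pr ij w)"
      unfolding sum_distrib_left by (intro sum.cong refl) (auto simp: pr_def tens_def mult_ac)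
    finally show "(\<Sum>ij\<in>?I. (ww ij * haar2_fn ij z) * haar2_fn ij w) = (\<Sum>ij\<in>?I. ((2 ^ a * 2 ^ b) * pr ij z) * pr ij w)" .
  qed (auto intro!: bounded_borel_scale bounded_borel_haar2_fn pr)
  also have "norm \<dots> \<le> (\<Sum>ij\<in>?I. \<bar>pairing (pr ij) F\<bar>)"
  proof (rule order_trans[OF norm_sum], rule sum_mono)
    fix ij assume "ij \<in> ?I"
    then obtain i j where ij: "ij = (i, j)" "i < 2 ^ Suc a" "j < 2 ^ Suc b" using a b by auto
    have "norm (to_L1 (pr ij)) = 1 / 2 ^ a * (1 / 2 ^ b)"
      unfolding ij(1) pr_def prod.case norm_to_L1_tens[OF bounded_borel_adapted bounded_borel_adapted]
        integral_abs_adapted[OF ij(2)] integral_abs_adapted[OF ij(3)] ..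
    then show "norm (pairing (\<lambda>z. (2 ^ a * 2 ^ b) * pr ij z) F *\<^sub>R to_L1 (pr ij)) \<le> \<bar>pairing (pr ij) F\<bar>"
      unfolding pairing_scale by (simp add: abs_mult)
  qed
  also have "\<dots> \<le> 4 * norm F"
  proof (rule sum_abs_pairing_le[OF pr])
    fix z :: "real \<times> real"
    have "(\<Sum>ij\<in>?I. \<bar>pr ij z\<bar>) = (\<Sum>i<A. \<bar>adapted a i (fst z)\<bar>) * (\<Sum>j<B. \<bar>adapted b j (snd z)\<bar>)"
      by (simp add: pr_def tens_def abs_mult sum_product sum.cartesian_product case_prod_beta)
    also have "\<dots> \<le> 2 * 2" by (intro mult_mono sum_adapted_le a b sum_nonneg) auto
    finally show "(\<Sum>ij\<in>?I. \<bar>pr ij z\<bar>) \<le> 4" by simp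
  qed
  finally show ?thesis .
qed auto

text \<open>
  The order by square shells: shell \<open>r\<close> runs through \<open>(0, r), \<dots>, (r - 1, r)\<close> and then through
  \<open>(r, 0), \<dots>, (r, r)\<close>, starting at position \<open>r\<^sup>2\<close>.
\<close>

definition shell :: "nat \<Rightarrow> nat \<times> nat" where
  "shell q = (let r = floor_sqrt q; d = q - r\<^sup>2 in if d < r then (d, r) else (r, d - r))"

lemma floor_sqrt_shell: "d \<le> 2 * r \<Longrightarrow> floor_sqrt (r\<^sup>2 + d) = r"
  by (rule floor_sqrt_unique) (auto simp: power2_eq_square)

lemma shell_low: "d < r \<Longrightarrow> shell (r\<^sup>2 + d) = (d, r)"
  by (simp add: shell_def floor_sqrt_shell)

lemma shell_high: "d \<le> r \<Longrightarrow> shell (r\<^sup>2 + r + d) = (r, d)"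
  using floor_sqrt_shell[of "r + d" r] by (simp add: shell_def add.assoc)

lemma shell_index:
  fixes q :: nat
  obtains r d where "q = r\<^sup>2 + d" "d < r" | r d where "q = r\<^sup>2 + r + d" "d \<le> r"
proof -
  define r where "r = floor_sqrt q"
  have r: "r\<^sup>2 \<le> q" "q < (Suc r)\<^sup>2" using floor_sqrt_power2_le[of q] Suc_floor_sqrt_power2_gt[of q] by (simp_all add: r_def)
  have "q - r\<^sup>2 \<le> 2 * r" using r by (simp add: power2_eq_square)
  show ?thesis
  proof (cases "q - r\<^sup>2 < r")
    case True then show ?thesis using that(1)[of r "q - r\<^sup>2"] r by simp
  next
    case False
    then show ?thesis using that(2)[of r "q - r\<^sup>2 - r"] r \<open>q - r\<^sup>2 \<le> 2 * r\<close> by simp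
  qed
qed

lemma bij_shell: "bij shell"
proof (rule bij_betw_byWitness[of _ "\<lambda>(i, j). if i < j then j\<^sup>2 + i else i\<^sup>2 + i + j"])
  show "\<forall>q\<in>UNIV. (case shell q of (i, j) \<Rightarrow> if i < j then j\<^sup>2 + i else i\<^sup>2 + i + j) = q"
  proof
    fix q show "(case shell q of (i, j) \<Rightarrow> if i < j then j\<^sup>2 + i else i\<^sup>2 + i + j) = q"
      by (rule shell_index[of q]) (auto simp: shell_low shell_high)
  qed
  show "\<forall>ij\<in>UNIV. shell (case ij of (i, j) \<Rightarrow> if i < j then j\<^sup>2 + i else i\<^sup>2 + i + j) = ij"
    by (auto simp: shell_low shell_high)
qed auto

lemma sum_shell:
  fixes g :: "nat \<times> nat \<Rightarrow> 'z::comm_monoid_add"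
  shows "(\<Sum>k<r\<^sup>2. g (shell k)) = (\<Sum>ij\<in>{..<r} \<times> {..<r}. g ij)"
    and "d \<le> r \<Longrightarrow> (\<Sum>k<r\<^sup>2 + d. g (shell k)) = (\<Sum>k<r\<^sup>2. g (shell k)) + (\<Sum>i<d. g (i, r))"
    and "d \<le> Suc r \<Longrightarrow> (\<Sum>k<r\<^sup>2 + r + d. g (shell k)) = (\<Sum>k<r\<^sup>2. g (shell k)) + (\<Sum>i<r. g (i, r)) + (\<Sum>j<d. g (r, j))"
proof -
  have low: "(\<Sum>k<r\<^sup>2 + d. g (shell k)) = (\<Sum>k<r\<^sup>2. g (shell k)) + (\<Sum>i<d. g (i, r))" if "d \<le> r" for r d
    using that by (induction d) (simp_all add: shell_low add.assoc)
  have high: "(\<Sum>k<r\<^sup>2 + r + d. g (shell k)) = (\<Sum>k<r\<^sup>2. g (shell k)) + (\<Sum>i<r. g (i, r)) + (\<Sum>j<d. g (r, j))" if "d \<le> Suc r" for r d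
    using that by (induction d) (simp_all add: shell_high[unfolded add.assoc] low add.assoc)
  show "(\<Sum>k<r\<^sup>2. g (shell k)) = (\<Sum>ij\<in>{..<r} \<times> {..<r}. g ij)"
  proof (induction r)
    case (Suc r)
    have "(Suc r)\<^sup>2 = r\<^sup>2 + r + Suc r" by (simp add: power2_eq_square)
    then have "(\<Sum>k<(Suc r)\<^sup>2. g (shell k)) = (\<Sum>i<r. \<Sum>j<r. g (i, j)) + (\<Sum>i<r. g (i, r)) + (\<Sum>j<Suc r. g (r, j))"
      using high[of "Suc r" r] Suc by (simp add: sum.cartesian_product)
    also have "\<dots> = (\<Sum>i<Suc r. \<Sum>j<Suc r. g (i, j))"
      by (simp add: sum.distrib ac_simps)
    finally show ?case by (simp only: sum.cartesian_product')
  qed simp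
  show "d \<le> r \<Longrightarrow> (\<Sum>k<r\<^sup>2 + d. g (shell k)) = (\<Sum>k<r\<^sup>2. g (shell k)) + (\<Sum>i<d. g (i, r))" by (rule low)
  show "d \<le> Suc r \<Longrightarrow> (\<Sum>k<r\<^sup>2 + r + d. g (shell k)) = (\<Sum>k<r\<^sup>2. g (shell k)) + (\<Sum>i<r. g (i, r)) + (\<Sum>j<d. g (r, j))"
    by (rule high)
qed

text \<open>
  A partial sum consists of a square, part of a column and part of a row. The latter two are differences
  of two rectangles each, which gives \<open>4 + 8 + 8\<close>.
\<close>

lemma haar2_vec_partial_sum: "norm (\<Sum>k<n. pairing (haar2_fn (shell k)) F *\<^sub>R haar2_vec (shell k)) \<le> 20 * norm F"
proof -
  define g where "g ij = pairing (haar2_fn ij) F *\<^sub>R haar2_vec ij" for ij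
  define Q where "Q A B = (\<Sum>ij\<in>{..<A} \<times> {..<B}. g ij)" for A B
  have Q: "norm (Q A B) \<le> 4 * norm F" for A B unfolding Q_def g_def by (rule rectangle_sum)
  have Q': "Q A B = (\<Sum>i<A. \<Sum>j<B. g (i, j))" for A B unfolding Q_def by (simp add: sum.cartesian_product)
  have col: "norm (\<Sum>i<d. g (i, r)) \<le> 8 * norm F" for d r
  proof -
    have "(\<Sum>i<d. g (i, r)) = Q d (Suc r) - Q d r" by (simp add: Q' sum.distrib)
    then have "norm (\<Sum>i<d. g (i, r)) \<le> norm (Q d (Suc r)) + norm (Q d r)" using norm_triangle_ineq4 by metis
    then show ?thesis using Q[of d "Suc r"] Q[of d r] by linarith
  qed
  have row: "norm (\<Sum>j<d. g (r, j)) \<le> 8 * norm F" for d r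
  proof -
    have "(\<Sum>j<d. g (r, j)) = Q (Suc r) d - Q r d" by (simp add: Q')
    then have "norm (\<Sum>j<d. g (r, j)) \<le> norm (Q (Suc r) d) + norm (Q r d)" using norm_triangle_ineq4 by metis
    then show ?thesis using Q[of "Suc r" d] Q[of r d] by linarith
  qed
  have "norm (\<Sum>k<n. g (shell k)) \<le> 20 * norm F"
  proof (rule shell_index[of n])
    fix r d assume "n = r\<^sup>2 + d" "d < r"
    then have "(\<Sum>k<n. g (shell k)) = Q r r + (\<Sum>i<d. g (i, r))" by (simp add: sum_shell Q_def)
    then have "norm (\<Sum>k<n. g (shell k)) \<le> norm (Q r r) + norm (\<Sum>i<d. g (i, r))" by (simp only: norm_triangle_ineq)
    then show ?thesis using Q[of r r] col[where d = d and r = r] norm_ge_zero[of F] by linarith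
  next
    fix r d assume "n = r\<^sup>2 + r + d" "d \<le> r"
    then have "(\<Sum>k<n. g (shell k)) = Q r r + (\<Sum>i<r. g (i, r)) + (\<Sum>j<d. g (r, j))"
      using sum_shell(3)[of d r g] by (simp add: sum_shell(1) Q_def)
    then have "norm (\<Sum>k<n. g (shell k)) \<le> norm (Q r r + (\<Sum>i<r. g (i, r))) + norm (\<Sum>j<d. g (r, j))"
      by (simp only: norm_triangle_ineq)
    then show ?thesis
      using norm_triangle_ineq[of "Q r r" "\<Sum>i<r. g (i, r)"]
        Q[of r r] col[where d = r and r = r] row[where d = d and r = r] norm_ge_zero[of F] by linarith
  qed
  then show ?thesis by (simp add: g_def)
qed

lemma indicator_sqcell: "indicator (dcell n i \<times> dcell m j) = tens (indicator (dcell n i)) (indicator (dcell m j))"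
  by (auto simp: tens_def indicator_def)

lemma square_atom_in_span:
  assumes "i < 2 ^ n" shows "square.atom n i \<in> span (range haar2_vec)"
proof -
  have even: "square.atom (2 * k) i \<in> span (range haar2_vec)" if i: "i < 2 ^ (2 * k)" for k i
  proof -
    define a b where "a = cell_column (2 * k) i" and "b = cell_row (2 * k) i"
    have ab: "a < 2 ^ k" "b < 2 ^ k" using cell_column_row_less[OF i] by (simp_all add: a_def b_def)
    define c where "c = (\<lambda>(l, l'). (2 ^ node_level l * haar_fn l (real a / 2 ^ k) / 2 ^ k) * (2 ^ node_level l' * haar_fn l' (real b / 2 ^ k) / 2 ^ k))"
    have "square.atom (2 * k) i = to_L1 (tens (indicator (dcell k a)) (indicator (dcell k b)))"
      unfolding square.atom_def sqcell_def indicator_sqcell by (simp add: a_def b_def)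
    also have "tens (indicator (dcell k a)) (indicator (dcell k b)) = (\<lambda>z. \<Sum>ll\<in>{..<2 ^ k} \<times> {..<2 ^ k}. c ll * haar2_fn ll z)"
    proof
      fix z
      show "tens (indicator (dcell k a)) (indicator (dcell k b)) z = (\<Sum>ll\<in>{..<2 ^ k} \<times> {..<2 ^ k}. c ll * haar2_fn ll z)"
        unfolding tens_def dcell_expansion[OF ab(1)] dcell_expansion[OF ab(2)] sum_product sum.cartesian_product
        by (intro sum.cong refl) (auto simp: c_def haar2_fn_def tens_def)
    qed
    also have "to_L1 \<dots> = (\<Sum>ll\<in>{..<2 ^ k} \<times> {..<2 ^ k}. c ll *\<^sub>R to_L1 (haar2_fn ll))"
      unfolding to_L1_scale[OF integrable_haar2_fn] by (rule to_L1_sum[symmetric]) (auto intro!: integrable_mult_right integrable_haar2_fn)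
    also have "\<dots> \<in> span (range haar2_vec)"
    proof (rule span_sum)
      fix ll :: "nat \<times> nat"
      obtain l l' where ll: "ll = (l, l')" by force
      have "to_L1 (haar2_fn ll) = (1 / (2 ^ node_level l * 2 ^ node_level l')) *\<^sub>R haar2_vec ll" by (simp add: ll haar2_vec_def)
      then show "c ll *\<^sub>R to_L1 (haar2_fn ll) \<in> span (range haar2_vec)" by (simp add: span_scale span_base)
    qed
    finally show ?thesis .
  qed
  show ?thesis
  proof (cases "even n")
    case True
    then obtain k where "n = 2 * k" by blast
    then show ?thesis using even assms by simp
  next
    case False
    then obtain k where k: "Suc n = 2 * k" by (metis even_Suc evenE)
    have "2 * i < 2 ^ (2 * k)" "2 * i + 1 < 2 ^ (2 * k)" using assms unfolding k[symmetric] by auto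
    then show ?thesis unfolding square.atom_split[OF assms] k by (intro span_add even)
  qed
qed

definition haar2_seq :: "nat \<Rightarrow> (real \<times> real) L1" where "haar2_seq k = haar2_vec (shell k)"

lemma haar2_seq_dense: "closure (span (range haar2_seq)) = UNIV"
proof -
  have r: "range haar2_seq = range haar2_vec"
  proof -
    have "range haar2_seq = haar2_vec ` range shell" by (auto simp: haar2_seq_def)
    also have "range shell = UNIV" using bij_shell by (simp add: bij_def)
    finally show ?thesis .
  qed
  have "span {square.atom n i | n i. i < 2 ^ n} \<subseteq> span (range haar2_seq)"
    unfolding r by (rule span_minimal) (auto simp: square_atom_in_span)
  from closure_mono[OF this] show ?thesis unfolding square.atoms_dense by auto
qed

lemma haar2_seq_schauder:
  "normalized_schauder_basis UNIV norm haar2_seq" "coordinate norm haar2_seq k F = pairing (haar2_fn (shell k)) F"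
proof -
  interpret complete_normed "UNIV :: (real \<times> real) L1 set" norm by (rule UNIV_complete_normed)
  note lin = linear_pairing[OF bounded_borel_haar2_fn]
  have inj: "shell k = shell l \<longleftrightarrow> k = l" for k l using bij_shell by (auto simp: bij_def inj_def)
  have facts: "norm (haar2_seq k) = 1" "pairing (haar2_fn (shell k)) (haar2_seq l) = (if k = l then 1 else 0)"
    "norm (\<Sum>k<n. pairing (haar2_fn (shell k)) F *\<^sub>R haar2_seq k) \<le> 20 * norm F" for k l n F
    by (simp_all add: haar2_seq_def norm_haar2_vec pairing_haar2_vec inj haar2_vec_partial_sum)
  note S = schauder_criterion[of haar2_seq "\<lambda>k. pairing (haar2_fn (shell k))" 1 20]
  show "normalized_schauder_basis UNIV norm haar2_seq"
    by (rule S(1)) (auto simp: facts linear_add[OF lin] linear_scale[OF lin]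
        abs_pairing_le[OF bounded_borel_haar2_fn abs_haar2_fn_le_1, simplified] intro: closure_approx[OF haar2_seq_dense])
  show "coordinate norm haar2_seq k F = pairing (haar2_fn (shell k)) F"
    by (rule S(2)) (auto simp: facts linear_add[OF lin] linear_scale[OF lin]
        abs_pairing_le[OF bounded_borel_haar2_fn abs_haar2_fn_le_1, simplified] intro: closure_approx[OF haar2_seq_dense])
qed

text \<open>
  For intervals \<open>I\<close>, \<open>J\<close> of length \<open>1 / 2 ^ n\<close> the rectangle \<open>I \<times> J\<close> is a cell of level \<open>2 * n\<close>, and
  \<open>h\<^sub>I \<otimes> h\<^sub>J\<close> is its block of depth 2 with the signs \<open>+, -, -, +\<close>.
\<close>

lemma square_haar_cells:
  assumes \<tau>: "linear \<tau>" "\<And>F. norm (\<tau> F) \<le> C * norm F" and \<delta>: "0 < \<delta>"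
    and diag: "\<And>ij. \<delta> \<le> \<bar>pairing (haar2_fn ij) (\<tau> (haar2_vec ij))\<bar>"
  shows "\<exists>k i. i < 2 ^ k \<and> \<delta> / 2 / 2 ^ k \<le> \<bar>square.D \<tau> (square.cell_ind k i)\<bar>"
proof (rule square.good_cell[OF \<tau> \<delta>])
  fix n :: nat
  define \<theta> :: "nat \<Rightarrow> real" where "\<theta> v = (- 1) ^ (v div 2) * (- 1) ^ v" for v
  have four: "(\<Sum>u<2 ^ 2. g u) = g 0 + g 1 + g 2 + g (3::nat)" for g :: "nat \<Rightarrow> 'z::comm_monoid_add"
    by (simp add: eval_nat_numeral)
  have "\<delta> / 2 ^ (2 * n) \<le> \<bar>\<Sum>u<2 ^ 2. \<theta> (2 ^ 2 * i + u) * square.E (2 * n + 2) (2 ^ 2 * i + u)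
          (\<tau> (\<Sum>v<2 ^ 2. \<theta> (2 ^ 2 * i + v) *\<^sub>R square.atom (2 * n + 2) (2 ^ 2 * i + v)))\<bar>" if i: "i < 2 ^ (2 * n)" for i
  proof -
    define a b where "a = cell_column (2 * n) i" and "b = cell_row (2 * n) i"
    have ab: "a < 2 ^ n" "b < 2 ^ n" using cell_column_row_less[OF i] by (simp_all add: a_def b_def)
    define ij where "ij = (2 ^ n + a, 2 ^ n + b)"
    have cell: "sqcell (2 * n + 2) (2 ^ 2 * i + u) = dcell (Suc n) (2 * a + u div 2) \<times> dcell (Suc n) (2 * b + u mod 2)" if "u < 4" for u
    proof -
      have "(2 ^ 2 * i + u) div 2 div 2 = i" "(2 ^ 2 * i + u) div 2 mod 2 = u div 2" "(2 ^ 2 * i + u) mod 2 = u mod 2"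
        using that unfolding power2_eq_square by (presburger, presburger, presburger)
      then show ?thesis by (simp add: sqcell_def a_def b_def)
    qed
    have \<theta>4: "\<theta> (2 ^ 2 * i + 0) = 1" "\<theta> (2 ^ 2 * i + 1) = -1" "\<theta> (2 ^ 2 * i + 2) = -1" "\<theta> (2 ^ 2 * i + 3) = 1"
    proof -
      have e: "(2 ^ 2 * i + 0) div 2 = 2 * i" "(2 ^ 2 * i + 1) div 2 = 2 * i" "(2 ^ 2 * i + 2) div 2 = 2 * i + 1" "(2 ^ 2 * i + 3) div 2 = 2 * i + 1"
        unfolding power2_eq_square by (presburger, presburger, presburger, presburger)
      show "\<theta> (2 ^ 2 * i + 0) = 1" "\<theta> (2 ^ 2 * i + 1) = -1" "\<theta> (2 ^ 2 * i + 2) = -1" "\<theta> (2 ^ 2 * i + 3) = 1"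
        unfolding \<theta>_def e by (simp_all add: power_add power_mult)
    qed
    define I where "I u = (indicator (sqcell (2 * n + 2) (2 ^ 2 * i + u)) :: real \<times> real \<Rightarrow> real)" for u
    have h: "haar2_fn ij = (\<lambda>z. (I 0 z + I 3 z) - (I 1 z + I 2 z))"
    proof
      fix z
      have "I 0 z = indicator (dcell (Suc n) (2 * a)) (fst z) * indicator (dcell (Suc n) (2 * b)) (snd z)"
        "I 1 z = indicator (dcell (Suc n) (2 * a)) (fst z) * indicator (dcell (Suc n) (2 * b + 1)) (snd z)"
        "I 2 z = indicator (dcell (Suc n) (2 * a + 1)) (fst z) * indicator (dcell (Suc n) (2 * b)) (snd z)"
        "I 3 z = indicator (dcell (Suc n) (2 * a + 1)) (fst z) * indicator (dcell (Suc n) (2 * b + 1)) (snd z)"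
        unfolding I_def using cell[of 0] cell[of 1] cell[of 2] cell[of 3] by (simp_all add: indicator_sqcell tens_def)
      then show "haar2_fn ij z = (I 0 z + I 3 z) - (I 1 z + I 2 z)"
        unfolding ij_def haar2_fn_def prod.case tens_def haar_fn_node[OF ab(1)] haar_fn_node[OF ab(2)] by (simp add: algebra_simps)
    qed
    have bI: "bounded_borel (I u)" for u unfolding I_def by (rule square.bounded_borel_cell)
    have iI: "integrable cube_measure (I u)" for u by (rule integrable_bounded_borel[OF bI])
    have A: "(\<Sum>v<2 ^ 2. \<theta> (2 ^ 2 * i + v) *\<^sub>R square.atom (2 * n + 2) (2 ^ 2 * i + v)) = to_L1 (haar2_fn ij)"
    proof -
      have "to_L1 (haar2_fn ij) = (to_L1 (I 0) + to_L1 (I 3)) - (to_L1 (I 1) + to_L1 (I 2))"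
        unfolding h by (simp add: to_L1_add to_L1_diff iI)
      then show ?thesis unfolding four \<theta>4 square.atom_def I_def[symmetric] by (simp add: algebra_simps)
    qed
    have E: "(\<Sum>u<2 ^ 2. \<theta> (2 ^ 2 * i + u) * square.E (2 * n + 2) (2 ^ 2 * i + u) G) = pairing (haar2_fn ij) G" for G
    proof -
      have "pairing (haar2_fn ij) G = (pairing (I 0) G + pairing (I 3) G) - (pairing (I 1) G + pairing (I 2) G)"
        unfolding h by (simp add: pairing_add pairing_diff bounded_borel_add bI)
      then show ?thesis unfolding four \<theta>4 square.E_def I_def[symmetric] by (simp add: algebra_simps)
    qed
    have "haar2_vec ij = (2 ^ n * 2 ^ n) *\<^sub>R to_L1 (haar2_fn ij)" unfolding ij_def haar2_vec_def prod.case node_level_node[OF ab(1)] node_level_node[OF ab(2)] ..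
    then have "\<delta> \<le> (2 ^ n * 2 ^ n) * \<bar>pairing (haar2_fn ij) (\<tau> (to_L1 (haar2_fn ij)))\<bar>"
      using diag[of ij] by (simp add: linear_scale[OF \<tau>(1)] linear_scale[OF linear_pairing[OF bounded_borel_haar2_fn]] abs_mult)
    moreover have "(2 :: real) ^ (2 * n) = 2 ^ n * 2 ^ n" by (simp add: mult_2 power_add)
    ultimately show ?thesis unfolding A E by (simp add: field_simps)
  qed
  moreover have "\<bar>\<theta> u\<bar> = 1" for u by (simp add: \<theta>_def abs_mult)
  moreover have "n \<le> 2 * n" by simp
  ultimately show "\<exists>k\<ge>n. \<exists>r \<theta>. (\<forall>u. \<bar>\<theta> u\<bar> = 1) \<and> (\<forall>i<2 ^ k. \<delta> / 2 ^ k \<le>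
      \<bar>\<Sum>u<2 ^ r. \<theta> (2 ^ r * i + u) * square.E (k + r) (2 ^ r * i + u)
          (\<tau> (\<Sum>v<2 ^ r. \<theta> (2 ^ r * i + v) *\<^sub>R square.atom (k + r) (2 ^ r * i + v)))\<bar>)"
    by (intro exI[of _ "2 * n"] conjI exI[of _ 2] exI[of _ \<theta>] allI impI) blast+
qed

lemma square_factorization: "factorization_property UNIV norm haar2_seq"
proof (rule factorization_propertyI[OF haar2_seq_schauder(1), of "\<lambda>k. pairing (haar2_fn (shell k))"])
  interpret direct_sum square.atom square.E UNIV norm "{0}" "\<lambda>_ a. a" "\<lambda>_ a. a"
    by (rule square.direct_sum_UNIV)
  fix T :: "(real \<times> real) L1 \<Rightarrow> (real \<times> real) L1" and \<delta> :: real
  assume T: "bounded_operator_on UNIV norm T" and \<delta>: "0 < \<delta>" and diag: "\<And>k. \<delta> \<le> \<bar>pairing (haar2_fn (shell k)) (T (haar2_seq k))\<bar>"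
  have bl: "bounded_linear T" using T by (simp add: bounded_operator_on_UNIV)
  obtain C where C: "\<And>F. norm (T F) \<le> C * norm F" using bounded_linear.bounded[OF bl] by (auto simp: mult.commute)
  have "\<delta> \<le> \<bar>pairing (haar2_fn ij) (T (haar2_vec ij))\<bar>" for ij
  proof -
    obtain k where "ij = shell k" using bij_shell by (meson bij_pointE)
    then show ?thesis using diag[of k] by (simp add: haar2_seq_def)
  qed
  then have "\<exists>k i. i < 2 ^ k \<and> \<delta> / 2 / 2 ^ k \<le> \<bar>square.D T (square.cell_ind k i)\<bar>"
    by (intro square_haar_cells[OF _ C \<delta>]) (use bl in \<open>simp_all add: bounded_linear.linear\<close>)
  then show "\<exists>R S. bounded_operator_on UNIV norm R \<and> bounded_operator_on UNIV norm S \<and> (\<forall>x\<in>UNIV. S (T (R x)) = x)"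
    by (intro identity_factors[OF T, of "\<delta> / 2"]) (use \<delta> in auto)
qed (rule haar2_seq_schauder(2))

theorem mainTheorem1:
  shows "system_factorization_property (UNIV :: real L1 set) norm dyadic_plus normalized_haar
    \<and> system_factorization_property (UNIV :: (real \<times> real) L1 set) norm
        (dyadic_plus \<times> dyadic_plus) normalized_haar2
    \<and> (\<forall>p::real. 1 \<le> p \<longrightarrow>
        system_factorization_property (lp_carrier p :: (nat \<Rightarrow> real L1) set) (lp_norm p)
          ((UNIV :: nat set) \<times> dyadic_plus) lp_haar)"
proof (intro conjI allI impI)
  show "system_factorization_property (UNIV :: real L1 set) norm dyadic_plus normalized_haar"
    unfolding system_factorization_property_def normalized_haar_node[symmetric]
  proof (intro exI conjI)
    show "bij_betw node UNIV dyadic_plus" by (rule bij_node)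
    show "factorization_property UNIV norm (\<lambda>n. normalized_haar (node n))"
      using L1_factorization by (simp add: normalized_haar_node)
  qed
  show "system_factorization_property (UNIV :: (real \<times> real) L1 set) norm (dyadic_plus \<times> dyadic_plus) normalized_haar2"
    unfolding system_factorization_property_def
  proof (intro exI conjI)
    have "bij_betw (map_prod node node) (UNIV \<times> UNIV) (dyadic_plus \<times> dyadic_plus)"
      by (rule bij_betw_map_prod[OF bij_node bij_node])
    then show "bij_betw (map_prod node node \<circ> shell) UNIV (dyadic_plus \<times> dyadic_plus)"
      using bij_shell by (auto intro: bij_betw_trans)
    have "normalized_haar2 ((map_prod node node \<circ> shell) k) = haar2_seq k" for k
      by (cases "shell k") (simp add: normalized_haar2_node haar2_seq_def)
    then show "factorization_property UNIV norm (\<lambda>k. normalized_haar2 ((map_prod node node \<circ> shell) k))"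
      using square_factorization by simp
  qed
  fix p :: real assume p: "1 \<le> p"
  show "system_factorization_property (lp_carrier p :: (nat \<Rightarrow> real L1) set) (lp_norm p) (UNIV \<times> dyadic_plus) lp_haar"
    unfolding system_factorization_property_def
  proof (intro exI conjI)
    have "bij_betw (map_prod id node) (UNIV \<times> UNIV) (UNIV \<times> dyadic_plus)"
      by (rule bij_betw_map_prod[OF bij_id bij_node])
    then show "bij_betw (map_prod id node \<circ> prod_decode) UNIV (UNIV \<times> dyadic_plus)"
      using bij_prod_decode by (auto intro: bij_betw_trans)
    have "lp_haar ((map_prod id node \<circ> prod_decode) k) = lp_vec k" for k
      by (cases "prod_decode k") (simp add: lp_haar_def lp_vec_def normalized_haar_node)
    then show "factorization_property (lp_carrier p) (lp_norm p) (\<lambda>k. lp_haar ((map_prod id node \<circ> prod_decode) k))"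
      using lp_factorization[OF p] by simp
  qed
qed

end
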